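(* Let $K$ be a field, $G$ a finite group, and $A$ a finite-dimensional $G$-graded $K$-algebra. Then $A$ is graded equivalent to a gr-basic $G$-graded $K$-algebra $B$, and $B$ is unique up to congruence: if $B$ and $C$ are gr-basic $G$-graded $K$-algebras which are both graded equivalent to $A$, then $B$ is a congruence of $C$.
   Context: $K$ is a field, $G$ a finite multiplicative group with identity $e$. Maps are composed from left to right ($\phi\psi$ means first $\phi$, then $\psi$). A graded algebra is an associative unital $K$-algebra $A=\bigoplus_{g\in G}A_g$ with $A_gA_h\subseteq A_{gh}$; isomorphisms of graded algebras are degree-preserving algebra isomorphisms. A graded (left) $A$-module is $M=\bigoplus_{g}M_g$ with $A_gM_h\subseteq M_{gh}$; a graded morphism is an $A$-linear map preserving degrees. $\mathrm{Gr}\,A$ is the category of graded $A$-modules. The shift functor $S_g$ on $\mathrm{Gr}\,A$ is $S_g(X)=Y$ with $Y_h=X_{hg}$ (and the same underlying maps on morphisms). For $M,N\in\mathrm{Gr}\,A$, $\mathrm{Hom}_A(M,N)$ is the space of all $A$-linear maps of underlying modules; it is graded by $\mathrm{Hom}_A(M,N)_g=\{\phi:\phi(M_h)\subseteq N_{hg}\ \forall h\in G\}$, and $\mathrm{End}_A(M)=\mathrm{Hom}_A(M,M)$ is a graded algebra. A functor $\mathcal U:\mathrm{Gr}\,A\to\mathrm{Gr}\,B$ is graded if it commutes with $S_g$ for all $g\in G$. A natural transformation $\eta:\mathcal U\to\mathcal V$ of graded functors is graded if $\eta_{S_g(M)}=S_g(\eta_M)$ for all $g\in G$, $M\in\mathrm{Gr}\,A$.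 A graded functor $\mathcal U$ is a graded equivalence if there is a graded functor $\mathcal V:\mathrm{Gr}\,B\to\mathrm{Gr}\,A$ with graded natural isomorphisms $\mathcal V\mathcal U\cong 1_{\mathrm{Gr} A}$ and $\mathcal U\mathcal V\cong 1_{\mathrm{Gr} B}$. $A$ and $B$ are graded equivalent if there is a graded equivalence $\mathrm{Gr}\,A\to\mathrm{Gr}\,B$. A nonzero graded module is gr-indecomposable if it is not a direct sum of two nonzero graded modules; a graded module is gr-projective if it is projective in $\mathrm{Gr}\,A$. A graded submodule is gr-maximal if the quotient by it has no graded submodules other than $0$ and itself (and is nonzero); $J_G(A)$ is the intersection of all gr-maximal submodules of ${}_AA$ (a graded ideal). A gr-division algebra is a graded algebra in which every nonzero homogeneous element is invertible. A finite-dimensional graded algebra $A$ is gr-basic if $A/J_G(A)$ is a direct sum of gr-division algebras; equivalently, any decomposition $A=\bigoplus_{i=1}^rP_i$ into gr-indecomposable gr-projective modules satisfies $P_i\not\cong S_g(P_j)$ for all $g\in G$ and $i\ne j$. If $A$ is gr-basic and $\{P_i\mid 1\le i\le n\}$ is a complete set of (finite-dimensional) gr-indecomposable gr-projective $A$-modules up to graded isomorphism and shift, a graded algebra $B$ is a congruence of $A$ if $B\cong \mathrm{End}_A(\bigoplus_{i=1}^nS_{g_i}(P_i))$ as graded algebras for some $(g_1,\dots,g_n)\in G^n$.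
   Formalization: Graded functors and equivalences are taken to be K-linear (without this uniqueness fails, e.g. for twists of an algebra by a field automorphism), and Gr A consists of the graded modules in a fixed, arbitrary infinite universe at least as large as K. *)

theory Defs
  imports "HOL-Algebra.Module" "HOL-Algebra.QuotRing"
begin

section \<open>Graded algebras and graded modules\<close>

text \<open>
  One record type serves for graded algebras (scalars from the field) and for graded left modules
  (scalars from the algebra).  As for \<^locale>\<open>module\<close> in HOL-Algebra, the ring multiplication and unit
  of a record carry no meaning when it is read as a module, and all fields are only meaningful on
  the carriers (\<open>component\<close> only on the carrier of the grading group).
\<close>

record ('r, 'm, 'g) graded = "('r, 'm) module" +
  component :: "'g \<Rightarrow> 'm set"

text \<open>The additive group of \<open>M\<close> is the direct sum of its components; \<open>G\<close> is finite throughout.\<close>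

definition graded_by :: "'g monoid \<Rightarrow> ('r, 'm, 'g) graded \<Rightarrow> bool" where
  "graded_by G M \<longleftrightarrow>
     (\<forall>g\<in>carrier G. additive_subgroup (component M g) M) \<and>
     (\<forall>x\<in>carrier M. \<exists>!f. f \<in> (\<Pi>\<^sub>E g\<in>carrier G. component M g) \<and>
        x = (\<Oplus>\<^bsub>M\<^esub>g\<in>carrier G. f g))"

locale graded_algebra = K?: field K + G?: group G + A?: ring A + module K A
  for K :: "'k ring" (structure) and G :: "'g monoid" (structure)
    and A :: "('k, 'a, 'g) graded" (structure) +
  assumes finite_group: "finite (carrier G)"
    and smult_mult_left: "\<lbrakk>c \<in> carrier K; x \<in> carrier A; y \<in> carrier A\<rbrakk> \<Longrightarrow>
      (c \<odot>\<^bsub>A\<^esub> x) \<otimes>\<^bsub>A\<^esub> y = c \<odot>\<^bsub>A\<^esub> (x \<otimes>\<^bsub>A\<^esub> y)"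
    and smult_mult_right: "\<lbrakk>c \<in> carrier K; x \<in> carrier A; y \<in> carrier A\<rbrakk> \<Longrightarrow>
      x \<otimes>\<^bsub>A\<^esub> (c \<odot>\<^bsub>A\<^esub> y) = c \<odot>\<^bsub>A\<^esub> (x \<otimes>\<^bsub>A\<^esub> y)"
    and grading: "graded_by G A"
    and component_smult: "\<lbrakk>c \<in> carrier K; g \<in> carrier G; x \<in> component A g\<rbrakk> \<Longrightarrow>
      c \<odot>\<^bsub>A\<^esub> x \<in> component A g"
    and component_mult: "\<lbrakk>g \<in> carrier G; h \<in> carrier G; x \<in> component A g; y \<in> component A h\<rbrakk> \<Longrightarrow>
      x \<otimes>\<^bsub>A\<^esub> y \<in> component A (g \<otimes>\<^bsub>G\<^esub> h)"

text \<open>\<^locale>\<open>module\<close> requires a commutative ring of scalars, hence the following variant.\<close>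

locale left_module = R?: ring R + M?: abelian_group M
  for R :: "('a, 'x) ring_scheme" (structure) and M :: "('a, 'm, 'y) module_scheme" (structure) +
  assumes smult_closed: "\<lbrakk>a \<in> carrier R; x \<in> carrier M\<rbrakk> \<Longrightarrow> a \<odot>\<^bsub>M\<^esub> x \<in> carrier M"
    and smult_l_distr: "\<lbrakk>a \<in> carrier R; b \<in> carrier R; x \<in> carrier M\<rbrakk> \<Longrightarrow>
      (a \<oplus>\<^bsub>R\<^esub> b) \<odot>\<^bsub>M\<^esub> x = a \<odot>\<^bsub>M\<^esub> x \<oplus>\<^bsub>M\<^esub> b \<odot>\<^bsub>M\<^esub> x"
    and smult_r_distr: "\<lbrakk>a \<in> carrier R; x \<in> carrier M; y \<in> carrier M\<rbrakk> \<Longrightarrow>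
      a \<odot>\<^bsub>M\<^esub> (x \<oplus>\<^bsub>M\<^esub> y) = a \<odot>\<^bsub>M\<^esub> x \<oplus>\<^bsub>M\<^esub> a \<odot>\<^bsub>M\<^esub> y"
    and smult_assoc: "\<lbrakk>a \<in> carrier R; b \<in> carrier R; x \<in> carrier M\<rbrakk> \<Longrightarrow>
      (a \<otimes>\<^bsub>R\<^esub> b) \<odot>\<^bsub>M\<^esub> x = a \<odot>\<^bsub>M\<^esub> (b \<odot>\<^bsub>M\<^esub> x)"
    and smult_one: "x \<in> carrier M \<Longrightarrow> \<one>\<^bsub>R\<^esub> \<odot>\<^bsub>M\<^esub> x = x"

locale graded_module = left_module A M
  for G :: "'g monoid" and A :: "('k, 'a, 'g) graded" and M :: "('a, 'm, 'g) graded" +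
  assumes grading: "graded_by G M"
    and component_smult: "\<lbrakk>g \<in> carrier G; h \<in> carrier G; a \<in> component A g; x \<in> component M h\<rbrakk> \<Longrightarrow>
      a \<odot>\<^bsub>M\<^esub> x \<in> component M (g \<otimes>\<^bsub>G\<^esub> h)"

definition fin_dim :: "'k ring \<Rightarrow> ('k, 'm, 'g) graded \<Rightarrow> bool" where
  "fin_dim K V \<longleftrightarrow> (\<exists>S. finite S \<and> S \<subseteq> carrier V \<and>
     (\<forall>x\<in>carrier V. \<exists>c \<in> S \<rightarrow> carrier K. x = (\<Oplus>\<^bsub>V\<^esub>s\<in>S. c s \<odot>\<^bsub>V\<^esub> s)))"

definition regular :: "('k, 'a, 'g) graded \<Rightarrow> ('a, 'a, 'g) graded" where
  "regular A = \<lparr>carrier = carrier A, mult = mult A, one = one A, zero = zero A, add = add A,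
     smult = mult A, component = component A\<rparr>"

text \<open>The \<open>A\<close>-module \<open>M\<close> as a vector space over the base field.\<close>

definition scalars :: "('k, 'a, 'g) graded \<Rightarrow> ('a, 'm, 'g) graded \<Rightarrow> ('k, 'm, 'g) graded" where
  "scalars A M = \<lparr>carrier = carrier M, mult = mult M, one = one M, zero = zero M, add = add M,
     smult = (\<lambda>c x. (c \<odot>\<^bsub>A\<^esub> \<one>\<^bsub>A\<^esub>) \<odot>\<^bsub>M\<^esub> x), component = component M\<rparr>"

definition shift :: "'g monoid \<Rightarrow> 'g \<Rightarrow> ('r, 'm, 'g) graded \<Rightarrow> ('r, 'm, 'g) graded" where
  "shift G g M = M\<lparr>component :=
     (\<lambda>h. if h \<in> carrier G then component M (h \<otimes>\<^bsub>G\<^esub> g) else component M h)\<rparr>"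

text \<open>
  The next two constructions are used both for modules and for algebras: for algebras the product
  and the unit are those of the direct product and of the quotient algebra.
\<close>

definition direct_sum :: "'i set \<Rightarrow> ('i \<Rightarrow> ('r, 'm, 'g) graded) \<Rightarrow> ('r, 'i \<Rightarrow> 'm, 'g) graded" where
  "direct_sum I M =
    \<lparr>carrier = (\<Pi>\<^sub>E i\<in>I. carrier (M i)),
     mult = (\<lambda>x y. \<lambda>i\<in>I. x i \<otimes>\<^bsub>M i\<^esub> y i),
     one = (\<lambda>i\<in>I. \<one>\<^bsub>M i\<^esub>),
     zero = (\<lambda>i\<in>I. \<zero>\<^bsub>M i\<^esub>),
     add = (\<lambda>x y. \<lambda>i\<in>I. x i \<oplus>\<^bsub>M i\<^esub> y i),
     smult = (\<lambda>a x. \<lambda>i\<in>I. a \<odot>\<^bsub>M i\<^esub> x i),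
     component = (\<lambda>g. \<Pi>\<^sub>E i\<in>I. component (M i) g)\<rparr>"

definition quotient :: "('r, 'm, 'g) graded \<Rightarrow> 'm set \<Rightarrow> ('r, 'm set, 'g) graded" where
  "quotient M N =
    \<lparr>carrier = carrier (M Quot N), mult = mult (M Quot N), one = one (M Quot N),
     zero = zero (M Quot N), add = add (M Quot N),
     smult = (\<lambda>a X. \<Union>x\<in>X. N +>\<^bsub>M\<^esub> (a \<odot>\<^bsub>M\<^esub> x)),
     component = (\<lambda>g. (\<lambda>x. N +>\<^bsub>M\<^esub> x) ` component M g)\<rparr>"

definition gr_alg_isomorphic ::
  "'k ring \<Rightarrow> 'g monoid \<Rightarrow> ('k, 'a, 'g) graded \<Rightarrow> ('k, 'b, 'g) graded \<Rightarrow> bool" where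
  "gr_alg_isomorphic K G A B \<longleftrightarrow> (\<exists>\<phi> \<in> ring_iso A B.
     (\<forall>c\<in>carrier K. \<forall>x\<in>carrier A. \<phi> (c \<odot>\<^bsub>A\<^esub> x) = c \<odot>\<^bsub>B\<^esub> \<phi> x) \<and>
     (\<forall>g\<in>carrier G. \<phi> ` component A g \<subseteq> component B g))"


section \<open>Homomorphisms\<close>

text \<open>Maps are normalised to be undefined outside the carrier, so that equality of maps is \<open>=\<close>.\<close>

definition lin_hom :: "('k, 'a, 'g) graded \<Rightarrow> ('a, 'm, 'g) graded \<Rightarrow> ('a, 'n, 'g) graded
    \<Rightarrow> ('m \<Rightarrow> 'n) set" where
  "lin_hom A M N = {\<phi> \<in> carrier M \<rightarrow>\<^sub>E carrier N.
     (\<forall>x\<in>carrier M. \<forall>y\<in>carrier M. \<phi> (x \<oplus>\<^bsub>M\<^esub> y) = \<phi> x \<oplus>\<^bsub>N\<^esub> \<phi> y) \<and>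
     (\<forall>a\<in>carrier A. \<forall>x\<in>carrier M. \<phi> (a \<odot>\<^bsub>M\<^esub> x) = a \<odot>\<^bsub>N\<^esub> \<phi> x)}"

definition lin_hom_component :: "'g monoid \<Rightarrow> ('k, 'a, 'g) graded \<Rightarrow> ('a, 'm, 'g) graded
    \<Rightarrow> ('a, 'n, 'g) graded \<Rightarrow> 'g \<Rightarrow> ('m \<Rightarrow> 'n) set" where
  "lin_hom_component G A M N g = {\<phi> \<in> lin_hom A M N.
     \<forall>h\<in>carrier G. \<phi> ` component M h \<subseteq> component N (h \<otimes>\<^bsub>G\<^esub> g)}"

definition gr_hom :: "'g monoid \<Rightarrow> ('k, 'a, 'g) graded \<Rightarrow> ('a, 'm, 'g) graded
    \<Rightarrow> ('a, 'n, 'g) graded \<Rightarrow> ('m \<Rightarrow> 'n) set" where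
  "gr_hom G A M N = {\<phi> \<in> lin_hom A M N. \<forall>h\<in>carrier G. \<phi> ` component M h \<subseteq> component N h}"

definition hom_add :: "('a, 'm, 'g) graded \<Rightarrow> ('a, 'n, 'g) graded
    \<Rightarrow> ('m \<Rightarrow> 'n) \<Rightarrow> ('m \<Rightarrow> 'n) \<Rightarrow> 'm \<Rightarrow> 'n" where
  "hom_add M N \<phi> \<psi> = (\<lambda>x\<in>carrier M. \<phi> x \<oplus>\<^bsub>N\<^esub> \<psi> x)"

definition hom_smult :: "('k, 'a, 'g) graded \<Rightarrow> ('a, 'm, 'g) graded \<Rightarrow> ('a, 'n, 'g) graded
    \<Rightarrow> 'k \<Rightarrow> ('m \<Rightarrow> 'n) \<Rightarrow> 'm \<Rightarrow> 'n" where
  "hom_smult A M N c \<phi> = (\<lambda>x\<in>carrier M. c \<odot>\<^bsub>scalars A N\<^esub> \<phi> x)"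

text \<open>
  The graded algebra \<open>End\<^sub>A(M)\<close>.  Maps are composed from left to right: the product of \<open>\<phi>\<close> and \<open>\<psi>\<close>
  is first \<open>\<phi>\<close>, then \<open>\<psi>\<close>.
\<close>

definition End_algebra :: "'g monoid \<Rightarrow> ('k, 'a, 'g) graded \<Rightarrow> ('a, 'm, 'g) graded
    \<Rightarrow> ('k, 'm \<Rightarrow> 'm, 'g) graded" where
  "End_algebra G A M =
    \<lparr>carrier = lin_hom A M M,
     mult = (\<lambda>\<phi> \<psi>. compose (carrier M) \<psi> \<phi>),
     one = (\<lambda>x\<in>carrier M. x),
     zero = (\<lambda>x\<in>carrier M. \<zero>\<^bsub>M\<^esub>),
     add = hom_add M M,
     smult = hom_smult A M M,
     component = lin_hom_component G A M M\<rparr>"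

definition gr_iso :: "'g monoid \<Rightarrow> ('k, 'a, 'g) graded \<Rightarrow> ('a, 'm, 'g) graded
    \<Rightarrow> ('a, 'n, 'g) graded \<Rightarrow> ('m \<Rightarrow> 'n) set" where
  "gr_iso G A M N = {\<phi> \<in> gr_hom G A M N. \<exists>\<psi> \<in> gr_hom G A N M.
     compose (carrier M) \<psi> \<phi> = (\<lambda>x\<in>carrier M. x) \<and>
     compose (carrier N) \<phi> \<psi> = (\<lambda>y\<in>carrier N. y)}"


section \<open>Graded equivalence\<close>

text \<open>
  HOL has no type of all graded modules.  The category of graded \<open>A\<close>-modules is taken relative to a
  universe \<open>'u\<close>: its objects are the graded modules whose carrier is a subset of the type \<open>'u\<close>.  If
  \<open>'u\<close> is infinite and at least as large as the base field, these are, up to isomorphism, all graded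
  modules of cardinality at most that of \<open>'u\<close>; in particular all finite-dimensional ones.
\<close>

definition Gr :: "'g monoid \<Rightarrow> ('k, 'a, 'g) graded \<Rightarrow> ('a, 'u, 'g) graded set" where
  "Gr G A = {M. graded_module G A M}"

record ('a, 'b, 'u, 'g) functor_data =
  fobj :: "('a, 'u, 'g) graded \<Rightarrow> ('b, 'u, 'g) graded"
  fmap :: "('a, 'u, 'g) graded \<Rightarrow> ('a, 'u, 'g) graded \<Rightarrow> ('u \<Rightarrow> 'u) \<Rightarrow> 'u \<Rightarrow> 'u"

text \<open>
  Functors between categories of modules over \<open>K\<close>-algebras are understood to be \<open>K\<close>-linear.  Functors
  that are not \<open>K\<close>-linear cannot distinguish \<open>A\<close> from the algebras obtained by twisting the scalar
  multiplication of \<open>A\<close> with an automorphism of \<open>K\<close>, which need not be isomorphic to \<open>A\<close> over \<open>K\<close>.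
\<close>

definition linear_functor :: "'k ring \<Rightarrow> 'g monoid \<Rightarrow> ('k, 'a, 'g) graded \<Rightarrow> ('k, 'b, 'g) graded
    \<Rightarrow> ('a, 'b, 'u, 'g) functor_data \<Rightarrow> bool" where
  "linear_functor K G A B F \<longleftrightarrow>
     (\<forall>M\<in>Gr G A. fobj F M \<in> Gr G B) \<and>
     (\<forall>M\<in>Gr G A. \<forall>N\<in>Gr G A. \<forall>\<phi>\<in>gr_hom G A M N.
        fmap F M N \<phi> \<in> gr_hom G B (fobj F M) (fobj F N)) \<and>
     (\<forall>M\<in>Gr G A. fmap F M M (\<lambda>x\<in>carrier M. x) = (\<lambda>x\<in>carrier (fobj F M). x)) \<and>
     (\<forall>L\<in>Gr G A. \<forall>M\<in>Gr G A. \<forall>N\<in>Gr G A. \<forall>\<phi>\<in>gr_hom G A L M. \<forall>\<psi>\<in>gr_hom G A M N.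
        fmap F L N (compose (carrier L) \<psi> \<phi>) =
          compose (carrier (fobj F L)) (fmap F M N \<psi>) (fmap F L M \<phi>)) \<and>
     (\<forall>M\<in>Gr G A. \<forall>N\<in>Gr G A. \<forall>\<phi>\<in>gr_hom G A M N. \<forall>\<psi>\<in>gr_hom G A M N.
        fmap F M N (hom_add M N \<phi> \<psi>) =
          hom_add (fobj F M) (fobj F N) (fmap F M N \<phi>) (fmap F M N \<psi>)) \<and>
     (\<forall>M\<in>Gr G A. \<forall>N\<in>Gr G A. \<forall>c\<in>carrier K. \<forall>\<phi>\<in>gr_hom G A M N.
        fmap F M N (hom_smult A M N c \<phi>) =
          hom_smult B (fobj F M) (fobj F N) c (fmap F M N \<phi>))"

text \<open>The shift functor does not change the underlying map of a morphism.\<close>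

definition graded_functor :: "'k ring \<Rightarrow> 'g monoid \<Rightarrow> ('k, 'a, 'g) graded \<Rightarrow> ('k, 'b, 'g) graded
    \<Rightarrow> ('a, 'b, 'u, 'g) functor_data \<Rightarrow> bool" where
  "graded_functor K G A B F \<longleftrightarrow> linear_functor K G A B F \<and>
     (\<forall>g\<in>carrier G. \<forall>M\<in>Gr G A. fobj F (shift G g M) = shift G g (fobj F M)) \<and>
     (\<forall>g\<in>carrier G. \<forall>M\<in>Gr G A. \<forall>N\<in>Gr G A. \<forall>\<phi>\<in>gr_hom G A M N.
        fmap F (shift G g M) (shift G g N) \<phi> = fmap F M N \<phi>)"

definition id_functor :: "('a, 'a, 'u, 'g) functor_data" where
  "id_functor = \<lparr>fobj = (\<lambda>M. M), fmap = (\<lambda>M N \<phi>. \<phi>)\<rparr>"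

definition comp_functor :: "('b, 'c, 'u, 'g) functor_data \<Rightarrow> ('a, 'b, 'u, 'g) functor_data
    \<Rightarrow> ('a, 'c, 'u, 'g) functor_data" where
  "comp_functor V U = \<lparr>fobj = (\<lambda>M. fobj V (fobj U M)),
     fmap = (\<lambda>M N \<phi>. fmap V (fobj U M) (fobj U N) (fmap U M N \<phi>))\<rparr>"

definition gr_naturally_isomorphic :: "'g monoid \<Rightarrow> ('k, 'a, 'g) graded \<Rightarrow> ('k, 'b, 'g) graded
    \<Rightarrow> ('a, 'b, 'u, 'g) functor_data \<Rightarrow> ('a, 'b, 'u, 'g) functor_data \<Rightarrow> bool" where
  "gr_naturally_isomorphic G A B U V \<longleftrightarrow> (\<exists>\<eta>.
     (\<forall>M\<in>Gr G A. \<eta> M \<in> gr_iso G B (fobj U M) (fobj V M)) \<and>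
     (\<forall>M\<in>Gr G A. \<forall>N\<in>Gr G A. \<forall>\<phi>\<in>gr_hom G A M N.
        compose (carrier (fobj U M)) (\<eta> N) (fmap U M N \<phi>) =
          compose (carrier (fobj U M)) (fmap V M N \<phi>) (\<eta> M)) \<and>
     (\<forall>g\<in>carrier G. \<forall>M\<in>Gr G A. \<eta> (shift G g M) = \<eta> M))"

definition graded_equivalence :: "'k ring \<Rightarrow> 'g monoid \<Rightarrow> ('k, 'a, 'g) graded
    \<Rightarrow> ('k, 'b, 'g) graded \<Rightarrow> ('a, 'b, 'u, 'g) functor_data \<Rightarrow> bool" where
  "graded_equivalence K G A B U \<longleftrightarrow> graded_functor K G A B U \<and>
     (\<exists>V. graded_functor K G B A V \<and>
        gr_naturally_isomorphic G A A (comp_functor V U) id_functor \<and>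
        gr_naturally_isomorphic G B B (comp_functor U V) id_functor)"

definition graded_equivalent :: "'u itself \<Rightarrow> 'k ring \<Rightarrow> 'g monoid \<Rightarrow> ('k, 'a, 'g) graded
    \<Rightarrow> ('k, 'b, 'g) graded \<Rightarrow> bool" where
  "graded_equivalent _ K G A B \<longleftrightarrow>
     (\<exists>U :: ('a, 'b, 'u, 'g) functor_data. graded_equivalence K G A B U)"


section \<open>Gr-basic algebras and congruence\<close>

definition gr_submodule :: "'g monoid \<Rightarrow> ('k, 'a, 'g) graded \<Rightarrow> 'm set
    \<Rightarrow> ('a, 'm, 'g) graded \<Rightarrow> bool" where
  "gr_submodule G A N M \<longleftrightarrow> additive_subgroup N M \<and>
     (\<forall>a\<in>carrier A. \<forall>x\<in>N. a \<odot>\<^bsub>M\<^esub> x \<in> N) \<and>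
     (\<forall>x\<in>N. \<exists>f \<in> (\<Pi>\<^sub>E g\<in>carrier G. N \<inter> component M g). x = (\<Oplus>\<^bsub>M\<^esub>g\<in>carrier G. f g))"

definition gr_maximal :: "'g monoid \<Rightarrow> ('k, 'a, 'g) graded \<Rightarrow> 'm set
    \<Rightarrow> ('a, 'm, 'g) graded \<Rightarrow> bool" where
  "gr_maximal G A N M \<longleftrightarrow> gr_submodule G A N M \<and>
     carrier (quotient M N) \<noteq> {\<zero>\<^bsub>quotient M N\<^esub>} \<and>
     (\<forall>L. gr_submodule G A L (quotient M N) \<longrightarrow>
        L = {\<zero>\<^bsub>quotient M N\<^esub>} \<or> L = carrier (quotient M N))"

text \<open>Intersecting with the carrier only matters for the zero algebra.\<close>

definition gr_radical :: "'g monoid \<Rightarrow> ('k, 'a, 'g) graded \<Rightarrow> 'a set" where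
  "gr_radical G A = carrier A \<inter> \<Inter>{N. gr_maximal G A N (regular A)}"

definition gr_division_algebra :: "'k ring \<Rightarrow> 'g monoid \<Rightarrow> ('k, 'a, 'g) graded \<Rightarrow> bool" where
  "gr_division_algebra K G D \<longleftrightarrow> graded_algebra K G D \<and>
     (\<forall>g\<in>carrier G. \<forall>x\<in>component D g. x \<noteq> \<zero>\<^bsub>D\<^esub> \<longrightarrow> x \<in> Units D)"

text \<open>The summands embed into \<open>A/J\<^sub>G(A)\<close>, so carriers in the type \<open>'a set\<close> suffice for them.\<close>

definition gr_basic :: "'k ring \<Rightarrow> 'g monoid \<Rightarrow> ('k, 'a, 'g) graded \<Rightarrow> bool" where
  "gr_basic K G A \<longleftrightarrow> graded_algebra K G A \<and> fin_dim K A \<and>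
     (\<exists>(n::nat) (D :: nat \<Rightarrow> ('k, 'a set, 'g) graded).
        (\<forall>i<n. gr_division_algebra K G (D i)) \<and>
        gr_alg_isomorphic K G (quotient A (gr_radical G A)) (direct_sum {..<n} D))"

definition gr_indecomposable :: "'g monoid \<Rightarrow> ('k, 'a, 'g) graded \<Rightarrow> ('a, 'm, 'g) graded \<Rightarrow> bool" where
  "gr_indecomposable G A M \<longleftrightarrow> carrier M \<noteq> {\<zero>\<^bsub>M\<^esub>} \<and>
     \<not> (\<exists>N\<^sub>1 N\<^sub>2. gr_submodule G A N\<^sub>1 M \<and> gr_submodule G A N\<^sub>2 M \<and>
          N\<^sub>1 \<noteq> {\<zero>\<^bsub>M\<^esub>} \<and> N\<^sub>2 \<noteq> {\<zero>\<^bsub>M\<^esub>} \<and>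
          N\<^sub>1 \<inter> N\<^sub>2 = {\<zero>\<^bsub>M\<^esub>} \<and> N\<^sub>1 <+>\<^bsub>M\<^esub> N\<^sub>2 = carrier M)"

definition gr_projective :: "'g monoid \<Rightarrow> ('k, 'a, 'g) graded \<Rightarrow> ('a, 'u, 'g) graded \<Rightarrow> bool" where
  "gr_projective G A P \<longleftrightarrow>
     (\<forall>X \<in> (Gr G A :: ('a, 'u, 'g) graded set). \<forall>Y \<in> (Gr G A :: ('a, 'u, 'g) graded set).
       \<forall>\<pi> \<in> gr_hom G A X Y. \<forall>\<phi> \<in> gr_hom G A P Y. \<pi> ` carrier X = carrier Y \<longrightarrow>
         (\<exists>\<psi> \<in> gr_hom G A P X. compose (carrier P) \<pi> \<psi> = \<phi>))"

definition complete_gr_projectives :: "'k ring \<Rightarrow> 'g monoid \<Rightarrow> ('k, 'a, 'g) graded \<Rightarrow> nat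
    \<Rightarrow> (nat \<Rightarrow> ('a, 'u, 'g) graded) \<Rightarrow> bool" where
  "complete_gr_projectives K G A n P \<longleftrightarrow>
     (\<forall>i<n. P i \<in> Gr G A \<and> gr_indecomposable G A (P i) \<and> gr_projective G A (P i) \<and>
        fin_dim K (scalars A (P i))) \<and>
     (\<forall>i<n. \<forall>j<n. \<forall>g\<in>carrier G. i \<noteq> j \<longrightarrow> gr_iso G A (P i) (shift G g (P j)) = {}) \<and>
     (\<forall>Q \<in> (Gr G A :: ('a, 'u, 'g) graded set). gr_indecomposable G A Q \<and> gr_projective G A Q \<longrightarrow>
        (\<exists>i<n. \<exists>g\<in>carrier G. gr_iso G A Q (shift G g (P i)) \<noteq> {}))"

text \<open>\<open>is_congruence U K G B A\<close> says that \<open>B\<close> is a congruence of the gr-basic algebra \<open>A\<close>.\<close>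

definition is_congruence :: "'u itself \<Rightarrow> 'k ring \<Rightarrow> 'g monoid \<Rightarrow> ('k, 'b, 'g) graded
    \<Rightarrow> ('k, 'a, 'g) graded \<Rightarrow> bool" where
  "is_congruence _ K G B A \<longleftrightarrow> graded_algebra K G B \<and> gr_basic K G A \<and>
     (\<exists>n (P :: nat \<Rightarrow> ('a, 'u, 'g) graded) (g :: nat \<Rightarrow> 'g).
        complete_gr_projectives K G A n P \<and> (\<forall>i<n. g i \<in> carrier G) \<and>
        gr_alg_isomorphic K G B
          (End_algebra G A (direct_sum {..<n} (\<lambda>i. shift G (g i) (P i)))))"

end

theory Submission
  imports Defs
begin

\<comment> \<open>Parse-only shorthand: an index written as a subscript, as in
  \<open>x \<oplus>\<^sub>M y\<close>, stands for the bracketed structure index of the same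
  operation.\<close>
syntax "_index_sub" :: "logic \<Rightarrow> index" ("(00\<^sub>_)" [1000] 1000)
translations "_index_sub M" \<rightharpoonup> "_index M"

text \<open>
  A graded algebra is gr-basic iff its unit is a sum of orthogonal local idempotents of degree \<open>1\<close> such that
  the left ideals generated by distinct ones are not isomorphic, not even up to shift.  To obtain a
  gr-basic algebra equivalent to \<open>A\<close>, decompose the unit of \<open>A\<close> into local idempotents, keep one of them for each
  isomorphism class up to shift, and let \<open>e\<close> be the sum of those kept.  Then \<open>e\<close> is full (the ideal \<open>AeA\<close>
  contains \<open>1\<close>), so that \<open>M \<mapsto> eM\<close> is a graded equivalence between the modules over \<open>A\<close> and over \<open>eAe\<close>,
  with inverse \<open>N \<mapsto> Hom(eA, N)\<close>.

  For the uniqueness, let \<open>F\<close> be an equivalence from the modules over \<open>B\<close> to those over \<open>C\<close>.  The left ideals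
  \<open>Bf\<close>, for \<open>f\<close> in a decomposition of the unit as above, are all the indecomposable projectives up to shift.
  Indecomposability (no nontrivial idempotent endomorphisms), projectivity and isomorphism are
  preserved by \<open>F\<close>, so the \<open>F(Bf)\<close> form a complete family over \<open>C\<close>.  As \<open>F\<close> commutes with shifts, it
  induces \<open>End(M) \<cong> End(F(M))\<close> degree by degree, and \<open>B \<cong> End(B) \<cong> End(F(B)) \<cong> End(\<Oplus>F(Bf))\<close>.
\<close>

section \<open>Additive maps and graded groups\<close>

text \<open>Functors have to commute with shifts as an equality of objects, and all modules live in
  one type \<open>'u\<close>. Quotients, Hom modules and the algebra itself are therefore brought
  into \<open>'u\<close> by explicit injections: coset representatives, values on a spanning set,
  coordinates over K. The direct sum of the projectives consists of families and lies outside
  \<open>'u\<close>, where the functors cannot reach it. They carry a copy T of it instead,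
  described by inclusions and projections, whose equations survive any additive functor; only over C
  is T compared with the direct sum. Finite dimension enters through a rank function on subspaces,
  behind Fitting's lemma and the nilpotence of the radical. The pivot is a graded Schur lemma: a
  homogeneous element of fAh outside the radical forces f = h and is invertible. It shows that eAe
  is gr-basic and classifies the indecomposable projectives. The finite dimension of F(Bf) cannot be
  seen from F; it is read off from the classification over C. As the F(Bf) themselves serve as the
  complete set over C, every shift in the congruence is trivial.\<close>

lemma (in abelian_group) additive_subgroup_closedI:
  assumes "N \<subseteq> carrier G" "\<zero> \<in> N" "\<And>x y. x \<in> N \<Longrightarrow> y \<in> N \<Longrightarrow> x \<oplus> y \<in> N" "\<And>x. x \<in> N \<Longrightarrow> \<ominus> x \<in> N"
  shows "additive_subgroup N G"
proof (rule additive_subgroupI, rule group.subgroupI[OF a_group])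
  show "N \<noteq> {}" using assms(2) by blast
qed (use assms in \<open>auto simp: a_inv_def\<close>)

lemma additive_subgroupD:
  assumes "additive_subgroup N M"
  shows "N \<subseteq> carrier M" "\<zero>\<^sub>M \<in> N" "\<And>x y. x \<in> N \<Longrightarrow> y \<in> N \<Longrightarrow> x \<oplus>\<^sub>M y \<in> N"
  using assms by (auto simp: additive_subgroup.a_subset additive_subgroup.zero_closed
      additive_subgroup.a_closed)

lemma (in abelian_group) additive_subgroup_neg:
  assumes "additive_subgroup N G" "x \<in> N" shows "\<ominus> x \<in> N"
proof -
  interpret additive_subgroup N G by fact
  show ?thesis using subgroup.m_inv_closed[OF a_subgroup, of x] assms(2) by (simp add: a_inv_def)
qed

lemma (in abelian_group) additive_subgroup_minus:
  assumes "additive_subgroup N G" "x \<in> N" "y \<in> N" shows "x \<ominus> y \<in> N"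
  using additive_subgroup_neg[OF assms(1,3)] additive_subgroupD(3)[OF assms(1)] assms(2) by (simp add: a_minus_def)

lemma (in abelian_group) additive_subgroup_finsum:
  assumes "additive_subgroup N G" "\<And>i. i \<in> I \<Longrightarrow> f i \<in> N"
  shows "finsum G f I \<in> N" using assms(2)
proof (induction I rule: infinite_finite_induct)
  case (infinite I)
  then show ?case using additive_subgroupD[OF assms(1)] by (simp add: finsum_infinite)
next
  case empty
  then show ?case using additive_subgroupD[OF assms(1)] by simp
next
  case (insert i I)
  note N = additive_subgroupD[OF assms(1)]
  have "finsum G f (insert i I) = f i \<oplus> finsum G f I" using insert N(1) by (intro finsum_insert) auto
  then show ?case using insert N by auto
qed

lemma (in abelian_group) minus_eq_zero_iff:
  assumes "x \<in> carrier G" "y \<in> carrier G" shows "x \<ominus> y = \<zero> \<longleftrightarrow> x = y"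
  using assms minus_equality[of x "\<ominus> y"] by (auto simp: a_minus_def r_neg)

text \<open>Group homomorphisms as a bare condition on functions, without the extensionality that
  \<open>lin_hom\<close> demands. Linear maps, evaluations, actions of one element and homogeneous
  projections are all instances, so that compatibility with finite sums is proved once for all of
  them.\<close>

definition additive :: "('m, 'x) ring_scheme \<Rightarrow> ('n, 'y) ring_scheme \<Rightarrow> ('m \<Rightarrow> 'n) \<Rightarrow> bool" where
  "additive M N f \<longleftrightarrow> f \<in> carrier M \<rightarrow> carrier N \<and>
     (\<forall>x\<in>carrier M. \<forall>y\<in>carrier M. f (x \<oplus>\<^sub>M y) = f x \<oplus>\<^sub>N f y)"

lemma additive_maps:
  assumes M: "abelian_group M" and N: "abelian_group N" and f: "additive M N f"
  shows additive_zero: "f \<zero>\<^sub>M = \<zero>\<^sub>N"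
    and additive_neg: "x \<in> carrier M \<Longrightarrow> f (\<ominus>\<^sub>M x) = \<ominus>\<^sub>N f x"
    and additive_minus: "\<lbrakk>x \<in> carrier M; y \<in> carrier M\<rbrakk> \<Longrightarrow> f (x \<ominus>\<^sub>M y) = f x \<ominus>\<^sub>N f y"
    and additive_finsum: "h \<in> I \<rightarrow> carrier M \<Longrightarrow> f (finsum M h I) = finsum N (\<lambda>i. f (h i)) I"
proof -
  interpret M: abelian_group M by fact
  interpret N: abelian_group N by fact
  have fc [simp]: "\<And>x. x \<in> carrier M \<Longrightarrow> f x \<in> carrier N"
    and fa: "\<And>x y. x \<in> carrier M \<Longrightarrow> y \<in> carrier M \<Longrightarrow> f (x \<oplus>\<^sub>M y) = f x \<oplus>\<^sub>N f y" using f by (auto simp: additive_def)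
  have "f \<zero>\<^sub>M \<oplus>\<^sub>N f \<zero>\<^sub>M = f \<zero>\<^sub>M" using fa[of "\<zero>\<^sub>M" "\<zero>\<^sub>M"] by simp
  then show z: "f \<zero>\<^sub>M = \<zero>\<^sub>N" by (metis M.zero_closed N.add.r_cancel_one fc)
  show n: "f (\<ominus>\<^sub>M x) = \<ominus>\<^sub>N f x" if "x \<in> carrier M" for x
  proof -
    have "f (\<ominus>\<^sub>M x) \<oplus>\<^sub>N f x = \<zero>\<^sub>N" using fa[of "\<ominus>\<^sub>M x" x] that z by (simp add: M.l_neg)
    then show ?thesis using that by (simp add: N.minus_equality)
  qed
  then show "\<lbrakk>x \<in> carrier M; y \<in> carrier M\<rbrakk> \<Longrightarrow> f (x \<ominus>\<^sub>M y) = f x \<ominus>\<^sub>N f y" by (simp add: a_minus_def fa)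
  show "h \<in> I \<rightarrow> carrier M \<Longrightarrow> f (finsum M h I) = finsum N (\<lambda>i. f (h i)) I"
  proof (induction I rule: infinite_finite_induct)
    case (insert i I)
    then have "f (finsum M h (insert i I)) = f (h i \<oplus>\<^sub>M finsum M h I)" by (subst M.finsum_insert) auto
    also have "\<dots> = f (h i) \<oplus>\<^sub>N finsum N (\<lambda>i. f (h i)) I" using insert by (subst fa) auto
    also have "\<dots> = finsum N (\<lambda>i. f (h i)) (insert i I)" using insert by (subst N.finsum_insert) (auto simp: Pi_def)
    finally show ?case .
  qed (simp_all add: z M.finsum_infinite N.finsum_infinite)
qed

text \<open>Sums and negatives look only at carrier, addition and zero. This moves additive facts
  between a module and records that differ from it in the other fields, such as
  \<open>regular A\<close>, \<open>shift G g M\<close> or \<open>scalars A M\<close>.\<close>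

lemma finsum_record_cong:
  assumes "carrier M = carrier N" "add M = add N" "zero M = zero N"
  shows "finsum M = finsum N" "a_inv M = a_inv N" "abelian_group M \<longleftrightarrow> abelian_group N"
    "additive_subgroup X M \<longleftrightarrow> additive_subgroup X N"
proof -
  show "finsum M = finsum N" unfolding finsum_def finprod_def by (simp add: assms cong: if_cong)
  show "a_inv M = a_inv N" by (intro ext) (simp add: a_inv_def m_inv_def assms)
  show "abelian_group M \<longleftrightarrow> abelian_group N"
  proof
    assume "abelian_group M"
    from abelian_groupE[OF this] show "abelian_group N" unfolding assms by (rule abelian_groupI)
  next
    assume "abelian_group N"
    from abelian_groupE[OF this] show "abelian_group M" unfolding assms[symmetric] by (rule abelian_groupI)
  qed
  show "additive_subgroup X M \<longleftrightarrow> additive_subgroup X N"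
    using assms unfolding additive_subgroup_def subgroup_def by (simp add: m_inv_def)
qed

lemma graded_by_cong:
  assumes "carrier M = carrier N" "add M = add N" "zero M = zero N"
    "\<And>g. g \<in> carrier G \<Longrightarrow> component M g = component N g"
  shows "graded_by G M \<longleftrightarrow> graded_by G N"
proof -
  have 1: "(\<Pi>\<^sub>E g\<in>carrier G. component M g) = (\<Pi>\<^sub>E g\<in>carrier G. component N g)" using assms(4) by (rule PiE_cong)
  have 2: "finsum M f (carrier G) = finsum N f (carrier G)" for f
    using finsum_record_cong(1)[OF assms(1-3)] by metis
  have 3: "(\<forall>g\<in>carrier G. additive_subgroup (component M g) M) \<longleftrightarrow>
      (\<forall>g\<in>carrier G. additive_subgroup (component N g) N)"
    using assms(4) finsum_record_cong(4)[OF assms(1-3)] by metis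
  show ?thesis unfolding graded_by_def 1 2 3 assms(1) ..
qed

lemma (in abelian_monoid) finsum_delta:
  assumes "finite I" "i \<in> I" "x \<in> carrier G"
  shows "(\<Oplus>j\<in>I. if j = i then x else \<zero>) = x" using finsum_singleton[of i I "\<lambda>_. x"] assms by (simp add: eq_commute)

lemma (in abelian_monoid) finsum_eq_single:
  assumes "finite I" "i \<in> I" "f i \<in> carrier G" "\<And>j. j \<in> I \<Longrightarrow> j \<noteq> i \<Longrightarrow> f j = \<zero>"
  shows "finsum G f I = f i"
proof -
  have "finsum G f I = (\<Oplus>j\<in>I. if j = i then f i else \<zero>)" using assms by (intro finsum_cong') auto
  then show ?thesis using finsum_delta[OF assms(1-3)] by simp
qed

text \<open>The homogeneous component of \<open>x\<close> in degree \<open>g\<close>: the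
  description picks the whole family of components, which is unique by \<open>graded_by\<close> when
  \<open>x\<close> lies in the carrier.\<close>

definition gpr :: "'g monoid \<Rightarrow> ('r, 'm, 'g) graded \<Rightarrow> 'm \<Rightarrow> 'g \<Rightarrow> 'm" where
  "gpr G M x = (THE f. f \<in> (\<Pi>\<^sub>E g\<in>carrier G. component M g) \<and> x = (\<Oplus>\<^sub>M g\<in>carrier G. f g))"

text \<open>The scalar-free core common to graded algebras, graded modules and groups of
  homomorphisms.\<close>

locale graded_group = G?: group G + M?: abelian_group M
  for G :: "'g monoid" and M :: "('r, 'm, 'g) graded" +
  assumes finite_G: "finite (carrier G)" and graded_by: "graded_by G M"
begin

lemma component_subgroup: "g \<in> carrier G \<Longrightarrow> additive_subgroup (component M g) M"
  using graded_by by (auto simp: graded_by_def)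

lemma component_closed: "\<lbrakk>g \<in> carrier G; x \<in> component M g\<rbrakk> \<Longrightarrow> x \<in> carrier M"
  using component_subgroup additive_subgroupD(1) by blast

lemma gpr_props:
  assumes "x \<in> carrier M"
  shows "gpr G M x \<in> (\<Pi>\<^sub>E g\<in>carrier G. component M g)" "(\<Oplus>\<^sub>M g\<in>carrier G. gpr G M x g) = x"
proof -
  have "\<exists>!f. f \<in> (\<Pi>\<^sub>E g\<in>carrier G. component M g) \<and> x = (\<Oplus>\<^sub>M g\<in>carrier G. f g)"
    using graded_by assms by (auto simp: graded_by_def)
  from theI'[OF this] show "gpr G M x \<in> (\<Pi>\<^sub>E g\<in>carrier G. component M g)"
    "(\<Oplus>\<^sub>M g\<in>carrier G. gpr G M x g) = x" by (auto simp: gpr_def)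
qed

lemma gpr_component: "\<lbrakk>x \<in> carrier M; g \<in> carrier G\<rbrakk> \<Longrightarrow> gpr G M x g \<in> component M g"
  using gpr_props(1) by (auto simp: PiE_def)

lemma gpr_closed [simp]: "\<lbrakk>x \<in> carrier M; g \<in> carrier G\<rbrakk> \<Longrightarrow> gpr G M x g \<in> carrier M"
  using gpr_component component_closed by blast

lemma gpr_unique:
  assumes "\<And>g. g \<in> carrier G \<Longrightarrow> f g \<in> component M g" "g \<in> carrier G"
  shows "gpr G M (\<Oplus>\<^sub>M g\<in>carrier G. f g) g = f g"
proof -
  let ?x = "\<Oplus>\<^sub>M g\<in>carrier G. f g" and ?f = "restrict f (carrier G)"
  have fc: "f \<in> carrier G \<rightarrow> carrier M" using assms(1) component_closed by blast
  then have x: "?x \<in> carrier M" by simp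
  have "\<exists>!f. f \<in> (\<Pi>\<^sub>E g\<in>carrier G. component M g) \<and> ?x = (\<Oplus>\<^sub>M g\<in>carrier G. f g)"
    using graded_by x by (auto simp: graded_by_def)
  moreover have "?f \<in> (\<Pi>\<^sub>E g\<in>carrier G. component M g)" using assms(1) by auto
  moreover have "?x = (\<Oplus>\<^sub>M g\<in>carrier G. ?f g)" using fc by (intro finsum_cong') auto
  ultimately have "gpr G M ?x = ?f" using gpr_props[OF x] by metis
  then show ?thesis using assms(2) by simp
qed

lemma gpr_homogeneous:
  assumes "h \<in> carrier G" "x \<in> component M h" "g \<in> carrier G"
  shows "gpr G M x g = (if g = h then x else \<zero>\<^sub>M)"
proof -
  let ?f = "\<lambda>g. if g = h then x else \<zero>\<^sub>M"
  have "(\<Oplus>\<^sub>M g\<in>carrier G. ?f g) = x" using finsum_delta[OF finite_G assms(1)] component_closed assms by blast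
  moreover have "?f g \<in> component M g" if "g \<in> carrier G" for g
    using assms additive_subgroupD(2)[OF component_subgroup[OF that]] by auto
  ultimately show ?thesis using gpr_unique[of ?f g] assms(3) by simp
qed

lemma gpr_add:
  assumes "x \<in> carrier M" "y \<in> carrier M" "g \<in> carrier G"
  shows "gpr G M (x \<oplus>\<^sub>M y) g = gpr G M x g \<oplus>\<^sub>M gpr G M y g"
proof -
  have "(\<Oplus>\<^sub>M g\<in>carrier G. gpr G M x g \<oplus>\<^sub>M gpr G M y g) = x \<oplus>\<^sub>M y"
    using assms(1,2) by (subst finsum_addf) (auto simp: gpr_props)
  then show ?thesis using gpr_unique[of "\<lambda>g. gpr G M x g \<oplus>\<^sub>M gpr G M y g" g] assms
      additive_subgroupD(3)[OF component_subgroup] gpr_component by auto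
qed

lemma gpr_additive: "g \<in> carrier G \<Longrightarrow> additive M M (\<lambda>x. gpr G M x g)"
  by (auto simp: additive_def gpr_add)

lemma gpr_zero [simp]: "g \<in> carrier G \<Longrightarrow> gpr G M \<zero>\<^sub>M g = \<zero>\<^sub>M"
  using additive_zero[OF abelian_group_axioms abelian_group_axioms gpr_additive] .

lemma gpr_minus: "\<lbrakk>x \<in> carrier M; y \<in> carrier M; g \<in> carrier G\<rbrakk> \<Longrightarrow>
    gpr G M (x \<ominus>\<^sub>M y) g = gpr G M x g \<ominus>\<^sub>M gpr G M y g"
  using additive_minus[OF abelian_group_axioms abelian_group_axioms gpr_additive] .

lemma gpr_eqI:
  assumes "x \<in> carrier M" "y \<in> carrier M" "\<And>g. g \<in> carrier G \<Longrightarrow> gpr G M x g = gpr G M y g"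
  shows "x = y"
proof -
  have "x = (\<Oplus>\<^sub>M g\<in>carrier G. gpr G M x g)" using gpr_props(2) assms(1) by simp
  also have "\<dots> = (\<Oplus>\<^sub>M g\<in>carrier G. gpr G M y g)" using assms by (intro finsum_cong') auto
  finally show ?thesis using gpr_props(2) assms(2) by simp
qed

lemma in_subgroupI:
  assumes "additive_subgroup N M" "x \<in> carrier M" "\<And>g. g \<in> carrier G \<Longrightarrow> gpr G M x g \<in> N"
  shows "x \<in> N" using additive_subgroup_finsum[OF assms(1), of "carrier G" "gpr G M x"] assms gpr_props(2) by simp

text \<open>Left translation permutes the finite group. A homogeneous scalar of degree k moves
  degree h to kh, and this restores the index set of the sum over all degrees. The right-handed
  version below does the same for shifts.\<close>

lemma finsum_left_translate:
  assumes "k \<in> carrier G" "\<And>h. h \<in> carrier G \<Longrightarrow> f h \<in> carrier M"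
  shows "(\<Oplus>\<^sub>M h\<in>carrier G. f (k \<otimes>\<^sub>G h)) = (\<Oplus>\<^sub>M h\<in>carrier G. f h)"
proof -
  have "(\<Oplus>\<^sub>M h\<in>carrier G. f (k \<otimes>\<^sub>G h)) = (\<Oplus>\<^sub>M h\<in>(\<lambda>h. k \<otimes>\<^sub>G h) ` carrier G. f h)"
    using assms by (subst finsum_reindex) (auto simp: inj_on_def)
  also have "(\<lambda>h. k \<otimes>\<^sub>G h) ` carrier G = carrier G"
  proof (intro equalityI subsetI)
    fix h assume h: "h \<in> carrier G"
    then have "h = k \<otimes>\<^sub>G (inv\<^bsub>G\<^esub> k \<otimes>\<^sub>G h)" using assms by (simp add: G.m_assoc[symmetric])
    then show "h \<in> (\<lambda>h. k \<otimes>\<^sub>G h) ` carrier G" using h assms by blast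
  qed (use assms in auto)
  finally show ?thesis .
qed

lemma finsum_right_translate:
  assumes "k \<in> carrier G" "\<And>h. h \<in> carrier G \<Longrightarrow> f h \<in> carrier M"
  shows "(\<Oplus>\<^sub>M h\<in>carrier G. f (h \<otimes>\<^sub>G k)) = (\<Oplus>\<^sub>M h\<in>carrier G. f h)"
proof -
  have "(\<Oplus>\<^sub>M h\<in>carrier G. f (h \<otimes>\<^sub>G k)) = (\<Oplus>\<^sub>M h\<in>(\<lambda>h. h \<otimes>\<^sub>G k) ` carrier G. f h)"
    using assms by (subst finsum_reindex) (auto simp: inj_on_def)
  also have "(\<lambda>h. h \<otimes>\<^sub>G k) ` carrier G = carrier G"
  proof (intro equalityI subsetI)
    fix h assume h: "h \<in> carrier G"
    then have "h = (h \<otimes>\<^sub>G inv\<^bsub>G\<^esub> k) \<otimes>\<^sub>G k" using assms by (simp add: G.m_assoc)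
    then show "h \<in> (\<lambda>h. h \<otimes>\<^sub>G k) ` carrier G" using h assms by blast
  qed (use assms in auto)
  finally show ?thesis .
qed

end

lemma abelian_group_image:
  assumes M: "abelian_group M" and c: "carrier Q = \<pi> ` carrier M" and z: "zero Q = \<pi> (zero M)"
    and a: "\<And>x y. \<lbrakk>x \<in> carrier M; y \<in> carrier M\<rbrakk> \<Longrightarrow> \<pi> x \<oplus>\<^sub>Q \<pi> y = \<pi> (x \<oplus>\<^sub>M y)"
  shows "abelian_group Q"
proof -
  interpret M: abelian_group M by fact
  show ?thesis
  proof (rule abelian_groupI)
    show "\<exists>y\<in>carrier Q. y \<oplus>\<^sub>Q x = \<zero>\<^sub>Q" if x: "x \<in> carrier Q" for x
    proof -
      obtain u where u: "u \<in> carrier M" "x = \<pi> u" using x c by auto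
      have "\<pi> (\<ominus>\<^sub>M u) \<oplus>\<^sub>Q x = \<zero>\<^sub>Q" using u by (simp add: a z M.l_neg)
      then show ?thesis using c u by blast
    qed
  qed (auto simp: c z a M.a_ac)
qed

text \<open>A grading is the same as a family of additive projections onto the components. Applying
  \<open>p g\<close> to any decomposition of x isolates its entry in degree g, which yields the
  uniqueness demanded by \<open>graded_by\<close>.\<close>

lemma graded_byI:
  assumes M: "abelian_group M" and fin: "finite (carrier G)"
    and sub: "\<And>g. g \<in> carrier G \<Longrightarrow> additive_subgroup (component M g) M"
    and p: "\<And>g. g \<in> carrier G \<Longrightarrow> additive M M (p g)"
    and pc: "\<And>g x. \<lbrakk>g \<in> carrier G; x \<in> carrier M\<rbrakk> \<Longrightarrow> p g x \<in> component M g"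
    and psum: "\<And>x. x \<in> carrier M \<Longrightarrow> (\<Oplus>\<^sub>M g\<in>carrier G. p g x) = x"
    and delta: "\<And>g h x. \<lbrakk>g \<in> carrier G; h \<in> carrier G; x \<in> component M h\<rbrakk> \<Longrightarrow>
      p g x = (if g = h then x else \<zero>\<^sub>M)"
  shows "graded_by G M" unfolding graded_by_def
proof (intro conjI ballI)
  interpret M: abelian_group M by fact
  fix x assume x: "x \<in> carrier M"
  have cc: "\<And>g y. g \<in> carrier G \<Longrightarrow> y \<in> component M g \<Longrightarrow> y \<in> carrier M" using additive_subgroupD(1)[OF sub] by blast
  show "\<exists>!f. f \<in> (\<Pi>\<^sub>E g\<in>carrier G. component M g) \<and> x = (\<Oplus>\<^sub>M g\<in>carrier G. f g)"
  proof (rule ex1I[of _ "\<lambda>g\<in>carrier G. p g x"])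
    have "(\<Oplus>\<^sub>M g\<in>carrier G. restrict (\<lambda>g. p g x) (carrier G) g) = (\<Oplus>\<^sub>M g\<in>carrier G. p g x)"
      using x p by (intro M.finsum_cong') (auto simp: additive_def)
    then show "(\<lambda>g\<in>carrier G. p g x) \<in> (\<Pi>\<^sub>E g\<in>carrier G. component M g) \<and>
        x = (\<Oplus>\<^sub>M g\<in>carrier G. (\<lambda>g\<in>carrier G. p g x) g)" using x pc psum by auto
  next
    fix f assume f: "f \<in> (\<Pi>\<^sub>E g\<in>carrier G. component M g) \<and> x = (\<Oplus>\<^sub>M g\<in>carrier G. f g)"
    have fc: "f \<in> carrier G \<rightarrow> carrier M" using f cc by blast
    show "f = (\<lambda>g\<in>carrier G. p g x)"
    proof (rule extensionalityI[of _ "carrier G"])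
      fix g assume g: "g \<in> carrier G"
      have "p g x = (\<Oplus>\<^sub>M h\<in>carrier G. p g (f h))" using additive_finsum[OF M M p[OF g] fc] f by simp
      also have "\<dots> = (\<Oplus>\<^sub>M h\<in>carrier G. if h = g then f g else \<zero>\<^sub>M)"
        using f g fc delta by (intro M.finsum_cong') (auto simp: PiE_def Pi_def)
      also have "\<dots> = f g" using M.finsum_delta[OF fin g] fc g by auto
      finally show "f g = (\<lambda>g\<in>carrier G. p g x) g" using g by simp
    qed (use f in \<open>auto simp: PiE_def\<close>)
  qed
qed (use sub in auto)

text \<open>If the kernel is closed under homogeneous components, the component of an image does not
  depend on the chosen preimage, and the grading descends. Quotients and copies along injections are
  both of this kind.\<close>

lemma graded_by_image:
  assumes M: "graded_group G M" and Q: "abelian_group Q" and c: "carrier Q = \<pi> ` carrier M"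
    and a: "\<And>x y. \<lbrakk>x \<in> carrier M; y \<in> carrier M\<rbrakk> \<Longrightarrow> \<pi> x \<oplus>\<^sub>Q \<pi> y = \<pi> (x \<oplus>\<^sub>M y)"
    and comp: "\<And>g. g \<in> carrier G \<Longrightarrow> component Q g = \<pi> ` component M g"
    and ker: "\<And>x g. \<lbrakk>x \<in> carrier M; \<pi> x = \<zero>\<^sub>Q; g \<in> carrier G\<rbrakk> \<Longrightarrow> \<pi> (gpr G M x g) = \<zero>\<^sub>Q"
  shows "graded_by G Q"
proof -
  interpret M: graded_group G M by fact
  interpret Q: abelian_group Q by fact
  have add: "additive M Q \<pi>" using c a by (auto simp: additive_def)
  note z = additive_zero[OF M.abelian_group_axioms Q add]
    and n = additive_neg[OF M.abelian_group_axioms Q add]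
    and m = additive_minus[OF M.abelian_group_axioms Q add]
    and s = additive_finsum[OF M.abelian_group_axioms Q add]
  define r where "r = inv_into (carrier M) \<pi>"
  have r: "r y \<in> carrier M" "\<pi> (r y) = y" if "y \<in> carrier Q" for y
    using that c by (auto simp: r_def inv_into_into f_inv_into_f)
  have pc: "\<pi> x \<in> carrier Q" if "x \<in> carrier M" for x using that c by auto
  \<comment> \<open>The component in the image, computed on the preimage \<open>r y\<close>. Two
    preimages differ by an element of the kernel, so the next fact holds for every preimage.\<close>
  define p where "p g y = \<pi> (gpr G M (r y) g)" for g y
  have p: "p g (\<pi> x) = \<pi> (gpr G M x g)" if x: "x \<in> carrier M" and g: "g \<in> carrier G" for g x
  proof -
    let ?d = "r (\<pi> x) \<ominus>\<^sub>M x"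
    have "\<pi> ?d = \<zero>\<^sub>Q" using m[of "r (\<pi> x)" x] r[OF pc[OF x]] x pc by (simp add: Q.minus_eq_zero_iff)
    then have "\<pi> (gpr G M ?d g) = \<zero>\<^sub>Q" using ker g x r[OF pc[OF x]] by simp
    then have "\<pi> (gpr G M (r (\<pi> x)) g) \<ominus>\<^sub>Q \<pi> (gpr G M x g) = \<zero>\<^sub>Q"
      using M.gpr_minus[of "r (\<pi> x)" x g] m r[OF pc[OF x]] x g by simp
    then show ?thesis using r[OF pc[OF x]] x g pc by (simp add: p_def Q.minus_eq_zero_iff)
  qed
  show ?thesis
  proof (rule graded_byI[of Q G p])
    show "additive_subgroup (component Q g) Q" if g: "g \<in> carrier G" for g unfolding comp[OF g]
    proof (rule Q.additive_subgroup_closedI)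
      note cs = M.component_subgroup[OF g]
      show "\<pi> ` component M g \<subseteq> carrier Q" using pc M.component_closed[OF g] by auto
      show "\<zero>\<^sub>Q \<in> \<pi> ` component M g" using z additive_subgroupD(2)[OF cs] by force
      show "x \<oplus>\<^sub>Q y \<in> \<pi> ` component M g"
        if xy: "x \<in> \<pi> ` component M g" "y \<in> \<pi> ` component M g" for x y
      proof -
        obtain u v where "u \<in> component M g" "v \<in> component M g" "x = \<pi> u" "y = \<pi> v" using xy by auto
        then show ?thesis using a[of u v] M.component_closed[OF g] additive_subgroupD(3)[OF cs, of u v] by auto
      qed
      show "\<ominus>\<^sub>Q x \<in> \<pi> ` component M g" if x: "x \<in> \<pi> ` component M g" for x
      proof -
        obtain u where "u \<in> component M g" "x = \<pi> u" using x by auto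
        then show ?thesis using n[of u] M.component_closed[OF g] M.additive_subgroup_neg[OF cs, of u]
          by (metis imageI)
      qed
    qed
    show "additive Q Q (p g)" if "g \<in> carrier G" for g
      using that unfolding additive_def c by (auto simp: p a M.gpr_add)
    show "p g y \<in> component Q g" if "g \<in> carrier G" "y \<in> carrier Q" for g y
      using that comp M.gpr_component r by (auto simp: p_def)
    show "(\<Oplus>\<^sub>Q g\<in>carrier G. p g y) = y" if "y \<in> carrier Q" for y
      using s[of "gpr G M (r y)" "carrier G"] r[OF that] M.gpr_props(2) by (simp add: p_def Pi_def)
    show "p g y = (if g = h then y else \<zero>\<^sub>Q)"
      if "g \<in> carrier G" "h \<in> carrier G" "y \<in> component Q h" for g h y
      using that comp p M.gpr_homogeneous M.component_closed z by auto
  qed (fact Q M.finite_G)+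
qed

section \<open>Graded modules and their homomorphisms\<close>

sublocale graded_algebra \<subseteq> AG: graded_group G A by (unfold_locales) (rule finite_group, rule grading)

definition sub :: "('r, 'm, 'g) graded \<Rightarrow> 'm set \<Rightarrow> ('r, 'm, 'g) graded" where
  "sub M N = M\<lparr>carrier := N, component := (\<lambda>g. component M g \<inter> N)\<rparr>"

lemma sub_simps [simp]:
  "carrier (sub M N) = N" "add (sub M N) = add M" "zero (sub M N) = zero M"
  "smult (sub M N) = smult M" "component (sub M N) g = component M g \<inter> N" by (auto simp: sub_def)

lemma shift_simps [simp]:
  "carrier (shift G g M) = carrier M" "add (shift G g M) = add M" "zero (shift G g M) = zero M"
  "smult (shift G g M) = smult M"
  "h \<in> carrier G \<Longrightarrow> component (shift G g M) h = component M (h \<otimes>\<^sub>G g)" by (auto simp: shift_def)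

lemma lin_hom_shift [simp]:
  "lin_hom A (shift G g M) N = lin_hom A M N" "lin_hom A M (shift G g N) = lin_hom A M N"
  by (auto simp: lin_hom_def)

lemma regular_simps [simp]:
  "carrier (regular A) = carrier A" "add (regular A) = add A" "zero (regular A) = zero A"
  "smult (regular A) = mult A" "component (regular A) = component A" by (auto simp: regular_def)

lemma finsum_regular [simp]: "finsum (regular A) = finsum A"
  by (rule finsum_record_cong) simp_all

lemma gpr_regular [simp]: "gpr G (regular A) = gpr G A"
  unfolding gpr_def regular_simps finsum_regular ..

lemma lin_homD:
  assumes "\<phi> \<in> lin_hom A M N"
  shows lin_hom_closed: "\<And>x. x \<in> carrier M \<Longrightarrow> \<phi> x \<in> carrier N"
    and lin_hom_add: "\<And>x y. \<lbrakk>x \<in> carrier M; y \<in> carrier M\<rbrakk> \<Longrightarrow> \<phi> (x \<oplus>\<^sub>M y) = \<phi> x \<oplus>\<^sub>N \<phi> y"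
    and lin_hom_smult: "\<And>a x. \<lbrakk>a \<in> carrier A; x \<in> carrier M\<rbrakk> \<Longrightarrow> \<phi> (a \<odot>\<^sub>M x) = a \<odot>\<^sub>N \<phi> x"
    and lin_hom_extensional: "\<phi> \<in> extensional (carrier M)"
    and lin_hom_additive: "additive M N \<phi>" using assms by (auto simp: lin_hom_def additive_def PiE_def)

lemma gr_hom_lin_hom: "\<phi> \<in> gr_hom G A M N \<Longrightarrow> \<phi> \<in> lin_hom A M N"
  by (simp add: gr_hom_def)

lemmas gr_homD = lin_homD[OF gr_hom_lin_hom]

lemma gr_hom_component:
  "\<lbrakk>\<phi> \<in> gr_hom G A M N; g \<in> carrier G; x \<in> component M g\<rbrakk> \<Longrightarrow> \<phi> x \<in> component N g" by (auto simp: gr_hom_def)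

lemma gr_homI:
  assumes "\<phi> \<in> extensional (carrier M)" "\<And>x. x \<in> carrier M \<Longrightarrow> \<phi> x \<in> carrier N"
    "\<And>x y. \<lbrakk>x \<in> carrier M; y \<in> carrier M\<rbrakk> \<Longrightarrow> \<phi> (x \<oplus>\<^sub>M y) = \<phi> x \<oplus>\<^sub>N \<phi> y"
    "\<And>a x. \<lbrakk>a \<in> carrier A; x \<in> carrier M\<rbrakk> \<Longrightarrow> \<phi> (a \<odot>\<^sub>M x) = a \<odot>\<^sub>N \<phi> x"
    "\<And>g x. \<lbrakk>g \<in> carrier G; x \<in> component M g\<rbrakk> \<Longrightarrow> \<phi> x \<in> component N g"
  shows "\<phi> \<in> gr_hom G A M N" using assms by (auto simp: gr_hom_def lin_hom_def PiE_def)

lemma lin_homI: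
  assumes "\<phi> \<in> extensional (carrier M)" "\<And>x. x \<in> carrier M \<Longrightarrow> \<phi> x \<in> carrier N"
    "\<And>x y. \<lbrakk>x \<in> carrier M; y \<in> carrier M\<rbrakk> \<Longrightarrow> \<phi> (x \<oplus>\<^sub>M y) = \<phi> x \<oplus>\<^sub>N \<phi> y"
    "\<And>a x. \<lbrakk>a \<in> carrier A; x \<in> carrier M\<rbrakk> \<Longrightarrow> \<phi> (a \<odot>\<^sub>M x) = a \<odot>\<^sub>N \<phi> x"
  shows "\<phi> \<in> lin_hom A M N" using assms by (auto simp: lin_hom_def PiE_def)

lemma lin_hom_eqI:
  assumes "\<phi> \<in> lin_hom A M N" "\<psi> \<in> lin_hom A M N'" "\<And>x. x \<in> carrier M \<Longrightarrow> \<phi> x = \<psi> x"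
  shows "\<phi> = \<psi>" using assms lin_homD(4) extensionalityI by metis

lemma lin_hom_compose:
  assumes "\<phi> \<in> lin_hom A L M" "\<psi> \<in> lin_hom A M N"
    and "\<And>x y. \<lbrakk>x \<in> carrier L; y \<in> carrier L\<rbrakk> \<Longrightarrow> x \<oplus>\<^sub>L y \<in> carrier L"
    and "\<And>a x. \<lbrakk>a \<in> carrier A; x \<in> carrier L\<rbrakk> \<Longrightarrow> a \<odot>\<^sub>L x \<in> carrier L"
  shows "compose (carrier L) \<psi> \<phi> \<in> lin_hom A L N"
  using lin_homD(1-3)[OF assms(1)] lin_homD(1-3)[OF assms(2)] assms(3,4)
  by (intro lin_homI) (simp_all add: compose_eq compose_extensional)

lemma gr_isoI':
  assumes "\<phi> \<in> gr_hom G A M N" "\<psi> \<in> gr_hom G A N M"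
    "\<And>x. x \<in> carrier M \<Longrightarrow> \<psi> (\<phi> x) = x" "\<And>y. y \<in> carrier N \<Longrightarrow> \<phi> (\<psi> y) = y"
  shows "\<phi> \<in> gr_iso G A M N"
  using assms unfolding gr_iso_def compose_def by (auto intro!: bexI[of _ \<psi>] cong: restrict_cong)

lemma gr_isoE:
  assumes "\<phi> \<in> gr_iso G A M N"
  obtains \<psi> where "\<phi> \<in> gr_hom G A M N" "\<psi> \<in> gr_hom G A N M"
    "\<And>x. x \<in> carrier M \<Longrightarrow> \<psi> (\<phi> x) = x" "\<And>y. y \<in> carrier N \<Longrightarrow> \<phi> (\<psi> y) = y"
proof -
  from assms obtain \<psi> where 1: "\<phi> \<in> gr_hom G A M N" "\<psi> \<in> gr_hom G A N M"
    "compose (carrier M) \<psi> \<phi> = (\<lambda>x\<in>carrier M. x)" "compose (carrier N) \<phi> \<psi> = (\<lambda>y\<in>carrier N. y)"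
    unfolding gr_iso_def by blast
  show ?thesis
  proof (rule that[OF 1(1,2)])
    show "\<psi> (\<phi> x) = x" if "x \<in> carrier M" for x using fun_cong[OF 1(3), of x] that by (simp add: compose_eq)
    show "\<phi> (\<psi> y) = y" if "y \<in> carrier N" for y using fun_cong[OF 1(4), of y] that by (simp add: compose_eq)
  qed
qed

lemma gr_iso_bij_betw:
  assumes "\<phi> \<in> gr_iso G A M N" shows "bij_betw \<phi> (carrier M) (carrier N)"
proof -
  obtain \<psi> where "\<phi> \<in> gr_hom G A M N" "\<psi> \<in> gr_hom G A N M"
    "\<And>x. x \<in> carrier M \<Longrightarrow> \<psi> (\<phi> x) = x" "\<And>y. y \<in> carrier N \<Longrightarrow> \<phi> (\<psi> y) = y" using gr_isoE[OF assms] by blast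
  then show ?thesis by (intro bij_betw_byWitness[where f'=\<psi>]) (auto dest: gr_homD(1))
qed

lemma gr_iso_gr_hom: "\<phi> \<in> gr_iso G A M N \<Longrightarrow> \<phi> \<in> gr_hom G A M N"
  by (simp add: gr_iso_def)

section \<open>Arithmetic in graded modules and graded submodules\<close>

context graded_algebra
begin

lemma GrD:
  assumes "M \<in> Gr G A"
  shows Gr_graded_group: "graded_group G M" and Gr_abelian_group: "abelian_group M"
    and Gr_smult_closed: "\<And>a x. \<lbrakk>a \<in> carrier A; x \<in> carrier M\<rbrakk> \<Longrightarrow> a \<odot>\<^sub>M x \<in> carrier M"
    and Gr_smult_l_distr: "\<And>a b x. \<lbrakk>a \<in> carrier A; b \<in> carrier A; x \<in> carrier M\<rbrakk> \<Longrightarrow>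
      (a \<oplus>\<^sub>A b) \<odot>\<^sub>M x = a \<odot>\<^sub>M x \<oplus>\<^sub>M b \<odot>\<^sub>M x"
    and Gr_smult_r_distr: "\<And>a x y. \<lbrakk>a \<in> carrier A; x \<in> carrier M; y \<in> carrier M\<rbrakk> \<Longrightarrow>
      a \<odot>\<^sub>M (x \<oplus>\<^sub>M y) = a \<odot>\<^sub>M x \<oplus>\<^sub>M a \<odot>\<^sub>M y"
    and Gr_smult_assoc: "\<And>a b x. \<lbrakk>a \<in> carrier A; b \<in> carrier A; x \<in> carrier M\<rbrakk> \<Longrightarrow>
      (a \<otimes>\<^sub>A b) \<odot>\<^sub>M x = a \<odot>\<^sub>M (b \<odot>\<^sub>M x)"
    and Gr_smult_one: "\<And>x. x \<in> carrier M \<Longrightarrow> \<one>\<^sub>A \<odot>\<^sub>M x = x"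
    and Gr_component_smult: "\<And>g h a x. \<lbrakk>g \<in> carrier G; h \<in> carrier G; a \<in> component A g;
      x \<in> component M h\<rbrakk> \<Longrightarrow> a \<odot>\<^sub>M x \<in> component M (g \<otimes>\<^sub>G h)"
    and Gr_component_closed: "\<And>g x. \<lbrakk>g \<in> carrier G; x \<in> component M g\<rbrakk> \<Longrightarrow> x \<in> carrier M"
    and Gr_graded_by: "graded_by G M"
proof -
  interpret M: graded_module G A M using assms by (simp add: Gr_def)
  show gg: "graded_group G M" by (intro graded_group.intro graded_group_axioms.intro finite_group M.grading
        M.abelian_group_axioms G.is_group)
  show "abelian_group M" ..
  show "\<And>g x. \<lbrakk>g \<in> carrier G; x \<in> component M g\<rbrakk> \<Longrightarrow> x \<in> carrier M" using graded_group.component_closed[OF gg] .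
qed (use assms in \<open>auto simp: Gr_def graded_module_def left_module_def left_module_axioms_def
      graded_module_axioms_def\<close>)

lemma GrI:
  assumes "abelian_group M" "graded_by G M"
    "\<And>a x. \<lbrakk>a \<in> carrier A; x \<in> carrier M\<rbrakk> \<Longrightarrow> a \<odot>\<^sub>M x \<in> carrier M"
    "\<And>a b x. \<lbrakk>a \<in> carrier A; b \<in> carrier A; x \<in> carrier M\<rbrakk> \<Longrightarrow>
      (a \<oplus>\<^sub>A b) \<odot>\<^sub>M x = a \<odot>\<^sub>M x \<oplus>\<^sub>M b \<odot>\<^sub>M x"
    "\<And>a x y. \<lbrakk>a \<in> carrier A; x \<in> carrier M; y \<in> carrier M\<rbrakk> \<Longrightarrow>
      a \<odot>\<^sub>M (x \<oplus>\<^sub>M y) = a \<odot>\<^sub>M x \<oplus>\<^sub>M a \<odot>\<^sub>M y"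
    "\<And>a b x. \<lbrakk>a \<in> carrier A; b \<in> carrier A; x \<in> carrier M\<rbrakk> \<Longrightarrow>
      (a \<otimes>\<^sub>A b) \<odot>\<^sub>M x = a \<odot>\<^sub>M (b \<odot>\<^sub>M x)"
    "\<And>x. x \<in> carrier M \<Longrightarrow> \<one>\<^sub>A \<odot>\<^sub>M x = x"
    "\<And>g h a x. \<lbrakk>g \<in> carrier G; h \<in> carrier G; a \<in> component A g; x \<in> component M h\<rbrakk> \<Longrightarrow>
      a \<odot>\<^sub>M x \<in> component M (g \<otimes>\<^sub>G h)"
  shows "M \<in> Gr G A" using assms A.ring_axioms by (auto simp: Gr_def graded_module_def left_module_def
      left_module_axioms_def graded_module_axioms_def)

lemma regular_Gr: "regular A \<in> Gr G A"
proof (rule GrI)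
  show "abelian_group (regular A)" using finsum_record_cong(3)[of "regular A" A] A.abelian_group_axioms by simp
  show "graded_by G (regular A)" using graded_by_cong[of "regular A" A G] grading by simp
qed (auto simp: A.l_distr A.r_distr A.m_assoc intro: component_mult)

lemma Gr_lin_hom_compose:
  "\<lbrakk>L \<in> Gr G A; \<phi> \<in> lin_hom A L M; \<psi> \<in> lin_hom A M N\<rbrakk> \<Longrightarrow> compose (carrier L) \<psi> \<phi> \<in> lin_hom A L N"
  by (rule lin_hom_compose) (auto simp: GrD abelian_groupE(1)[OF Gr_abelian_group])

lemma gr_hom_compose:
  "\<lbrakk>L \<in> Gr G A; \<phi> \<in> gr_hom G A L M; \<psi> \<in> gr_hom G A M N\<rbrakk> \<Longrightarrow> compose (carrier L) \<psi> \<phi> \<in> gr_hom G A L N"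
  using Gr_lin_hom_compose[of L \<phi> M \<psi> N] Gr_component_closed[of L] by (fastforce simp: gr_hom_def compose_eq)

lemma Gr_smult_additive: "\<lbrakk>M \<in> Gr G A; a \<in> carrier A\<rbrakk> \<Longrightarrow> additive M M (\<lambda>x. a \<odot>\<^sub>M x)"
  by (auto simp: additive_def GrD)

lemma Gr_smult_additive_left: "\<lbrakk>M \<in> Gr G A; x \<in> carrier M\<rbrakk> \<Longrightarrow> additive A M (\<lambda>a. a \<odot>\<^sub>M x)"
  by (auto simp: additive_def GrD)

lemma Gr_smult:
  assumes M: "M \<in> Gr G A"
  shows Gr_smult_zero: "a \<in> carrier A \<Longrightarrow> a \<odot>\<^sub>M \<zero>\<^sub>M = \<zero>\<^sub>M"
    and Gr_zero_smult: "x \<in> carrier M \<Longrightarrow> \<zero>\<^sub>A \<odot>\<^sub>M x = \<zero>\<^sub>M"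
    and Gr_smult_neg: "\<lbrakk>a \<in> carrier A; x \<in> carrier M\<rbrakk> \<Longrightarrow> a \<odot>\<^sub>M (\<ominus>\<^sub>M x) = \<ominus>\<^sub>M (a \<odot>\<^sub>M x)"
    and Gr_neg_smult: "\<lbrakk>a \<in> carrier A; x \<in> carrier M\<rbrakk> \<Longrightarrow> (\<ominus>\<^sub>A a) \<odot>\<^sub>M x = \<ominus>\<^sub>M (a \<odot>\<^sub>M x)"
    and Gr_smult_minus: "\<lbrakk>a \<in> carrier A; x \<in> carrier M; y \<in> carrier M\<rbrakk> \<Longrightarrow>
      a \<odot>\<^sub>M (x \<ominus>\<^sub>M y) = a \<odot>\<^sub>M x \<ominus>\<^sub>M a \<odot>\<^sub>M y"
    and Gr_minus_smult: "\<lbrakk>a \<in> carrier A; b \<in> carrier A; x \<in> carrier M\<rbrakk> \<Longrightarrow>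
      (a \<ominus>\<^sub>A b) \<odot>\<^sub>M x = a \<odot>\<^sub>M x \<ominus>\<^sub>M b \<odot>\<^sub>M x"
    and Gr_smult_finsum: "\<lbrakk>a \<in> carrier A; f \<in> I \<rightarrow> carrier M\<rbrakk> \<Longrightarrow>
      a \<odot>\<^sub>M finsum M f I = (\<Oplus>\<^sub>M i\<in>I. a \<odot>\<^sub>M f i)"
    and Gr_finsum_smult: "\<lbrakk>x \<in> carrier M; h \<in> I \<rightarrow> carrier A\<rbrakk> \<Longrightarrow>
      finsum A h I \<odot>\<^sub>M x = (\<Oplus>\<^sub>M i\<in>I. h i \<odot>\<^sub>M x)"
proof -
  note ab = Gr_abelian_group[OF M] A.abelian_group_axioms
  note r = Gr_smult_additive[OF M] and l = Gr_smult_additive_left[OF M]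
  show "a \<in> carrier A \<Longrightarrow> a \<odot>\<^sub>M \<zero>\<^sub>M = \<zero>\<^sub>M" using additive_zero[OF ab(1,1) r] .
  show "x \<in> carrier M \<Longrightarrow> \<zero>\<^sub>A \<odot>\<^sub>M x = \<zero>\<^sub>M" using additive_zero[OF ab(2,1) l] .
  show "\<lbrakk>a \<in> carrier A; x \<in> carrier M\<rbrakk> \<Longrightarrow> a \<odot>\<^sub>M (\<ominus>\<^sub>M x) = \<ominus>\<^sub>M (a \<odot>\<^sub>M x)" using additive_neg[OF ab(1,1) r] .
  show "\<lbrakk>a \<in> carrier A; x \<in> carrier M\<rbrakk> \<Longrightarrow> (\<ominus>\<^sub>A a) \<odot>\<^sub>M x = \<ominus>\<^sub>M (a \<odot>\<^sub>M x)" using additive_neg[OF ab(2,1) l] .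
  show "\<lbrakk>a \<in> carrier A; x \<in> carrier M; y \<in> carrier M\<rbrakk> \<Longrightarrow>
      a \<odot>\<^sub>M (x \<ominus>\<^sub>M y) = a \<odot>\<^sub>M x \<ominus>\<^sub>M a \<odot>\<^sub>M y" using additive_minus[OF ab(1,1) r] .
  show "\<lbrakk>a \<in> carrier A; b \<in> carrier A; x \<in> carrier M\<rbrakk> \<Longrightarrow>
      (a \<ominus>\<^sub>A b) \<odot>\<^sub>M x = a \<odot>\<^sub>M x \<ominus>\<^sub>M b \<odot>\<^sub>M x" using additive_minus[OF ab(2,1) l] .
  show "\<lbrakk>a \<in> carrier A; f \<in> I \<rightarrow> carrier M\<rbrakk> \<Longrightarrow>
      a \<odot>\<^sub>M finsum M f I = (\<Oplus>\<^sub>M i\<in>I. a \<odot>\<^sub>M f i)" using additive_finsum[OF ab(1,1) r] .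
  show "\<lbrakk>x \<in> carrier M; h \<in> I \<rightarrow> carrier A\<rbrakk> \<Longrightarrow>
      finsum A h I \<odot>\<^sub>M x = (\<Oplus>\<^sub>M i\<in>I. h i \<odot>\<^sub>M x)" using additive_finsum[OF ab(2,1) l] .
qed

text \<open>Multiplying the decomposition of x by a scalar of degree h gives a decomposition of the
  product with all degrees translated by h, and decompositions are unique.\<close>

lemma gpr_smult:
  assumes M: "M \<in> Gr G A" and h: "h \<in> carrier G" and a: "a \<in> component A h"
    and x: "x \<in> carrier M" and g: "g \<in> carrier G"
  shows "gpr G M (a \<odot>\<^sub>M x) (h \<otimes>\<^sub>G g) = a \<odot>\<^sub>M gpr G M x g"
proof -
  interpret M: graded_group G M by (rule Gr_graded_group[OF M])
  note ac = AG.component_closed[OF h a]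
  let ?f = "\<lambda>k. a \<odot>\<^sub>M gpr G M x (inv\<^bsub>G\<^esub> h \<otimes>\<^sub>G k)"
  have fc: "?f k \<in> component M k" if "k \<in> carrier G" for k
    using Gr_component_smult[OF M h _ a, of "inv\<^bsub>G\<^esub> h \<otimes>\<^sub>G k" "gpr G M x (inv\<^bsub>G\<^esub> h \<otimes>\<^sub>G k)"]
      M.gpr_component x h that by (simp add: G.m_assoc[symmetric])
  have "a \<odot>\<^sub>M x = (\<Oplus>\<^sub>M k\<in>carrier G. a \<odot>\<^sub>M gpr G M x k)"
    using Gr_smult_finsum[OF M ac, of "gpr G M x" "carrier G"] M.gpr_props(2)[OF x] x by (auto simp: Pi_def)
  also have "\<dots> = (\<Oplus>\<^sub>M k\<in>carrier G. ?f (h \<otimes>\<^sub>G k))"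
    using x h ac by (intro M.finsum_cong') (auto simp: G.m_assoc[symmetric] GrD[OF M])
  also have "\<dots> = (\<Oplus>\<^sub>M k\<in>carrier G. ?f k)" using x h ac by (intro M.finsum_left_translate) (auto simp: GrD[OF M])
  finally have "a \<odot>\<^sub>M x = (\<Oplus>\<^sub>M k\<in>carrier G. ?f k)" .
  then have "gpr G M (a \<odot>\<^sub>M x) (h \<otimes>\<^sub>G g) = ?f (h \<otimes>\<^sub>G g)" using M.gpr_unique[of ?f "h \<otimes>\<^sub>G g"] fc h g by simp
  then show ?thesis using h g by (simp add: G.m_assoc[symmetric])
qed

text \<open>Comparing degrees in \<open>x \<bullet> \<one> = x\<close> for homogeneous x shows that
  the component \<open>?e\<close> of the unit in the identity degree is right neutral on homogeneous
  elements. Summing over the components of the unit gives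
  \<open>\<one> \<bullet> ?e = \<one>\<close>.\<close>

lemma one_component: "\<one>\<^sub>A \<in> component A \<one>\<^sub>G"
proof -
  let ?e = "gpr G A \<one>\<^sub>A \<one>\<^sub>G"
  have e: "?e \<in> component A \<one>\<^sub>G" "?e \<in> carrier A" by (auto intro: AG.gpr_component)
  have 1: "x \<otimes>\<^sub>A ?e = x" if "g \<in> carrier G" "x \<in> component A g" for g x
    using gpr_smult[OF regular_Gr, of g x "\<one>\<^sub>A" "\<one>\<^sub>G"] that AG.component_closed[OF that]
      AG.gpr_homogeneous[of g x g] by simp
  have "\<one>\<^sub>A \<otimes>\<^sub>A ?e = (\<Oplus>\<^sub>A g\<in>carrier G. gpr G A \<one>\<^sub>A g) \<otimes>\<^sub>A ?e" using AG.gpr_props(2) by simp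
  also have "\<dots> = (\<Oplus>\<^sub>A g\<in>carrier G. gpr G A \<one>\<^sub>A g \<otimes>\<^sub>A ?e)"
    using e(2) by (intro A.finsum_ldistr) (auto simp: finite_group)
  also have "\<dots> = (\<Oplus>\<^sub>A g\<in>carrier G. gpr G A \<one>\<^sub>A g)" using 1 e(2) AG.gpr_component by (intro A.finsum_cong') auto
  also have "\<dots> = \<one>\<^sub>A" using AG.gpr_props(2) by simp
  finally show ?thesis using e by simp
qed

lemma gr_submoduleD:
  assumes M: "M \<in> Gr G A" and N: "gr_submodule G A N M"
  shows "additive_subgroup N M" "\<And>a x. \<lbrakk>a \<in> carrier A; x \<in> N\<rbrakk> \<Longrightarrow> a \<odot>\<^sub>M x \<in> N"
    "\<And>x g. \<lbrakk>x \<in> N; g \<in> carrier G\<rbrakk> \<Longrightarrow> gpr G M x g \<in> N" "N \<subseteq> carrier M" "\<zero>\<^sub>M \<in> N"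
    "\<And>x y. \<lbrakk>x \<in> N; y \<in> N\<rbrakk> \<Longrightarrow> x \<oplus>\<^sub>M y \<in> N" "\<And>x y. \<lbrakk>x \<in> N; y \<in> N\<rbrakk> \<Longrightarrow> x \<ominus>\<^sub>M y \<in> N"
    "\<And>x. x \<in> N \<Longrightarrow> \<ominus>\<^sub>M x \<in> N"
proof -
  interpret M: graded_group G M by (rule Gr_graded_group[OF M])
  show sg: "additive_subgroup N M" and "\<And>a x. \<lbrakk>a \<in> carrier A; x \<in> N\<rbrakk> \<Longrightarrow> a \<odot>\<^sub>M x \<in> N"
    using N by (auto simp: gr_submodule_def)
  show "gpr G M x g \<in> N" if x: "x \<in> N" and g: "g \<in> carrier G" for x g
  proof -
    obtain f where f: "f \<in> (\<Pi>\<^sub>E g\<in>carrier G. N \<inter> component M g)" "x = (\<Oplus>\<^sub>M g\<in>carrier G. f g)"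
      using N x by (auto simp: gr_submodule_def)
    have "gpr G M x g = f g" unfolding f(2) using f(1) g by (intro M.gpr_unique) (auto simp: PiE_def Pi_def)
    then show ?thesis using f(1) g by (auto simp: PiE_def Pi_def)
  qed
  show "N \<subseteq> carrier M" "\<zero>\<^sub>M \<in> N" "\<And>x y. \<lbrakk>x \<in> N; y \<in> N\<rbrakk> \<Longrightarrow> x \<oplus>\<^sub>M y \<in> N" using additive_subgroupD[OF sg] by auto
  show "\<And>x y. \<lbrakk>x \<in> N; y \<in> N\<rbrakk> \<Longrightarrow> x \<ominus>\<^sub>M y \<in> N" "\<And>x. x \<in> N \<Longrightarrow> \<ominus>\<^sub>M x \<in> N"
    using M.additive_subgroup_minus[OF sg] M.additive_subgroup_neg[OF sg] by auto
qed

text \<open>Homogeneous scalars are enough, because every scalar is the sum of its components.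
  Negatives come from the scalar -1, which is homogeneous of identity degree.\<close>

lemma gr_submoduleI:
  assumes M: "M \<in> Gr G A" and sub: "N \<subseteq> carrier M" and z: "\<zero>\<^sub>M \<in> N"
    and add: "\<And>x y. \<lbrakk>x \<in> N; y \<in> N\<rbrakk> \<Longrightarrow> x \<oplus>\<^sub>M y \<in> N"
    and sm: "\<And>g a x. \<lbrakk>g \<in> carrier G; a \<in> component A g; x \<in> N\<rbrakk> \<Longrightarrow> a \<odot>\<^sub>M x \<in> N"
    and gp: "\<And>x g. \<lbrakk>x \<in> N; g \<in> carrier G\<rbrakk> \<Longrightarrow> gpr G M x g \<in> N"
  shows "gr_submodule G A N M"
proof -
  interpret M: graded_group G M by (rule Gr_graded_group[OF M])
  have neg: "\<ominus>\<^sub>M x \<in> N" if "x \<in> N" for x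
  proof -
    have "(\<ominus>\<^sub>A \<one>\<^sub>A) \<odot>\<^sub>M x \<in> N" using sm[OF _ _ that, of "\<one>\<^sub>G"] one_component
        A.additive_subgroup_neg[OF AG.component_subgroup[of "\<one>\<^sub>G"]] by auto
    then show ?thesis using Gr_neg_smult[OF M, of "\<one>\<^sub>A" x] Gr_smult_one[OF M, of x] sub that by auto
  qed
  have sg: "additive_subgroup N M" using sub z add neg by (intro M.additive_subgroup_closedI) auto
  have sm': "a \<odot>\<^sub>M x \<in> N" if "a \<in> carrier A" "x \<in> N" for a x
  proof -
    have "a \<odot>\<^sub>M x = (\<Oplus>\<^sub>M g\<in>carrier G. gpr G A a g \<odot>\<^sub>M x)"
      using Gr_finsum_smult[OF M, of x "gpr G A a" "carrier G"] AG.gpr_props(2)[of a] that sub by auto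
    moreover have "gpr G A a g \<odot>\<^sub>M x \<in> N" if "g \<in> carrier G" for g
      using sm \<open>a \<in> carrier A\<close> \<open>x \<in> N\<close> that AG.gpr_component by blast
    ultimately show ?thesis by (simp add: M.additive_subgroup_finsum[OF sg])
  qed
  have "\<exists>f \<in> (\<Pi>\<^sub>E g\<in>carrier G. N \<inter> component M g). x = (\<Oplus>\<^sub>M g\<in>carrier G. f g)" if "x \<in> N" for x
    using that sub M.gpr_props[of x] gp by (intro bexI[of _ "gpr G M x"]) (auto simp: PiE_def Pi_def)
  then show ?thesis using sg sm' by (auto simp: gr_submodule_def)
qed

end

section \<open>Submodules, shifts, transport and quotients\<close>

text \<open>The copy of \<open>M\<close> on the image of an injection j, which places modules in a
  prescribed type. Product and unit carry no meaning for a module and are left undefined.\<close>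

definition transport :: "('m \<Rightarrow> 'n) \<Rightarrow> ('r, 'm, 'g) graded \<Rightarrow> ('r, 'n, 'g) graded" where
  "transport j M = \<lparr>carrier = j ` carrier M, mult = undefined, one = undefined, zero = j \<zero>\<^sub>M,
     add = (\<lambda>x y. j (inv_into (carrier M) j x \<oplus>\<^sub>M inv_into (carrier M) j y)),
     smult = (\<lambda>a x. j (a \<odot>\<^sub>M inv_into (carrier M) j x)),
     component = (\<lambda>g. j ` component M g)\<rparr>"

context graded_algebra
begin

lemma additive_subgroup_abelian_group:
  assumes M: "abelian_group M" and N: "additive_subgroup N M"
  shows "abelian_group (sub M N)"
proof -
  interpret M: abelian_group M by fact
  note Nd = additive_subgroupD[OF N]
  have Nc: "\<And>x. x \<in> N \<Longrightarrow> x \<in> carrier M" using Nd(1) by auto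
  show ?thesis
  proof (rule abelian_groupI)
    show "\<exists>y\<in>carrier (sub M N). y \<oplus>\<^bsub>sub M N\<^esub> x = \<zero>\<^bsub>sub M N\<^esub>" if "x \<in> carrier (sub M N)" for x
      using that M.additive_subgroup_neg[OF N, of x] Nc[of x] by (intro bexI[of _ "\<ominus>\<^sub>M x"]) (auto simp: M.l_neg)
  qed (auto simp: Nd Nc M.a_ac)
qed

lemma graded_by_sub:
  assumes M: "graded_group G M" and N: "additive_subgroup N M"
    and gp: "\<And>x g. \<lbrakk>x \<in> N; g \<in> carrier G\<rbrakk> \<Longrightarrow> gpr G M x g \<in> N"
  shows "graded_by G (sub M N)"
proof -
  interpret M: graded_group G M by fact
  note Nd = additive_subgroupD[OF N]
  have Nc: "\<And>x. x \<in> N \<Longrightarrow> x \<in> carrier M" using Nd(1) by auto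
  have ab: "abelian_group (sub M N)" using additive_subgroup_abelian_group[OF M.abelian_group_axioms N] .
  interpret S: abelian_group "sub M N" by fact
  have neg: "\<ominus>\<^bsub>sub M N\<^esub> x = \<ominus>\<^sub>M x" if "x \<in> N" for x
    using that M.additive_subgroup_neg[OF N that] Nc by (intro S.minus_equality) (auto simp: M.l_neg)
  have inc: "additive (sub M N) M (\<lambda>x. x)" using Nc by (auto simp: additive_def)
  show ?thesis
  proof (rule graded_byI[OF ab finite_group, of "\<lambda>g x. gpr G M x g"])
    show "additive_subgroup (component (sub M N) g) (sub M N)" if g: "g \<in> carrier G" for g
      using additive_subgroupD[OF M.component_subgroup[OF g]] M.additive_subgroup_neg[OF N]
        M.additive_subgroup_neg[OF M.component_subgroup[OF g]]
      by (intro S.additive_subgroup_closedI) (auto simp: Nd neg)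
    show "additive (sub M N) (sub M N) (\<lambda>x. gpr G M x g)" if "g \<in> carrier G" for g
      using that gp by (auto simp: additive_def Nc M.gpr_add)
    show "gpr G M x g \<in> component (sub M N) g" if "g \<in> carrier G" "x \<in> carrier (sub M N)" for g x
      using that Nc gp M.gpr_component by auto
    show "(\<Oplus>\<^bsub>sub M N\<^esub>g\<in>carrier G. gpr G M x g) = x" if "x \<in> carrier (sub M N)" for x
      using additive_finsum[OF ab M.abelian_group_axioms inc, of "gpr G M x" "carrier G"] that gp Nc
        M.gpr_props(2) by (auto simp: Pi_def)
    show "gpr G M x g = (if g = h then x else \<zero>\<^bsub>sub M N\<^esub>)"
      if "g \<in> carrier G" "h \<in> carrier G" "x \<in> component (sub M N) h" for g h x using that M.gpr_homogeneous by auto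
  qed
qed

lemma sub_Gr:
  assumes M: "M \<in> Gr G A" and N: "gr_submodule G A N M"
  shows "sub M N \<in> Gr G A"
proof -
  note Nd = gr_submoduleD[OF M N]
  have "N \<subseteq> carrier M" using Nd(4) .
  then show ?thesis
    using additive_subgroup_abelian_group[OF Gr_abelian_group[OF M] Nd(1)] Nd(2) AG.component_closed
      graded_by_sub[OF Gr_graded_group[OF M] Nd(1) Nd(3)]
    by (intro GrI) (auto simp: subset_iff GrD(4-7)[OF M] intro: Gr_component_smult[OF M])
qed

lemma gr_hom_gpr:
  assumes M: "M \<in> Gr G A" and N: "N \<in> Gr G A" and f: "\<phi> \<in> gr_hom G A M N"
    and x: "x \<in> carrier M" and g: "g \<in> carrier G"
  shows "\<phi> (gpr G M x g) = gpr G N (\<phi> x) g"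
proof -
  interpret M: graded_group G M by (rule Gr_graded_group[OF M])
  interpret N: graded_group G N by (rule Gr_graded_group[OF N])
  have "\<phi> x = (\<Oplus>\<^sub>N g\<in>carrier G. \<phi> (gpr G M x g))"
    using additive_finsum[OF M.abelian_group_axioms N.abelian_group_axioms gr_homD(5)[OF f],
        of "gpr G M x" "carrier G"] M.gpr_props(2) x by simp
  then show ?thesis
    using N.gpr_unique[of "\<lambda>g. \<phi> (gpr G M x g)" g] gr_hom_component[OF f] M.gpr_component x g by simp
qed

lemma gr_submodule_inclusion:
  assumes M: "M \<in> Gr G A" and N: "gr_submodule G A N M"
  shows "(\<lambda>x\<in>N. x) \<in> gr_hom G A (sub M N) M" using gr_submoduleD(2,4,6)[OF M N] by (intro gr_homI) auto

lemma gr_hom_id: "M \<in> Gr G A \<Longrightarrow> (\<lambda>x\<in>carrier M. x) \<in> gr_hom G A M M"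
  by (rule gr_homI) (simp_all add: Gr_smult_closed abelian_groupE(1)[OF Gr_abelian_group] Gr_component_closed)

lemma gr_hom_zero:
  assumes "M \<in> Gr G A" "N \<in> Gr G A" shows "(\<lambda>x\<in>carrier M. \<zero>\<^sub>N) \<in> gr_hom G A M N"
proof -
  interpret N: graded_group G N by (rule Gr_graded_group) fact
  show ?thesis
    by (rule gr_homI) (simp_all add: GrD(3)[OF assms(1)] abelian_groupE(1)[OF Gr_abelian_group[OF assms(1)]]
        Gr_smult_zero[OF assms(2)] Gr_component_closed[OF assms(1)]
        additive_subgroupD(2)[OF N.component_subgroup])
qed

lemma gr_submodule_image:
  assumes M: "M \<in> Gr G A" and N: "N \<in> Gr G A" and f: "\<phi> \<in> gr_hom G A M N"
    and L: "gr_submodule G A L M"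
  shows "gr_submodule G A (\<phi> ` L) N"
proof (rule gr_submoduleI[OF N])
  note Ld = gr_submoduleD[OF M L] and fd = gr_homD[OF f]
  have Lc: "\<And>x. x \<in> L \<Longrightarrow> x \<in> carrier M" using Ld(4) by auto
  show "\<phi> ` L \<subseteq> carrier N" using Lc fd(1) by auto
  show "\<zero>\<^sub>N \<in> \<phi> ` L" using additive_zero[OF Gr_abelian_group[OF M] Gr_abelian_group[OF N] fd(5)] Ld(5) by force
  show "x \<oplus>\<^sub>N y \<in> \<phi> ` L" if "x \<in> \<phi> ` L" "y \<in> \<phi> ` L" for x y using that Ld(6) Lc by (auto simp: fd(2)[symmetric])
  show "a \<odot>\<^sub>N x \<in> \<phi> ` L" if "g \<in> carrier G" "a \<in> component A g" "x \<in> \<phi> ` L" for g a x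
    using that Ld(2) Lc AG.component_closed by (auto simp: fd(3)[symmetric])
  show "gpr G N x g \<in> \<phi> ` L" if "x \<in> \<phi> ` L" "g \<in> carrier G" for x g
    using that gr_hom_gpr[OF M N f] Ld(3) Lc by (auto simp: gr_hom_gpr[OF M N f, symmetric])
qed

lemma gr_submodule_preimage:
  assumes M: "M \<in> Gr G A" and N: "N \<in> Gr G A" and f: "\<phi> \<in> gr_hom G A M N"
    and L: "gr_submodule G A L N"
  shows "gr_submodule G A {x \<in> carrier M. \<phi> x \<in> L} M"
proof (rule gr_submoduleI[OF M])
  note Ld = gr_submoduleD[OF N L] and fd = gr_homD[OF f]
  interpret M: graded_group G M by (rule Gr_graded_group[OF M])
  show "\<zero>\<^sub>M \<in> {x \<in> carrier M. \<phi> x \<in> L}"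
    using additive_zero[OF Gr_abelian_group[OF M] Gr_abelian_group[OF N] fd(5)] Ld(5) by simp
  show "x \<oplus>\<^sub>M y \<in> {x \<in> carrier M. \<phi> x \<in> L}"
    if "x \<in> {x \<in> carrier M. \<phi> x \<in> L}" "y \<in> {x \<in> carrier M. \<phi> x \<in> L}" for x y using that by (simp add: fd(2) Ld(6))
  show "a \<odot>\<^sub>M x \<in> {x \<in> carrier M. \<phi> x \<in> L}"
    if "g \<in> carrier G" "a \<in> component A g" "x \<in> {x \<in> carrier M. \<phi> x \<in> L}" for g a x
    using that AG.component_closed[OF that(1,2)] by (simp add: fd(3) Ld(2) GrD(3)[OF M])
  show "gpr G M x g \<in> {x \<in> carrier M. \<phi> x \<in> L}"
    if "x \<in> {x \<in> carrier M. \<phi> x \<in> L}" "g \<in> carrier G" for x g using that by (simp add: Ld(3) gr_hom_gpr[OF M N f])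
qed simp

lemma gr_submodule_zero:
  assumes M: "M \<in> Gr G A" shows "gr_submodule G A {\<zero>\<^sub>M} M"
proof -
  interpret M: graded_group G M by (rule Gr_graded_group[OF M])
  show ?thesis by (rule gr_submoduleI[OF M]) (auto simp: Gr_smult_zero[OF M] AG.component_closed)
qed

lemma gr_submodule_carrier:
  assumes M: "M \<in> Gr G A" shows "gr_submodule G A (carrier M) M"
proof -
  interpret M: graded_group G M by (rule Gr_graded_group[OF M])
  show ?thesis by (rule gr_submoduleI[OF M]) (auto simp: GrD[OF M] AG.component_closed)
qed

lemma gr_submodule_kernel:
  assumes M: "M \<in> Gr G A" and N: "N \<in> Gr G A" and f: "\<phi> \<in> gr_hom G A M N"
  shows "gr_submodule G A {x \<in> carrier M. \<phi> x = \<zero>\<^sub>N} M"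
  using gr_submodule_preimage[OF assms gr_submodule_zero[OF N]] by simp

lemma gr_submodule_Inter:
  assumes M: "M \<in> Gr G A" and X: "\<And>N. N \<in> X \<Longrightarrow> gr_submodule G A N M"
  shows "gr_submodule G A (carrier M \<inter> \<Inter>X) M"
proof (rule gr_submoduleI[OF M])
  interpret M: graded_group G M by (rule Gr_graded_group[OF M])
  note Xd = gr_submoduleD[OF M X]
  show "\<zero>\<^sub>M \<in> carrier M \<inter> \<Inter>X" using Xd(5) by simp
  show "x \<oplus>\<^sub>M y \<in> carrier M \<inter> \<Inter>X"
    if "x \<in> carrier M \<inter> \<Inter>X" "y \<in> carrier M \<inter> \<Inter>X" for x y using that Xd(6) by simp
  show "a \<odot>\<^sub>M x \<in> carrier M \<inter> \<Inter>X"
    if "g \<in> carrier G" "a \<in> component A g" "x \<in> carrier M \<inter> \<Inter>X" for g a x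
    using that AG.component_closed[OF that(1,2)] Xd(2) by (simp add: GrD(3)[OF M])
  show "gpr G M x g \<in> carrier M \<inter> \<Inter>X" if "x \<in> carrier M \<inter> \<Inter>X" "g \<in> carrier G" for x g using that Xd(3) by simp
qed simp

lemma gr_submodule_chain:
  assumes M: "M \<in> Gr G A" and X: "\<And>N. N \<in> X \<Longrightarrow> gr_submodule G A N M" and ne: "X \<noteq> {}"
    and ch: "\<And>N L. \<lbrakk>N \<in> X; L \<in> X\<rbrakk> \<Longrightarrow> N \<subseteq> L \<or> L \<subseteq> N"
  shows "gr_submodule G A (\<Union>X) M"
proof (rule gr_submoduleI[OF M])
  note Xd = gr_submoduleD[OF M X]
  show "\<Union>X \<subseteq> carrier M" using Xd(4) by auto
  show "\<zero>\<^sub>M \<in> \<Union>X" using ne Xd(5) by auto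
  show "x \<oplus>\<^sub>M y \<in> \<Union>X" if xy: "x \<in> \<Union>X" "y \<in> \<Union>X" for x y
  proof -
    obtain N L where "N \<in> X" "L \<in> X" "x \<in> N" "y \<in> L" using xy by auto
    then show ?thesis using ch[of N L] Xd(6)[of N x y] Xd(6)[of L x y] by auto
  qed
  show "a \<odot>\<^sub>M x \<in> \<Union>X" if "g \<in> carrier G" "a \<in> component A g" "x \<in> \<Union>X" for g a x
    using that AG.component_closed[OF that(1,2)] Xd(2) by blast
  show "gpr G M x g \<in> \<Union>X" if "x \<in> \<Union>X" "g \<in> carrier G" for x g using that Xd(3) by blast
qed

lemma gr_submodule_sum:
  assumes M: "M \<in> Gr G A" and N: "gr_submodule G A N M" and L: "gr_submodule G A L M"
  shows "gr_submodule G A {x \<oplus>\<^sub>M y |x y. x \<in> N \<and> y \<in> L} M"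
proof -
  interpret M: graded_group G M by (rule Gr_graded_group[OF M])
  note Nd = gr_submoduleD[OF M N] and Ld = gr_submoduleD[OF M L]
  have Nc: "\<And>x. x \<in> N \<Longrightarrow> x \<in> carrier M" and Lc: "\<And>x. x \<in> L \<Longrightarrow> x \<in> carrier M" using Nd(4) Ld(4) by auto
  show ?thesis
  proof (rule gr_submoduleI[OF M])
    show "\<zero>\<^sub>M \<in> {x \<oplus>\<^sub>M y |x y. x \<in> N \<and> y \<in> L}" using Nd(5) Ld(5) by force
    show "u \<oplus>\<^sub>M v \<in> {x \<oplus>\<^sub>M y |x y. x \<in> N \<and> y \<in> L}"
      if uv: "u \<in> {x \<oplus>\<^sub>M y |x y. x \<in> N \<and> y \<in> L}" "v \<in> {x \<oplus>\<^sub>M y |x y. x \<in> N \<and> y \<in> L}" for u v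
    proof -
      obtain x y x' y' where *: "x \<in> N" "y \<in> L" "x' \<in> N" "y' \<in> L" "u = x \<oplus>\<^sub>M y" "v = x' \<oplus>\<^sub>M y'" using uv by auto
      then have "u \<oplus>\<^sub>M v = (x \<oplus>\<^sub>M x') \<oplus>\<^sub>M (y \<oplus>\<^sub>M y')" using Nc Lc by (simp add: M.a_ac)
      then show ?thesis using * Nd(6) Ld(6) by blast
    qed
    show "a \<odot>\<^sub>M u \<in> {x \<oplus>\<^sub>M y |x y. x \<in> N \<and> y \<in> L}"
      if "g \<in> carrier G" "a \<in> component A g" "u \<in> {x \<oplus>\<^sub>M y |x y. x \<in> N \<and> y \<in> L}" for g a u
      using that AG.component_closed[of g a] Nd(2) Ld(2) Nc Lc by (auto simp: GrD(5)[OF M]) blast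
    show "gpr G M u g \<in> {x \<oplus>\<^sub>M y |x y. x \<in> N \<and> y \<in> L}"
      if "u \<in> {x \<oplus>\<^sub>M y |x y. x \<in> N \<and> y \<in> L}" "g \<in> carrier G" for u g
      using that Nd(3) Ld(3) Nc Lc by (auto simp: M.gpr_add) blast
  qed (use Nc Lc in auto)
qed

lemma shift_one [simp]: "shift G \<one>\<^sub>G M = M"
  by (rule graded.equality) (auto simp: shift_def fun_eq_iff)

text \<open>Scalars translate degrees on the left and shifts on the right, so the two are compatible
  in a nonabelian group as well.\<close>

lemma shift_Gr:
  assumes M: "M \<in> Gr G A" and k: "k \<in> carrier G"
  shows "shift G k M \<in> Gr G A"
    and gpr_shift: "\<lbrakk>x \<in> carrier M; g \<in> carrier G\<rbrakk> \<Longrightarrow> gpr G (shift G k M) x g = gpr G M x (g \<otimes>\<^sub>G k)"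
proof -
  interpret M: graded_group G M by (rule Gr_graded_group[OF M])
  have fs: "finsum (shift G k M) = finsum M" and ai: "additive_subgroup X (shift G k M) = additive_subgroup X M" for X
    by (rule finsum_record_cong, simp_all)+
  have ab: "abelian_group (shift G k M)"
    using finsum_record_cong(3)[of "shift G k M" M] M.abelian_group_axioms by simp
  have sum: "(\<Oplus>\<^sub>M g\<in>carrier G. gpr G M x (g \<otimes>\<^sub>G k)) = x" if "x \<in> carrier M" for x
    using M.finsum_right_translate[OF k, of "gpr G M x"] M.gpr_props(2) that by simp
  have "graded_by G (shift G k M)"
  proof (rule graded_byI[OF ab finite_group, of "\<lambda>g x. gpr G M x (g \<otimes>\<^sub>G k)"])
    show "additive (shift G k M) (shift G k M) (\<lambda>x. gpr G M x (g \<otimes>\<^sub>G k))" if "g \<in> carrier G" for g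
      using M.gpr_additive[of "g \<otimes>\<^sub>G k"] that k by (simp add: additive_def)
    show "gpr G M x (g \<otimes>\<^sub>G k) = (if g = h then x else \<zero>\<^bsub>shift G k M\<^esub>)"
      if "g \<in> carrier G" "h \<in> carrier G" "x \<in> component (shift G k M) h" for g h x
      using M.gpr_homogeneous[of "h \<otimes>\<^sub>G k" x "g \<otimes>\<^sub>G k"] that k by simp
  qed (use k in \<open>auto simp: ai fs M.component_subgroup M.gpr_component sum\<close>)
  then show S: "shift G k M \<in> Gr G A" using ab k by (intro GrI) (auto simp: GrD[OF M] G.m_assoc)
  show "gpr G (shift G k M) x g = gpr G M x (g \<otimes>\<^sub>G k)" if "x \<in> carrier M" "g \<in> carrier G"
    using graded_group.gpr_unique[OF Gr_graded_group[OF S], of "\<lambda>g. gpr G M x (g \<otimes>\<^sub>G k)" g]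
      that k sum by (simp add: fs M.gpr_component)
qed

text \<open>A shift only relabels the homogeneous components by a right translation, and being
  closed under all of them is the same condition.\<close>

lemma gr_submodule_shift:
  assumes M: "M \<in> Gr G A" and k: "k \<in> carrier G"
  shows "gr_submodule G A N (shift G k M) \<longleftrightarrow> gr_submodule G A N M"
proof
  note S = shift_Gr[OF assms]
  show "gr_submodule G A N (shift G k M)" if N: "gr_submodule G A N M"
  proof (rule gr_submoduleI[OF S(1)])
    note Nd = gr_submoduleD[OF M N]
    show "gpr G (shift G k M) x g \<in> N" if "x \<in> N" "g \<in> carrier G" for x g using that Nd(3,4) k by (subst S(2)) auto
  qed (use gr_submoduleD(2,4,5,6)[OF M N] AG.component_closed in auto)
  show "gr_submodule G A N M" if N: "gr_submodule G A N (shift G k M)"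
  proof (rule gr_submoduleI[OF M])
    show "gpr G M x g \<in> N" if "x \<in> N" "g \<in> carrier G" for x g
      using gr_submoduleD(3)[OF S(1) N that(1), of "g \<otimes>\<^sub>G inv\<^bsub>G\<^esub> k"] gr_submoduleD(4)[OF S(1) N]
        that k S(2)[of x "g \<otimes>\<^sub>G inv\<^bsub>G\<^esub> k"] by (auto simp: G.m_assoc subset_iff)
  qed (use gr_submoduleD(2,4,5,6)[OF S(1) N] AG.component_closed in auto)
qed

lemma gr_hom_shift:
  assumes k: "k \<in> carrier G"
  shows "gr_hom G A (shift G k M) (shift G k N) = gr_hom G A M N"
proof -
  have "(\<forall>h\<in>carrier G. \<phi> ` component M (h \<otimes>\<^sub>G k) \<subseteq> component N (h \<otimes>\<^sub>G k)) \<longleftrightarrow>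
      (\<forall>h\<in>carrier G. \<phi> ` component M h \<subseteq> component N h)" (is "?l \<longleftrightarrow> ?r") for \<phi>
  proof
    assume l: ?l
    show ?r
    proof
      fix h assume "h \<in> carrier G"
      then show "\<phi> ` component M h \<subseteq> component N h"
        using l[rule_format, of "h \<otimes>\<^sub>G inv\<^bsub>G\<^esub> k"] k by (simp add: G.m_assoc)
    qed
  qed (use k in simp)
  then show ?thesis by (simp add: gr_hom_def)
qed

text \<open>Maps of degree g become degree-preserving maps into a shift. In this form a functor
  between categories of graded modules can act on them.\<close>

lemma lin_hom_component_shift:
  "lin_hom_component G A M N g = gr_hom G A M (shift G g N)" by (simp add: lin_hom_component_def gr_hom_def)

definition rmul :: "('a, 'm, 'g) graded \<Rightarrow> 'm \<Rightarrow> 'a \<Rightarrow> 'm" where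
  "rmul M x = (\<lambda>a\<in>carrier A. a \<odot>\<^sub>M x)"

lemma rmul_gr_hom:
  assumes M: "M \<in> Gr G A" and h: "h \<in> carrier G" and x: "x \<in> component M h"
  shows "rmul M x \<in> gr_hom G A (regular A) (shift G h M)"
  using Gr_component_closed[OF M h x] AG.component_closed h x by (intro gr_homI) (auto simp: rmul_def GrD[OF M])

text \<open>Here the module element is homogeneous and the scalar arbitrary: right multiplication by
  x is a graded morphism from \<open>A\<close> into a shift of M, and graded morphisms commute with
  taking components.\<close>

lemma gpr_smult_right:
  assumes M: "M \<in> Gr G A" and h: "h \<in> carrier G" and x: "x \<in> component M h"
    and a: "a \<in> carrier A" and g: "g \<in> carrier G"
  shows "gpr G M (a \<odot>\<^sub>M x) (g \<otimes>\<^sub>G h) = gpr G A a g \<odot>\<^sub>M x"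
  using gr_hom_gpr[OF regular_Gr shift_Gr(1)[OF M h] rmul_gr_hom[OF M h x], of a g] a g
    gpr_shift[OF M h, of "a \<odot>\<^sub>M x" g] Gr_component_closed[OF M h x] by (simp add: rmul_def Gr_smult_closed[OF M])

lemma gr_submodule_cyclic:
  assumes M: "M \<in> Gr G A" and h: "h \<in> carrier G" and x: "x \<in> component M h"
  shows "gr_submodule G A ((\<lambda>a. a \<odot>\<^sub>M x) ` carrier A) M"
proof -
  have "rmul M x ` carrier A = (\<lambda>a. a \<odot>\<^sub>M x) ` carrier A" by (auto simp: rmul_def image_def)
  then show ?thesis using gr_submodule_image[OF regular_Gr shift_Gr(1)[OF M h] rmul_gr_hom[OF M h x]
        gr_submodule_carrier[OF regular_Gr]] by (simp add: gr_submodule_shift[OF M h])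
qed

text \<open>Module axioms are identities and pass to the image of an operation-preserving map.
  Quotients, transported modules and the direct sum of a biproduct all obtain their module structure
  from here.\<close>

lemma Gr_image:
  assumes M: "M \<in> Gr G A" and c: "carrier Q = \<pi> ` carrier M" and z: "zero Q = \<pi> (zero M)"
    and a: "\<And>x y. \<lbrakk>x \<in> carrier M; y \<in> carrier M\<rbrakk> \<Longrightarrow> \<pi> x \<oplus>\<^sub>Q \<pi> y = \<pi> (x \<oplus>\<^sub>M y)"
    and s: "\<And>b x. \<lbrakk>b \<in> carrier A; x \<in> carrier M\<rbrakk> \<Longrightarrow> b \<odot>\<^sub>Q \<pi> x = \<pi> (b \<odot>\<^sub>M x)"
    and comp: "\<And>g. g \<in> carrier G \<Longrightarrow> component Q g = \<pi> ` component M g"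
    and ker: "\<And>x g. \<lbrakk>x \<in> carrier M; \<pi> x = \<zero>\<^sub>Q; g \<in> carrier G\<rbrakk> \<Longrightarrow> \<pi> (gpr G M x g) = \<zero>\<^sub>Q"
  shows "Q \<in> Gr G A" "restrict \<pi> (carrier M) \<in> gr_hom G A M Q"
proof -
  interpret M: graded_group G M by (rule Gr_graded_group[OF M])
  have ab: "abelian_group Q" using abelian_group_image[OF M.abelian_group_axioms c z a] .
  have "graded_by G Q" using graded_by_image[OF Gr_graded_group[OF M] ab c a comp ker] .
  moreover have "b \<odot>\<^sub>Q y \<in> component Q (g \<otimes>\<^sub>G h)"
    if "g \<in> carrier G" "h \<in> carrier G" "b \<in> component A g" "y \<in> component Q h" for g h b y
    using that Gr_component_smult[OF M that(1-3)] Gr_component_closed[OF M that(2)]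
      AG.component_closed[OF that(1,3)] by (auto simp: comp s)
  ultimately show "Q \<in> Gr G A" using ab by (intro GrI) (auto simp: c a s GrD(3-7)[OF M])
  show "restrict \<pi> (carrier M) \<in> gr_hom G A M Q"
    by (rule gr_homI) (auto simp: c a s comp GrD[OF M] Gr_component_closed[OF M])
qed

lemma bij_gr_hom_gr_iso:
  assumes M: "M \<in> Gr G A" and N: "N \<in> Gr G A" and f: "\<phi> \<in> gr_hom G A M N"
    and b: "bij_betw \<phi> (carrier M) (carrier N)"
  shows "\<phi> \<in> gr_iso G A M N" "(\<lambda>y\<in>carrier N. inv_into (carrier M) \<phi> y) \<in> gr_iso G A N M"
proof -
  interpret M: graded_group G M by (rule Gr_graded_group[OF M])
  interpret N: graded_group G N by (rule Gr_graded_group[OF N])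
  note fd = gr_homD[OF f]
  let ?i = "inv_into (carrier M) \<phi>"
  have i: "?i y \<in> carrier M" "\<phi> (?i y) = y" if "y \<in> carrier N" for y
    using that b by (auto simp: bij_betw_def inv_into_into f_inv_into_f)
  have i': "?i (\<phi> x) = x" if "x \<in> carrier M" for x using that b by (auto simp: bij_betw_def)
  have inj: "x = y" if "x \<in> carrier M" "y \<in> carrier M" "\<phi> x = \<phi> y" for x y
    using that b by (auto simp: bij_betw_def inj_on_def)
  have g: "(\<lambda>y\<in>carrier N. ?i y) \<in> gr_hom G A N M"
  proof (rule gr_homI)
    show "(\<lambda>y\<in>carrier N. ?i y) (x \<oplus>\<^sub>N y) = (\<lambda>y\<in>carrier N. ?i y) x \<oplus>\<^sub>M (\<lambda>y\<in>carrier N. ?i y) y"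
      if "x \<in> carrier N" "y \<in> carrier N" for x y using that i by (intro inj) (auto simp: fd)
    show "(\<lambda>y\<in>carrier N. ?i y) (a \<odot>\<^sub>N x) = a \<odot>\<^sub>M (\<lambda>y\<in>carrier N. ?i y) x"
      if "a \<in> carrier A" "x \<in> carrier N" for a x
      using that i by (intro inj) (auto simp: fd Gr_smult_closed[OF N] Gr_smult_closed[OF M])
    show "(\<lambda>y\<in>carrier N. ?i y) x \<in> component M g" if g: "g \<in> carrier G" "x \<in> component N g" for g x
    proof -
      have x: "x \<in> carrier N" using N.component_closed g by blast
      \<comment> \<open>Both sides have the same image x, since x is homogeneous of degree g;
        injectivity identifies them, so the inverse preserves degrees.\<close>
      have "?i x = gpr G M (?i x) g" using g i[OF x] N.gpr_homogeneous[of g x g]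
        by (intro inj) (auto simp: gr_hom_gpr[OF M N f])
      then show ?thesis using M.gpr_component i[OF x] x g by (metis restrict_apply)
    qed
  qed (use i in auto)
  show "\<phi> \<in> gr_iso G A M N" by (rule gr_isoI'[OF f g]) (use i i' fd(1) in auto)
  show "(\<lambda>y\<in>carrier N. ?i y) \<in> gr_iso G A N M" by (rule gr_isoI'[OF g f]) (use i i' fd(1) in auto)
qed

lemma transport_Gr:
  assumes M: "M \<in> Gr G A" and j: "inj_on j (carrier M)"
  shows "transport j M \<in> Gr G A" "restrict j (carrier M) \<in> gr_iso G A M (transport j M)"
proof -
  interpret M: graded_group G M by (rule Gr_graded_group[OF M])
  have e: "j x = j y \<longleftrightarrow> x = y" if "x \<in> carrier M" "y \<in> carrier M" for x y using that j by (auto simp: inj_on_def)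
  have *: "transport j M \<in> Gr G A \<and> restrict j (carrier M) \<in> gr_hom G A M (transport j M)"
    by (intro conjI Gr_image[OF M, where \<pi>=j]) (use j in \<open>auto simp: transport_def e\<close>)
  then show "transport j M \<in> Gr G A" by simp
  show "restrict j (carrier M) \<in> gr_iso G A M (transport j M)"
    using bij_gr_hom_gr_iso(1)[OF M, of "transport j M" "restrict j (carrier M)"] * j
    by (auto simp: bij_betw_def transport_def inj_on_def)
qed

lemma coset_eq_iff:
  assumes "abelian_group M" "additive_subgroup N M" "x \<in> carrier M" "y \<in> carrier M"
  shows "N +>\<^sub>M x = N +>\<^sub>M y \<longleftrightarrow> x \<ominus>\<^sub>M y \<in> N"
proof -
  interpret abelian_group M by fact
  interpret abelian_subgroup N M using assms by (intro abelian_subgroupI3)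
  show ?thesis using assms a_rcos_module[of y x] a_repr_independence'[of x y] a_rcos_self[of x] by (metis minus_eq)
qed

lemma quotient_Gr:
  assumes M: "M \<in> Gr G A" and N: "gr_submodule G A N M"
  shows "quotient M N \<in> Gr G A" "(\<lambda>x\<in>carrier M. N +>\<^sub>M x) \<in> gr_hom G A M (quotient M N)"
    "carrier (quotient M N) = (\<lambda>x. N +>\<^sub>M x) ` carrier M"
    "\<And>x y. \<lbrakk>x \<in> carrier M; y \<in> carrier M\<rbrakk> \<Longrightarrow> N +>\<^sub>M x = N +>\<^sub>M y \<longleftrightarrow> x \<ominus>\<^sub>M y \<in> N"
    "\<zero>\<^bsub>quotient M N\<^esub> = N +>\<^sub>M \<zero>\<^sub>M"
    "\<And>x. x \<in> carrier M \<Longrightarrow> N +>\<^sub>M x = \<zero>\<^bsub>quotient M N\<^esub> \<longleftrightarrow> x \<in> N"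
proof -
  interpret M: graded_group G M by (rule Gr_graded_group[OF M])
  note Nd = gr_submoduleD[OF M N]
  interpret N: abelian_subgroup N M using M.abelian_group_axioms Nd(1) by (intro abelian_subgroupI3)
  show eq: "N +>\<^sub>M x = N +>\<^sub>M y \<longleftrightarrow> x \<ominus>\<^sub>M y \<in> N" if "x \<in> carrier M" "y \<in> carrier M" for x y
    using coset_eq_iff[OF M.abelian_group_axioms Nd(1) that] .
  show z: "\<zero>\<^bsub>quotient M N\<^esub> = N +>\<^sub>M \<zero>\<^sub>M" using Nd(4) by (simp add: quotient_def FactRing_def)
  show c: "carrier (quotient M N) = (\<lambda>x. N +>\<^sub>M x) ` carrier M"
    by (auto simp: quotient_def FactRing_def A_RCOSETS_def')
  \<comment> \<open>The action on the quotient is a union over all representatives of the coset.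
    They all lead to the same coset, so the union collapses to a single one.\<close>
  have s: "b \<odot>\<^bsub>quotient M N\<^esub> (N +>\<^sub>M x) = N +>\<^sub>M (b \<odot>\<^sub>M x)"
    if b: "b \<in> carrier A" and x: "x \<in> carrier M" for b x
  proof -
    have "N +>\<^sub>M (b \<odot>\<^sub>M y) = N +>\<^sub>M (b \<odot>\<^sub>M x)" if y: "y \<in> N +>\<^sub>M x" for y
    proof -
      have yc: "y \<in> carrier M" using y x N.a_elemrcos_carrier by blast
      then have "y \<ominus>\<^sub>M x \<in> N" using y x eq[of y x] N.a_repr_independence'[of y x] by auto
      then have "b \<odot>\<^sub>M y \<ominus>\<^sub>M b \<odot>\<^sub>M x \<in> N" using Nd(2) b x yc Gr_smult_minus[OF M, of b y x] by metis
      then show ?thesis using eq b x yc by (simp add: GrD[OF M])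
    qed
    then have "(\<Union>y\<in>N +>\<^sub>M x. N +>\<^sub>M (b \<odot>\<^sub>M y)) = N +>\<^sub>M (b \<odot>\<^sub>M x)"
      using N.a_rcos_self[OF x] by (intro SUP_eq_const) (blast, assumption)
    then show ?thesis by (simp add: quotient_def)
  qed
  have a: "(N +>\<^sub>M x) \<oplus>\<^bsub>quotient M N\<^esub> (N +>\<^sub>M y) = N +>\<^sub>M (x \<oplus>\<^sub>M y)"
    if "x \<in> carrier M" "y \<in> carrier M" for x y using that N.a_rcos_sum by (simp add: quotient_def FactRing_def)
  show k: "N +>\<^sub>M x = \<zero>\<^bsub>quotient M N\<^esub> \<longleftrightarrow> x \<in> N" if "x \<in> carrier M" for x
    using eq[of x "\<zero>\<^sub>M"] that M.minus_equality[of "\<zero>\<^sub>M" "\<zero>\<^sub>M"] unfolding z by (simp add: M.minus_eq)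
  have comp: "component (quotient M N) g = (\<lambda>x. N +>\<^sub>M x) ` component M g" for g by (simp add: quotient_def)
  show "quotient M N \<in> Gr G A" "(\<lambda>x\<in>carrier M. N +>\<^sub>M x) \<in> gr_hom G A M (quotient M N)"
    using Gr_image[OF M c z a s comp] k Nd(3) by simp_all
qed

lemma shift_shift:
  "\<lbrakk>g \<in> carrier G; h \<in> carrier G\<rbrakk> \<Longrightarrow> shift G g (shift G h M) = shift G (g \<otimes>\<^sub>G h) M"
  by (rule graded.equality) (auto simp: shift_def G.m_assoc fun_eq_iff)

end

section \<open>Groups of homomorphisms and endomorphism algebras\<close>

context graded_algebra
begin

lemma hom_add_lin_hom:
  assumes N: "N \<in> Gr G A" and M: "M \<in> Gr G A" and f: "\<phi> \<in> lin_hom A M N" "\<psi> \<in> lin_hom A M N"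
  shows "hom_add M N \<phi> \<psi> \<in> lin_hom A M N"
proof -
  interpret N: graded_group G N by (rule Gr_graded_group[OF N])
  interpret M: graded_group G M by (rule Gr_graded_group[OF M])
  note fd = lin_homD(1-3)[OF f(1)] lin_homD(1-3)[OF f(2)]
  show ?thesis by (rule lin_homI) (simp_all add: hom_add_def fd GrD(3,5)[OF N] GrD(3)[OF M] N.a_ac)
qed

lemma hom_neg_lin_hom:
  assumes N: "N \<in> Gr G A" and M: "M \<in> Gr G A" and f: "\<phi> \<in> lin_hom A M N"
  shows "(\<lambda>x\<in>carrier M. \<ominus>\<^sub>N \<phi> x) \<in> lin_hom A M N"
proof -
  interpret N: graded_group G N by (rule Gr_graded_group[OF N])
  interpret M: graded_group G M by (rule Gr_graded_group[OF M])
  note fd = lin_homD(1-3)[OF f]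
  show ?thesis by (rule lin_homI) (simp_all add: fd Gr_smult_neg[OF N] GrD(3)[OF M] N.minus_add N.a_comm)
qed

lemma hom_smult_lin_hom:
  assumes N: "N \<in> Gr G A" and M: "M \<in> Gr G A" and f: "\<phi> \<in> lin_hom A M N" and c: "c \<in> carrier K"
  shows "hom_smult A M N c \<phi> \<in> lin_hom A M N"
proof -
  interpret N: graded_group G N by (rule Gr_graded_group[OF N])
  interpret M: graded_group G M by (rule Gr_graded_group[OF M])
  note fd = lin_homD(1-3)[OF f]
  let ?c = "c \<odot>\<^sub>A \<one>\<^sub>A"
  have cc: "?c \<in> carrier A" using c by simp
  have comm: "?c \<otimes>\<^sub>A a = a \<otimes>\<^sub>A ?c" if "a \<in> carrier A" for a
    using that c by (simp add: smult_mult_left smult_mult_right)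
  have "?c \<odot>\<^sub>N (a \<odot>\<^sub>N x) = a \<odot>\<^sub>N (?c \<odot>\<^sub>N x)" if "a \<in> carrier A" "x \<in> carrier N" for a x
    using that cc comm by (simp add: GrD(6)[OF N, symmetric])
  then show ?thesis
    using cc by (intro lin_homI) (simp_all add: hom_smult_def scalars_def fd GrD(3,5)[OF N] GrD(3)[OF M])
qed

lemma lin_hom_zero:
  assumes N: "N \<in> Gr G A" and M: "M \<in> Gr G A"
  shows "(\<lambda>x\<in>carrier M. \<zero>\<^sub>N) \<in> lin_hom A M N" using gr_hom_zero[OF M N] gr_hom_lin_hom by blast

text \<open>The homogeneous elements generate the additive group, so two additive maps need only be
  compared there.\<close>

lemma additive_eq_homogeneous:
  assumes X: "graded_group G X" and Y: "abelian_group Y" and f: "additive X Y f" and h: "additive X Y h"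
    and eq: "\<And>g x. \<lbrakk>g \<in> carrier G; x \<in> component X g\<rbrakk> \<Longrightarrow> f x = h x" and x: "x \<in> carrier X"
  shows "f x = h x"
proof -
  interpret X: graded_group G X by fact
  interpret Y: abelian_group Y by fact
  have "f (\<Oplus>\<^sub>X g\<in>carrier G. gpr G X x g) = h (\<Oplus>\<^sub>X g\<in>carrier G. gpr G X x g)"
    using additive_finsum[OF X.abelian_group_axioms Y f, of "gpr G X x" "carrier G"]
      additive_finsum[OF X.abelian_group_axioms Y h, of "gpr G X x" "carrier G"] x
      eq X.gpr_component f h by (auto simp: Pi_def additive_def intro!: Y.finsum_cong')
  then show ?thesis using X.gpr_props(2)[OF x] by simp
qed

lemma lin_homI_homogeneous:
  assumes M: "M \<in> Gr G A" and N: "N \<in> Gr G A" and ext: "\<phi> \<in> extensional (carrier M)"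
    and add: "additive M N \<phi>"
    and sm: "\<And>g a x. \<lbrakk>g \<in> carrier G; a \<in> component A g; x \<in> carrier M\<rbrakk> \<Longrightarrow> \<phi> (a \<odot>\<^sub>M x) = a \<odot>\<^sub>N \<phi> x"
  shows "\<phi> \<in> lin_hom A M N"
proof (rule lin_homI)
  interpret N: graded_group G N by (rule Gr_graded_group[OF N])
  have cl: "\<And>x. x \<in> carrier M \<Longrightarrow> \<phi> x \<in> carrier N"
    and ad: "\<And>x y. \<lbrakk>x \<in> carrier M; y \<in> carrier M\<rbrakk> \<Longrightarrow> \<phi> (x \<oplus>\<^sub>M y) = \<phi> x \<oplus>\<^sub>N \<phi> y"
    using add by (auto simp: additive_def)
  show "\<phi> (a \<odot>\<^sub>M x) = a \<odot>\<^sub>N \<phi> x" if a: "a \<in> carrier A" and x: "x \<in> carrier M" for a x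
    by (rule additive_eq_homogeneous[OF AG.graded_group_axioms N.abelian_group_axioms,
          of "\<lambda>a. \<phi> (a \<odot>\<^sub>M x)" "\<lambda>a. a \<odot>\<^sub>N \<phi> x"])
      (use a x sm in \<open>simp_all add: additive_def cl ad GrD(3,4)[OF M] GrD(3,4)[OF N]\<close>)
qed (use ext add in \<open>auto simp: additive_def\<close>)

text \<open>The part of degree g of a linear map. On x of degree h it is the component of
  \<open>\<phi> x\<close> in degree hg, and the sum extends this additively. The sum is over the
  finite group, hence the decomposition reaches every linear map.\<close>

definition hpr :: "('a, 'm, 'g) graded \<Rightarrow> ('a, 'n, 'g) graded \<Rightarrow> 'g \<Rightarrow> ('m \<Rightarrow> 'n) \<Rightarrow> 'm \<Rightarrow> 'n" where
  "hpr M N g \<phi> = (\<lambda>x\<in>carrier M. \<Oplus>\<^sub>N h\<in>carrier G. gpr G N (\<phi> (gpr G M x h)) (h \<otimes>\<^sub>G g))"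

lemma hpr_homogeneous:
  assumes M: "M \<in> Gr G A" and N: "N \<in> Gr G A" and f: "\<phi> \<in> lin_hom A M N"
    and g: "g \<in> carrier G" and h: "h \<in> carrier G" and x: "x \<in> component M h"
  shows "hpr M N g \<phi> x = gpr G N (\<phi> x) (h \<otimes>\<^sub>G g)"
proof -
  interpret N: graded_group G N by (rule Gr_graded_group[OF N])
  interpret M: graded_group G M by (rule Gr_graded_group[OF M])
  have xc: "x \<in> carrier M" using M.component_closed[OF h x] .
  have z: "\<phi> \<zero>\<^sub>M = \<zero>\<^sub>N" using additive_zero[OF M.abelian_group_axioms N.abelian_group_axioms lin_homD(5)[OF f]] .
  have "hpr M N g \<phi> x = (\<Oplus>\<^sub>N k\<in>carrier G. gpr G N (\<phi> (gpr G M x k)) (k \<otimes>\<^sub>G g))" using xc by (simp add: hpr_def)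
  also have "\<dots> = gpr G N (\<phi> (gpr G M x h)) (h \<otimes>\<^sub>G g)" using h g xc x by (intro N.finsum_eq_single)
      (simp_all add: finite_group lin_homD(1)[OF f] M.gpr_homogeneous[OF h x] z)
  finally show ?thesis using M.gpr_homogeneous[OF h x h] by simp
qed

lemma hpr_lin_hom:
  assumes M: "M \<in> Gr G A" and N: "N \<in> Gr G A" and f: "\<phi> \<in> lin_hom A M N" and g: "g \<in> carrier G"
  shows "hpr M N g \<phi> \<in> lin_hom A M N" "hpr M N g \<phi> \<in> lin_hom_component G A M N g"
proof -
  interpret N: graded_group G N by (rule Gr_graded_group[OF N])
  interpret M: graded_group G M by (rule Gr_graded_group[OF M])
  note fd = lin_homD[OF f]
  show l: "hpr M N g \<phi> \<in> lin_hom A M N"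
  proof (rule lin_homI_homogeneous[OF M N])
    show "hpr M N g \<phi> \<in> extensional (carrier M)" by (simp add: hpr_def)
    show "additive M N (hpr M N g \<phi>)" unfolding additive_def
    proof (intro conjI ballI funcsetI)
      show "hpr M N g \<phi> (x \<oplus>\<^sub>M y) = hpr M N g \<phi> x \<oplus>\<^sub>N hpr M N g \<phi> y"
        if "x \<in> carrier M" "y \<in> carrier M" for x y using that g fd(1)
        by (simp add: hpr_def M.gpr_add fd(2) N.gpr_add N.finsum_addf Pi_def cong: N.finsum_cong)
    qed (use g fd(1) in \<open>auto simp: hpr_def\<close>)
    show "hpr M N g \<phi> (a \<odot>\<^sub>M x) = a \<odot>\<^sub>N hpr M N g \<phi> x"
      if k: "k \<in> carrier G" and a: "a \<in> component A k" and x: "x \<in> carrier M" for k a x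
    proof -
      have ac: "a \<in> carrier A" using AG.component_closed[OF k a] .
      let ?f = "\<lambda>h. gpr G N (\<phi> (gpr G M (a \<odot>\<^sub>M x) h)) (h \<otimes>\<^sub>G g)"
      have "hpr M N g \<phi> (a \<odot>\<^sub>M x) = (\<Oplus>\<^sub>N h\<in>carrier G. ?f h)" using ac x by (simp add: hpr_def GrD(3)[OF M])
      \<comment> \<open>A scalar of degree k moves the summand of index h to index kh, so the sum is
        reindexed before it is compared term by term.\<close>
      also have "\<dots> = (\<Oplus>\<^sub>N h\<in>carrier G. ?f (k \<otimes>\<^sub>G h))"
        using k g ac x fd(1) by (intro N.finsum_left_translate[symmetric]) (simp_all add: GrD(3)[OF M])
      also have "\<dots> = (\<Oplus>\<^sub>N h\<in>carrier G. a \<odot>\<^sub>N gpr G N (\<phi> (gpr G M x h)) (h \<otimes>\<^sub>G g))"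
        using k g ac x fd(1) by (intro N.finsum_cong')
          (simp_all add: Pi_def GrD(3)[OF N] gpr_smult[OF M k a x] fd(3) G.m_assoc gpr_smult[OF N k a])
      also have "\<dots> = a \<odot>\<^sub>N hpr M N g \<phi> x" using k g ac x fd(1) by (simp add: hpr_def Gr_smult_finsum[OF N])
      finally show ?thesis .
    qed
  qed
  have "hpr M N g \<phi> x \<in> component N (h \<otimes>\<^sub>G g)" if "h \<in> carrier G" "x \<in> component M h" for h x
    using that g hpr_homogeneous[OF M N f g that] N.gpr_component fd(1) M.component_closed by simp
  then show "hpr M N g \<phi> \<in> lin_hom_component G A M N g" using l by (auto simp: lin_hom_component_def)
qed

text \<open>The record \<open>H\<close> is prescribed only in its additive fields. The same facts
  then serve endomorphism algebras and the Hom modules over a corner, which differ in products and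
  scalars.\<close>

lemma hom_abelian_group:
  fixes H :: "('r, 'm \<Rightarrow> 'n, 'g) graded"
  assumes M: "M \<in> Gr G A" and N: "N \<in> Gr G A" and c: "carrier H = lin_hom A M N"
    and a: "add H = hom_add M N" and z: "zero H = (\<lambda>x\<in>carrier M. \<zero>\<^sub>N)"
  shows "abelian_group H"
proof -
  interpret N: graded_group G N by (rule Gr_graded_group[OF N])
  interpret M: graded_group G M by (rule Gr_graded_group[OF M])
  have ext: "\<And>\<phi>. \<phi> \<in> lin_hom A M N \<Longrightarrow> (\<lambda>x\<in>carrier M. \<phi> x) = \<phi>" using lin_homD(4) by (metis extensional_restrict)
  show "abelian_group H"
  proof (rule abelian_groupI)
    show "\<exists>y\<in>carrier H. y \<oplus>\<^sub>H x = \<zero>\<^sub>H" if "x \<in> carrier H" for x using that hom_neg_lin_hom[OF N M, of x]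
      by (intro bexI[of _ "\<lambda>u\<in>carrier M. \<ominus>\<^sub>N x u"])
        (auto simp: c a z hom_add_def lin_homD(1) N.l_neg cong: restrict_cong)
    show "\<zero>\<^sub>H \<oplus>\<^sub>H x = x" if "x \<in> carrier H" for x
      using that ext by (auto simp: c a z hom_add_def lin_homD(1) cong: restrict_cong)
    show "x \<oplus>\<^sub>H y = y \<oplus>\<^sub>H x" if "x \<in> carrier H" "y \<in> carrier H" for x y
      using that by (auto simp: c a z hom_add_def lin_homD(1) N.a_comm cong: restrict_cong)
    show "x \<oplus>\<^sub>H y \<oplus>\<^sub>H u = x \<oplus>\<^sub>H (y \<oplus>\<^sub>H u)"
      if "x \<in> carrier H" "y \<in> carrier H" "u \<in> carrier H" for x y u
      using that by (auto simp: c a z hom_add_def lin_homD(1) N.a_assoc cong: restrict_cong)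
  qed (use hom_add_lin_hom[OF N M] lin_hom_zero[OF N M] in \<open>auto simp: c a z\<close>)
qed

lemma hom_finsum:
  fixes H :: "('r, 'm \<Rightarrow> 'n, 'g) graded"
  assumes M: "M \<in> Gr G A" and N: "N \<in> Gr G A" and c: "carrier H = lin_hom A M N"
    and a: "add H = hom_add M N" and z: "zero H = (\<lambda>x\<in>carrier M. \<zero>\<^sub>N)"
    and x: "x \<in> carrier M" and f: "f \<in> I \<rightarrow> lin_hom A M N"
  shows "finsum H f I x = (\<Oplus>\<^sub>N i\<in>I. f i x)"
  using x f by (intro additive_finsum[OF hom_abelian_group[OF M N c a z] Gr_abelian_group[OF N], of "\<lambda>\<phi>. \<phi> x"])
    (auto simp: additive_def c a hom_add_def lin_homD(1))

lemma hom_group: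
  fixes H :: "('r, 'm \<Rightarrow> 'n, 'g) graded"
  assumes M: "M \<in> Gr G A" and N: "N \<in> Gr G A" and c: "carrier H = lin_hom A M N"
    and a: "add H = hom_add M N" and z: "zero H = (\<lambda>x\<in>carrier M. \<zero>\<^sub>N)"
    and comp: "\<And>g. g \<in> carrier G \<Longrightarrow> component H g = lin_hom_component G A M N g"
  shows hom_graded: "graded_by G H"
    and hom_gpr: "\<And>\<phi> g. \<lbrakk>\<phi> \<in> lin_hom A M N; g \<in> carrier G\<rbrakk> \<Longrightarrow> gpr G H \<phi> g = hpr M N g \<phi>"
proof -
  interpret N: graded_group G N by (rule Gr_graded_group[OF N])
  interpret M: graded_group G M by (rule Gr_graded_group[OF M])
  note ab = hom_abelian_group[OF M N c a z] and fs = hom_finsum[OF M N c a z]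
  interpret H: abelian_group H by fact
  have neg: "\<ominus>\<^sub>H \<phi> = (\<lambda>x\<in>carrier M. \<ominus>\<^sub>N \<phi> x)" if "\<phi> \<in> lin_hom A M N" for \<phi> using that hom_neg_lin_hom[OF N M that]
    by (intro H.minus_equality) (auto simp: c a z hom_add_def lin_homD(1) N.l_neg cong: restrict_cong)
  have sum: "(\<Oplus>\<^sub>H g\<in>carrier G. hpr M N g \<phi>) = \<phi>" if f: "\<phi> \<in> lin_hom A M N" for \<phi>
  proof (rule lin_hom_eqI[of _ A M N _ N])
    have hc: "(\<lambda>g. hpr M N g \<phi>) \<in> carrier G \<rightarrow> carrier H" using hpr_lin_hom[OF M N f] by (simp add: c)
    show l: "(\<Oplus>\<^sub>H g\<in>carrier G. hpr M N g \<phi>) \<in> lin_hom A M N" using H.finsum_closed[OF hc] by (simp add: c)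
    show "(\<Oplus>\<^sub>H g\<in>carrier G. hpr M N g \<phi>) x = \<phi> x" if x: "x \<in> carrier M" for x
    proof (rule additive_eq_homogeneous[OF M.graded_group_axioms N.abelian_group_axioms
          lin_homD(5)[OF l] lin_homD(5)[OF f] _ x])
      fix h x assume h: "h \<in> carrier G" and x: "x \<in> component M h"
      have xc: "x \<in> carrier M" using M.component_closed[OF h x] .
      have "(\<Oplus>\<^sub>H g\<in>carrier G. hpr M N g \<phi>) x = (\<Oplus>\<^sub>N g\<in>carrier G. gpr G N (\<phi> x) (h \<otimes>\<^sub>G g))"
        using fs[OF xc, of "\<lambda>g. hpr M N g \<phi>" "carrier G"] hpr_lin_hom(1)[OF M N f] h x xc
        by (auto simp: hpr_homogeneous[OF M N f _ h x] lin_homD(1)[OF f] intro!: N.finsum_cong')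
      also have "\<dots> = \<phi> x"
        using N.finsum_left_translate[OF h, of "gpr G N (\<phi> x)"] N.gpr_props(2) lin_homD(1)[OF f xc] by simp
      finally show "(\<Oplus>\<^sub>H g\<in>carrier G. hpr M N g \<phi>) x = \<phi> x" .
    qed
  qed (use f in simp)
  have lc: "\<phi> \<in> lin_hom A M N" if "\<phi> \<in> lin_hom_component G A M N g" for \<phi> g
    using that by (simp add: lin_hom_component_def)
  have lcc: "\<phi> x \<in> component N (h \<otimes>\<^sub>G g)" if "\<phi> \<in> lin_hom_component G A M N g" "h \<in> carrier G"
    "x \<in> component M h" for \<phi> g h x using that by (auto simp: lin_hom_component_def)
  show gr: "graded_by G H"
  proof (rule graded_byI[OF ab finite_group, of "hpr M N"])
    show "additive_subgroup (component H g) H" if g: "g \<in> carrier G" for g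
    proof (rule H.additive_subgroup_closedI)
      show "component H g \<subseteq> carrier H" using g lc by (auto simp: comp c)
      note cs = N.component_subgroup
      show "\<zero>\<^sub>H \<in> component H g" using g lin_hom_zero[OF N M] M.component_closed additive_subgroupD(2)[OF cs]
        by (auto simp: comp z lin_hom_component_def)
      show "\<phi> \<oplus>\<^sub>H \<psi> \<in> component H g" if f: "\<phi> \<in> component H g" "\<psi> \<in> component H g" for \<phi> \<psi>
      proof -
        have "hom_add M N \<phi> \<psi> x \<in> component N (h \<otimes>\<^sub>G g)" if "h \<in> carrier G" "x \<in> component M h" for h x
          using f g that lcc[OF _ that] M.component_closed[OF that] additive_subgroupD(3)[OF cs]
          by (simp add: hom_add_def comp)
        then show ?thesis using f g hom_add_lin_hom[OF N M lc lc] by (auto simp: comp a lin_hom_component_def)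
      qed
      show "\<ominus>\<^sub>H \<phi> \<in> component H g" if f: "\<phi> \<in> component H g" for \<phi>
      proof -
        have f': "\<phi> \<in> lin_hom_component G A M N g" using f g comp by simp
        have "\<ominus>\<^sub>N \<phi> x \<in> component N (h \<otimes>\<^sub>G g)" if "h \<in> carrier G" "x \<in> component M h" for h x
          using N.additive_subgroup_neg[OF cs lcc[OF f' that]] g that by simp
        then have "(\<lambda>x\<in>carrier M. \<ominus>\<^sub>N \<phi> x) \<in> lin_hom_component G A M N g"
          using hom_neg_lin_hom[OF N M lc[OF f']] M.component_closed by (auto simp: lin_hom_component_def)
        then show ?thesis using neg[OF lc[OF f']] comp[OF g] by simp
      qed
    qed
    show "additive H H (hpr M N g)" if g: "g \<in> carrier G" for g unfolding additive_def
    proof (intro conjI ballI funcsetI)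
      fix \<phi> \<psi> assume f: "\<phi> \<in> carrier H" "\<psi> \<in> carrier H"
      then have f': "\<phi> \<in> lin_hom A M N" "\<psi> \<in> lin_hom A M N" by (auto simp: c)
      note l = hpr_lin_hom(1)[OF M N _ g]
      have s: "\<phi> \<oplus>\<^sub>H \<psi> \<in> lin_hom A M N" using f H.a_closed by (metis c)
      have s': "hpr M N g \<phi> \<oplus>\<^sub>H hpr M N g \<psi> \<in> lin_hom A M N" using l[OF f'(1)] l[OF f'(2)] H.a_closed by (metis c)
      show "hpr M N g (\<phi> \<oplus>\<^sub>H \<psi>) = hpr M N g \<phi> \<oplus>\<^sub>H hpr M N g \<psi>"
      proof (rule lin_hom_eqI[OF l[OF s] s'])
        fix x assume x: "x \<in> carrier M"
        show "hpr M N g (\<phi> \<oplus>\<^sub>H \<psi>) x = (hpr M N g \<phi> \<oplus>\<^sub>H hpr M N g \<psi>) x"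
          using x g lin_homD(1)[OF f'(1)] lin_homD(1)[OF f'(2)]
          by (simp add: hpr_def a hom_add_def N.gpr_add N.finsum_addf Pi_def cong: N.finsum_cong)
      qed
    qed (use hpr_lin_hom(1)[OF M N _ g] in \<open>simp add: c\<close>)
    show "hpr M N g \<phi> \<in> component H g" if "g \<in> carrier G" "\<phi> \<in> carrier H" for g \<phi>
      using that hpr_lin_hom(2)[OF M N] by (simp add: comp c)
    show "(\<Oplus>\<^sub>H g\<in>carrier G. hpr M N g \<phi>) = \<phi>" if "\<phi> \<in> carrier H" for \<phi> using that sum by (simp add: c)
    show "hpr M N g \<phi> = (if g = h then \<phi> else \<zero>\<^sub>H)"
      if g: "g \<in> carrier G" and h: "h \<in> carrier G" and f: "\<phi> \<in> component H h" for g h \<phi>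
    proof -
      have l: "\<phi> \<in> lin_hom A M N" using f h lc by (simp add: comp)
      have r: "(if g = h then \<phi> else \<zero>\<^sub>H) \<in> lin_hom A M N" using l lin_hom_zero[OF N M] by (simp add: z)
      note l' = hpr_lin_hom(1)[OF M N l g]
      show ?thesis
      proof (rule lin_hom_eqI[OF l' r])
        show "hpr M N g \<phi> x = (if g = h then \<phi> else \<zero>\<^sub>H) x" if x: "x \<in> carrier M" for x
        proof (rule additive_eq_homogeneous[OF M.graded_group_axioms N.abelian_group_axioms
              lin_homD(5)[OF l'] lin_homD(5)[OF r] _ x])
          fix k x assume k: "k \<in> carrier G" and x: "x \<in> component M k"
          have "\<phi> x \<in> component N (k \<otimes>\<^sub>G h)" using f h lcc k x by (simp add: comp)
          then show "hpr M N g \<phi> x = (if g = h then \<phi> else \<zero>\<^sub>H) x"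
            using hpr_homogeneous[OF M N l g k x] k g h N.gpr_homogeneous[of "k \<otimes>\<^sub>G h" "\<phi> x" "k \<otimes>\<^sub>G g"]
              M.component_closed[OF k x] by (simp add: z)
        qed
      qed
    qed
  qed
  interpret HG: graded_group G H
    by (intro graded_group.intro graded_group_axioms.intro G.is_group ab finite_group gr)
  show "gpr G H \<phi> g = hpr M N g \<phi>" if "\<phi> \<in> lin_hom A M N" "g \<in> carrier G" for \<phi> g
    using HG.gpr_unique[of "\<lambda>g. hpr M N g \<phi>" g] hpr_lin_hom(2)[OF M N that(1)] sum[OF that(1)] that(2)
    by (simp add: comp)
qed

section \<open>The graded endomorphism algebra as a ring\<close>

lemma End_simps [simp]:
  "carrier (End_algebra G A M) = lin_hom A M M" "add (End_algebra G A M) = hom_add M M"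
  "zero (End_algebra G A M) = (\<lambda>x\<in>carrier M. \<zero>\<^sub>M)" "one (End_algebra G A M) = (\<lambda>x\<in>carrier M. x)"
  "mult (End_algebra G A M) = (\<lambda>\<phi> \<psi>. compose (carrier M) \<psi> \<phi>)"
  "smult (End_algebra G A M) = hom_smult A M M"
  "component (End_algebra G A M) = lin_hom_component G A M M" by (simp_all add: End_algebra_def)

lemma End_ring:
  assumes M: "M \<in> Gr G A"
  shows "ring (End_algebra G A M)" "graded_group G (End_algebra G A M)"
proof -
  interpret M: graded_group G M by (rule Gr_graded_group[OF M])
  note H = hom_group[OF M M, of "End_algebra G A M"] hom_abelian_group[OF M M, of "End_algebra G A M"]
  show "graded_group G (End_algebra G A M)"
    using H by (intro graded_group.intro graded_group_axioms.intro G.is_group finite_group) simp_all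
  show "ring (End_algebra G A M)"
  proof (rule ringI)
    show "abelian_group (End_algebra G A M)" using H by simp
    show "monoid (End_algebra G A M)"
    proof (rule monoidI)
      let ?E = "End_algebra G A M"
      have r: "(\<lambda>u\<in>carrier M. x u) = x" if "x \<in> carrier ?E" for x
        using that lin_homD(4)[of x A M M] by (simp add: extensional_restrict)
      show "x \<otimes>\<^bsub>?E\<^esub> y \<in> carrier ?E" if "x \<in> carrier ?E" "y \<in> carrier ?E" for x y
        using that by (simp add: Gr_lin_hom_compose[OF M])
      show "x \<otimes>\<^bsub>?E\<^esub> y \<otimes>\<^bsub>?E\<^esub> z = x \<otimes>\<^bsub>?E\<^esub> (y \<otimes>\<^bsub>?E\<^esub> z)" if "x \<in> carrier ?E" for x y z
        using that by (auto simp: compose_def lin_homD(1) cong: restrict_cong)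
      show "\<one>\<^bsub>?E\<^esub> \<in> carrier ?E" using gr_hom_id[OF M] gr_hom_lin_hom by auto
      show "\<one>\<^bsub>?E\<^esub> \<otimes>\<^bsub>?E\<^esub> x = x" if "x \<in> carrier ?E" for x
        using r[OF that] by (simp add: compose_def cong: restrict_cong)
      show "x \<otimes>\<^bsub>?E\<^esub> \<one>\<^bsub>?E\<^esub> = x" if "x \<in> carrier ?E" for x
        using r[OF that] that by (simp add: compose_def lin_homD(1) cong: restrict_cong)
    qed
  qed (auto simp: compose_def hom_add_def lin_homD(1,2) cong: restrict_cong)
qed

end

section \<open>A rank function on subspaces\<close>

definition subspace :: "'k ring \<Rightarrow> ('k, 'm, 'g) graded \<Rightarrow> 'm set \<Rightarrow> bool" where
  "subspace K V L \<longleftrightarrow> additive_subgroup L V \<and> (\<forall>c\<in>carrier K. \<forall>x\<in>L. c \<odot>\<^sub>V x \<in> L)"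

locale kmodule = K?: field K + module K V for K :: "'k ring" and V :: "('k, 'm, 'g) graded"
begin

lemma subspaceD:
  assumes "subspace K V L"
  shows "additive_subgroup L V" "L \<subseteq> carrier V" "\<zero>\<^sub>V \<in> L" "\<And>x y. \<lbrakk>x \<in> L; y \<in> L\<rbrakk> \<Longrightarrow> x \<oplus>\<^sub>V y \<in> L"
    "\<And>x y. \<lbrakk>x \<in> L; y \<in> L\<rbrakk> \<Longrightarrow> x \<ominus>\<^sub>V y \<in> L" "\<And>c x. \<lbrakk>c \<in> carrier K; x \<in> L\<rbrakk> \<Longrightarrow> c \<odot>\<^sub>V x \<in> L"
  using assms additive_subgroupD[of L V] additive_subgroup_minus[of L] by (auto simp: subspace_def)

lemma subspaceI:
  assumes L: "L \<subseteq> carrier V" "\<zero>\<^sub>V \<in> L" and add: "\<And>x y. \<lbrakk>x \<in> L; y \<in> L\<rbrakk> \<Longrightarrow> x \<oplus>\<^sub>V y \<in> L"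
    and sm: "\<And>c x. \<lbrakk>c \<in> carrier K; x \<in> L\<rbrakk> \<Longrightarrow> c \<odot>\<^sub>V x \<in> L"
  shows "subspace K V L"
proof -
  have "\<ominus>\<^sub>V x \<in> L" if x: "x \<in> L" for x using sm[of "\<ominus>\<^sub>K \<one>\<^sub>K" x] x L smult_l_minus[of "\<one>\<^sub>K" x] by auto
  then show ?thesis using assms additive_subgroup_closedI[of L] by (auto simp: subspace_def)
qed

text \<open>Spanning without coefficients: a subspace that contains S is everything. An identity is
  then propagated from S by checking that it holds on a subspace.\<close>

lemma fin_dimD:
  assumes "fin_dim K V"
  obtains S where "finite S" "S \<subseteq> carrier V" "\<And>L. \<lbrakk>subspace K V L; S \<subseteq> L\<rbrakk> \<Longrightarrow> L = carrier V"
proof -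
  obtain S where S: "finite S" "S \<subseteq> carrier V"
    "\<forall>x\<in>carrier V. \<exists>c \<in> S \<rightarrow> carrier K. x = (\<Oplus>\<^sub>V s\<in>S. c s \<odot>\<^sub>V s)" using assms unfolding fin_dim_def by blast
  have "x \<in> L" if L: "subspace K V L" "S \<subseteq> L" and x: "x \<in> carrier V" for L x
  proof -
    obtain c where "c \<in> S \<rightarrow> carrier K" "x = (\<Oplus>\<^sub>V s\<in>S. c s \<odot>\<^sub>V s)" using S(3) x by blast
    then show ?thesis
      using additive_subgroup_finsum[OF subspaceD(1)[OF L(1)], of S "\<lambda>s. c s \<odot>\<^sub>V s"] subspaceD(6)[OF L(1)] L(2)
      by (auto simp: Pi_def)
  qed
  then show ?thesis using that[OF S(1,2)] subspaceD(2) by blast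
qed

lemma fin_dimI:
  assumes S: "finite S" "S \<subseteq> carrier V" and span: "\<And>L. \<lbrakk>subspace K V L; S \<subseteq> L\<rbrakk> \<Longrightarrow> carrier V \<subseteq> L"
  shows "fin_dim K V"
proof -
  let ?s = "\<lambda>c. \<Oplus>\<^sub>V s\<in>S. c s \<odot>\<^sub>V s"
  let ?L = "?s ` (S \<rightarrow> carrier K)"
  have Sc: "s \<in> carrier V" if "s \<in> S" for s using that S(2) by auto
  have cl: "(\<lambda>s. c s \<odot>\<^sub>V s) \<in> S \<rightarrow> carrier V" if "c \<in> S \<rightarrow> carrier K" for c using that Sc by auto
  have "subspace K V ?L"
  proof (rule subspaceI)
    show "?L \<subseteq> carrier V" using cl by auto
    have "?s (\<lambda>_. \<zero>\<^sub>K) = (\<Oplus>\<^sub>V s\<in>S. \<zero>\<^sub>V)" by (intro finsum_cong') (auto simp: Sc)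
    then have "\<zero>\<^sub>V = ?s (\<lambda>_. \<zero>\<^sub>K)" by (simp add: finsum_zero)
    then show "\<zero>\<^sub>V \<in> ?L" by (rule image_eqI[where x = "\<lambda>_. \<zero>\<^sub>K"]) simp
    show "x \<oplus>\<^sub>V y \<in> ?L" if xy: "x \<in> ?L" "y \<in> ?L" for x y
    proof -
      obtain c d where cd: "c \<in> S \<rightarrow> carrier K" "d \<in> S \<rightarrow> carrier K" "x = ?s c" "y = ?s d" using xy by auto
      have "?s (\<lambda>s. c s \<oplus>\<^sub>K d s) = (\<Oplus>\<^sub>V s\<in>S. c s \<odot>\<^sub>V s \<oplus>\<^sub>V d s \<odot>\<^sub>V s)"
        using cd(1,2) Sc by (intro finsum_cong') (auto simp: smult_l_distr Pi_def)
      also have "\<dots> = x \<oplus>\<^sub>V y" using cl cd by (simp add: finsum_addf)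
      finally show ?thesis using cd(1,2) by (intro image_eqI[where x = "\<lambda>s. c s \<oplus>\<^sub>K d s"]) auto
    qed
    show "b \<odot>\<^sub>V x \<in> ?L" if b: "b \<in> carrier K" and x: "x \<in> ?L" for b x
    proof -
      obtain c where c: "c \<in> S \<rightarrow> carrier K" "x = ?s c" using x by auto
      have "b \<odot>\<^sub>V x = (\<Oplus>\<^sub>V s\<in>S. b \<odot>\<^sub>V (c s \<odot>\<^sub>V s))"
        unfolding c(2) using finsum_smult_ldistr[OF S(1) b cl[OF c(1)]] .
      also have "\<dots> = ?s (\<lambda>s. b \<otimes>\<^sub>K c s)" using b c(1) Sc by (intro finsum_cong') (auto simp: smult_assoc1 Pi_def)
      finally show ?thesis using b c(1) by (intro image_eqI[where x = "\<lambda>s. b \<otimes>\<^sub>K c s"]) auto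
    qed
  qed
  moreover have "S \<subseteq> ?L"
  proof
    fix t assume t: "t \<in> S"
    have "?s (\<lambda>s. if s = t then \<one>\<^sub>K else \<zero>\<^sub>K) = t"
      using t Sc finsum_eq_single[OF S(1) t, of "\<lambda>s. (if s = t then \<one>\<^sub>K else \<zero>\<^sub>K) \<odot>\<^sub>V s"] by simp
    then show "t \<in> ?L" by (intro image_eqI[where x = "\<lambda>s. if s = t then \<one>\<^sub>K else \<zero>\<^sub>K"]) auto
  qed
  ultimately have "carrier V \<subseteq> ?L" by (rule span)
  then show ?thesis unfolding fin_dim_def using S by blast
qed

text \<open>The span along a list. Adjoining one vector at a time makes the list the induction
  parameter of the rank.\<close>

primrec lspan :: "'m list \<Rightarrow> 'm set" where
  "lspan [] = {\<zero>\<^sub>V}"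
| "lspan (s # ss) = {x \<oplus>\<^sub>V c \<odot>\<^sub>V s |x c. x \<in> lspan ss \<and> c \<in> carrier K}"

lemma lspan_subspace:
  assumes "set ss \<subseteq> carrier V" shows "subspace K V (lspan ss)" "set ss \<subseteq> lspan ss"
proof -
  have "subspace K V (lspan ss) \<and> set ss \<subseteq> lspan ss" using assms
  proof (induction ss)
    case Nil
    show ?case by (auto intro!: subspaceI)
  next
    case (Cons s ss)
    then have IH: "subspace K V (lspan ss)" "set ss \<subseteq> lspan ss" and s: "s \<in> carrier V" by auto
    note D = subspaceD[OF IH(1)]
    have Dc: "\<And>x. x \<in> lspan ss \<Longrightarrow> x \<in> carrier V" using D(2) by auto
    have in_ss: "x \<in> lspan (s # ss)" if "x \<in> lspan ss" for x
      using that s Dc by (auto intro!: exI[of _ x] exI[of _ "\<zero>\<^sub>K"])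
    have "subspace K V (lspan (s # ss))"
    proof (rule subspaceI)
      show "\<zero>\<^sub>V \<in> lspan (s # ss)" using in_ss D(3) by blast
      show "x \<oplus>\<^sub>V y \<in> lspan (s # ss)" if xy: "x \<in> lspan (s # ss)" "y \<in> lspan (s # ss)" for x y
      proof -
        obtain u v c d where *: "u \<in> lspan ss" "v \<in> lspan ss" "c \<in> carrier K" "d \<in> carrier K"
          "x = u \<oplus>\<^sub>V c \<odot>\<^sub>V s" "y = v \<oplus>\<^sub>V d \<odot>\<^sub>V s" using xy by auto
        then have "x \<oplus>\<^sub>V y = (u \<oplus>\<^sub>V v) \<oplus>\<^sub>V (c \<oplus>\<^sub>K d) \<odot>\<^sub>V s" using Dc s by (simp add: smult_l_distr M.a_ac)
        then show ?thesis using * D(4) by auto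
      qed
      show "b \<odot>\<^sub>V x \<in> lspan (s # ss)" if b: "b \<in> carrier K" and x: "x \<in> lspan (s # ss)" for b x
      proof -
        obtain u c where *: "u \<in> lspan ss" "c \<in> carrier K" "x = u \<oplus>\<^sub>V c \<odot>\<^sub>V s" using x by auto
        then have "b \<odot>\<^sub>V x = b \<odot>\<^sub>V u \<oplus>\<^sub>V (b \<otimes>\<^sub>K c) \<odot>\<^sub>V s" using Dc s b by (simp add: smult_r_distr smult_assoc1)
        then show ?thesis using * D(6) b by auto
      qed
    qed (use Dc s in auto)
    moreover have "s \<in> lspan (s # ss)" using s D(3) by (auto intro!: exI[of _ "\<zero>\<^sub>V"] exI[of _ "\<one>\<^sub>K"])
    ultimately show ?case using IH(2) in_ss by auto
  qed
  then show "subspace K V (lspan ss)" "set ss \<subseteq> lspan ss" by auto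
qed

text \<open>The rank counts the places in the filtration by the spans of the tails of the list at
  which the intersection with L grows. If L lies in L' and the counts agree, they agree at each
  step, and the intersections coincide along the whole filtration. Boundedness and strict growth are
  all that is used of dimension.\<close>

lemma rank_list:
  assumes "set ss \<subseteq> carrier V"
  shows "\<exists>r :: 'm set \<Rightarrow> nat. (\<forall>L. r L \<le> length ss) \<and>
    (\<forall>L L'. subspace K V L \<longrightarrow> subspace K V L' \<longrightarrow> L \<subseteq> L' \<longrightarrow>
       r L \<le> r L' \<and> (r L = r L' \<longrightarrow> L' \<inter> lspan ss \<subseteq> L))" using assms
proof (induction ss)
  case Nil
  show ?case by (intro exI[of _ "\<lambda>_. 0"]) (auto dest: subspaceD(3))
next
  case (Cons s ss)
  have ss: "set ss \<subseteq> carrier V" and s: "s \<in> carrier V" using Cons.prems by auto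
  from Cons.IH[OF ss] obtain r :: "'m set \<Rightarrow> nat" where r0: "\<forall>L. r L \<le> length ss"
    "\<forall>L L'. subspace K V L \<longrightarrow> subspace K V L' \<longrightarrow> L \<subseteq> L' \<longrightarrow>
       r L \<le> r L' \<and> (r L = r L' \<longrightarrow> L' \<inter> lspan ss \<subseteq> L)" by blast
  then have r: "\<And>L. r L \<le> length ss"
    "\<And>L L'. \<lbrakk>subspace K V L; subspace K V L'; L \<subseteq> L'\<rbrakk> \<Longrightarrow> r L \<le> r L'"
    "\<And>L L'. \<lbrakk>subspace K V L; subspace K V L'; L \<subseteq> L'; r L = r L'\<rbrakk> \<Longrightarrow> L' \<inter> lspan ss \<subseteq> L" by blast+
  note D = subspaceD[OF lspan_subspace(1)[OF ss]]
  \<comment> \<open>The jump at s: one exactly when L contains a vector of the longer span with a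
    nonzero coefficient at s that cannot be removed.\<close>
  define d where "d L = (if L \<inter> lspan (s # ss) \<subseteq> lspan ss then 0 else 1::nat)" for L
  show ?case
  proof (intro exI[of _ "\<lambda>L. r L + d L"] conjI allI impI)
    show "r L + d L \<le> length (s # ss)" for L using r(1)[of L] by (auto simp: d_def)
  next
    fix L L' assume L: "subspace K V L" "subspace K V L'" "L \<subseteq> L'"
    have dm: "d L \<le> d L'" using L(3) by (auto simp: d_def)
    then show "r L + d L \<le> r L' + d L'" using r(2)[OF L] by simp
    assume "r L + d L = r L' + d L'"
    then have eq: "r L = r L'" "d L = d L'" using r(2)[OF L] dm by auto
    note r3 = r(3)[OF L eq(1)]
    note DL = subspaceD[OF L(1)] and DL' = subspaceD[OF L(2)]
    show "L' \<inter> lspan (s # ss) \<subseteq> L"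
    proof
      fix w' assume w': "w' \<in> L' \<inter> lspan (s # ss)"
      show "w' \<in> L"
      proof (cases "d L = 0")
        case True
        then have "w' \<in> lspan ss" using w' eq by (auto simp: d_def split: if_splits)
        then show ?thesis using w' r3 by auto
      next
        case False
        then obtain w where w: "w \<in> L" "w \<in> lspan (s # ss)" "w \<notin> lspan ss" by (auto simp: d_def split: if_splits)
        obtain x c where xc: "x \<in> lspan ss" "c \<in> carrier K" "w = x \<oplus>\<^sub>V c \<odot>\<^sub>V s" using w(2) by auto
        obtain x' c' where xc': "x' \<in> lspan ss" "c' \<in> carrier K" "w' = x' \<oplus>\<^sub>V c' \<odot>\<^sub>V s" using w' by auto
        have X: "x \<in> carrier V" "x' \<in> carrier V" using xc xc' D(2) by auto
        have "c \<noteq> \<zero>\<^sub>K" using w(3) xc X s by auto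
        then have u: "c \<in> Units K" using xc(2) by (simp add: field_Units)
        \<comment> \<open>The factor that cancels the coefficient of s: \<open>w'\<close> minus b
          times w falls into the span of the shorter list, where the induction hypothesis
          applies.\<close>
        define b where "b = c' \<otimes>\<^sub>K inv\<^bsub>K\<^esub> c"
        have b: "b \<in> carrier K" "b \<otimes>\<^sub>K c = c'" using u xc xc' by (auto simp: b_def K.m_assoc)
        have wc: "w \<in> carrier V" "w' \<in> carrier V" using w w' DL(2) L(3) DL'(2) by auto
        have bw: "b \<odot>\<^sub>V w = b \<odot>\<^sub>V x \<oplus>\<^sub>V c' \<odot>\<^sub>V s"
          using X s b xc by (simp add: smult_r_distr smult_assoc1[symmetric])
        have e: "w' \<ominus>\<^sub>V b \<odot>\<^sub>V w = x' \<ominus>\<^sub>V b \<odot>\<^sub>V x"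
        proof -
          have "w' = (x' \<ominus>\<^sub>V b \<odot>\<^sub>V x) \<oplus>\<^sub>V b \<odot>\<^sub>V w" unfolding bw xc'(3) using X s b xc'(2)
            by (simp add: M.minus_eq M.a_assoc) (metis M.a_assoc M.a_inv_closed M.l_neg M.l_zero smult_closed)
          then show ?thesis using X s b wc by (simp add: M.minus_eq M.a_assoc M.r_neg)
        qed
        have "w' \<in> L'" "w \<in> L'" using w w' L(3) by auto
        then have "w' \<ominus>\<^sub>V b \<odot>\<^sub>V w \<in> L'" using DL'(5,6) b(1) by blast
        moreover have "w' \<ominus>\<^sub>V b \<odot>\<^sub>V w \<in> lspan ss" unfolding e using D(5)[OF xc'(1) D(6)[OF b(1) xc(1)]] .
        ultimately have "w' \<ominus>\<^sub>V b \<odot>\<^sub>V w \<in> L' \<inter> lspan ss" by simp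
        then have "w' \<ominus>\<^sub>V b \<odot>\<^sub>V w \<in> L" using r3 by auto
        then have "(w' \<ominus>\<^sub>V b \<odot>\<^sub>V w) \<oplus>\<^sub>V b \<odot>\<^sub>V w \<in> L" using DL(4,6) b w by simp
        then show ?thesis using wc b by (simp add: M.minus_eq M.a_assoc M.l_neg)
      qed
    qed
  qed
qed

text \<open>For a list that spans the whole space the intersections with \<open>lspan ss\<close>
  disappear, and equal rank of nested subspaces means equality.\<close>

lemma rank_exists:
  assumes "fin_dim K V"
  obtains r :: "'m set \<Rightarrow> nat" and m :: nat where "\<And>L. r L \<le> m"
    "\<And>L L'. \<lbrakk>subspace K V L; subspace K V L'; L \<subset> L'\<rbrakk> \<Longrightarrow> r L < r L'"
proof -
  obtain S where S: "finite S" "S \<subseteq> carrier V" "\<And>L. \<lbrakk>subspace K V L; S \<subseteq> L\<rbrakk> \<Longrightarrow> L = carrier V"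
    using fin_dimD[OF assms] by blast
  obtain ss where ss: "set ss = S" using finite_list[OF S(1)] by blast
  have full: "lspan ss = carrier V" using lspan_subspace[of ss] S ss by auto
  have "set ss \<subseteq> carrier V" using S(2) ss by simp
  from rank_list[OF this] obtain r :: "'m set \<Rightarrow> nat" where r0: "\<forall>L. r L \<le> length ss"
    "\<forall>L L'. subspace K V L \<longrightarrow> subspace K V L' \<longrightarrow> L \<subseteq> L' \<longrightarrow>
       r L \<le> r L' \<and> (r L = r L' \<longrightarrow> L' \<inter> lspan ss \<subseteq> L)" by blast
  then have r: "\<And>L. r L \<le> length ss"
    "\<And>L L'. \<lbrakk>subspace K V L; subspace K V L'; L \<subseteq> L'\<rbrakk> \<Longrightarrow> r L \<le> r L'"
    "\<And>L L'. \<lbrakk>subspace K V L; subspace K V L'; L \<subseteq> L'; r L = r L'\<rbrakk> \<Longrightarrow> L' \<inter> lspan ss \<subseteq> L" by blast+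
  have "r L < r L'" if L: "subspace K V L" "subspace K V L'" "L \<subset> L'" for L L'
    using r(2)[OF L(1,2)] r(3)[OF L(1,2)] L full subspaceD(2)[OF L(2)]
    by (metis inf.absorb_iff1 nat_less_le psubsetE)
  then show ?thesis by (rule that[OF r(1)])
qed

end

section \<open>Graded modules as vector spaces over the base field\<close>

context graded_algebra
begin

lemma scalars_simps [simp]:
  "carrier (scalars A M) = carrier M" "add (scalars A M) = add M" "zero (scalars A M) = zero M"
  "c \<odot>\<^bsub>scalars A M\<^esub> x = (c \<odot>\<^sub>A \<one>\<^sub>A) \<odot>\<^sub>M x" by (simp_all add: scalars_def)

lemma scalars_kmodule:
  assumes M: "M \<in> Gr G A" shows "kmodule K (scalars A M)"
proof -
  interpret M: graded_group G M by (rule Gr_graded_group[OF M])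
  have ab: "abelian_group (scalars A M)"
    using finsum_record_cong(3)[of "scalars A M" M] M.abelian_group_axioms by simp
  have assoc: "(a \<otimes>\<^sub>K b) \<odot>\<^sub>A \<one>\<^sub>A = (a \<odot>\<^sub>A \<one>\<^sub>A) \<otimes>\<^sub>A (b \<odot>\<^sub>A \<one>\<^sub>A)"
    if "a \<in> carrier K" "b \<in> carrier K" for a b using that by (simp add: smult_mult_left smult_assoc1)
  have "module K (scalars A M)"
    using domain.axioms(1)[OF field.axioms(1)[OF K.field_axioms]] ab by (intro module.intro module_axioms.intro)
      (simp_all add: GrD(3-7)[OF M] smult_l_distr assoc)
  then show ?thesis by (intro kmodule.intro K.field_axioms)
qed

lemma algebra_kmodule: "kmodule K A"
  by (intro kmodule.intro K.field_axioms module_axioms)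

end

section \<open>Local idempotents\<close>

text \<open>Locality of the corner of e in the identity-degree part of A, in the strong form that
  each element is invertible or nilpotent. These are the two outcomes that Fitting's lemma leaves
  for a primitive idempotent in finite dimension.\<close>

definition local_idempotent :: "'g monoid \<Rightarrow> ('k, 'a, 'g) graded \<Rightarrow> 'a \<Rightarrow> bool" where
  "local_idempotent G A e \<longleftrightarrow> e \<in> component A \<one>\<^sub>G \<and> e \<otimes>\<^sub>A e = e \<and> e \<noteq> \<zero>\<^sub>A \<and>
     (\<forall>x\<in>component A \<one>\<^sub>G. e \<otimes>\<^sub>A x = x \<and> x \<otimes>\<^sub>A e = x \<longrightarrow>
        (\<exists>y\<in>component A \<one>\<^sub>G. e \<otimes>\<^sub>A y = y \<and> y \<otimes>\<^sub>A e = y \<and> y \<otimes>\<^sub>A x = e \<and> x \<otimes>\<^sub>A y = e) \<or>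
        (\<exists>n::nat. x [^]\<^sub>A n = \<zero>\<^sub>A))"

text \<open>For idempotents \<open>f\<close> and \<open>h\<close>, with \<open>f\<close> local, this says that \<open>Af\<close> is isomorphic to a shift of
  a direct summand of \<open>Ah\<close>.\<close>

definition factors_through :: "'g monoid \<Rightarrow> ('k, 'a, 'g) graded \<Rightarrow> 'a \<Rightarrow> 'a \<Rightarrow> bool" where
  "factors_through G A f h \<longleftrightarrow>
     (\<exists>g\<in>carrier G. \<exists>u\<in>component A g. \<exists>v\<in>component A (inv\<^bsub>G\<^esub> g). u \<otimes>\<^sub>A h \<otimes>\<^sub>A v = f)"

definition orthogonal_idempotents :: "'g monoid \<Rightarrow> ('k, 'a, 'g) graded \<Rightarrow> 'a set \<Rightarrow> bool" where
  "orthogonal_idempotents G A E \<longleftrightarrow> finite E \<and> (\<forall>e\<in>E. local_idempotent G A e) \<and>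
     (\<forall>e\<in>E. \<forall>f\<in>E. e \<noteq> f \<longrightarrow> e \<otimes>\<^sub>A f = \<zero>\<^sub>A)"

definition basic_set :: "'g monoid \<Rightarrow> ('k, 'a, 'g) graded \<Rightarrow> 'a set \<Rightarrow> bool" where
  "basic_set G A E \<longleftrightarrow> orthogonal_idempotents G A E \<and> (\<Oplus>\<^sub>A e\<in>E. e) = \<one>\<^sub>A \<and>
     (\<forall>e\<in>E. \<forall>f\<in>E. e \<noteq> f \<longrightarrow> \<not> factors_through G A e f)"

context graded_algebra
begin

abbreviation amult :: "'a \<Rightarrow> 'a \<Rightarrow> 'a" (infixl "\<bullet>" 70) where "x \<bullet> y \<equiv> x \<otimes>\<^sub>A y"
abbreviation A1 :: "'a set" where "A1 \<equiv> component A \<one>\<^sub>G"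

lemma A1_closed: "x \<in> A1 \<Longrightarrow> x \<in> carrier A"
  using AG.component_closed[of "\<one>\<^sub>G"] by simp

lemma A1_mult: "\<lbrakk>x \<in> A1; y \<in> A1\<rbrakk> \<Longrightarrow> x \<bullet> y \<in> A1"
  using component_mult[of "\<one>\<^sub>G" "\<one>\<^sub>G"] by simp

lemma component_A1_mult: "\<lbrakk>g \<in> carrier G; x \<in> component A g; y \<in> A1\<rbrakk> \<Longrightarrow> x \<bullet> y \<in> component A g"
  using component_mult[of g "\<one>\<^sub>G"] by simp

lemma A1_component_mult: "\<lbrakk>g \<in> carrier G; x \<in> A1; y \<in> component A g\<rbrakk> \<Longrightarrow> x \<bullet> y \<in> component A g"
  using component_mult[of "\<one>\<^sub>G" g] by simp

lemma A1_subgroup: "additive_subgroup A1 A"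
  using AG.component_subgroup by simp

lemmas A1_zero = additive_subgroupD(2)[OF A1_subgroup]
  and A1_add = additive_subgroupD(3)[OF A1_subgroup]
  and A1_minus = A.additive_subgroup_minus[OF A1_subgroup]

lemma A1_pow: "x \<in> A1 \<Longrightarrow> x [^]\<^sub>A (n::nat) \<in> A1"
  by (induction n) (auto simp: one_component A1_mult)

lemma local_idempotentD:
  assumes "local_idempotent G A e"
  shows "e \<in> A1" "e \<in> carrier A" "e \<bullet> e = e" "e \<noteq> \<zero>\<^sub>A"
    "\<And>x. \<lbrakk>x \<in> carrier A\<rbrakk> \<Longrightarrow> e \<bullet> (e \<bullet> x) = e \<bullet> x"
  using assms A1_closed by (auto simp: local_idempotent_def A.m_assoc[symmetric])

text \<open>An idempotent equals all its positive powers, so if it is nilpotent it vanishes. If it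
  is invertible in the corner, cancelling one factor in \<open>f \<bullet> f = f\<close> gives e.
  Thus local idempotents are primitive.\<close>

lemma A1_idempotent_of_local:
  assumes e: "local_idempotent G A e" and f: "f \<in> A1" "f \<bullet> f = f" "e \<bullet> f = f" "f \<bullet> e = f"
  shows "f = \<zero>\<^sub>A \<or> f = e"
proof -
  have fc: "f \<in> carrier A" using f A1_closed by simp
  have pow: "f [^]\<^sub>A Suc n = f" for n by (induction n) (use fc f in auto)
  from e f consider y where "y \<in> A1" "e \<bullet> y = y" "y \<bullet> f = e" | n where "f [^]\<^sub>A (n::nat) = \<zero>\<^sub>A"
    unfolding local_idempotent_def by blast
  then show ?thesis
  proof cases
    case 1
    have ec: "e \<in> carrier A" using e local_idempotentD by blast
    have "f = e \<bullet> f" using f by simp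
    also have "\<dots> = y \<bullet> (f \<bullet> f)" using 1 fc A1_closed[of y] by (simp add: A.m_assoc[symmetric])
    also have "\<dots> = e" using 1 f by simp
    finally show ?thesis ..
  next
    case 2
    have "f = f [^]\<^sub>A Suc n" using pow by simp
    also have "\<dots> = \<zero>\<^sub>A" using 2 fc by simp
    finally show ?thesis ..
  qed
qed

section \<open>Fitting's lemma and the decomposition of idempotents\<close>

lemma scalar_subspace:
  assumes "L \<subseteq> carrier A" "\<zero>\<^sub>A \<in> L" "\<And>x y. \<lbrakk>x \<in> L; y \<in> L\<rbrakk> \<Longrightarrow> x \<oplus>\<^sub>A y \<in> L"
    "\<And>c x. \<lbrakk>c \<in> carrier K; x \<in> L\<rbrakk> \<Longrightarrow> c \<odot>\<^sub>A x \<in> L"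
  shows "subspace K A L" using kmodule.subspaceI[OF algebra_kmodule] assms by blast

lemma left_multiples_subspace: "x \<in> carrier A \<Longrightarrow> subspace K A ((\<lambda>a. a \<bullet> x) ` A1)"
proof (rule scalar_subspace)
  assume x: "x \<in> carrier A"
  show "\<zero>\<^sub>A \<in> (\<lambda>a. a \<bullet> x) ` A1" using x A1_zero by (intro image_eqI[where x = "\<zero>\<^sub>A"]) auto
  show "u \<oplus>\<^sub>A v \<in> (\<lambda>a. a \<bullet> x) ` A1" if uv: "u \<in> (\<lambda>a. a \<bullet> x) ` A1" "v \<in> (\<lambda>a. a \<bullet> x) ` A1" for u v
  proof -
    obtain a b where "a \<in> A1" "b \<in> A1" "u = a \<bullet> x" "v = b \<bullet> x" using uv by auto
    then show ?thesis using x A1_add A1_closed by (intro image_eqI[where x = "a \<oplus>\<^sub>A b"]) (auto simp: A.l_distr)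
  qed
  show "c \<odot>\<^sub>A u \<in> (\<lambda>a. a \<bullet> x) ` A1" if c: "c \<in> carrier K" and u: "u \<in> (\<lambda>a. a \<bullet> x) ` A1" for c u
  proof -
    obtain a where "a \<in> A1" "u = a \<bullet> x" using u by auto
    then show ?thesis using x c component_smult[of c "\<one>\<^sub>G" a] A1_closed
      by (intro image_eqI[where x = "c \<odot>\<^sub>A a"]) (auto simp: smult_mult_left)
  qed
qed (use A1_closed in auto)

lemma right_multiples_subspace: "x \<in> carrier A \<Longrightarrow> subspace K A ((\<lambda>a. x \<bullet> a) ` A1)"
proof (rule scalar_subspace)
  assume x: "x \<in> carrier A"
  show "\<zero>\<^sub>A \<in> (\<lambda>a. x \<bullet> a) ` A1" using x A1_zero by (intro image_eqI[where x = "\<zero>\<^sub>A"]) auto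
  show "u \<oplus>\<^sub>A v \<in> (\<lambda>a. x \<bullet> a) ` A1" if uv: "u \<in> (\<lambda>a. x \<bullet> a) ` A1" "v \<in> (\<lambda>a. x \<bullet> a) ` A1" for u v
  proof -
    obtain a b where "a \<in> A1" "b \<in> A1" "u = x \<bullet> a" "v = x \<bullet> b" using uv by auto
    then show ?thesis using x A1_add A1_closed by (intro image_eqI[where x = "a \<oplus>\<^sub>A b"]) (auto simp: A.r_distr)
  qed
  show "c \<odot>\<^sub>A u \<in> (\<lambda>a. x \<bullet> a) ` A1" if c: "c \<in> carrier K" and u: "u \<in> (\<lambda>a. x \<bullet> a) ` A1" for c u
  proof -
    obtain a where "a \<in> A1" "u = x \<bullet> a" using u by auto
    then show ?thesis using x c component_smult[of c "\<one>\<^sub>G" a] A1_closed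
      by (intro image_eqI[where x = "c \<odot>\<^sub>A a"]) (auto simp: smult_mult_right)
  qed
qed (use A1_closed in auto)

text \<open>Fitting's lemma: some power \<open>z\<close> of \<open>x\<close> generates the same left and right ideals of \<open>A1\<close> as its
  square, so that \<open>z = yz\<^sup>2 = z\<^sup>2y'\<close>, and \<open>yz = zy'\<close> is the idempotent in question.\<close>

lemma fitting:
  assumes fd: "fin_dim K A" and e: "e \<in> A1" "e \<bullet> e = e" and x: "x \<in> A1" "e \<bullet> x = x" "x \<bullet> e = x"
  obtains f where "f \<in> A1" "f \<bullet> f = f" "e \<bullet> f = f" "f \<bullet> e = f"
    "f = \<zero>\<^sub>A \<Longrightarrow> \<exists>n::nat. x [^]\<^sub>A n = \<zero>\<^sub>A"
    "f = e \<Longrightarrow> \<exists>y\<in>A1. e \<bullet> y = y \<and> y \<bullet> e = y \<and> y \<bullet> x = e \<and> x \<bullet> y = e"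
proof -
  obtain r :: "'a set \<Rightarrow> nat" and m :: nat where r: "\<And>L. r L \<le> m"
    "\<And>L L'. \<lbrakk>subspace K A L; subspace K A L'; L \<subset> L'\<rbrakk> \<Longrightarrow> r L < r L'"
    using kmodule.rank_exists[OF algebra_kmodule fd] by blast
  note xc = A1_closed[OF x(1)] and ec = A1_closed[OF e(1)]
  define p where "p k = x [^]\<^sub>A (k::nat)" for k
  have p: "p k \<in> A1" "p k \<in> carrier A" for k using A1_pow[OF x(1)] A1_closed by (auto simp: p_def)
  have pm: "p (k + l) = p k \<bullet> p l" for k l using xc by (simp add: p_def A.nat_pow_mult)
  have ep: "e \<bullet> p k = p k" "p k \<bullet> e = p k" if "k \<ge> 1" for k
  proof -
    obtain l where l: "k = l + 1" using \<open>k \<ge> 1\<close> by (metis le_add_diff_inverse2)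
    have p1: "p 1 = x" using xc by (simp add: p_def)
    show "p k \<bullet> e = p k" unfolding l pm p1 using p xc ec x by (simp add: A.m_assoc)
    have "p k = x \<bullet> p l" using pm[of 1 l] p1 l by (simp add: add.commute)
    then show "e \<bullet> p k = p k" using p xc ec x by (simp add: A.m_assoc[symmetric])
  qed
  define L where "L k = (\<lambda>a. a \<bullet> p k) ` A1" for k
  define R where "R k = (\<lambda>a. p k \<bullet> a) ` A1" for k
  have sub: "subspace K A (L k)" "subspace K A (R k)" for k
    using left_multiples_subspace right_multiples_subspace p by (auto simp: L_def R_def)
  \<comment> \<open>A power whose left and right ideals have the least total rank. The ideals of its
    square are contained in them and cannot have smaller rank, so they are equal. Exponents start at
    1 because e acts as the identity on the positive powers of x.\<close>
  obtain k where k: "k \<ge> 1" "\<And>l. l \<ge> 1 \<Longrightarrow> r (L k) + r (R k) \<le> r (L l) + r (R l)"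
    using ex_has_least_nat[of "\<lambda>k. k \<ge> 1" "1::nat" "\<lambda>k. r (L k) + r (R k)"] by auto
  have inc: "L (k + k) \<subseteq> L k" "R (k + k) \<subseteq> R k"
  proof -
    show "L (k + k) \<subseteq> L k"
    proof
      fix u assume "u \<in> L (k + k)"
      then obtain a where a: "a \<in> A1" "u = a \<bullet> (p k \<bullet> p k)" unfolding L_def pm by auto
      then have "u = (a \<bullet> p k) \<bullet> p k" using p A1_closed by (simp add: A.m_assoc)
      then show "u \<in> L k" unfolding L_def using a p A1_mult by blast
    qed
    show "R (k + k) \<subseteq> R k"
    proof
      fix u assume "u \<in> R (k + k)"
      then obtain a where a: "a \<in> A1" "u = (p k \<bullet> p k) \<bullet> a" unfolding R_def pm by auto
      then have "u = p k \<bullet> (p k \<bullet> a)" using p A1_closed by (simp add: A.m_assoc)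
      then show "u \<in> R k" unfolding R_def using a p A1_mult by blast
    qed
  qed
  have "L (k + k) = L k" "R (k + k) = R k"
    using inc r(2)[OF sub(1) sub(1), of "k + k" k] r(2)[OF sub(2) sub(2), of "k + k" k] k(2)[of "k + k"] k(1)
    by fastforce+
  moreover have "p k \<in> L k" "p k \<in> R k" unfolding L_def R_def using p one_component
    by (auto intro: image_eqI[where x = "\<one>\<^sub>A"])
  ultimately have "p k \<in> L (k + k)" "p k \<in> R (k + k)" by auto
  then obtain y0 y0' where y0: "y0 \<in> A1" "p k = y0 \<bullet> (p k \<bullet> p k)" "y0' \<in> A1" "p k = (p k \<bullet> p k) \<bullet> y0'"
    unfolding L_def R_def pm by auto
  define z where "z = p k"
  have z: "z \<in> A1" "z \<in> carrier A" "e \<bullet> z = z" "z \<bullet> e = z" using p ep k by (auto simp: z_def)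
  have y0c: "y0 \<in> carrier A" "y0' \<in> carrier A" using y0 A1_closed by auto
  \<comment> \<open>The coefficients are compressed into the corner of e. As z lies in that corner
    already, both equations for z survive the compression.\<close>
  define y where "y = e \<bullet> y0 \<bullet> e"
  define y' where "y' = e \<bullet> y0' \<bullet> e"
  have corner: "e \<bullet> a \<bullet> e \<in> A1" "e \<bullet> a \<bullet> e \<in> carrier A" "e \<bullet> (e \<bullet> a \<bullet> e) = e \<bullet> a \<bullet> e"
    "e \<bullet> a \<bullet> e \<bullet> e = e \<bullet> a \<bullet> e" if a: "a \<in> A1" for a
  proof -
    have ac: "a \<in> carrier A" using a A1_closed by simp
    show "e \<bullet> a \<bullet> e \<in> A1" using e a A1_mult by simp
    then show "e \<bullet> a \<bullet> e \<in> carrier A" using A1_closed by simp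
    have "e \<bullet> (e \<bullet> a \<bullet> e) = (e \<bullet> e) \<bullet> a \<bullet> e" using ec ac by (simp add: A.m_assoc)
    then show "e \<bullet> (e \<bullet> a \<bullet> e) = e \<bullet> a \<bullet> e" using e by simp
    have "e \<bullet> a \<bullet> e \<bullet> e = e \<bullet> a \<bullet> (e \<bullet> e)" using ec ac by (simp add: A.m_assoc)
    then show "e \<bullet> a \<bullet> e \<bullet> e = e \<bullet> a \<bullet> e" using e by simp
  qed
  note y = corner[OF y0(1), folded y_def] and y' = corner[OF y0(3), folded y'_def]
  have yz: "y \<bullet> (z \<bullet> z) = z"
  proof -
    have "e \<bullet> (z \<bullet> z) = z \<bullet> z" using z ec by (simp add: A.m_assoc[symmetric])
    then have "y \<bullet> (z \<bullet> z) = e \<bullet> (y0 \<bullet> (z \<bullet> z))" using ec y0c z(2) by (simp add: y_def A.m_assoc)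
    also have "\<dots> = z" using y0(2) z by (simp add: z_def)
    finally show ?thesis .
  qed
  have zy: "z \<bullet> z \<bullet> y' = z"
  proof -
    have "z \<bullet> z \<bullet> y' = z \<bullet> (z \<bullet> e) \<bullet> y0' \<bullet> e" using ec y0c z(2) by (simp add: y'_def A.m_assoc)
    also have "\<dots> = z" using y0(4) z by (simp add: z_def)
    finally show ?thesis .
  qed
  define f where "f = y \<bullet> z"
  have f': "f = z \<bullet> y'"
  proof -
    have "f = y \<bullet> (z \<bullet> z \<bullet> y')" using zy by (simp add: f_def)
    also have "\<dots> = y \<bullet> (z \<bullet> z) \<bullet> y'" using y y' z by (simp add: A.m_assoc)
    finally show ?thesis using yz by simp
  qed
  have fc: "f \<in> A1" "f \<in> carrier A" using y z A1_mult by (auto simp: f_def)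
  have fz: "f \<bullet> z = z" using yz y z by (simp add: f_def A.m_assoc)
  have ff: "f \<bullet> f = f"
  proof -
    have "f \<bullet> f = f \<bullet> z \<bullet> y'" using fc z y' by (subst (2) f') (simp add: A.m_assoc)
    then show ?thesis using fz f' by simp
  qed
  have ef: "e \<bullet> f = f" "f \<bullet> e = f" using y z ec by (simp_all add: f_def A.m_assoc) (simp add: A.m_assoc[symmetric])
  have nil: "\<exists>n::nat. x [^]\<^sub>A n = \<zero>\<^sub>A" if "f = \<zero>\<^sub>A" using fz z that by (intro exI[of _ k]) (simp add: z_def p_def)
  have unit: "\<exists>y\<in>A1. e \<bullet> y = y \<and> y \<bullet> e = y \<and> y \<bullet> x = e \<and> x \<bullet> y = e" if fe: "f = e"
  proof -
    obtain l where l: "k = l + 1" using k(1) by (metis le_add_diff_inverse2)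
    have p1: "p 1 = x" using xc by (simp add: p_def)
    have zl: "z = p l \<bullet> x" "z = x \<bullet> p l" using pm[of l 1] pm[of 1 l] p1 by (simp_all add: z_def l add.commute)
    \<comment> \<open>Relative to e, \<open>a\<close> is a left inverse and \<open>b\<close> a right
      inverse of x. Evaluating \<open>a \<bullet> x \<bullet> b\<close> in two ways gives
      \<open>a \<bullet> e = e \<bullet> b\<close>, and this common value is a two-sided inverse
      inside the corner.\<close>
    define a where "a = y \<bullet> p l"
    define b where "b = p l \<bullet> y'"
    have ac: "a \<in> A1" "a \<in> carrier A" "b \<in> A1" "b \<in> carrier A" using y y' p A1_mult by (auto simp: a_def b_def)
    have ax: "a \<bullet> x = e" using fe y p(2) xc by (simp add: a_def f_def zl(1) A.m_assoc)
    have xb: "x \<bullet> b = e" using fe f' y' p(2) xc by (simp add: b_def zl(2) A.m_assoc)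
    have "a \<bullet> e = (a \<bullet> x) \<bullet> b" using xb ac xc by (simp add: A.m_assoc)
    then have ae: "a \<bullet> e = e \<bullet> b" using ax by simp
    define c where "c = a \<bullet> e"
    have ea: "e \<bullet> a = a" using y p ec by (simp add: a_def A.m_assoc[symmetric])
    have "c \<in> A1" "e \<bullet> c = c" "c \<bullet> e = c" using ac e ea ec A1_mult
      by (auto simp: c_def A.m_assoc) (simp add: A.m_assoc[symmetric])
    moreover have "c \<bullet> x = e" using ax ac ec xc x by (simp add: c_def A.m_assoc)
    moreover have "x \<bullet> c = e" using xb ac ec xc x unfolding c_def ae by (simp add: A.m_assoc[symmetric])
    ultimately show ?thesis by blast
  qed
  show ?thesis by (rule that[OF fc(1) ff ef nil unit])
qed

lemma orthogonal_idempotentsD: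
  assumes "orthogonal_idempotents G A E"
  shows "finite E" "\<And>e. e \<in> E \<Longrightarrow> local_idempotent G A e" "\<And>e. e \<in> E \<Longrightarrow> e \<in> A1" "\<And>e. e \<in> E \<Longrightarrow> e \<in> carrier A"
    "\<And>e f. \<lbrakk>e \<in> E; f \<in> E\<rbrakk> \<Longrightarrow> e \<bullet> f = (if e = f then e else \<zero>\<^sub>A)"
  using assms local_idempotentD by (auto simp: orthogonal_idempotents_def)

lemma orthogonal_sum:
  assumes E: "orthogonal_idempotents G A E" and f: "f \<in> E"
  shows "f \<bullet> (\<Oplus>\<^sub>A e\<in>E. e) = f" "(\<Oplus>\<^sub>A e\<in>E. e) \<bullet> f = f"
proof -
  note D = orthogonal_idempotentsD[OF E]
  have "f \<bullet> (\<Oplus>\<^sub>A e\<in>E. e) = (\<Oplus>\<^sub>A e\<in>E. f \<bullet> e)" using D f by (intro A.finsum_rdistr) auto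
  also have "\<dots> = f \<bullet> f" using D f by (intro A.finsum_eq_single) auto
  finally show "f \<bullet> (\<Oplus>\<^sub>A e\<in>E. e) = f" using D(5)[OF f f] by simp
  have "(\<Oplus>\<^sub>A e\<in>E. e) \<bullet> f = (\<Oplus>\<^sub>A e\<in>E. e \<bullet> f)" using D f by (intro A.finsum_ldistr) auto
  also have "\<dots> = f \<bullet> f" using D f by (intro A.finsum_eq_single) auto
  finally show "(\<Oplus>\<^sub>A e\<in>E. e) \<bullet> f = f" using D(5)[OF f f] by simp
qed

text \<open>If a nonzero e is not local, its corner has an element neither invertible nor nilpotent,
  and the idempotent f that Fitting's lemma attaches to it is neither 0 nor e. This splits e into f
  and e - f. Both generate strictly smaller left ideals of \<open>A1\<close>, so induction on the
  rank ends.\<close>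

lemma idempotent_decomposition:
  assumes fd: "fin_dim K A" and "e \<in> A1" "e \<bullet> e = e"
  shows "\<exists>E. orthogonal_idempotents G A E \<and> (\<Oplus>\<^sub>A f\<in>E. f) = e"
proof -
  obtain r :: "'a set \<Rightarrow> nat" and m :: nat where r: "\<And>L. r L \<le> m"
    "\<And>L L'. \<lbrakk>subspace K A L; subspace K A L'; L \<subset> L'\<rbrakk> \<Longrightarrow> r L < r L'"
    using kmodule.rank_exists[OF algebra_kmodule fd] by blast
  define L where "L e = (\<lambda>a. a \<bullet> e) ` A1" for e
  have rank_less: "r (L f) < r (L e)"
    if f: "f \<in> A1" "f \<bullet> f = f" "f \<bullet> e = f" "e \<bullet> f = f" "f \<noteq> e" and e: "e \<in> A1" for e f
  proof (rule r(2))
    show "subspace K A (L f)" "subspace K A (L e)"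
      using left_multiples_subspace f e A1_closed by (auto simp: L_def)
    have "e \<notin> L f"
    proof
      assume "e \<in> L f"
      then obtain a where a: "a \<in> A1" "e = a \<bullet> f" by (auto simp: L_def)
      then have "e = e \<bullet> f" using f A1_closed by (metis A.m_assoc)
      then show False using f by simp
    qed
    moreover have "e \<in> L e" unfolding L_def using e one_component A1_closed
      by (intro image_eqI[where x = "\<one>\<^sub>A"]) auto
    moreover have "L f \<subseteq> L e"
    proof
      fix u assume "u \<in> L f"
      then obtain a where a: "a \<in> A1" "u = a \<bullet> f" by (auto simp: L_def)
      then have "u = (a \<bullet> f) \<bullet> e" using f e A1_closed by (metis A.m_assoc)
      then show "u \<in> L e" unfolding L_def using a f A1_mult by blast
    qed
    ultimately show "L f \<subset> L e" by blast
  qed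
  show ?thesis using assms(2,3)
  proof (induction "r (L e)" arbitrary: e rule: less_induct)
    case less
    note ec = A1_closed[OF less.prems(1)]
    consider "e = \<zero>\<^sub>A" | "local_idempotent G A e" | "e \<noteq> \<zero>\<^sub>A" "\<not> local_idempotent G A e" by blast
    then show ?case
    proof cases
      case 1
      then show ?thesis by (intro exI[of _ "{}"]) (simp add: orthogonal_idempotents_def)
    next
      case 2
      then show ?thesis by (intro exI[of _ "{e}"]) (simp add: orthogonal_idempotents_def A.finsum_insert ec)
    next
      case 3
      then obtain x where x: "x \<in> A1" "e \<bullet> x = x" "x \<bullet> e = x"
        "\<not> (\<exists>y\<in>A1. e \<bullet> y = y \<and> y \<bullet> e = y \<and> y \<bullet> x = e \<and> x \<bullet> y = e)" "\<not> (\<exists>n::nat. x [^]\<^sub>A n = \<zero>\<^sub>A)"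
        using less.prems by (auto simp: local_idempotent_def)
      obtain f where f: "f \<in> A1" "f \<bullet> f = f" "e \<bullet> f = f" "f \<bullet> e = f" "f \<noteq> \<zero>\<^sub>A" "f \<noteq> e"
        using fitting[OF fd less.prems x(1-3)] x(4,5) by metis
      have fc: "f \<in> carrier A" using f A1_closed by simp
      define h where "h = e \<ominus>\<^sub>A f"
      have h: "h \<in> A1" "h \<in> carrier A" using less.prems f ec fc by (auto simp: h_def A1_minus)
      have eh: "e \<bullet> h = h" "h \<bullet> e = h" "f \<bullet> h = \<zero>\<^sub>A" "h \<bullet> f = \<zero>\<^sub>A" using f fc ec less.prems(2)
        by (simp_all add: h_def A.minus_eq A.r_distr A.l_distr A.r_minus A.l_minus A.r_neg)
      have hh: "h \<bullet> h = h"
      proof -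
        have "h \<bullet> h = h \<bullet> e \<ominus>\<^sub>A h \<bullet> f" using fc ec h by (simp add: h_def A.minus_eq A.r_distr A.r_minus)
        then show ?thesis using eh h ec fc by (simp add: A.minus_eq)
      qed
      have efh: "f \<oplus>\<^sub>A h = e" using fc ec by (simp add: h_def A.minus_eq A.a_lcomm A.r_neg)
      have "h \<noteq> e" using efh f fc ec by (metis A.add.r_cancel_one A.a_comm eh(3) A.r_null A.l_null)
      then have lt: "r (L h) < r (L e)" "r (L f) < r (L e)"
        using rank_less[OF h(1) hh eh(2,1) _ less.prems(1)] rank_less[OF f(1,2,4,3,6) less.prems(1)] by auto
      then obtain E1 E2 where E: "orthogonal_idempotents G A E1" "(\<Oplus>\<^sub>A u\<in>E1. u) = f"
        "orthogonal_idempotents G A E2" "(\<Oplus>\<^sub>A u\<in>E2. u) = h"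
        using less.hyps[OF lt(1) h(1) hh] less.hyps[OF lt(2) f(1,2)] by blast
      note D1 = orthogonal_idempotentsD[OF E(1)] and D2 = orthogonal_idempotentsD[OF E(3)]
      note s1 = orthogonal_sum[OF E(1), unfolded E(2)] and s2 = orthogonal_sum[OF E(3), unfolded E(4)]
      have o: "u \<bullet> v = \<zero>\<^sub>A" "v \<bullet> u = \<zero>\<^sub>A" if uv: "u \<in> E1" "v \<in> E2" for u v
      proof -
        have "u \<bullet> v = (u \<bullet> f) \<bullet> (h \<bullet> v)" using s1[OF uv(1)] s2[OF uv(2)] by simp
        also have "\<dots> = u \<bullet> ((f \<bullet> h) \<bullet> v)" using fc h D1(4)[OF uv(1)] D2(4)[OF uv(2)] by (simp add: A.m_assoc)
        finally show "u \<bullet> v = \<zero>\<^sub>A" using eh D1(4)[OF uv(1)] D2(4)[OF uv(2)] by simp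
        have "v \<bullet> u = (v \<bullet> h) \<bullet> (f \<bullet> u)" using s1[OF uv(1)] s2[OF uv(2)] by simp
        also have "\<dots> = v \<bullet> ((h \<bullet> f) \<bullet> u)" using fc h D1(4)[OF uv(1)] D2(4)[OF uv(2)] by (simp add: A.m_assoc)
        finally show "v \<bullet> u = \<zero>\<^sub>A" using eh D1(4)[OF uv(1)] D2(4)[OF uv(2)] by simp
      qed
      have "E1 \<inter> E2 = {}" using o local_idempotentD(3,4)[OF D1(2)] by fastforce
      then have "(\<Oplus>\<^sub>A u\<in>E1 \<union> E2. u) = e" using D1 D2 E efh by (subst A.finsum_Un_disjoint) auto
      moreover have "orthogonal_idempotents G A (E1 \<union> E2)" using D1 D2 o by (auto simp: orthogonal_idempotents_def)
      ultimately show ?thesis by blast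
    qed
  qed
qed

section \<open>Selecting representatives among the local idempotents\<close>

lemma factors_through_refl: "local_idempotent G A f \<Longrightarrow> factors_through G A f f"
  unfolding factors_through_def by (intro bexI[of _ "\<one>\<^sub>G"] bexI[of _ f]) (auto dest: local_idempotentD)

lemma factors_through_trans:
  assumes "factors_through G A f h" "factors_through G A h i" "i \<in> carrier A"
  shows "factors_through G A f i"
proof -
  obtain g u v where 1: "g \<in> carrier G" "u \<in> component A g" "v \<in> component A (inv\<^bsub>G\<^esub> g)" "u \<bullet> h \<bullet> v = f"
    using assms(1) by (auto simp: factors_through_def)
  obtain g' u' v' where 2: "g' \<in> carrier G" "u' \<in> component A g'" "v' \<in> component A (inv\<^bsub>G\<^esub> g')" "u' \<bullet> i \<bullet> v' = h"
    using assms(2) by (auto simp: factors_through_def)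
  have c: "u \<in> carrier A" "v \<in> carrier A" "u' \<in> carrier A" "v' \<in> carrier A"
    using 1 2 AG.component_closed by (metis G.inv_closed)+
  have "u \<bullet> u' \<in> component A (g \<otimes>\<^sub>G g')" using 1 2 component_mult by simp
  moreover have "v' \<bullet> v \<in> component A (inv\<^bsub>G\<^esub> (g \<otimes>\<^sub>G g'))"
    using 1 2 component_mult[of "inv\<^bsub>G\<^esub> g'" "inv\<^bsub>G\<^esub> g"] by (simp add: G.inv_mult_group)
  moreover have "u \<bullet> u' \<bullet> i \<bullet> (v' \<bullet> v) = f" using 1(4) c assms(3) by (simp add: 2(4)[symmetric] A.m_assoc)
  ultimately show ?thesis using 1 2 unfolding factors_through_def by (metis G.m_closed)
qed

text \<open>A subset T of least cardinality through which all of E factors takes the place of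
  representatives of classes: if one member factored through another, transitivity would allow it to
  be dropped. Fullness comes out as an explicit equation. Each i in E is \<open>u h v\<close> with h
  in T, and h absorbs the sum e of T, so summing over E gives the unit.\<close>

lemma basic_idempotent:
  assumes fd: "fin_dim K A"
  obtains T and E :: "'a set" and u v :: "'a \<Rightarrow> 'a" where "orthogonal_idempotents G A T"
    "\<And>f h. \<lbrakk>f \<in> T; h \<in> T; f \<noteq> h\<rbrakk> \<Longrightarrow> \<not> factors_through G A f h"
    "finite E" "u \<in> E \<rightarrow> carrier A" "v \<in> E \<rightarrow> carrier A"
    "(\<Oplus>\<^sub>A i\<in>E. u i \<bullet> (\<Oplus>\<^sub>A f\<in>T. f) \<bullet> v i) = \<one>\<^sub>A"
proof -
  obtain E where E: "orthogonal_idempotents G A E" "(\<Oplus>\<^sub>A f\<in>E. f) = \<one>\<^sub>A"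
    using idempotent_decomposition[OF fd one_component] by auto
  note D = orthogonal_idempotentsD[OF E(1)]
  let ?P = "\<lambda>T. T \<subseteq> E \<and> (\<forall>f\<in>E. \<exists>h\<in>T. factors_through G A f h)"
  have "?P E" using factors_through_refl D(2) by blast
  from ex_has_least_nat[of ?P, OF this, of card]
  obtain T where T: "T \<subseteq> E" "\<And>f. f \<in> E \<Longrightarrow> \<exists>h\<in>T. factors_through G A f h"
    "\<And>T'. \<lbrakk>T' \<subseteq> E; \<And>f. f \<in> E \<Longrightarrow> \<exists>h\<in>T'. factors_through G A f h\<rbrakk> \<Longrightarrow> card T \<le> card T'" by auto
  have oT: "orthogonal_idempotents G A T"
    using E(1) T(1) finite_subset[OF T(1) D(1)] unfolding orthogonal_idempotents_def by blast
  have nf: "\<not> factors_through G A f h" if fh: "f \<in> T" "h \<in> T" "f \<noteq> h" for f h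
  proof
    assume a: "factors_through G A f h"
    have "card T \<le> card (T - {f})"
    proof (rule T(3))
      show "\<exists>h\<in>T - {f}. factors_through G A i h" if i: "i \<in> E" for i
      proof -
        obtain j where "j \<in> T" "factors_through G A i j" using T(2)[OF i] by blast
        then show ?thesis using fh a factors_through_trans[of i f h] D(4) T(1) by (cases "j = f") auto
      qed
    qed (use T(1) in auto)
    moreover have "finite T" using T(1) D(1) finite_subset by blast
    ultimately show False using fh(1) by (metis card_Diff1_less leD)
  qed
  have "\<exists>h u v. h \<in> T \<and> u \<in> carrier A \<and> v \<in> carrier A \<and> u \<bullet> h \<bullet> v = f" if f: "f \<in> E" for f
    using T(2)[OF f] AG.component_closed unfolding factors_through_def by (metis G.inv_closed)
  then obtain h u v where huv: "\<And>f. f \<in> E \<Longrightarrow> h f \<in> T" "\<And>f. f \<in> E \<Longrightarrow> u f \<in> carrier A"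
    "\<And>f. f \<in> E \<Longrightarrow> v f \<in> carrier A" "\<And>f. f \<in> E \<Longrightarrow> u f \<bullet> h f \<bullet> v f = f" by metis
  let ?e = "\<Oplus>\<^sub>A f\<in>T. f"
  have Tc: "f \<in> carrier A" if "f \<in> T" for f using that T(1) D(4) by auto
  have ec: "?e \<in> carrier A" using Tc by (intro A.finsum_closed) auto
  have "(\<Oplus>\<^sub>A i\<in>E. (u i \<bullet> h i) \<bullet> ?e \<bullet> v i) = (\<Oplus>\<^sub>A i\<in>E. i)"
    using huv Tc ec D(4) orthogonal_sum(1)[OF oT] by (intro A.finsum_cong') (auto simp: A.m_assoc)
  then have "(\<Oplus>\<^sub>A i\<in>E. (u i \<bullet> h i) \<bullet> ?e \<bullet> v i) = \<one>\<^sub>A" using E(2) by simp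
  then show ?thesis using huv Tc by (intro that[OF oT nf D(1), of "\<lambda>i. u i \<bullet> h i" v]) auto
qed

end

section \<open>The graded radical\<close>

context graded_algebra
begin

text \<open>Zorn's lemma. For y = 1 in the regular module the result is a gr-maximal left ideal; for
  other modules and elements, maximality among the graded submodules that miss y is exactly what the
  study of projectives needs.\<close>

lemma gr_submodule_maximal_avoiding:
  assumes M: "M \<in> Gr G A" and N0: "gr_submodule G A N0 M" and y: "y \<notin> N0"
  obtains N where "gr_submodule G A N M" "N0 \<subseteq> N" "y \<notin> N"
    "\<And>L. \<lbrakk>gr_submodule G A L M; N \<subset> L\<rbrakk> \<Longrightarrow> y \<in> L"
proof -
  let ?A = "{N. gr_submodule G A N M \<and> N0 \<subseteq> N \<and> y \<notin> N}"
  have "\<exists>N\<in>?A. \<forall>X\<in>?A. N \<subseteq> X \<longrightarrow> X = N"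
  proof (rule subset_Zorn_nonempty)
    show "?A \<noteq> {}" using N0 y by blast
    show "\<Union>C \<in> ?A" if C: "C \<noteq> {}" "subset.chain ?A C" for C
    proof -
      have C': "\<And>N. N \<in> C \<Longrightarrow> N \<in> ?A" "\<And>N L. \<lbrakk>N \<in> C; L \<in> C\<rbrakk> \<Longrightarrow> N \<subseteq> L \<or> L \<subseteq> N"
        using C(2) by (auto simp: subset.chain_def)
      have "gr_submodule G A (\<Union>C) M" using gr_submodule_chain[OF M _ C(1) C'(2)] C'(1) by blast
      then show ?thesis using C(1) C'(1) by blast
    qed
  qed
  then obtain N where N: "N \<in> ?A" and max: "\<forall>X\<in>?A. N \<subseteq> X \<longrightarrow> X = N" by blast
  show ?thesis
  proof (rule that)
    show "y \<in> L" if L: "gr_submodule G A L M" "N \<subset> L" for L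
    proof (rule ccontr)
      assume "y \<notin> L"
      then have "L \<in> ?A" using L N by auto
      then show False using max L(2) by auto
    qed
  qed (use N in auto)
qed

lemma coset_regular [simp]: "N +>\<^bsub>regular A\<^esub> x = N +>\<^sub>A x"
  by (simp add: a_r_coset_def r_coset_def)

text \<open>Image and preimage under the projection match the graded submodules of the quotient with
  those containing N. This trades a condition on cosets for one inside M.\<close>

lemma gr_maximal_iff:
  assumes M: "M \<in> Gr G A"
  shows "gr_maximal G A N M \<longleftrightarrow> gr_submodule G A N M \<and> N \<noteq> carrier M \<and>
    (\<forall>L. gr_submodule G A L M \<longrightarrow> N \<subseteq> L \<longrightarrow> L = N \<or> L = carrier M)"
proof (cases "gr_submodule G A N M")
  case N: True
  note Nd = gr_submoduleD[OF M N] and Q = quotient_Gr[OF M N]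
  interpret M: graded_group G M by (rule Gr_graded_group[OF M])
  let ?Q = "quotient M N" and ?p = "\<lambda>x\<in>carrier M. N +>\<^sub>M x"
  note p = gr_homD[OF Q(2)]
  have q: "carrier ?Q = {\<zero>\<^bsub>?Q\<^esub>} \<longleftrightarrow> N = carrier M"
  proof
    assume "carrier ?Q = {\<zero>\<^bsub>?Q\<^esub>}"
    then have "x \<in> N" if "x \<in> carrier M" for x using that Q(6)[OF that] unfolding Q(3) by (metis imageI singletonD)
    then show "N = carrier M" using Nd(4) by blast
  next
    assume "N = carrier M"
    then have "y = \<zero>\<^bsub>?Q\<^esub>" if "y \<in> carrier ?Q" for y using that Q(6) unfolding Q(3) by (elim imageE) simp
    moreover have "\<zero>\<^bsub>?Q\<^esub> \<in> carrier ?Q" unfolding Q(3,5) by simp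
    ultimately show "carrier ?Q = {\<zero>\<^bsub>?Q\<^esub>}" by blast
  qed
  have "(\<forall>L. gr_submodule G A L ?Q \<longrightarrow> L = {\<zero>\<^bsub>?Q\<^esub>} \<or> L = carrier ?Q) \<longleftrightarrow>
    (\<forall>L. gr_submodule G A L M \<longrightarrow> N \<subseteq> L \<longrightarrow> L = N \<or> L = carrier M)" (is "?l \<longleftrightarrow> ?r")
  proof
    assume l: ?l
    show ?r
    proof (intro allI impI)
      fix L assume L: "gr_submodule G A L M" "N \<subseteq> L"
      note Ld = gr_submoduleD[OF M L(1)]
      have Lc: "x \<in> carrier M" if "x \<in> L" for x using that Ld(4) by auto
      from l[rule_format, OF gr_submodule_image[OF M Q(1,2) L(1)]]
      consider "?p ` L = {\<zero>\<^bsub>?Q\<^esub>}" | "?p ` L = carrier ?Q" by (rule disjE)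
      then show "L = N \<or> L = carrier M"
      proof cases
        case 1
        have "x \<in> N" if "x \<in> L" for x
        proof -
          have "?p x = \<zero>\<^bsub>?Q\<^esub>" using 1 that by blast
          then show ?thesis using Lc[OF that] Q(6) by simp
        qed
        then show ?thesis using L(2) by blast
      next
        case 2
        have "x \<in> L" if x: "x \<in> carrier M" for x
        proof -
          have "?p x \<in> ?p ` L" using 2 p(1)[OF x] by simp
          then obtain l where l: "l \<in> L" "?p x = ?p l" by blast
          then have "x \<ominus>\<^sub>M l \<in> N" using Q(4)[OF x Lc[OF l(1)]] x Lc[OF l(1)] by simp
          then have "(x \<ominus>\<^sub>M l) \<oplus>\<^sub>M l \<in> L" using L(2) l(1) Ld(6) by blast
          then show ?thesis using x Lc[OF l(1)] by (simp add: M.minus_eq M.a_assoc M.l_neg)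
        qed
        then show ?thesis using Ld(4) by blast
      qed
    qed
  next
    assume r: ?r
    show ?l
    proof (intro allI impI)
      fix L assume L: "gr_submodule G A L ?Q"
      note Ld = gr_submoduleD[OF Q(1) L]
      let ?P = "{x \<in> carrier M. ?p x \<in> L}"
      have NP: "N \<subseteq> ?P"
      proof
        fix x assume "x \<in> N"
        then have x: "x \<in> carrier M" "N +>\<^sub>M x = \<zero>\<^bsub>?Q\<^esub>" using Nd(4) Q(6)[of x] by auto
        then show "x \<in> ?P" using Ld(5) by simp
      qed
      from r[rule_format, OF gr_submodule_preimage[OF M Q(1,2) L] NP]
      consider "?P = N" | "?P = carrier M" by (rule disjE)
      then show "L = {\<zero>\<^bsub>?Q\<^esub>} \<or> L = carrier ?Q"
      proof cases
        case 1
        have "y = \<zero>\<^bsub>?Q\<^esub>" if y: "y \<in> L" for y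
        proof -
          obtain x where x: "x \<in> carrier M" "y = N +>\<^sub>M x" using y Ld(4) Q(3) by blast
          then have "x \<in> ?P" using y by simp
          then have "x \<in> N" unfolding 1 .
          then show ?thesis using x Q(6) by simp
        qed
        then show ?thesis using Ld(5) by blast
      next
        case 2
        have "carrier ?Q \<subseteq> L"
        proof
          fix y assume "y \<in> carrier ?Q"
          then obtain x where x: "x \<in> carrier M" "y = N +>\<^sub>M x" unfolding Q(3) by blast
          then have "x \<in> ?P" unfolding 2 by simp
          then show "y \<in> L" using x by simp
        qed
        then show ?thesis using Ld(4) by blast
      qed
    qed
  qed
  then show ?thesis using N q by (simp add: gr_maximal_def)
qed (simp add: gr_maximal_def)

abbreviation J :: "'a set" where "J \<equiv> gr_radical G A"

lemma radical_gr_submodule: "gr_submodule G A J (regular A)"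
  using gr_submodule_Inter[OF regular_Gr, of "{N. gr_maximal G A N (regular A)}"]
  by (simp add: gr_radical_def gr_maximal_def)

lemmas radicalD = gr_submoduleD[OF regular_Gr radical_gr_submodule]

lemma radical_subgroup: "additive_subgroup J A"
  using radicalD(1) finsum_record_cong(4)[of "regular A" A] by simp

text \<open>The elementwise description of the Jacobson radical, in graded form. The coefficient y
  has the degree inverse to that of x, so that \<open>1 - yx\<close> is homogeneous and generates a
  graded left ideal. If that ideal were proper, a gr-maximal left ideal containing it and x would
  contain 1. Conversely, if x lies outside a gr-maximal N, then N + Ax is everything and 1 = n +
  ax.\<close>

lemma radical_homogeneous:
  assumes g: "g \<in> carrier G" and x: "x \<in> component A g"
  shows "x \<in> J \<longleftrightarrow> (\<forall>y\<in>component A (inv\<^bsub>G\<^esub> g). \<exists>c\<in>carrier A. c \<bullet> (\<one>\<^sub>A \<ominus>\<^sub>A y \<bullet> x) = \<one>\<^sub>A)"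
proof (intro iffI ballI)
  note R = regular_Gr
  have xc: "x \<in> carrier A" using AG.component_closed[OF g x] .
  fix y assume xJ: "x \<in> J" and y: "y \<in> component A (inv\<^bsub>G\<^esub> g)"
  have yc: "y \<in> carrier A" using AG.component_closed y g by blast
  let ?d = "\<one>\<^sub>A \<ominus>\<^sub>A y \<bullet> x"
  have yx: "y \<bullet> x \<in> A1" using component_mult[OF _ g y x] g by simp
  have d: "?d \<in> A1" using A1_minus one_component yx by simp
  have dc: "?d \<in> carrier A" using d A1_closed by simp
  let ?I = "(\<lambda>a. a \<bullet> ?d) ` carrier A"
  have I: "gr_submodule G A ?I (regular A)" using gr_submodule_cyclic[OF R, of "\<one>\<^sub>G" ?d] d by simp
  have "\<one>\<^sub>A \<in> ?I"
  proof (rule ccontr)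
    assume n: "\<one>\<^sub>A \<notin> ?I"
    obtain N where N: "gr_submodule G A N (regular A)" "?I \<subseteq> N" "\<one>\<^sub>A \<notin> N"
      "\<And>L. \<lbrakk>gr_submodule G A L (regular A); N \<subset> L\<rbrakk> \<Longrightarrow> \<one>\<^sub>A \<in> L"
      using gr_submodule_maximal_avoiding[OF R I n] by blast
    note Nd = gr_submoduleD[OF R N(1), simplified]
    have "L = N \<or> L = carrier A" if L: "gr_submodule G A L (regular A)" "N \<subseteq> L" for L
    proof (cases "L = N")
      case False
      then have "\<one>\<^sub>A \<in> L" using N(4)[OF L(1)] L(2) by blast
      then have "a \<in> L" if "a \<in> carrier A" for a using gr_submoduleD(2)[OF R L(1), of a "\<one>\<^sub>A"] that by simp
      then show ?thesis using gr_submoduleD(4)[OF R L(1)] by auto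
    qed simp
    then have "gr_maximal G A N (regular A)" unfolding gr_maximal_iff[OF R] using N(1,3) by auto
    then have "x \<in> N" using xJ by (auto simp: gr_radical_def)
    then have "y \<bullet> x \<in> N" using Nd(2) yc by blast
    moreover have "?d \<in> N" using N(2) dc by (metis A.l_one A.one_closed image_eqI subsetD)
    ultimately have "?d \<oplus>\<^sub>A y \<bullet> x \<in> N" using Nd(6) by blast
    then show False using N(3) xc yc by (simp add: A.minus_eq A.a_assoc A.l_neg)
  qed
  then show "\<exists>c\<in>carrier A. c \<bullet> ?d = \<one>\<^sub>A" by (elim imageE) (intro bexI, rule sym)
next
  note R = regular_Gr
  have xc: "x \<in> carrier A" using AG.component_closed[OF g x] .
  assume inv: "\<forall>y\<in>component A (inv\<^bsub>G\<^esub> g). \<exists>c\<in>carrier A. c \<bullet> (\<one>\<^sub>A \<ominus>\<^sub>A y \<bullet> x) = \<one>\<^sub>A"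
  show "x \<in> J"
  proof (rule ccontr)
    assume "x \<notin> J"
    then obtain N where N: "gr_maximal G A N (regular A)" "x \<notin> N" using xc by (auto simp: gr_radical_def)
    then have N': "gr_submodule G A N (regular A)" "N \<noteq> carrier A"
      "\<And>L. \<lbrakk>gr_submodule G A L (regular A); N \<subseteq> L\<rbrakk> \<Longrightarrow> L = N \<or> L = carrier A" using gr_maximal_iff[OF R] by auto
    note Nd = gr_submoduleD[OF R N'(1), simplified]
    let ?X = "(\<lambda>a. a \<bullet> x) ` carrier A"
    let ?L = "{n \<oplus>\<^sub>A y |n y. n \<in> N \<and> y \<in> ?X}"
    have X: "gr_submodule G A ?X (regular A)" using gr_submodule_cyclic[OF R g] x by simp
    have L: "gr_submodule G A ?L (regular A)" using gr_submodule_sum[OF R N'(1) X] by simp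
    have Nc: "n \<in> carrier A" if "n \<in> N" for n using that Nd(4) by auto
    have "n \<in> ?L" if "n \<in> N" for n
    proof -
      have "n = n \<oplus>\<^sub>A \<zero>\<^sub>A \<bullet> x" using Nc[OF that] xc by simp
      then show ?thesis using that by blast
    qed
    moreover have "x \<in> ?L"
    proof -
      have "x = \<zero>\<^sub>A \<oplus>\<^sub>A \<one>\<^sub>A \<bullet> x" using xc by simp
      then show ?thesis using Nd(5) by blast
    qed
    ultimately have "?L = carrier A" using N'(3)[OF L] N(2) by blast
    then have "\<one>\<^sub>A \<in> ?L" by simp
    then obtain n a where na: "n \<in> N" "a \<in> carrier A" "\<one>\<^sub>A = n \<oplus>\<^sub>A a \<bullet> x" by blast
    \<comment> \<open>In identity degree the equation 1 = n + ax involves only this component of a,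
      which has just the degree allowed for the coefficient.\<close>
    define y where "y = gpr G A a (inv\<^bsub>G\<^esub> g)"
    have y: "y \<in> component A (inv\<^bsub>G\<^esub> g)" using AG.gpr_component na g by (simp add: y_def)
    have yc: "y \<in> carrier A" using AG.component_closed[OF _ y] g by simp
    have "gpr G A (a \<bullet> x) \<one>\<^sub>G = y \<bullet> x"
      using gpr_smult_right[OF R g _ na(2), of x "inv\<^bsub>G\<^esub> g"] x g by (simp add: y_def)
    moreover have "gpr G A \<one>\<^sub>A \<one>\<^sub>G = \<one>\<^sub>A" using AG.gpr_homogeneous[of "\<one>\<^sub>G" "\<one>\<^sub>A"] one_component by simp
    ultimately have "\<one>\<^sub>A = gpr G A n \<one>\<^sub>G \<oplus>\<^sub>A y \<bullet> x" using na xc Nc AG.gpr_add[of n "a \<bullet> x" "\<one>\<^sub>G"] by simp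
    moreover have "gpr G A n \<one>\<^sub>G \<in> N" using Nd(3) na by simp
    ultimately have "\<one>\<^sub>A \<ominus>\<^sub>A y \<bullet> x \<in> N" using Nc xc yc by (simp add: A.minus_eq A.a_assoc A.r_neg)
    moreover obtain c where "c \<in> carrier A" "c \<bullet> (\<one>\<^sub>A \<ominus>\<^sub>A y \<bullet> x) = \<one>\<^sub>A" using inv y by blast
    ultimately have "\<one>\<^sub>A \<in> N" using Nd(2) by metis
    then have "carrier A \<subseteq> N" using Nd(2)[of _ "\<one>\<^sub>A"] by auto
    then show False using N'(2) Nd(4) by blast
  qed
qed

text \<open>The formal geometric series suggests the inverse: if c inverts \<open>1 - bp\<close>,
  then \<open>1 + pcb\<close> inverts \<open>1 - pb\<close>.\<close>

lemma left_inverse_swap: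
  assumes p: "p \<in> carrier A" and b: "b \<in> carrier A" and c: "c \<in> carrier A" "c \<bullet> (\<one>\<^sub>A \<ominus>\<^sub>A b \<bullet> p) = \<one>\<^sub>A"
  shows "\<exists>d\<in>carrier A. d \<bullet> (\<one>\<^sub>A \<ominus>\<^sub>A p \<bullet> b) = \<one>\<^sub>A"
proof (intro bexI)
  let ?d = "\<one>\<^sub>A \<oplus>\<^sub>A p \<bullet> c \<bullet> b"
  show "?d \<in> carrier A" using p b c by simp
  have 1: "c \<bullet> (\<one>\<^sub>A \<ominus>\<^sub>A b \<bullet> p) \<bullet> b = b" using c b by simp
  have "p \<bullet> c \<bullet> b \<bullet> (\<one>\<^sub>A \<ominus>\<^sub>A p \<bullet> b) = p \<bullet> (c \<bullet> (\<one>\<^sub>A \<ominus>\<^sub>A b \<bullet> p) \<bullet> b)"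
    using p b c(1) by (simp add: A.minus_eq A.l_distr A.r_distr A.m_assoc A.l_minus A.r_minus)
  then have "p \<bullet> c \<bullet> b \<bullet> (\<one>\<^sub>A \<ominus>\<^sub>A p \<bullet> b) = p \<bullet> b" using 1 by simp
  then have "?d \<bullet> (\<one>\<^sub>A \<ominus>\<^sub>A p \<bullet> b) = (\<one>\<^sub>A \<ominus>\<^sub>A p \<bullet> b) \<oplus>\<^sub>A p \<bullet> b" using p b c(1) by (simp add: A.l_distr)
  then show "?d \<bullet> (\<one>\<^sub>A \<ominus>\<^sub>A p \<bullet> b) = \<one>\<^sub>A" using p b by (simp add: A.minus_eq A.a_assoc A.l_neg)
qed

text \<open>The radical is defined by left ideals; the swap of factors makes it two-sided. For
  homogeneous x and b, left invertibility of \<open>1 - yxb\<close> follows from that of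
  \<open>1 - (by)x\<close>, and by has the degree required for x. Sums of components then give the
  general case.\<close>

lemma radical_right: "\<lbrakk>x \<in> J; b \<in> carrier A\<rbrakk> \<Longrightarrow> x \<bullet> b \<in> J"
proof -
  assume xJ: "x \<in> J" and b: "b \<in> carrier A"
  have hom: "x \<bullet> b \<in> J" if g: "g \<in> carrier G" and h: "h \<in> carrier G" and x: "x \<in> component A g" and b: "b \<in> component A h"
    and xJ: "x \<in> J" for g h x b
  proof -
    have c: "x \<in> carrier A" "b \<in> carrier A" using AG.component_closed g h x b by auto
    have "\<exists>d\<in>carrier A. d \<bullet> (\<one>\<^sub>A \<ominus>\<^sub>A y \<bullet> (x \<bullet> b)) = \<one>\<^sub>A"
      if y: "y \<in> component A (inv\<^bsub>G\<^esub> (g \<otimes>\<^sub>G h))" for y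
    proof -
      have yc: "y \<in> carrier A" using AG.component_closed[OF _ y] g h by simp
      have "h \<otimes>\<^sub>G inv\<^bsub>G\<^esub> (g \<otimes>\<^sub>G h) = inv\<^bsub>G\<^esub> g" using g h by (simp add: G.inv_mult_group G.m_assoc[symmetric])
      then have "b \<bullet> y \<in> component A (inv\<^bsub>G\<^esub> g)" using component_mult[OF h _ b y] g h by simp
      then obtain d where "d \<in> carrier A" "d \<bullet> (\<one>\<^sub>A \<ominus>\<^sub>A b \<bullet> y \<bullet> x) = \<one>\<^sub>A"
        using xJ radical_homogeneous[OF g x] by blast
      then show ?thesis using left_inverse_swap[of "y \<bullet> x" b d] c yc by (simp add: A.m_assoc)
    qed
    then show ?thesis using radical_homogeneous[of "g \<otimes>\<^sub>G h" "x \<bullet> b"] component_mult[OF g h x b] g h by simp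
  qed
  have xc: "x \<in> carrier A" using xJ radicalD(4) by auto
  have "x \<bullet> gpr G A b h \<in> J" if h: "h \<in> carrier G" for h
  proof -
    have "x \<bullet> gpr G A b h = (\<Oplus>\<^sub>A g\<in>carrier G. gpr G A x g) \<bullet> gpr G A b h" using AG.gpr_props(2)[OF xc] by simp
    also have "\<dots> = (\<Oplus>\<^sub>A g\<in>carrier G. gpr G A x g \<bullet> gpr G A b h)"
      using xc b h by (intro A.finsum_ldistr) (auto simp: finite_group)
    finally show ?thesis using hom h b xc xJ radicalD(3) AG.gpr_component
      by (simp add: A.additive_subgroup_finsum[OF radical_subgroup])
  qed
  moreover have "x \<bullet> b = (\<Oplus>\<^sub>A h\<in>carrier G. x \<bullet> gpr G A b h)"
  proof -
    have "x \<bullet> b = x \<bullet> (\<Oplus>\<^sub>A h\<in>carrier G. gpr G A b h)" using AG.gpr_props(2)[OF b] by simp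
    also have "\<dots> = (\<Oplus>\<^sub>A h\<in>carrier G. x \<bullet> gpr G A b h)"
      using xc b by (intro A.finsum_rdistr) (auto simp: finite_group)
    finally show ?thesis .
  qed
  ultimately show "x \<bullet> b \<in> J" by (simp add: A.additive_subgroup_finsum[OF radical_subgroup])
qed

lemma radical_ideal: "ideal J A"
  using radical_subgroup radicalD(2) radical_right
  by (intro idealI A.ring_axioms) (auto simp: additive_subgroup_def)

text \<open>Taking y = e makes \<open>1 - e\<close> left invertible, while
  \<open>(1 - e) \<bullet> e = \<zero>\<close>.\<close>

lemma idempotent_not_radical: "\<lbrakk>e \<in> A1; e \<bullet> e = e; e \<in> J\<rbrakk> \<Longrightarrow> e = \<zero>\<^sub>A"
proof -
  assume e: "e \<in> A1" "e \<bullet> e = e" "e \<in> J"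
  have ec: "e \<in> carrier A" using e A1_closed by simp
  obtain c where c: "c \<in> carrier A" "c \<bullet> (\<one>\<^sub>A \<ominus>\<^sub>A e \<bullet> e) = \<one>\<^sub>A" using radical_homogeneous[of "\<one>\<^sub>G" e] e by auto
  have "e = c \<bullet> (\<one>\<^sub>A \<ominus>\<^sub>A e) \<bullet> e" using c e ec by simp
  also have "\<dots> = c \<bullet> (e \<ominus>\<^sub>A e \<bullet> e)" using c ec by (simp add: A.m_assoc A.minus_eq A.l_distr A.l_minus)
  also have "\<dots> = \<zero>\<^sub>A" using e(2) ec c by (simp add: A.minus_eq A.r_neg)
  finally show "e = \<zero>\<^sub>A" .
qed

text \<open>The partial sums of the geometric series telescope; the induction runs over their
  length, and nilpotence removes the remainder.\<close>

lemma nilpotent_left_inverse: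
  assumes w: "w \<in> carrier A" "w [^]\<^sub>A (n::nat) = \<zero>\<^sub>A"
  shows "\<exists>c\<in>carrier A. c \<bullet> (\<one>\<^sub>A \<ominus>\<^sub>A w) = \<one>\<^sub>A"
proof -
  have "\<exists>c\<in>carrier A. c \<bullet> (\<one>\<^sub>A \<ominus>\<^sub>A w) = \<one>\<^sub>A \<ominus>\<^sub>A w [^]\<^sub>A k" for k :: nat
  proof (induction k)
    case 0
    show ?case by (intro bexI[of _ "\<zero>\<^sub>A"]) (use w in \<open>simp_all add: A.minus_eq A.r_neg\<close>)
  next
    case (Suc k)
    then obtain c where c: "c \<in> carrier A" "c \<bullet> (\<one>\<^sub>A \<ominus>\<^sub>A w) = \<one>\<^sub>A \<ominus>\<^sub>A w [^]\<^sub>A k" by blast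
    let ?p = "w [^]\<^sub>A k"
    have p: "?p \<in> carrier A" using w by simp
    have "(c \<oplus>\<^sub>A ?p) \<bullet> (\<one>\<^sub>A \<ominus>\<^sub>A w) = (\<one>\<^sub>A \<ominus>\<^sub>A ?p) \<oplus>\<^sub>A (?p \<ominus>\<^sub>A ?p \<bullet> w)"
      using c w p by (simp add: A.l_distr) (simp add: A.minus_eq A.r_distr A.r_minus)
    also have "\<dots> = \<one>\<^sub>A \<ominus>\<^sub>A w [^]\<^sub>A Suc k" using w p by (simp add: A.minus_eq A.a_assoc A.r_neg1)
    finally show ?case using c p by blast
  qed
  from this[of n] show ?thesis using w by (simp add: A.minus_eq)
qed

text \<open>The graded Schur lemma. As x is outside the radical, some \<open>1 - yx\<close> has no
  left inverse. Then w = hyx is not nilpotent: otherwise \<open>1 - hyx\<close> would be left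
  invertible and, after a swap, so would \<open>1 - yx\<close>. By locality of h, w is invertible in
  its corner, which gives u with ux = h. So h factors through f and f = h. With t = fuf, the product
  xt is a nonzero idempotent in the corner of f, hence equal to f.\<close>

lemma radical_or_unit:
  assumes E: "basic_set G A E" and f: "f \<in> E" and h: "h \<in> E" and g: "g \<in> carrier G"
    and x: "x \<in> component A g" "f \<bullet> x = x" "x \<bullet> h = x" "x \<notin> J"
  shows "f = h" "\<exists>t\<in>component A (inv\<^bsub>G\<^esub> g). f \<bullet> t = t \<and> t \<bullet> f = t \<and> t \<bullet> x = f \<and> x \<bullet> t = f"
proof -
  have oE: "orthogonal_idempotents G A E" using E by (simp add: basic_set_def)
  note D = orthogonal_idempotentsD[OF oE]
  note lf = local_idempotentD[OF D(2)[OF f]] and lh = local_idempotentD[OF D(2)[OF h]]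
  have ig: "inv\<^bsub>G\<^esub> g \<in> carrier G" using g by simp
  have xc: "x \<in> carrier A" using AG.component_closed[OF g x(1)] .
  obtain y where y: "y \<in> component A (inv\<^bsub>G\<^esub> g)" "\<not> (\<exists>c\<in>carrier A. c \<bullet> (\<one>\<^sub>A \<ominus>\<^sub>A y \<bullet> x) = \<one>\<^sub>A)"
    using x(4) radical_homogeneous[OF g x(1)] by blast
  have yc: "y \<in> carrier A" using AG.component_closed[OF ig y(1)] .
  define w where "w = h \<bullet> (y \<bullet> x)"
  have w: "w \<in> A1" using A1_mult[OF lh(1)] component_mult[OF ig g y(1) x(1)] g by (simp add: w_def)
  have wc: "w \<in> carrier A" using A1_closed[OF w] .
  have hw: "h \<bullet> w = w" "w \<bullet> h = w" using lh yc xc x by (simp_all add: w_def A.m_assoc)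
  have "\<not> (\<exists>n::nat. w [^]\<^sub>A n = \<zero>\<^sub>A)"
  proof
    assume "\<exists>n::nat. w [^]\<^sub>A n = \<zero>\<^sub>A"
    then obtain c where c: "c \<in> carrier A" "c \<bullet> (\<one>\<^sub>A \<ominus>\<^sub>A h \<bullet> (y \<bullet> x)) = \<one>\<^sub>A"
      using nilpotent_left_inverse[OF wc] by (auto simp: w_def)
    have "y \<bullet> x \<bullet> h = y \<bullet> x" using x yc xc lh by (simp add: A.m_assoc)
    then show False using left_inverse_swap[OF _ lh(2) c] y(2) yc xc by simp
  qed
  then obtain w' where w': "w' \<in> A1" "h \<bullet> w' = w'" "w' \<bullet> h = w'" "w' \<bullet> w = h"
    using D(2)[OF h] w hw unfolding local_idempotent_def by blast
  have w'c: "w' \<in> carrier A" using A1_closed[OF w'(1)] .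
  define u where "u = w' \<bullet> y"
  have u: "u \<in> component A (inv\<^bsub>G\<^esub> g)" "u \<in> carrier A"
    using A1_component_mult[OF ig w'(1) y(1)] w'c yc by (simp_all add: u_def)
  have ux: "u \<bullet> x = h"
  proof -
    have "u \<bullet> x = (w' \<bullet> h) \<bullet> (y \<bullet> x)" using w' w'c yc xc by (simp add: u_def A.m_assoc)
    also have "\<dots> = w' \<bullet> w" using w'c yc xc lh by (simp add: w_def A.m_assoc)
    finally show ?thesis using w' by simp
  qed
  have "u \<bullet> f \<bullet> x = h" using ux u xc x lf by (simp add: A.m_assoc)
  then have "factors_through G A h f" unfolding factors_through_def using u x(1) ig g by (metis G.inv_inv)
  moreover have "\<forall>e\<in>E. \<forall>f\<in>E. e \<noteq> f \<longrightarrow> \<not> factors_through G A e f" using E unfolding basic_set_def by (elim conjE)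
  ultimately show fh: "f = h" using f h by metis
  define t where "t = f \<bullet> (u \<bullet> f)"
  have t: "t \<in> component A (inv\<^bsub>G\<^esub> g)"
    using A1_component_mult[OF ig lf(1) component_A1_mult[OF ig u(1) lf(1)]] by (simp add: t_def)
  have tc: "t \<in> carrier A" using AG.component_closed[OF ig t] .
  have ft: "f \<bullet> t = t" "t \<bullet> f = t" using lf u by (simp_all add: t_def A.m_assoc)
  have tx: "t \<bullet> x = f" using ux u xc x lf fh by (simp add: t_def A.m_assoc)
  have "x \<bullet> t \<in> A1" using component_mult[OF g ig x(1) t] g by simp
  moreover have "x \<bullet> t \<bullet> (x \<bullet> t) = x \<bullet> t"
  proof -
    have "x \<bullet> t \<bullet> (x \<bullet> t) = x \<bullet> ((t \<bullet> x) \<bullet> t)" using xc tc by (simp add: A.m_assoc)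
    then show ?thesis using tx ft by simp
  qed
  moreover have "f \<bullet> (x \<bullet> t) = x \<bullet> t" using x xc tc lf by (simp add: A.m_assoc[symmetric])
  moreover have "x \<bullet> t \<bullet> f = x \<bullet> t" using ft xc tc lf by (simp add: A.m_assoc)
  ultimately have "x \<bullet> t = \<zero>\<^sub>A \<or> x \<bullet> t = f" using A1_idempotent_of_local[OF D(2)[OF f]] by blast
  moreover have "x \<bullet> t \<noteq> \<zero>\<^sub>A"
  proof
    assume z: "x \<bullet> t = \<zero>\<^sub>A"
    have "f = t \<bullet> x \<bullet> (t \<bullet> x)" using tx lf by simp
    also have "\<dots> = t \<bullet> ((x \<bullet> t) \<bullet> x)" using xc tc by (simp add: A.m_assoc)
    finally show False using z lf(4) tc xc by simp
  qed
  ultimately show "\<exists>t\<in>component A (inv\<^bsub>G\<^esub> g). f \<bullet> t = t \<and> t \<bullet> f = t \<and> t \<bullet> x = f \<and> x \<bullet> t = f" using t ft tx by blast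
qed

end

section \<open>Quotients and corners of graded algebras\<close>

definition corner :: "('k, 'a, 'g) graded \<Rightarrow> 'a \<Rightarrow> ('k, 'a, 'g) graded" where
  "corner A e = (sub A {x \<in> carrier A. e \<otimes>\<^sub>A x = x \<and> x \<otimes>\<^sub>A e = x})\<lparr>one := e\<rparr>"

lemma corner_simps [simp]:
  "carrier (corner A e) = {x \<in> carrier A. e \<otimes>\<^sub>A x = x \<and> x \<otimes>\<^sub>A e = x}"
  "add (corner A e) = add A" "zero (corner A e) = zero A" "mult (corner A e) = mult A"
  "one (corner A e) = e" "smult (corner A e) = smult A"
  "component (corner A e) g = component A g \<inter> {x \<in> carrier A. e \<otimes>\<^sub>A x = x \<and> x \<otimes>\<^sub>A e = x}"
  by (simp_all add: corner_def sub_def)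

context graded_algebra
begin

lemma graded_algebraI:
  fixes Q :: "('k, 'b, 'g) graded"
  assumes "abelian_group Q" "graded_by G Q"
    "\<And>x y. \<lbrakk>x \<in> carrier Q; y \<in> carrier Q\<rbrakk> \<Longrightarrow> x \<otimes>\<^sub>Q y \<in> carrier Q" "\<one>\<^sub>Q \<in> carrier Q"
    "\<And>x y z. \<lbrakk>x \<in> carrier Q; y \<in> carrier Q; z \<in> carrier Q\<rbrakk> \<Longrightarrow> x \<otimes>\<^sub>Q y \<otimes>\<^sub>Q z = x \<otimes>\<^sub>Q (y \<otimes>\<^sub>Q z)"
    "\<And>x. x \<in> carrier Q \<Longrightarrow> \<one>\<^sub>Q \<otimes>\<^sub>Q x = x" "\<And>x. x \<in> carrier Q \<Longrightarrow> x \<otimes>\<^sub>Q \<one>\<^sub>Q = x"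
    "\<And>x y z. \<lbrakk>x \<in> carrier Q; y \<in> carrier Q; z \<in> carrier Q\<rbrakk> \<Longrightarrow> (x \<oplus>\<^sub>Q y) \<otimes>\<^sub>Q z = x \<otimes>\<^sub>Q z \<oplus>\<^sub>Q y \<otimes>\<^sub>Q z"
    "\<And>x y z. \<lbrakk>x \<in> carrier Q; y \<in> carrier Q; z \<in> carrier Q\<rbrakk> \<Longrightarrow> z \<otimes>\<^sub>Q (x \<oplus>\<^sub>Q y) = z \<otimes>\<^sub>Q x \<oplus>\<^sub>Q z \<otimes>\<^sub>Q y"
    "\<And>c x. \<lbrakk>c \<in> carrier K; x \<in> carrier Q\<rbrakk> \<Longrightarrow> c \<odot>\<^sub>Q x \<in> carrier Q"
    "\<And>a b x. \<lbrakk>a \<in> carrier K; b \<in> carrier K; x \<in> carrier Q\<rbrakk> \<Longrightarrow> (a \<oplus>\<^sub>K b) \<odot>\<^sub>Q x = a \<odot>\<^sub>Q x \<oplus>\<^sub>Q b \<odot>\<^sub>Q x"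
    "\<And>a x y. \<lbrakk>a \<in> carrier K; x \<in> carrier Q; y \<in> carrier Q\<rbrakk> \<Longrightarrow> a \<odot>\<^sub>Q (x \<oplus>\<^sub>Q y) = a \<odot>\<^sub>Q x \<oplus>\<^sub>Q a \<odot>\<^sub>Q y"
    "\<And>a b x. \<lbrakk>a \<in> carrier K; b \<in> carrier K; x \<in> carrier Q\<rbrakk> \<Longrightarrow> (a \<otimes>\<^sub>K b) \<odot>\<^sub>Q x = a \<odot>\<^sub>Q (b \<odot>\<^sub>Q x)"
    "\<And>x. x \<in> carrier Q \<Longrightarrow> \<one>\<^sub>K \<odot>\<^sub>Q x = x"
    "\<And>c x y. \<lbrakk>c \<in> carrier K; x \<in> carrier Q; y \<in> carrier Q\<rbrakk> \<Longrightarrow> (c \<odot>\<^sub>Q x) \<otimes>\<^sub>Q y = c \<odot>\<^sub>Q (x \<otimes>\<^sub>Q y)"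
    "\<And>c x y. \<lbrakk>c \<in> carrier K; x \<in> carrier Q; y \<in> carrier Q\<rbrakk> \<Longrightarrow> x \<otimes>\<^sub>Q (c \<odot>\<^sub>Q y) = c \<odot>\<^sub>Q (x \<otimes>\<^sub>Q y)"
    "\<And>c g x. \<lbrakk>c \<in> carrier K; g \<in> carrier G; x \<in> component Q g\<rbrakk> \<Longrightarrow> c \<odot>\<^sub>Q x \<in> component Q g"
    "\<And>g h x y. \<lbrakk>g \<in> carrier G; h \<in> carrier G; x \<in> component Q g; y \<in> component Q h\<rbrakk> \<Longrightarrow>
      x \<otimes>\<^sub>Q y \<in> component Q (g \<otimes>\<^sub>G h)"
  shows "graded_algebra K G Q"
proof (intro graded_algebra.intro graded_algebra_axioms.intro)
  show "ring Q" using assms(1-9) by (intro ringI monoidI) auto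
  show "module K Q" using assms(10-14) domain.axioms(1)[OF field.axioms(1)[OF K.field_axioms]] assms(1)
    by (intro module.intro module_axioms.intro) auto
qed (use assms in \<open>simp_all add: finite_group K.field_axioms G.is_group\<close>)

lemma graded_algebra_image:
  fixes Q :: "('k, 'b, 'g) graded"
  assumes c: "carrier Q = \<pi> ` carrier A" and z: "\<zero>\<^sub>Q = \<pi> \<zero>\<^sub>A" and o: "\<one>\<^sub>Q = \<pi> \<one>\<^sub>A"
    and a: "\<And>x y. \<lbrakk>x \<in> carrier A; y \<in> carrier A\<rbrakk> \<Longrightarrow> \<pi> x \<oplus>\<^sub>Q \<pi> y = \<pi> (x \<oplus>\<^sub>A y)"
    and m: "\<And>x y. \<lbrakk>x \<in> carrier A; y \<in> carrier A\<rbrakk> \<Longrightarrow> \<pi> x \<otimes>\<^sub>Q \<pi> y = \<pi> (x \<bullet> y)"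
    and s: "\<And>b x. \<lbrakk>b \<in> carrier K; x \<in> carrier A\<rbrakk> \<Longrightarrow> b \<odot>\<^sub>Q \<pi> x = \<pi> (b \<odot>\<^sub>A x)"
    and comp: "\<And>g. g \<in> carrier G \<Longrightarrow> component Q g = \<pi> ` component A g"
    and ker: "\<And>x g. \<lbrakk>x \<in> carrier A; \<pi> x = \<zero>\<^sub>Q; g \<in> carrier G\<rbrakk> \<Longrightarrow> \<pi> (gpr G A x g) = \<zero>\<^sub>Q"
  shows "graded_algebra K G Q"
proof (rule graded_algebraI)
  show ab: "abelian_group Q" using abelian_group_image[OF A.abelian_group_axioms c z a] .
  show "graded_by G Q" using graded_by_image[OF AG.graded_group_axioms ab c a comp ker] .
  show "x \<otimes>\<^sub>Q y \<in> component Q (g \<otimes>\<^sub>G h)"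
    if "g \<in> carrier G" "h \<in> carrier G" "x \<in> component Q g" "y \<in> component Q h" for g h x y
    using that component_mult[OF that(1,2)] AG.component_closed[OF that(1)] AG.component_closed[OF that(2)]
    by (auto simp: comp m)
  show "b \<odot>\<^sub>Q x \<in> component Q g" if "b \<in> carrier K" "g \<in> carrier G" "x \<in> component Q g" for b g x
    using that component_smult[OF that(1,2)] AG.component_closed[OF that(2)] by (auto simp: comp s)
  show "\<one>\<^sub>K \<odot>\<^sub>Q x = x" if "x \<in> carrier Q" for x using that by (auto simp: c s)
qed (auto simp: c z o a m s A.m_assoc A.l_distr A.r_distr smult_l_distr smult_r_distr smult_assoc1
    smult_mult_left smult_mult_right)

lemma finsum_sub:
  assumes M: "abelian_group M" and N: "additive_subgroup N M" and f: "f \<in> I \<rightarrow> N"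
  shows "finsum (sub M N) f I = finsum M f I"
  using additive_finsum[OF additive_subgroup_abelian_group[OF M N] M, of "\<lambda>x. x" f I] additive_subgroupD(1)[OF N] f
  by (auto simp: additive_def)

section \<open>Corner algebras eAe\<close>

context
  fixes e assumes e: "e \<in> A1" "e \<bullet> e = e"
begin

lemma corner_subgroup: "additive_subgroup {x \<in> carrier A. e \<bullet> x = x \<and> x \<bullet> e = x} A"
  using A1_closed[OF e(1)]
  by (intro A.additive_subgroup_closedI) (auto simp: A.r_distr A.l_distr A.r_minus A.l_minus)

lemma corner_record:
  "abelian_group (corner A e)" "finsum (corner A e) = finsum (sub A {x \<in> carrier A. e \<bullet> x = x \<and> x \<bullet> e = x})"
proof -
  let ?S = "sub A {x \<in> carrier A. e \<bullet> x = x \<and> x \<bullet> e = x}"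
  show "abelian_group (corner A e)" using finsum_record_cong(3)[of "corner A e" ?S]
      additive_subgroup_abelian_group[OF A.abelian_group_axioms corner_subgroup] by simp
  show "finsum (corner A e) = finsum ?S" by (rule finsum_record_cong) simp_all
qed

lemma corner_graded_algebra: "graded_algebra K G (corner A e)"
proof (rule graded_algebraI)
  note ec = A1_closed[OF e(1)]
  let ?S = "sub A {x \<in> carrier A. e \<bullet> x = x \<and> x \<bullet> e = x}"
  show "abelian_group (corner A e)" by (rule corner_record)
  have "graded_by G ?S"
  proof (rule graded_by_sub[OF AG.graded_group_axioms corner_subgroup])
    fix x g assume x: "x \<in> {x \<in> carrier A. e \<bullet> x = x \<and> x \<bullet> e = x}" and g: "g \<in> carrier G"
    have "e \<bullet> gpr G A x g = gpr G A x g" using gpr_smult[OF regular_Gr _ e(1), of x g] x g by simp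
    moreover have "gpr G A x g \<bullet> e = gpr G A x g"
      using gpr_smult_right[OF regular_Gr, of "\<one>\<^sub>G" e x g] e x g by simp
    ultimately show "gpr G A x g \<in> {x \<in> carrier A. e \<bullet> x = x \<and> x \<bullet> e = x}" using x g by simp
  qed
  then show "graded_by G (corner A e)" using graded_by_cong[of "corner A e" ?S G] by simp
  have mult: "x \<bullet> y \<in> carrier (corner A e)" if "x \<in> carrier (corner A e)" "y \<in> carrier (corner A e)" for x y
  proof -
    have xy: "x \<in> carrier A" "y \<in> carrier A" using that by simp_all
    have "e \<bullet> (x \<bullet> y) = (e \<bullet> x) \<bullet> y" "(x \<bullet> y) \<bullet> e = x \<bullet> (y \<bullet> e)"
      using A.m_assoc[OF ec xy] A.m_assoc[OF xy ec] by simp_all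
    then show ?thesis using that by simp
  qed
  then show "x \<otimes>\<^bsub>corner A e\<^esub> y \<in> carrier (corner A e)"
    if "x \<in> carrier (corner A e)" "y \<in> carrier (corner A e)" for x y using that by simp
  show "x \<otimes>\<^bsub>corner A e\<^esub> y \<in> component (corner A e) (g \<otimes>\<^sub>G h)"
    if "g \<in> carrier G" "h \<in> carrier G" "x \<in> component (corner A e) g" "y \<in> component (corner A e) h" for g h x y
    using that mult[of x y] component_mult[OF that(1,2), of x y] by simp
  show "c \<odot>\<^bsub>corner A e\<^esub> x \<in> component (corner A e) g"
    if "c \<in> carrier K" "g \<in> carrier G" "x \<in> component (corner A e) g" for c g x
    using that ec component_smult[OF that(1,2), of x] by (simp add: smult_mult_left smult_mult_right)
qed (use A1_closed[OF e(1)] e in \<open>simp_all add: A.m_assoc A.l_distr A.r_distr smult_l_distr smult_r_distr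
    smult_assoc1 smult_mult_left smult_mult_right\<close>)

text \<open>The compressions \<open>ese\<close> of a spanning set span the corner, because x maps to
  exe and this map fixes the corner.\<close>

lemma corner_fin_dim:
  assumes fd: "fin_dim K A" shows "fin_dim K (corner A e)"
proof -
  note ec = A1_closed[OF e(1)]
  interpret C: graded_algebra K G "corner A e" by (rule corner_graded_algebra)
  obtain S where S: "finite S" "S \<subseteq> carrier A" "\<And>L. \<lbrakk>subspace K A L; S \<subseteq> L\<rbrakk> \<Longrightarrow> L = carrier A"
    using kmodule.fin_dimD[OF algebra_kmodule fd] by blast
  let ?p = "\<lambda>x. e \<bullet> x \<bullet> e"
  have p: "?p x \<in> carrier (corner A e)" if "x \<in> carrier A" for x
  proof -
    have "e \<bullet> (e \<bullet> x \<bullet> e) = e \<bullet> e \<bullet> x \<bullet> e" using ec that by (simp add: A.m_assoc)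
    moreover have "e \<bullet> x \<bullet> e \<bullet> e = e \<bullet> x \<bullet> (e \<bullet> e)" using ec that by (simp add: A.m_assoc)
    ultimately show ?thesis using ec that e by simp
  qed
  show ?thesis
  proof (rule kmodule.fin_dimI[OF C.algebra_kmodule])
    show "finite (?p ` S)" using S by simp
    show "?p ` S \<subseteq> carrier (corner A e)" using p S by blast
    fix L assume L: "subspace K (corner A e) L" "?p ` S \<subseteq> L"
    note Ld = kmodule.subspaceD[OF C.algebra_kmodule L(1)]
    have "subspace K A {x \<in> carrier A. ?p x \<in> L}"
      using Ld(3,4,6) ec by (intro scalar_subspace) (auto simp: A.l_distr A.r_distr smult_mult_left smult_mult_right)
    moreover have "S \<subseteq> {x \<in> carrier A. ?p x \<in> L}" using S(2) L(2) by auto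
    ultimately have "{x \<in> carrier A. ?p x \<in> L} = carrier A" using S(3) by blast
    then have "?p x \<in> L" if "x \<in> carrier A" for x using that by blast
    then have "x \<in> L" if "x \<in> carrier A" "e \<bullet> x = x" "x \<bullet> e = x" for x using that by force
    then show "carrier (corner A e) \<subseteq> L" by auto
  qed
qed

end

text \<open>The corner of f inside \<open>eAe\<close> is the same as inside A, since e is neutral on
  it; locality carries over unchanged. A factorization inside \<open>eAe\<close> is one inside A, so
  none appears between distinct members of T.\<close>

lemma corner_basic_set:
  assumes T: "orthogonal_idempotents G A T"
    and nf: "\<And>f h. \<lbrakk>f \<in> T; h \<in> T; f \<noteq> h\<rbrakk> \<Longrightarrow> \<not> factors_through G A f h"
    and e: "e = (\<Oplus>\<^sub>A f\<in>T. f)"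
  shows "e \<in> A1" "e \<bullet> e = e" "basic_set G (corner A e) T"
proof -
  note D = orthogonal_idempotentsD[OF T] and s = orthogonal_sum[OF T, folded e]
  show eA: "e \<in> A1" unfolding e using D(3) by (intro A.additive_subgroup_finsum[OF A1_subgroup])
  note ec = A1_closed[OF eA]
  have "e \<bullet> e = (\<Oplus>\<^sub>A f\<in>T. e \<bullet> f)" by (subst (2) e) (intro A.finsum_rdistr, use D ec in auto)
  also have "\<dots> = e" unfolding e using s[unfolded e] D(4) by (intro A.finsum_cong') auto
  finally show ee: "e \<bullet> e = e" .
  let ?C = "corner A e"
  have TC: "f \<in> carrier ?C" if "f \<in> T" for f using that s D by auto
  have "finsum ?C (\<lambda>f. f) T = finsum A (\<lambda>f. f) T" unfolding corner_record(2)[OF eA ee]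
    using TC by (intro finsum_sub[OF A.abelian_group_axioms corner_subgroup[OF eA ee]]) auto
  then have sum: "(\<Oplus>\<^bsub>?C\<^esub>f\<in>T. f) = \<one>\<^bsub>?C\<^esub>" using e by simp
  have "\<not> factors_through G ?C f h" if "f \<in> T" "h \<in> T" "f \<noteq> h" for f h
    using nf[OF that] unfolding factors_through_def by auto
  moreover have "local_idempotent G ?C f" if f: "f \<in> T" for f unfolding local_idempotent_def
  proof (intro conjI ballI impI)
    note lf = local_idempotentD[OF D(2)[OF f]]
    fix x assume x: "x \<in> component ?C \<one>\<^sub>G" "f \<otimes>\<^bsub>?C\<^esub> x = x \<and> x \<otimes>\<^bsub>?C\<^esub> f = x"
    then have x': "x \<in> A1" "f \<bullet> x = x" "x \<bullet> f = x" "x \<in> carrier A" "x \<bullet> e = x" "e \<bullet> x = x" by auto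
    \<comment> \<open>Only positive powers can be compared: the zeroth power is e in the corner and
      1 in A.\<close>
    have pow: "x [^]\<^bsub>?C\<^esub> Suc n = x [^]\<^sub>A Suc n" for n by (induction n) (use x' in auto)
    from D(2)[OF f] x' consider y where "y \<in> A1" "f \<bullet> y = y" "y \<bullet> f = y" "y \<bullet> x = f" "x \<bullet> y = f"
      | n where "x [^]\<^sub>A (n::nat) = \<zero>\<^sub>A" unfolding local_idempotent_def by blast
    then show "(\<exists>y\<in>component ?C \<one>\<^sub>G. f \<otimes>\<^bsub>?C\<^esub> y = y \<and> y \<otimes>\<^bsub>?C\<^esub> f = y \<and> y \<otimes>\<^bsub>?C\<^esub> x = f \<and> x \<otimes>\<^bsub>?C\<^esub> y = f) \<or>
        (\<exists>n::nat. x [^]\<^bsub>?C\<^esub> n = \<zero>\<^bsub>?C\<^esub>)"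
    proof cases
      case 1
      have yc: "y \<in> carrier A" using 1 A1_closed by simp
      have "e \<bullet> y = (e \<bullet> f) \<bullet> y" using 1 yc ec lf by (simp add: A.m_assoc)
      moreover have "y \<bullet> e = y \<bullet> (f \<bullet> e)" using 1 yc ec lf by (simp add: A.m_assoc[symmetric])
      ultimately have "e \<bullet> y = y" "y \<bullet> e = y" using s[OF f] 1 by auto
      then show ?thesis using 1 yc by (intro disjI1 bexI[of _ y]) auto
    next
      case 2
      then have "x [^]\<^bsub>?C\<^esub> Suc n = \<zero>\<^bsub>?C\<^esub>" unfolding pow using x' by simp
      then show ?thesis by blast
    qed
  qed (use f local_idempotentD[OF D(2)[OF f]] TC[OF f] in auto)
  ultimately show "basic_set G ?C T" using sum T by (auto simp: basic_set_def orthogonal_idempotents_def)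
qed

section \<open>The quotient by the graded radical\<close>

definition rq :: "('k, 'a set, 'g) graded" where "rq = quotient A J"
definition rcos :: "'a \<Rightarrow> 'a set" where "rcos x = J +>\<^sub>A x"

lemma rq_simps:
  shows "carrier rq = rcos ` carrier A" "\<zero>\<^sub>rq = rcos \<zero>\<^sub>A" "\<one>\<^sub>rq = rcos \<one>\<^sub>A"
    "component rq g = rcos ` component A g"
    and "\<lbrakk>x \<in> carrier A; y \<in> carrier A\<rbrakk> \<Longrightarrow> rcos x = rcos y \<longleftrightarrow> x \<ominus>\<^sub>A y \<in> J"
    and "x \<in> carrier A \<Longrightarrow> rcos x = \<zero>\<^sub>rq \<longleftrightarrow> x \<in> J"
    and "\<lbrakk>x \<in> carrier A; y \<in> carrier A\<rbrakk> \<Longrightarrow> rcos x \<oplus>\<^sub>rq rcos y = rcos (x \<oplus>\<^sub>A y)"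
    and "\<lbrakk>x \<in> carrier A; y \<in> carrier A\<rbrakk> \<Longrightarrow> rcos x \<otimes>\<^sub>rq rcos y = rcos (x \<bullet> y)"
    and "\<lbrakk>c \<in> carrier K; x \<in> carrier A\<rbrakk> \<Longrightarrow> c \<odot>\<^sub>rq rcos x = rcos (c \<odot>\<^sub>A x)"
proof -
  interpret J: ideal J A by (rule radical_ideal)
  show "carrier rq = rcos ` carrier A" by (auto simp: rq_def rcos_def quotient_def FactRing_def A_RCOSETS_def')
  show z: "\<zero>\<^sub>rq = rcos \<zero>\<^sub>A" using radicalD(4) by (simp add: rq_def rcos_def quotient_def FactRing_def)
  show "\<one>\<^sub>rq = rcos \<one>\<^sub>A" by (simp add: rq_def rcos_def quotient_def FactRing_def)
  show "component rq g = rcos ` component A g" by (simp add: rq_def rcos_def quotient_def)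
  show eq: "rcos x = rcos y \<longleftrightarrow> x \<ominus>\<^sub>A y \<in> J" if "x \<in> carrier A" "y \<in> carrier A" for x y
    using coset_eq_iff[OF A.abelian_group_axioms radical_subgroup that] by (simp add: rcos_def)
  show "rcos x = \<zero>\<^sub>rq \<longleftrightarrow> x \<in> J" if "x \<in> carrier A" for x
    using eq[OF that, of "\<zero>\<^sub>A"] that by (simp add: z A.minus_eq)
  show "rcos x \<oplus>\<^sub>rq rcos y = rcos (x \<oplus>\<^sub>A y)" if "x \<in> carrier A" "y \<in> carrier A" for x y
    using that J.a_rcos_sum by (simp add: rq_def rcos_def quotient_def FactRing_def)
  show "rcos x \<otimes>\<^sub>rq rcos y = rcos (x \<bullet> y)" if "x \<in> carrier A" "y \<in> carrier A" for x y
    using that J.rcoset_mult_add by (simp add: rq_def rcos_def quotient_def FactRing_def)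
  show "c \<odot>\<^sub>rq rcos x = rcos (c \<odot>\<^sub>A x)" if c: "c \<in> carrier K" and x: "x \<in> carrier A" for c x
  proof -
    have "rcos (c \<odot>\<^sub>A y) = rcos (c \<odot>\<^sub>A x)" if y: "y \<in> rcos x" for y
    proof -
      have yc: "y \<in> carrier A" using y x J.a_elemrcos_carrier by (auto simp: rcos_def)
      have "rcos x = rcos y" using y x J.a_repr_independence' by (auto simp: rcos_def)
      then have "rcos y = rcos x" by simp
      then have "y \<ominus>\<^sub>A x \<in> J" using eq[OF yc x] by simp
      then have "(c \<odot>\<^sub>A \<one>\<^sub>A) \<bullet> (y \<ominus>\<^sub>A x) \<in> J" using radicalD(2) c by simp
      moreover have "(c \<odot>\<^sub>A \<one>\<^sub>A) \<bullet> (y \<ominus>\<^sub>A x) = c \<odot>\<^sub>A y \<ominus>\<^sub>A c \<odot>\<^sub>A x"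
        using c x yc by (simp add: smult_mult_left A.minus_eq smult_r_distr smult_r_minus)
      ultimately show ?thesis using eq[of "c \<odot>\<^sub>A y" "c \<odot>\<^sub>A x"] c x yc by simp
    qed
    moreover have "x \<in> rcos x" using J.a_rcos_self[OF x] by (simp add: rcos_def)
    ultimately have "(\<Union>y\<in>rcos x. rcos (c \<odot>\<^sub>A y)) = rcos (c \<odot>\<^sub>A x)" by (intro SUP_eq_const) (blast, assumption)
    then show ?thesis by (simp add: rq_def rcos_def quotient_def)
  qed
qed

lemma rq_graded_algebra: "graded_algebra K G rq"
proof (rule graded_algebra_image[of rq rcos])
  show "rcos (gpr G A x g) = \<zero>\<^sub>rq" if "x \<in> carrier A" "rcos x = \<zero>\<^sub>rq" "g \<in> carrier G" for x g
    using that radicalD(3)[of x g] rq_simps(6)[of x] rq_simps(6)[of "gpr G A x g"] by simp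
qed (use rq_simps in simp_all)

lemma direct_sum_simps [simp]:
  "carrier (direct_sum I M) = (\<Pi>\<^sub>E i\<in>I. carrier (M i))" "add (direct_sum I M) = (\<lambda>x y. \<lambda>i\<in>I. x i \<oplus>\<^bsub>M i\<^esub> y i)"
  "mult (direct_sum I M) = (\<lambda>x y. \<lambda>i\<in>I. x i \<otimes>\<^bsub>M i\<^esub> y i)" "one (direct_sum I M) = (\<lambda>i\<in>I. \<one>\<^bsub>M i\<^esub>)"
  "zero (direct_sum I M) = (\<lambda>i\<in>I. \<zero>\<^bsub>M i\<^esub>)" "smult (direct_sum I M) = (\<lambda>a x. \<lambda>i\<in>I. a \<odot>\<^bsub>M i\<^esub> x i)"
  "component (direct_sum I M) g = (\<Pi>\<^sub>E i\<in>I. component (M i) g)" by (simp_all add: direct_sum_def)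

text \<open>The Peirce decomposition for central idempotents: x is sent to the family of all
  \<open>f i \<bullet> x\<close>, and summing a family is the inverse, by orthogonality and
  completeness. The index set is an initial segment of the naturals because \<open>gr_basic\<close>
  is phrased with one.\<close>

lemma central_idempotents_direct_sum:
  fixes f :: "nat \<Rightarrow> 'a"
  assumes f: "\<And>i. i < n \<Longrightarrow> f i \<in> A1" "\<And>i. i < n \<Longrightarrow> f i \<bullet> f i = f i"
    "\<And>i j. \<lbrakk>i < n; j < n; i \<noteq> j\<rbrakk> \<Longrightarrow> f i \<bullet> f j = \<zero>\<^sub>A"
    and sum: "(\<Oplus>\<^sub>A i\<in>{..<n}. f i) = \<one>\<^sub>A"
    and central: "\<And>i x. \<lbrakk>i < n; x \<in> carrier A\<rbrakk> \<Longrightarrow> f i \<bullet> x = x \<bullet> f i"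
  shows "gr_alg_isomorphic K G A (direct_sum {..<n} (\<lambda>i. corner A (f i)))"
proof -
  let ?S = "direct_sum {..<n} (\<lambda>i. corner A (f i))"
  let ?p = "\<lambda>x. \<lambda>i\<in>{..<n}. f i \<bullet> x"
  have fc: "f i \<in> carrier A" if "i < n" for i using f(1)[OF that] A1_closed by simp
  have ff: "f i \<bullet> (f i \<bullet> x) = f i \<bullet> x" if "i < n" "x \<in> carrier A" for i x
    using that f(2)[OF that(1)] fc by (simp add: A.m_assoc[symmetric])
  have fxf: "f i \<bullet> x \<bullet> f i = f i \<bullet> x" if "i < n" "x \<in> carrier A" for i x
    using that central[OF that(1), of "f i \<bullet> x"] ff[OF that] fc by simp
  have pc: "?p x \<in> carrier ?S" if "x \<in> carrier A" for x using that ff fxf fc by auto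
  have mult: "f i \<bullet> (x \<bullet> y) = f i \<bullet> x \<bullet> (f i \<bullet> y)" if "i < n" "x \<in> carrier A" "y \<in> carrier A" for i x y
  proof -
    have "f i \<bullet> x \<bullet> (f i \<bullet> y) = f i \<bullet> x \<bullet> f i \<bullet> y" using that fc by (simp add: A.m_assoc)
    then show ?thesis using fxf[OF that(1,2)] that fc by (simp add: A.m_assoc)
  qed
  have "bij_betw ?p (carrier A) (carrier ?S)"
  proof (rule bij_betw_byWitness[where f' = "\<lambda>y. \<Oplus>\<^sub>A i\<in>{..<n}. y i"])
    show "\<forall>x\<in>carrier A. (\<Oplus>\<^sub>A i\<in>{..<n}. ?p x i) = x"
    proof
      fix x assume x: "x \<in> carrier A"
      have "(\<Oplus>\<^sub>A i\<in>{..<n}. ?p x i) = (\<Oplus>\<^sub>A i\<in>{..<n}. f i \<bullet> x)" using x fc by (intro A.finsum_cong') auto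
      also have "\<dots> = (\<Oplus>\<^sub>A i\<in>{..<n}. f i) \<bullet> x" using x fc by (intro A.finsum_ldistr[symmetric]) auto
      finally show "(\<Oplus>\<^sub>A i\<in>{..<n}. ?p x i) = x" using sum x by simp
    qed
    show "\<forall>y\<in>carrier ?S. ?p (\<Oplus>\<^sub>A i\<in>{..<n}. y i) = y"
    proof
      fix y assume y: "y \<in> carrier ?S"
      have yc: "y i \<in> carrier A" "f i \<bullet> y i = y i" if "i < n" for i using y that by (auto simp: PiE_def Pi_def)
      have "f i \<bullet> (\<Oplus>\<^sub>A j\<in>{..<n}. y j) = y i" if i: "i < n" for i
      proof -
        have "f i \<bullet> (\<Oplus>\<^sub>A j\<in>{..<n}. y j) = (\<Oplus>\<^sub>A j\<in>{..<n}. f i \<bullet> y j)" using yc fc i by (intro A.finsum_rdistr) auto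
        also have "\<dots> = f i \<bullet> y i"
        proof (rule A.finsum_eq_single)
          fix j assume j: "j \<in> {..<n}" "j \<noteq> i"
          have "f i \<bullet> y j = f i \<bullet> (f j \<bullet> y j)" using j yc by simp
          also have "\<dots> = (f i \<bullet> f j) \<bullet> y j" using j i yc fc by (simp add: A.m_assoc)
          finally show "f i \<bullet> y j = \<zero>\<^sub>A" using f(3)[OF i] j yc by simp
        qed (use i yc fc in auto)
        finally show ?thesis using yc i by simp
      qed
      then show "?p (\<Oplus>\<^sub>A i\<in>{..<n}. y i) = y" using y by (intro extensionalityI[of _ "{..<n}"]) (auto simp: PiE_def)
    qed
    show "?p ` carrier A \<subseteq> carrier ?S" using pc by blast
    show "(\<lambda>y. \<Oplus>\<^sub>A i\<in>{..<n}. y i) ` carrier ?S \<subseteq> carrier A"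
      by (intro image_subsetI A.finsum_closed) (auto simp: PiE_def Pi_def)
  qed
  moreover have "?p \<in> ring_hom A ?S" using pc fc mult central
    by (intro ring_hom_memI) (auto simp: A.r_distr restrict_def fun_eq_iff)
  ultimately have iso: "?p \<in> ring_iso A ?S" by (simp add: ring_iso_def)
  have smult: "?p (c \<odot>\<^sub>A x) = c \<odot>\<^bsub>?S\<^esub> ?p x" if "c \<in> carrier K" "x \<in> carrier A" for c x
    using that fc by (auto simp: smult_mult_right restrict_def fun_eq_iff)
  have comp: "?p x \<in> component ?S g" if "g \<in> carrier G" "x \<in> component A g" for g x
    using that fc ff fxf AG.component_closed[OF that] f(1) A1_component_mult[OF that(1) _ that(2)] by auto
  show ?thesis unfolding gr_alg_isomorphic_def
    by (rule bexI[OF _ iso]) (intro conjI ballI image_subsetI smult comp)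
qed

end

section \<open>Gr-basic algebras in terms of idempotents\<close>

context graded_algebra
begin

lemma gpr_corner:
  assumes f: "f \<in> A1" and h: "h \<in> A1" and x: "x \<in> carrier A" and g: "g \<in> carrier G"
  shows "gpr G A (f \<bullet> x \<bullet> h) g = f \<bullet> gpr G A x g \<bullet> h"
proof -
  note fc = A1_closed[OF f] and hc = A1_closed[OF h]
  have "gpr G A (f \<bullet> x \<bullet> h) g = gpr G A (f \<bullet> x) g \<bullet> h"
    using gpr_smult_right[OF regular_Gr, of "\<one>\<^sub>G" h "f \<bullet> x" g] h g fc x by simp
  also have "gpr G A (f \<bullet> x) g = f \<bullet> gpr G A x g" using gpr_smult[OF regular_Gr _ f, of x g] x g by simp
  finally show ?thesis .
qed

section \<open>Peirce blocks modulo the radical\<close>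

context
  fixes E assumes E: "basic_set G A E"
begin

lemma basic_setD:
  shows "orthogonal_idempotents G A E" "(\<Oplus>\<^sub>A e\<in>E. e) = \<one>\<^sub>A"
    "\<And>e f. \<lbrakk>e \<in> E; f \<in> E; e \<noteq> f\<rbrakk> \<Longrightarrow> \<not> factors_through G A e f" using E by (simp_all add: basic_set_def)

lemmas basic_idem = orthogonal_idempotentsD[OF basic_setD(1)]

text \<open>The components of \<open>f \<bullet> x \<bullet> h\<close> again lie in the block of f
  and h, and one of them outside the radical would force f = h.\<close>

lemma basic_off_diagonal:
  assumes f: "f \<in> E" and h: "h \<in> E" and x: "x \<in> carrier A" and ne: "f \<noteq> h"
  shows "f \<bullet> x \<bullet> h \<in> J"
proof (rule AG.in_subgroupI[OF radical_subgroup])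
  note lf = local_idempotentD[OF basic_idem(2)[OF f]] and lh = local_idempotentD[OF basic_idem(2)[OF h]]
  show "f \<bullet> x \<bullet> h \<in> carrier A" using lf lh x by simp
  fix g assume g: "g \<in> carrier G"
  let ?y = "f \<bullet> gpr G A x g \<bullet> h"
  have xg: "gpr G A x g \<in> component A g" "gpr G A x g \<in> carrier A" using x g by (simp_all add: AG.gpr_component)
  have "?y \<in> component A g" using component_A1_mult[OF g A1_component_mult[OF g lf(1) xg(1)] lh(1)] .
  moreover have "f \<bullet> ?y = ?y" "?y \<bullet> h = ?y" using lf lh xg by (simp_all add: A.m_assoc)
  ultimately have "?y \<in> J" using radical_or_unit(1)[OF E f h g] ne by blast
  then show "gpr G A (f \<bullet> x \<bullet> h) g \<in> J" using gpr_corner[OF lf(1) lh(1) x g] by simp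
qed

text \<open>Expanding the unit on one side leaves the diagonal block plus off-diagonal blocks in the
  radical. The two congruences together say that f is central modulo the radical.\<close>

lemma basic_diagonal:
  assumes f: "f \<in> E" and x: "x \<in> carrier A"
  shows "f \<bullet> x \<ominus>\<^sub>A f \<bullet> x \<bullet> f \<in> J" "x \<bullet> f \<ominus>\<^sub>A f \<bullet> x \<bullet> f \<in> J"
proof -
  note c = basic_idem(4)
  have ins: "E = insert f (E - {f})" using f by blast
  have fin: "finite (E - {f})" using basic_idem(1) by simp
  have "f \<bullet> x = f \<bullet> x \<bullet> (\<Oplus>\<^sub>A h\<in>E. h)" using basic_setD(2) c[OF f] x by simp
  also have "\<dots> = (\<Oplus>\<^sub>A h\<in>E. f \<bullet> x \<bullet> h)" using c f x basic_idem(1) by (intro A.finsum_rdistr) auto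
  also have "\<dots> = f \<bullet> x \<bullet> f \<oplus>\<^sub>A (\<Oplus>\<^sub>A h\<in>E - {f}. f \<bullet> x \<bullet> h)"
    using c f x fin by (subst ins, subst A.finsum_insert) auto
  finally have 1: "f \<bullet> x = f \<bullet> x \<bullet> f \<oplus>\<^sub>A (\<Oplus>\<^sub>A h\<in>E - {f}. f \<bullet> x \<bullet> h)" .
  have s1: "(\<Oplus>\<^sub>A h\<in>E - {f}. f \<bullet> x \<bullet> h) \<in> J"
    using basic_off_diagonal[OF f _ x] by (intro A.additive_subgroup_finsum[OF radical_subgroup]) auto
  have s1c: "(\<Oplus>\<^sub>A h\<in>E - {f}. f \<bullet> x \<bullet> h) \<in> carrier A" using c f x by (intro A.finsum_closed) auto
  have "f \<bullet> x \<ominus>\<^sub>A f \<bullet> x \<bullet> f = (\<Oplus>\<^sub>A h\<in>E - {f}. f \<bullet> x \<bullet> h)"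
    by (subst 1) (use s1c c[OF f] x in \<open>simp add: A.minus_eq A.a_assoc A.a_comm A.r_neg1\<close>)
  then show "f \<bullet> x \<ominus>\<^sub>A f \<bullet> x \<bullet> f \<in> J" using s1 by simp
  have "x \<bullet> f = (\<Oplus>\<^sub>A h\<in>E. h) \<bullet> (x \<bullet> f)" using basic_setD(2) c[OF f] x by simp
  also have "\<dots> = (\<Oplus>\<^sub>A h\<in>E. h \<bullet> (x \<bullet> f))" using c f x basic_idem(1) by (intro A.finsum_ldistr) auto
  also have "\<dots> = f \<bullet> (x \<bullet> f) \<oplus>\<^sub>A (\<Oplus>\<^sub>A h\<in>E - {f}. h \<bullet> (x \<bullet> f))"
    using c f x fin by (subst ins, subst A.finsum_insert) auto
  finally have 2: "x \<bullet> f = f \<bullet> x \<bullet> f \<oplus>\<^sub>A (\<Oplus>\<^sub>A h\<in>E - {f}. h \<bullet> (x \<bullet> f))" using c[OF f] x by (simp add: A.m_assoc)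
  have "h \<bullet> (x \<bullet> f) \<in> J" if "h \<in> E - {f}" for h
    using basic_off_diagonal[OF _ f x, of h] that c[OF f] c[of h] x by (simp add: A.m_assoc)
  then have s2: "(\<Oplus>\<^sub>A h\<in>E - {f}. h \<bullet> (x \<bullet> f)) \<in> J" by (intro A.additive_subgroup_finsum[OF radical_subgroup]) auto
  have s2c: "(\<Oplus>\<^sub>A h\<in>E - {f}. h \<bullet> (x \<bullet> f)) \<in> carrier A" using c f x by (intro A.finsum_closed) auto
  have "x \<bullet> f \<ominus>\<^sub>A f \<bullet> x \<bullet> f = (\<Oplus>\<^sub>A h\<in>E - {f}. h \<bullet> (x \<bullet> f))"
    by (subst 2) (use s2c c[OF f] x in \<open>simp add: A.minus_eq A.a_assoc A.a_comm A.r_neg1\<close>)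
  then show "x \<bullet> f \<ominus>\<^sub>A f \<bullet> x \<bullet> f \<in> J" using s2 by simp
qed

text \<open>A nonzero homogeneous class in the corner is represented by y = fxf outside the radical.
  Such a y is invertible in \<open>fAf\<close>, and the class of its inverse inverts the given
  one.\<close>

lemma corner_gr_division:
  assumes f: "f \<in> E" shows "gr_division_algebra K G (corner rq (rcos f))"
proof -
  interpret Q: graded_algebra K G rq by (rule rq_graded_algebra)
  note lf = local_idempotentD[OF basic_idem(2)[OF f]]
  let ?C = "corner rq (rcos f)"
  have F: "rcos f \<in> component rq \<one>\<^sub>G" "rcos f \<otimes>\<^sub>rq rcos f = rcos f" using lf rq_simps(4,8) by auto
  have "X \<in> Units ?C" if g: "g \<in> carrier G" and X: "X \<in> component ?C g" "X \<noteq> \<zero>\<^bsub>?C\<^esub>" for g X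
  proof -
    obtain x where x: "x \<in> component A g" "X = rcos x" using X(1) by (auto simp: rq_simps(4))
    have xc: "x \<in> carrier A" using AG.component_closed[OF g x(1)] .
    define y where "y = f \<bullet> x \<bullet> f"
    have y: "y \<in> component A g" "y \<in> carrier A" "f \<bullet> y = y" "y \<bullet> f = y"
      using component_A1_mult[OF g A1_component_mult[OF g lf(1) x(1)] lf(1)] lf xc
      by (simp_all add: y_def A.m_assoc)
    have Xy: "X = rcos y"
    proof -
      have "X = rcos f \<otimes>\<^sub>rq X" "X = X \<otimes>\<^sub>rq rcos f" using X(1) by simp_all
      then have "X = rcos f \<otimes>\<^sub>rq X \<otimes>\<^sub>rq rcos f" by simp
      then show ?thesis using x xc lf rq_simps(8) by (simp add: y_def)
    qed
    then have "y \<notin> J" using X(2) rq_simps(6)[OF y(2)] by simp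
    then obtain t where t: "t \<in> component A (inv\<^bsub>G\<^esub> g)" "f \<bullet> t = t" "t \<bullet> f = t" "t \<bullet> y = f" "y \<bullet> t = f"
      using radical_or_unit(2)[OF E f f g y(1,3,4)] by blast
    have tc: "t \<in> carrier A" using AG.component_closed[OF _ t(1)] g by simp
    have "rcos t \<in> carrier ?C" using tc t lf rq_simps(1,8) by auto
    moreover have "rcos t \<otimes>\<^bsub>?C\<^esub> X = rcos f" "X \<otimes>\<^bsub>?C\<^esub> rcos t = rcos f" unfolding Xy using tc t y rq_simps(8) by auto
    moreover have "X \<in> carrier ?C" using X(1) by simp
    ultimately show ?thesis unfolding Units_def by auto
  qed
  then show ?thesis using Q.corner_graded_algebra[OF F] by (simp add: gr_division_algebra_def)
qed

lemma basic_set_gr_basic: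
  assumes fd: "fin_dim K A" shows "gr_basic K G A"
proof -
  interpret Q: graded_algebra K G rq by (rule rq_graded_algebra)
  obtain n and idx :: "nat \<Rightarrow> 'a" where idx: "bij_betw idx {..<n} E"
    using ex_bij_betw_nat_finite[OF basic_idem(1)] by (auto simp: atLeast0LessThan)
  have iE: "idx i \<in> E" if "i < n" for i using that idx by (auto simp: bij_betw_def)
  have ic: "idx i \<in> carrier A" if "i < n" for i using basic_idem(4)[OF iE[OF that]] .
  let ?f = "\<lambda>i. rcos (idx i)"
  have add: "additive A rq rcos" using rq_simps(1,7) by (auto simp: additive_def)
  have "(\<Oplus>\<^sub>rq i\<in>{..<n}. ?f i) = rcos (\<Oplus>\<^sub>A i\<in>{..<n}. idx i)"
    using ic by (intro additive_finsum[OF A.abelian_group_axioms Q.abelian_group_axioms add, symmetric]) auto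
  also have "(\<Oplus>\<^sub>A i\<in>{..<n}. idx i) = (\<Oplus>\<^sub>A e\<in>idx ` {..<n}. e)"
    using ic idx by (intro A.finsum_reindex[symmetric]) (auto simp: bij_betw_def)
  also have "idx ` {..<n} = E" using idx by (simp add: bij_betw_def)
  finally have sum: "(\<Oplus>\<^sub>rq i\<in>{..<n}. ?f i) = \<one>\<^sub>rq" using basic_setD(2) rq_simps(3) by simp
  have "gr_alg_isomorphic K G rq (direct_sum {..<n} (\<lambda>i. corner rq (?f i)))"
  proof (rule Q.central_idempotents_direct_sum[OF _ _ _ sum])
    show "?f i \<in> component rq \<one>\<^sub>G" if "i < n" for i using basic_idem(3)[OF iE[OF that]] rq_simps(4) by simp
    show "?f i \<otimes>\<^sub>rq ?f i = ?f i" if "i < n" for i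
      using basic_idem(5)[OF iE[OF that] iE[OF that]] ic[OF that] rq_simps(8) by simp
    show "?f i \<otimes>\<^sub>rq ?f j = \<zero>\<^sub>rq" if ij: "i < n" "j < n" "i \<noteq> j" for i j
    proof -
      have "idx i \<noteq> idx j" using ij idx by (auto simp: bij_betw_def inj_on_def)
      then show ?thesis using basic_idem(5)[OF iE iE] ij ic rq_simps(2,8) by simp
    qed
    show "?f i \<otimes>\<^sub>rq X = X \<otimes>\<^sub>rq ?f i" if i: "i < n" and X: "X \<in> carrier rq" for i X
    proof -
      obtain x where x: "x \<in> carrier A" "X = rcos x" using X rq_simps(1) by auto
      let ?e = "idx i"
      have d: "rcos (?e \<bullet> x) = rcos (?e \<bullet> x \<bullet> ?e)" "rcos (x \<bullet> ?e) = rcos (?e \<bullet> x \<bullet> ?e)"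
        using basic_diagonal[OF iE[OF i] x(1)] ic[OF i] x(1) rq_simps(5) by auto
      then show ?thesis using x ic[OF i] rq_simps(8) by simp
    qed
  qed
  then show ?thesis unfolding gr_basic_def using corner_gr_division[OF iE] fd graded_algebra_axioms rq_def
    by (intro conjI exI[of _ n] exI[of _ "\<lambda>i. corner rq (?f i)"]) auto
qed

end

text \<open>Any decomposition of the unit into local idempotents will do. Suppose f = uev with e and
  f distinct. In a factor D of A/J where f does not vanish, its image is an invertible idempotent,
  hence 1. Since fe = 0, the image of e is 0, and then so is that of uev = f, a
  contradiction.\<close>

lemma gr_basic_basic_set:
  assumes B: "gr_basic K G A" shows "\<exists>E. basic_set G A E"
proof -
  have fd: "fin_dim K A" using B by (simp add: gr_basic_def)
  obtain E where E: "orthogonal_idempotents G A E" "(\<Oplus>\<^sub>A f\<in>E. f) = \<one>\<^sub>A"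
    using idempotent_decomposition[OF fd one_component] by auto
  note D = orthogonal_idempotentsD[OF E(1)]
  obtain n and D :: "nat \<Rightarrow> ('k, 'a set, 'g) graded" where
    Dd: "\<forall>i<n. gr_division_algebra K G (D i)" and iso: "gr_alg_isomorphic K G rq (direct_sum {..<n} D)"
    using B unfolding gr_basic_def rq_def by (elim conjE exE)
  let ?S = "direct_sum {..<n} D"
  obtain \<phi> where \<phi>: "\<phi> \<in> ring_iso rq ?S" "\<And>g. g \<in> carrier G \<Longrightarrow> \<phi> ` component rq g \<subseteq> component ?S g"
    using iso unfolding gr_alg_isomorphic_def by (elim bexE conjE) blast
  have ph: "\<phi> X \<in> carrier ?S" "\<phi> (X \<otimes>\<^sub>rq Y) = \<phi> X \<otimes>\<^bsub>?S\<^esub> \<phi> Y" "\<phi> (X \<oplus>\<^sub>rq Y) = \<phi> X \<oplus>\<^bsub>?S\<^esub> \<phi> Y"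
    if "X \<in> carrier rq" "Y \<in> carrier rq" for X Y using \<phi>(1) that unfolding ring_iso_def ring_hom_def by auto
  have inj: "inj_on \<phi> (carrier rq)" using \<phi>(1) unfolding ring_iso_def bij_betw_def by simp
  interpret Q: graded_algebra K G rq by (rule rq_graded_algebra)
  have Dg: "graded_algebra K G (D k)" "\<And>g x. \<lbrakk>g \<in> carrier G; x \<in> component (D k) g; x \<noteq> \<zero>\<^bsub>D k\<^esub>\<rbrakk> \<Longrightarrow> x \<in> Units (D k)"
    if "k < n" for k using Dd that by (auto simp: gr_division_algebra_def)
  have zero: "\<phi> \<zero>\<^sub>rq k = \<zero>\<^bsub>D k\<^esub>" if k: "k < n" for k
  proof -
    interpret Dk: graded_algebra K G "D k" using Dg(1)[OF k] .
    have "\<phi> \<zero>\<^sub>rq k \<in> carrier (D k)" using ph(1)[of "\<zero>\<^sub>rq" "\<zero>\<^sub>rq"] k by (auto simp: PiE_def Pi_def)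
    moreover have "\<phi> \<zero>\<^sub>rq k = (\<phi> \<zero>\<^sub>rq \<oplus>\<^bsub>?S\<^esub> \<phi> \<zero>\<^sub>rq) k" using ph(3)[of "\<zero>\<^sub>rq" "\<zero>\<^sub>rq"] by simp
    moreover have "(\<phi> \<zero>\<^sub>rq \<oplus>\<^bsub>?S\<^esub> \<phi> \<zero>\<^sub>rq) k = \<phi> \<zero>\<^sub>rq k \<oplus>\<^bsub>D k\<^esub> \<phi> \<zero>\<^sub>rq k" using k by simp
    ultimately show ?thesis by (metis Dk.A.add.l_cancel_one)
  qed
  have "\<not> factors_through G A f e" if fe: "f \<in> E" "e \<in> E" "f \<noteq> e" for f e
  proof
    assume "factors_through G A f e"
    then obtain g u v where guv: "g \<in> carrier G" "u \<in> component A g" "v \<in> component A (inv\<^bsub>G\<^esub> g)" "u \<bullet> e \<bullet> v = f"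
      by (auto simp: factors_through_def)
    have c: "u \<in> carrier A" "v \<in> carrier A" "e \<in> carrier A" "f \<in> carrier A"
      using guv AG.component_closed fe D(4) by (metis G.inv_closed)+
    have rc: "rcos u \<in> carrier rq" "rcos v \<in> carrier rq" "rcos e \<in> carrier rq" "rcos f \<in> carrier rq"
      using c rq_simps(1) by auto
    note lf = local_idempotentD[OF D(2)[OF fe(1)]]
    have "rcos f \<noteq> \<zero>\<^sub>rq" using idempotent_not_radical[OF lf(1,3)] lf(4) rq_simps(6)[OF c(4)] by blast
    then have "\<phi> (rcos f) \<noteq> \<phi> \<zero>\<^sub>rq" using inj rc by (auto dest: inj_onD)
    \<comment> \<open>A factor in which the class of f is visible; it exists because f, a nonzero
      idempotent, is not in the radical.\<close>
    then obtain k where k: "k < n" "\<phi> (rcos f) k \<noteq> \<phi> \<zero>\<^sub>rq k"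
      using extensionalityI[of "\<phi> (rcos f)" "{..<n}" "\<phi> \<zero>\<^sub>rq"] ph(1)[OF rc(4) rc(4)]
        ph(1)[of "\<zero>\<^sub>rq" "\<zero>\<^sub>rq"] by (auto simp: PiE_def)
    interpret Dk: graded_algebra K G "D k" using Dg(1)[OF k(1)] .
    define a where "a X = \<phi> X k" for X
    have ac: "a X \<in> carrier (D k)" if "X \<in> carrier rq" for X
      using ph(1)[OF that that] k(1) by (auto simp: a_def PiE_def Pi_def)
    have am: "a (X \<otimes>\<^sub>rq Y) = a X \<otimes>\<^bsub>D k\<^esub> a Y" if "X \<in> carrier rq" "Y \<in> carrier rq" for X Y
      using ph(2)[OF that] k(1) by (simp add: a_def)
    have az: "a (rcos \<zero>\<^sub>A) = \<zero>\<^bsub>D k\<^esub>" using zero[OF k(1)] rq_simps(2) by (simp add: a_def)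
    have "\<phi> (rcos f) \<in> component ?S \<one>\<^sub>G" using \<phi>(2)[of "\<one>\<^sub>G"] rq_simps(4) lf(1) by auto
    then have "a (rcos f) \<in> component (D k) \<one>\<^sub>G" using k(1) by (auto simp: a_def PiE_def Pi_def)
    then have "a (rcos f) \<in> Units (D k)" using Dg(2)[OF k(1), of "\<one>\<^sub>G"] k zero[OF k(1)] by (simp add: a_def)
    moreover have aff: "a (rcos f) \<otimes>\<^bsub>D k\<^esub> a (rcos f) = a (rcos f)"
      using am[OF rc(4) rc(4)] rq_simps(8)[OF c(4) c(4)] lf(3) by simp
    ultimately have one: "a (rcos f) = \<one>\<^bsub>D k\<^esub>"
      using ac[OF rc(4)] by (metis Dk.A.Units_l_cancel Dk.A.one_closed Dk.A.r_one)
    have "a (rcos f) \<otimes>\<^bsub>D k\<^esub> a (rcos e) = \<zero>\<^bsub>D k\<^esub>"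
      using am[OF rc(4) rc(3)] rq_simps(8)[OF c(4) c(3)] D(5)[OF fe(1,2)] fe(3) az by simp
    then have e0: "a (rcos e) = \<zero>\<^bsub>D k\<^esub>" using one ac[OF rc(3)] by simp
    have "rcos f = rcos u \<otimes>\<^sub>rq rcos e \<otimes>\<^sub>rq rcos v" using guv(4) c by (simp add: rq_simps(8))
    then have "a (rcos f) = a (rcos u) \<otimes>\<^bsub>D k\<^esub> a (rcos e) \<otimes>\<^bsub>D k\<^esub> a (rcos v)" using am rc by simp
    then have "a (rcos f) = \<zero>\<^bsub>D k\<^esub>" using e0 ac rc by simp
    then show False using k zero[OF k(1)] by (simp add: a_def)
  qed
  then have "basic_set G A E" using E by (simp add: basic_set_def)
  then show ?thesis ..
qed

end

section \<open>The equivalence between an algebra and a full corner\<close>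

text \<open>For the corner, explicit formulas exist for maps from the identity into the composite
  functors, whereas an equivalence asks for the opposite direction. Pointwise inverses are again
  graded morphisms, natural and invariant under shifts.\<close>

lemma gr_naturally_isomorphic_inverse:
  assumes B: "graded_algebra K G B"
    and ob: "\<And>M. M \<in> Gr G A \<Longrightarrow> fobj U M \<in> Gr G B" "\<And>M. M \<in> Gr G A \<Longrightarrow> fobj V M \<in> Gr G B"
    and mo: "\<And>M N \<phi>. \<lbrakk>M \<in> Gr G A; N \<in> Gr G A; \<phi> \<in> gr_hom G A M N\<rbrakk> \<Longrightarrow> fmap U M N \<phi> \<in> gr_hom G B (fobj U M) (fobj U N)"
      "\<And>M N \<phi>. \<lbrakk>M \<in> Gr G A; N \<in> Gr G A; \<phi> \<in> gr_hom G A M N\<rbrakk> \<Longrightarrow> fmap V M N \<phi> \<in> gr_hom G B (fobj V M) (fobj V N)"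
    and sh: "\<And>M g. \<lbrakk>M \<in> Gr G A; g \<in> carrier G\<rbrakk> \<Longrightarrow> carrier (fobj U (shift G g M)) = carrier (fobj U M)"
      "\<And>M g. \<lbrakk>M \<in> Gr G A; g \<in> carrier G\<rbrakk> \<Longrightarrow> carrier (fobj V (shift G g M)) = carrier (fobj V M)"
    and k: "\<And>M. M \<in> Gr G A \<Longrightarrow> \<kappa> M \<in> gr_hom G B (fobj U M) (fobj V M)"
    and bij: "\<And>M. M \<in> Gr G A \<Longrightarrow> bij_betw (\<kappa> M) (carrier (fobj U M)) (carrier (fobj V M))"
    and nat: "\<And>M N \<phi> x. \<lbrakk>M \<in> Gr G A; N \<in> Gr G A; \<phi> \<in> gr_hom G A M N; x \<in> carrier (fobj U M)\<rbrakk> \<Longrightarrow>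
      \<kappa> N (fmap U M N \<phi> x) = fmap V M N \<phi> (\<kappa> M x)"
    and ks: "\<And>M g. \<lbrakk>M \<in> Gr G A; g \<in> carrier G\<rbrakk> \<Longrightarrow> \<kappa> (shift G g M) = \<kappa> M"
  shows "gr_naturally_isomorphic G A B V U"
proof -
  interpret B: graded_algebra K G B by fact
  define \<eta> where "\<eta> M = (\<lambda>y\<in>carrier (fobj V M). inv_into (carrier (fobj U M)) (\<kappa> M) y)" for M
  have iso: "\<eta> M \<in> gr_iso G B (fobj V M) (fobj U M)" if "M \<in> Gr G A" for M
    unfolding \<eta>_def using B.bij_gr_hom_gr_iso(2)[OF ob[OF that] k[OF that] bij[OF that]] .
  have ke: "\<kappa> M (\<eta> M y) = y" "\<eta> M y \<in> carrier (fobj U M)" if "M \<in> Gr G A" "y \<in> carrier (fobj V M)" for M y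
    using bij[OF that(1)] that(2) by (auto simp: \<eta>_def bij_betw_def f_inv_into_f inv_into_into)
  have ek: "\<eta> M (\<kappa> M x) = x" if "M \<in> Gr G A" "x \<in> carrier (fobj U M)" for M x
    using bij[OF that(1)] that(2) by (auto simp: \<eta>_def bij_betw_def)
  have "compose (carrier (fobj V M)) (\<eta> N) (fmap V M N \<phi>) = compose (carrier (fobj V M)) (fmap U M N \<phi>) (\<eta> M)"
    if M: "M \<in> Gr G A" and N: "N \<in> Gr G A" and f: "\<phi> \<in> gr_hom G A M N" for M N \<phi>
  proof (rule extensionalityI[of _ "carrier (fobj V M)"])
    fix y assume y: "y \<in> carrier (fobj V M)"
    have "\<eta> N (fmap V M N \<phi> y) = \<eta> N (fmap V M N \<phi> (\<kappa> M (\<eta> M y)))" using ke[OF M y] by simp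
    also have "\<dots> = \<eta> N (\<kappa> N (fmap U M N \<phi> (\<eta> M y)))" using nat[OF M N f ke(2)[OF M y]] by simp
    also have "\<dots> = fmap U M N \<phi> (\<eta> M y)" using ek[OF N] gr_homD(1)[OF mo(1)[OF M N f] ke(2)[OF M y]] .
    finally show "compose (carrier (fobj V M)) (\<eta> N) (fmap V M N \<phi>) y =
        compose (carrier (fobj V M)) (fmap U M N \<phi>) (\<eta> M) y" using y by (simp add: compose_eq)
  qed (auto simp: compose_extensional)
  moreover have "\<eta> (shift G g M) = \<eta> M" if "M \<in> Gr G A" "g \<in> carrier G" for M g
    using that by (simp add: \<eta>_def sh ks)
  ultimately show ?thesis unfolding gr_naturally_isomorphic_def using iso by (intro exI[of _ \<eta>]) blast
qed

text \<open>The module \<open>eM\<close>, written as the fixed points of e. It is then literally a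
  subset of M and stays in the same type.\<close>

definition fixed_part :: "'a \<Rightarrow> ('a, 'm, 'g) graded \<Rightarrow> ('a, 'm, 'g) graded" where
  "fixed_part e M = sub M {x \<in> carrier M. e \<odot>\<^sub>M x = x}"

lemma fixed_part_simps [simp]:
  "carrier (fixed_part e M) = {x \<in> carrier M. e \<odot>\<^sub>M x = x}" "add (fixed_part e M) = add M"
  "zero (fixed_part e M) = zero M" "smult (fixed_part e M) = smult M"
  "component (fixed_part e M) g = component M g \<inter> {x \<in> carrier M. e \<odot>\<^sub>M x = x}" by (simp_all add: fixed_part_def)

text \<open>The assumption \<open>full\<close> spells out that the ideal generated by e contains 1.
  The map \<open>j\<close> brings B-linear maps on eA back into the universe. A single j is
  injective on the Hom set of every N, and using the same j for a module and its shifts is what lets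
  the inverse functor commute with shifts strictly.\<close>

locale full_corner = graded_algebra K G A
  for K :: "'k ring" and G :: "'g monoid" and A :: "('k, 'a, 'g) graded" +
  fixes e :: 'a and E :: "'a set" and u v :: "'a \<Rightarrow> 'a" and j :: "('a \<Rightarrow> 'u) \<Rightarrow> 'u"
  assumes e_A1: "e \<in> A1" and e_idem: "e \<bullet> e = e"
    and E_finite: "finite E" and uv: "u \<in> E \<rightarrow> carrier A" "v \<in> E \<rightarrow> carrier A"
    and full: "(\<Oplus>\<^sub>A i\<in>E. u i \<bullet> e \<bullet> v i) = \<one>\<^sub>A"
    and j_inj: "\<And>N :: ('a, 'u, 'g) graded. N \<in> Gr G (corner A e) \<Longrightarrow>
      inj_on j (lin_hom (corner A e) (fixed_part e (regular A)) N)"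
begin

abbreviation B :: "('k, 'a, 'g) graded" where "B \<equiv> corner A e"
abbreviation P :: "('a, 'a, 'g) graded" where "P \<equiv> fixed_part e (regular A)"

lemma B_graded_algebra: "graded_algebra K G B"
  using corner_graded_algebra[OF e_A1 e_idem] .

sublocale B: graded_algebra K G B by (rule B_graded_algebra)

lemma ec [simp]: "e \<in> carrier A" using A1_closed[OF e_A1] .

lemma e_e [simp]: "x \<in> carrier A \<Longrightarrow> e \<bullet> (e \<bullet> x) = e \<bullet> x" "x \<in> carrier A \<Longrightarrow> x \<bullet> e \<bullet> e = x \<bullet> e"
  using e_idem by (simp add: A.m_assoc[symmetric]) (simp add: A.m_assoc e_idem)

lemma fixed_part_Gr:
  assumes M: "M \<in> Gr G A" shows "fixed_part e M \<in> Gr G B"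
proof -
  interpret M: graded_group G M by (rule Gr_graded_group[OF M])
  let ?N = "{x \<in> carrier M. e \<odot>\<^sub>M x = x}"
  have sg: "additive_subgroup ?N M"
    by (intro M.additive_subgroup_closedI) (auto simp: GrD(5)[OF M] Gr_smult_neg[OF M] Gr_smult_zero[OF M])
  have "gpr G M x g \<in> ?N" if "x \<in> ?N" "g \<in> carrier G" for x g using that gpr_smult[OF M _ e_A1, of x g] by simp
  then have gr: "graded_by G (fixed_part e M)"
    unfolding fixed_part_def by (rule graded_by_sub[OF Gr_graded_group[OF M] sg])
  have ab: "abelian_group (fixed_part e M)"
    unfolding fixed_part_def by (rule additive_subgroup_abelian_group[OF M.abelian_group_axioms sg])
  have fixd: "e \<odot>\<^sub>M (b \<odot>\<^sub>M x) = b \<odot>\<^sub>M x" if "b \<in> carrier B" "x \<in> carrier M" for b x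
    using that GrD(6)[OF M, of e b x, symmetric] by simp
  show ?thesis
  proof (rule B.GrI[OF ab gr])
    show "b \<odot>\<^bsub>fixed_part e M\<^esub> x \<in> component (fixed_part e M) (g \<otimes>\<^sub>G h)"
      if "g \<in> carrier G" "h \<in> carrier G" "b \<in> component B g" "x \<in> component (fixed_part e M) h" for g h b x
      using that fixd[of b x] Gr_component_smult[OF M that(1,2), of b x] by (simp add: GrD(3)[OF M])
  qed (use fixd in \<open>auto simp: GrD(3-6)[OF M]\<close>)
qed

lemma P_Gr: "P \<in> Gr G B"
  using fixed_part_Gr[OF regular_Gr] .

lemma fixed_part_finsum:
  assumes M: "M \<in> Gr G A" and f: "f \<in> I \<rightarrow> {x \<in> carrier M. e \<odot>\<^sub>M x = x}"
  shows "finsum (fixed_part e M) f I = finsum M f I"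
proof -
  interpret M: graded_group G M by (rule Gr_graded_group[OF M])
  show ?thesis unfolding fixed_part_def
    by (intro finsum_sub[OF M.abelian_group_axioms _ f] M.additive_subgroup_closedI)
      (auto simp: GrD(5)[OF M] Gr_smult_neg[OF M] Gr_smult_zero[OF M])
qed

lemma fixed_part_shift: "g \<in> carrier G \<Longrightarrow> fixed_part e (shift G g M) = shift G g (fixed_part e M)"
  by (rule graded.equality) (auto simp: fixed_part_def sub_def shift_def fun_eq_iff)

lemma P_simps: "x \<in> carrier P \<longleftrightarrow> x \<in> carrier A \<and> e \<bullet> x = x"
  "x \<in> component P g \<longleftrightarrow> x \<in> component A g \<and> x \<in> carrier A \<and> e \<bullet> x = x" by auto

lemma P_mult: "\<lbrakk>x \<in> carrier P; a \<in> carrier A\<rbrakk> \<Longrightarrow> x \<bullet> a \<in> carrier P"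
  by (auto simp: A.m_assoc[symmetric])

lemma P_left: "a \<in> carrier A \<Longrightarrow> e \<bullet> a \<in> carrier P"
  by auto

text \<open>The module \<open>Hom(eA, N)\<close>, with A acting through its right action on eA.
  Components outside the group are pinned to the empty set: functors must commute with shifts as an
  equality of records, and this also compares the components at arguments outside the
  carrier.\<close>

definition HomP :: "('a, 'n, 'g) graded \<Rightarrow> ('a, 'a \<Rightarrow> 'n, 'g) graded" where
  "HomP N = \<lparr>carrier = lin_hom B P N, mult = undefined, one = undefined, zero = (\<lambda>x\<in>carrier P. \<zero>\<^sub>N),
     add = hom_add P N, smult = (\<lambda>a \<phi>. \<lambda>x\<in>carrier P. \<phi> (x \<bullet> a)),
     component = (\<lambda>g. if g \<in> carrier G then lin_hom_component G B P N g else {})\<rparr>"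

lemma HomP_simps [simp]:
  "carrier (HomP N) = lin_hom B P N" "zero (HomP N) = (\<lambda>x\<in>carrier P. \<zero>\<^sub>N)" "add (HomP N) = hom_add P N"
  "a \<odot>\<^bsub>HomP N\<^esub> \<phi> = (\<lambda>x\<in>carrier P. \<phi> (x \<bullet> a))"
  "component (HomP N) g = (if g \<in> carrier G then lin_hom_component G B P N g else {})" by (simp_all add: HomP_def)

text \<open>Right multiplication by a on eA commutes with the left action of the corner.\<close>

lemma HomP_smult_closed:
  assumes a: "a \<in> carrier A" and f: "\<phi> \<in> lin_hom B P N"
  shows "(\<lambda>x\<in>carrier P. \<phi> (x \<bullet> a)) \<in> lin_hom B P N"
proof (rule lin_homI)
  note fd = lin_homD[OF f]
  note P = B.GrD[OF P_Gr]
  show "(\<lambda>x\<in>carrier P. \<phi> (x \<bullet> a)) x \<in> carrier N" if "x \<in> carrier P" for x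
    using that fd(1)[OF P_mult[OF that a]] by simp
  show "(\<lambda>x\<in>carrier P. \<phi> (x \<bullet> a)) (x \<oplus>\<^sub>P y) =
      (\<lambda>x\<in>carrier P. \<phi> (x \<bullet> a)) x \<oplus>\<^sub>N (\<lambda>x\<in>carrier P. \<phi> (x \<bullet> a)) y"
    if xy: "x \<in> carrier P" "y \<in> carrier P" for x y
    using fd(2)[OF P_mult[OF xy(1) a] P_mult[OF xy(2) a]] abelian_groupE(1)[OF P(2) xy] xy a
    by (simp add: A.l_distr)
  show "(\<lambda>x\<in>carrier P. \<phi> (x \<bullet> a)) (b \<odot>\<^sub>P x) = b \<odot>\<^sub>N (\<lambda>x\<in>carrier P. \<phi> (x \<bullet> a)) x"
    if bx: "b \<in> carrier B" "x \<in> carrier P" for b x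
    using fd(3)[OF bx(1) P_mult[OF bx(2) a]] P(3)[OF bx] bx a by (simp add: A.m_assoc)
qed simp

lemma HomP_Gr:
  assumes N: "N \<in> Gr G B" shows "HomP N \<in> Gr G A"
proof (rule GrI)
  note hg = P_Gr N HomP_simps(1,3,2)
  show "abelian_group (HomP N)" using B.hom_abelian_group[OF hg] .
  show "graded_by G (HomP N)" by (rule B.hom_graded[OF hg]) simp
  note P = B.GrD[OF P_Gr]
  have ext: "(\<lambda>x\<in>carrier P. \<phi> x) = \<phi>" if "\<phi> \<in> lin_hom B P N" for \<phi>
    using lin_homD(4)[OF that] by (rule extensional_restrict)
  show "a \<odot>\<^bsub>HomP N\<^esub> \<phi> \<in> carrier (HomP N)" if "a \<in> carrier A" "\<phi> \<in> carrier (HomP N)" for a \<phi>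
    using that HomP_smult_closed by simp
  show "(a \<oplus>\<^sub>A b) \<odot>\<^bsub>HomP N\<^esub> \<phi> = a \<odot>\<^bsub>HomP N\<^esub> \<phi> \<oplus>\<^bsub>HomP N\<^esub> b \<odot>\<^bsub>HomP N\<^esub> \<phi>"
    if a: "a \<in> carrier A" "b \<in> carrier A" and f: "\<phi> \<in> carrier (HomP N)" for a b \<phi>
  proof -
    have "\<phi> (x \<bullet> (a \<oplus>\<^sub>A b)) = \<phi> (x \<bullet> a) \<oplus>\<^sub>N \<phi> (x \<bullet> b)" if x: "x \<in> carrier P" for x
      using lin_homD(2)[of \<phi> B P N, OF _ P_mult[OF x a(1)] P_mult[OF x a(2)]] f x a by (simp add: A.r_distr)
    then show ?thesis by (simp add: hom_add_def cong: restrict_cong)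
  qed
  show "a \<odot>\<^bsub>HomP N\<^esub> (\<phi> \<oplus>\<^bsub>HomP N\<^esub> \<psi>) = a \<odot>\<^bsub>HomP N\<^esub> \<phi> \<oplus>\<^bsub>HomP N\<^esub> a \<odot>\<^bsub>HomP N\<^esub> \<psi>"
    if a: "a \<in> carrier A" for a \<phi> \<psi>
  proof -
    have "hom_add P N \<phi> \<psi> (x \<bullet> a) = \<phi> (x \<bullet> a) \<oplus>\<^sub>N \<psi> (x \<bullet> a)" if "x \<in> carrier P" for x
      using P_mult[OF that a] by (simp add: hom_add_def)
    then show ?thesis by (simp add: hom_add_def cong: restrict_cong)
  qed
  show "(a \<bullet> b) \<odot>\<^bsub>HomP N\<^esub> \<phi> = a \<odot>\<^bsub>HomP N\<^esub> (b \<odot>\<^bsub>HomP N\<^esub> \<phi>)"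
    if a: "a \<in> carrier A" "b \<in> carrier A" for a b \<phi>
  proof -
    have "\<phi> (x \<bullet> (a \<bullet> b)) = (\<lambda>x\<in>carrier P. \<phi> (x \<bullet> b)) (x \<bullet> a)" if "x \<in> carrier P" for x
      using P_mult[OF that a(1)] that a by (simp add: A.m_assoc)
    then show ?thesis by (simp cong: restrict_cong)
  qed
  show "\<one>\<^sub>A \<odot>\<^bsub>HomP N\<^esub> \<phi> = \<phi>" if f: "\<phi> \<in> carrier (HomP N)" for \<phi>
  proof -
    have "(\<lambda>x\<in>carrier P. \<phi> (x \<bullet> \<one>\<^sub>A)) = (\<lambda>x\<in>carrier P. \<phi> x)" by (rule restrict_ext) simp
    then show ?thesis using ext f by simp
  qed
  show "a \<odot>\<^bsub>HomP N\<^esub> \<phi> \<in> component (HomP N) (g \<otimes>\<^sub>G h)"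
    if g: "g \<in> carrier G" and h: "h \<in> carrier G" and a: "a \<in> component A g" and f: "\<phi> \<in> component (HomP N) h"
    for g h a \<phi>
  proof -
    have ac: "a \<in> carrier A" using AG.component_closed[OF g a] .
    have f': "\<phi> \<in> lin_hom B P N" "\<And>k x. \<lbrakk>k \<in> carrier G; x \<in> component P k\<rbrakk> \<Longrightarrow> \<phi> x \<in> component N (k \<otimes>\<^sub>G h)"
      using f h by (auto simp: lin_hom_component_def)
    have "\<phi> (x \<bullet> a) \<in> component N (k \<otimes>\<^sub>G (g \<otimes>\<^sub>G h))" if k: "k \<in> carrier G" and x: "x \<in> component P k" for k x
    proof -
      have "x \<in> component A k" "x \<in> carrier P" using x by auto
      then have "x \<bullet> a \<in> component P (k \<otimes>\<^sub>G g)"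
        using component_mult[OF k g _ a] P_mult[OF _ ac] by (simp add: P_simps)
      then show ?thesis using f'(2)[of "k \<otimes>\<^sub>G g"] k g h by (simp add: G.m_assoc)
    qed
    then show ?thesis using HomP_smult_closed[OF ac f'(1)] g h B.Gr_component_closed[OF P_Gr]
      by (auto simp: lin_hom_component_def)
  qed
qed

section \<open>The functors M to eM and N to Hom(eA, N)\<close>

definition V_obj :: "('a, 'u, 'g) graded \<Rightarrow> ('a, 'u, 'g) graded" where
  "V_obj N = transport j (HomP N)"

definition V_map :: "('a, 'u, 'g) graded \<Rightarrow> ('a, 'u, 'g) graded \<Rightarrow> ('u \<Rightarrow> 'u) \<Rightarrow> 'u \<Rightarrow> 'u" where
  "V_map N N' \<phi> = (\<lambda>y\<in>carrier (V_obj N). j (compose (carrier P) \<phi> (inv_into (lin_hom B P N) j y)))"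

definition V :: "('a, 'a, 'u, 'g) functor_data" where "V = \<lparr>fobj = V_obj, fmap = V_map\<rparr>"

definition U :: "('a, 'a, 'u, 'g) functor_data" where
  "U = \<lparr>fobj = fixed_part e, fmap = (\<lambda>M N \<phi>. restrict \<phi> (carrier (fixed_part e M)))\<rparr>"

lemma V_obj_Gr: "N \<in> Gr G B \<Longrightarrow> V_obj N \<in> Gr G A"
  unfolding V_obj_def by (rule transport_Gr(1)[OF HomP_Gr]) (simp_all only: HomP_simps j_inj)

lemma V_simps:
  assumes N: "N \<in> Gr G B"
  shows "carrier (V_obj N) = j ` lin_hom B P N" "\<zero>\<^bsub>V_obj N\<^esub> = j (\<lambda>x\<in>carrier P. \<zero>\<^sub>N)"
    "\<And>\<phi> \<psi>. \<lbrakk>\<phi> \<in> lin_hom B P N; \<psi> \<in> lin_hom B P N\<rbrakk> \<Longrightarrow> j \<phi> \<oplus>\<^bsub>V_obj N\<^esub> j \<psi> = j (hom_add P N \<phi> \<psi>)"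
    "\<And>a \<phi>. \<phi> \<in> lin_hom B P N \<Longrightarrow> a \<odot>\<^bsub>V_obj N\<^esub> j \<phi> = j (\<lambda>x\<in>carrier P. \<phi> (x \<bullet> a))"
    "\<And>g. g \<in> carrier G \<Longrightarrow> component (V_obj N) g = j ` lin_hom_component G B P N g"
    "\<And>\<phi> \<psi>. \<lbrakk>\<phi> \<in> lin_hom B P N; \<psi> \<in> lin_hom B P N\<rbrakk> \<Longrightarrow> j \<phi> = j \<psi> \<longleftrightarrow> \<phi> = \<psi>"
    "\<And>\<phi> \<psi> N'. \<psi> \<in> lin_hom B P N \<Longrightarrow> V_map N N' \<phi> (j \<psi>) = j (compose (carrier P) \<phi> \<psi>)"
  using j_inj[OF N] by (auto simp: V_obj_def V_map_def transport_def inj_on_def inv_into_f_f[OF j_inj[OF N]])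

lemma U_functor: "graded_functor K G A B U"
  unfolding graded_functor_def linear_functor_def
proof (intro conjI ballI)
  fix M :: "('a, 'u, 'g) graded" assume M: "M \<in> Gr G A"
  show "fobj U M \<in> Gr G B" using fixed_part_Gr[OF M] by (simp add: U_def)
  show "fmap U M M (\<lambda>x\<in>carrier M. x) = (\<lambda>x\<in>carrier (fobj U M). x)" by (auto simp: U_def restrict_def fun_eq_iff)
next
  fix M N :: "('a, 'u, 'g) graded" and \<phi> assume M: "M \<in> Gr G A" and N: "N \<in> Gr G A" and f: "\<phi> \<in> gr_hom G A M N"
  note fd = gr_homD[OF f]
  have fixd: "\<phi> x \<in> carrier N \<and> e \<odot>\<^sub>N \<phi> x = \<phi> x" if "x \<in> carrier (fixed_part e M)" for x
    using that fd(1) fd(3)[of e x] by simp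
  note FM = B.GrD[OF fixed_part_Gr[OF M]]
  show "fmap U M N \<phi> \<in> gr_hom G B (fobj U M) (fobj U N)"
  proof (rule gr_homI)
    fix x y assume xy: "x \<in> carrier (fobj U M)" "y \<in> carrier (fobj U M)"
    then show "fmap U M N \<phi> (x \<oplus>\<^bsub>fobj U M\<^esub> y) = fmap U M N \<phi> x \<oplus>\<^bsub>fobj U N\<^esub> fmap U M N \<phi> y"
      using abelian_groupE(1)[OF FM(2), of x y] fd(2) by (simp add: U_def)
  next
    fix b x assume "b \<in> carrier B" "x \<in> carrier (fobj U M)"
    then show "fmap U M N \<phi> (b \<odot>\<^bsub>fobj U M\<^esub> x) = b \<odot>\<^bsub>fobj U N\<^esub> fmap U M N \<phi> x"
      using FM(3)[of b x] fd(3) by (simp add: U_def)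
  next
    fix g x assume "g \<in> carrier G" "x \<in> component (fobj U M) g"
    then show "fmap U M N \<phi> x \<in> component (fobj U N) g"
      using fixd[of x] gr_hom_component[OF f, of g x] by (simp add: U_def)
  qed (use fixd in \<open>auto simp: U_def\<close>)
  fix c assume c: "c \<in> carrier K"
  \<comment> \<open>A scalar c of the field acts through \<open>c 1\<close> over A and through
    \<open>c e\<close> over the corner. On fixed points of e the two agree.\<close>
  have "(c \<odot>\<^sub>A \<one>\<^sub>A) \<odot>\<^sub>N \<phi> x = (c \<odot>\<^sub>A e) \<odot>\<^sub>N \<phi> x" if "x \<in> carrier (fixed_part e M)" for x
  proof -
    have "(c \<odot>\<^sub>A \<one>\<^sub>A) \<odot>\<^sub>N (e \<odot>\<^sub>N \<phi> x) = (c \<odot>\<^sub>A e) \<odot>\<^sub>N \<phi> x"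
      using c fixd[OF that] GrD(6)[OF N, of "c \<odot>\<^sub>A \<one>\<^sub>A" e "\<phi> x"] by (simp add: smult_mult_left)
    then show ?thesis using fixd[OF that] by simp
  qed
  then show "fmap U M N (hom_smult A M N c \<phi>) = hom_smult B (fobj U M) (fobj U N) c (fmap U M N \<phi>)"
    by (auto simp: U_def hom_smult_def scalars_def restrict_def fun_eq_iff)
next
  fix M N :: "('a, 'u, 'g) graded" and \<phi> \<psi>
  show "fmap U M N (hom_add M N \<phi> \<psi>) = hom_add (fobj U M) (fobj U N) (fmap U M N \<phi>) (fmap U M N \<psi>)"
    by (auto simp: U_def hom_add_def restrict_def fun_eq_iff)
next
  fix L M N :: "('a, 'u, 'g) graded" and \<phi> \<psi>
  assume f: "\<phi> \<in> gr_hom G A L M" "\<psi> \<in> gr_hom G A M N"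
  show "fmap U L N (compose (carrier L) \<psi> \<phi>) = compose (carrier (fobj U L)) (fmap U M N \<psi>) (fmap U L M \<phi>)"
    using gr_homD(1)[OF f(1)] gr_homD(3)[OF f(1), of e] by (fastforce simp: U_def compose_def restrict_def fun_eq_iff)
next
  fix g and M :: "('a, 'u, 'g) graded" assume g: "g \<in> carrier G"
  show "fobj U (shift G g M) = shift G g (fobj U M)" using fixed_part_shift[OF g] by (simp add: U_def)
next
  fix g and M N :: "('a, 'u, 'g) graded" and \<phi>
  show "fmap U (shift G g M) (shift G g N) \<phi> = fmap U M N \<phi>" by (simp add: U_def)
qed

text \<open>Into the shift of N by g, maps of degree h are the maps of degree hg into N. Carrier,
  operations and the encoding j are untouched, so the two records are equal.\<close>

lemma V_obj_shift: "g \<in> carrier G \<Longrightarrow> V_obj (shift G g N) = shift G g (V_obj N)"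
proof -
  assume g: "g \<in> carrier G"
  have "lin_hom_component G B P (shift G g N) h = lin_hom_component G B P N (h \<otimes>\<^sub>G g)" if "h \<in> carrier G" for h
    using g that by (simp add: lin_hom_component_def G.m_assoc)
  moreover have sc: "component (shift G g M) = (\<lambda>h. if h \<in> carrier G then component M (h \<otimes>\<^sub>G g) else component M h)"
    for M :: "('a, 'u, 'g) graded" by (simp add: shift_def)
  ultimately have "component (V_obj (shift G g N)) = component (shift G g (V_obj N))"
    using g unfolding sc by (auto simp: V_obj_def transport_def HomP_def fun_eq_iff)
  moreover have "hom_add P (shift G g N) = hom_add P N" by (simp add: hom_add_def fun_eq_iff)
  ultimately show "V_obj (shift G g N) = shift G g (V_obj N)"
    by (intro graded.equality) (simp_all add: V_obj_def transport_def HomP_def, simp_all add: shift_def)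
qed

lemma V_functor: "graded_functor K G B A V"
  unfolding graded_functor_def linear_functor_def
proof (intro conjI ballI)
  fix M :: "('a, 'u, 'g) graded" assume M: "M \<in> Gr G B"
  show "fobj V M \<in> Gr G A" using V_obj_Gr[OF M] by (simp add: V_def)
  have "compose (carrier P) (\<lambda>x\<in>carrier M. x) \<psi> = \<psi>" if "\<psi> \<in> lin_hom B P M" for \<psi>
  proof (rule extensionalityI[of _ "carrier P"])
    show "compose (carrier P) (\<lambda>x\<in>carrier M. x) \<psi> x = \<psi> x" if "x \<in> carrier P" for x
      using that lin_homD(1)[OF \<open>\<psi> \<in> lin_hom B P M\<close>] by (simp add: compose_def)
  qed (use lin_homD(4)[OF that] compose_extensional in auto)
  then show "fmap V M M (\<lambda>x\<in>carrier M. x) = (\<lambda>x\<in>carrier (fobj V M). x)"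
    using V_simps(1,7)[OF M] by (intro extensionalityI[of _ "carrier (V_obj M)"]) (auto simp: V_def V_map_def)
next
  fix M N :: "('a, 'u, 'g) graded" and \<phi> assume M: "M \<in> Gr G B" and N: "N \<in> Gr G B" and f: "\<phi> \<in> gr_hom G B M N"
  note fd = gr_homD[OF f] and SM = V_simps[OF M] and SN = V_simps[OF N]
  have cl: "compose (carrier P) \<phi> \<psi> \<in> lin_hom B P N" if "\<psi> \<in> lin_hom B P M" for \<psi>
    using B.Gr_lin_hom_compose[OF P_Gr that gr_hom_lin_hom[OF f]] .
  note VM = GrD[OF V_obj_Gr[OF M]]
  show "fmap V M N \<phi> \<in> gr_hom G A (fobj V M) (fobj V N)"
  proof (rule gr_homI)
    show "fmap V M N \<phi> \<in> extensional (carrier (fobj V M))" by (simp add: V_def V_map_def)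
    show "fmap V M N \<phi> y \<in> carrier (fobj V N)" if "y \<in> carrier (fobj V M)" for y
      using that cl SM(1,7) SN(1) by (auto simp: V_def)
    show "fmap V M N \<phi> (y \<oplus>\<^bsub>fobj V M\<^esub> z) = fmap V M N \<phi> y \<oplus>\<^bsub>fobj V N\<^esub> fmap V M N \<phi> z"
      if yz: "y \<in> carrier (fobj V M)" "z \<in> carrier (fobj V M)" for y z
    proof -
      obtain \<psi> \<chi> where p: "\<psi> \<in> lin_hom B P M" "\<chi> \<in> lin_hom B P M" "y = j \<psi>" "z = j \<chi>"
        using yz SM(1) by (auto simp: V_def)
      have "compose (carrier P) \<phi> (hom_add P M \<psi> \<chi>) = hom_add P N (compose (carrier P) \<phi> \<psi>) (compose (carrier P) \<phi> \<chi>)"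
        using lin_homD(1)[OF p(1)] lin_homD(1)[OF p(2)]
        by (auto simp: compose_def hom_add_def fd(2) restrict_def fun_eq_iff)
      then show ?thesis using p cl B.hom_add_lin_hom[OF M P_Gr p(1,2)] by (simp add: V_def SM(3,7) SN(3))
    qed
    show "fmap V M N \<phi> (a \<odot>\<^bsub>fobj V M\<^esub> y) = a \<odot>\<^bsub>fobj V N\<^esub> fmap V M N \<phi> y"
      if a: "a \<in> carrier A" and y: "y \<in> carrier (fobj V M)" for a y
    proof -
      obtain \<psi> where p: "\<psi> \<in> lin_hom B P M" "y = j \<psi>" using y SM(1) by (auto simp: V_def)
      have "compose (carrier P) \<phi> (\<lambda>x\<in>carrier P. \<psi> (x \<bullet> a)) = (\<lambda>x\<in>carrier P. compose (carrier P) \<phi> \<psi> (x \<bullet> a))"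
        using P_mult[OF _ a] by (auto simp: compose_def restrict_def fun_eq_iff)
      then show ?thesis using p cl[OF p(1)] HomP_smult_closed[OF a p(1)] by (simp add: V_def SM(4,7) SN(4))
    qed
    show "fmap V M N \<phi> y \<in> component (fobj V N) g"
      if g: "g \<in> carrier G" and y: "y \<in> component (fobj V M) g" for g y
    proof -
      obtain \<psi> where p: "\<psi> \<in> lin_hom_component G B P M g" "y = j \<psi>" using y SM(5)[OF g] by (auto simp: V_def)
      have p': "\<psi> \<in> lin_hom B P M" using p(1) by (simp add: lin_hom_component_def)
      have "compose (carrier P) \<phi> \<psi> x \<in> component N (h \<otimes>\<^sub>G g)" if h: "h \<in> carrier G" and x: "x \<in> component P h" for h x
      proof -
        have "\<psi> x \<in> component M (h \<otimes>\<^sub>G g)" using p(1) h x by (auto simp: lin_hom_component_def)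
        then show ?thesis using gr_hom_component[OF f, of "h \<otimes>\<^sub>G g" "\<psi> x"] h g B.Gr_component_closed[OF P_Gr h x]
          by (simp add: compose_eq)
      qed
      then have "compose (carrier P) \<phi> \<psi> \<in> lin_hom_component G B P N g"
        using cl[OF p'] by (auto simp: lin_hom_component_def)
      then show ?thesis using p p' by (simp add: V_def SM(7) SN(5)[OF g])
    qed
  qed
  fix c assume c: "c \<in> carrier K"
  show "fmap V M N (hom_smult B M N c \<phi>) = hom_smult A (fobj V M) (fobj V N) c (fmap V M N \<phi>)"
  proof (rule extensionalityI[of _ "carrier (V_obj M)"])
    fix y assume y: "y \<in> carrier (V_obj M)"
    then obtain \<psi> where p: "\<psi> \<in> lin_hom B P M" "y = j \<psi>" using SM(1) by auto
    \<comment> \<open>On the encoded Hom module c acts by precomposition with right multiplication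
      by \<open>c 1\<close>. On eA this is left multiplication by \<open>c e\<close> from the
      corner, which both maps carry through by linearity.\<close>
    have "compose (carrier P) (hom_smult B M N c \<phi>) \<psi> = (\<lambda>x\<in>carrier P. compose (carrier P) \<phi> \<psi> (x \<bullet> (c \<odot>\<^sub>A \<one>\<^sub>A)))"
    proof (rule extensionalityI[of _ "carrier P"])
      fix x assume x: "x \<in> carrier P"
      have cb: "c \<odot>\<^sub>A e \<in> carrier B" using c e_idem by (simp add: smult_mult_left smult_mult_right)
      have xe: "x \<bullet> (c \<odot>\<^sub>A \<one>\<^sub>A) = (c \<odot>\<^sub>A e) \<odot>\<^sub>P x" using x c by (simp add: smult_mult_left smult_mult_right)
      have xc: "x \<bullet> (c \<odot>\<^sub>A \<one>\<^sub>A) \<in> carrier P" using P_mult[OF x] c by simp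
      have "\<psi> (x \<bullet> (c \<odot>\<^sub>A \<one>\<^sub>A)) = (c \<odot>\<^sub>A e) \<odot>\<^sub>M \<psi> x" unfolding xe using lin_homD(3)[OF p(1) cb x] .
      then have "\<phi> (\<psi> (x \<bullet> (c \<odot>\<^sub>A \<one>\<^sub>A))) = (c \<odot>\<^sub>A e) \<odot>\<^sub>N \<phi> (\<psi> x)" using fd(3)[OF cb lin_homD(1)[OF p(1) x]] by simp
      then show "compose (carrier P) (hom_smult B M N c \<phi>) \<psi> x =
          (\<lambda>x\<in>carrier P. compose (carrier P) \<phi> \<psi> (x \<bullet> (c \<odot>\<^sub>A \<one>\<^sub>A))) x"
        using x xc lin_homD(1)[OF p(1) x] by (simp add: compose_eq hom_smult_def scalars_def)
    qed (auto simp: compose_extensional)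
    then show "fmap V M N (hom_smult B M N c \<phi>) y = hom_smult A (fobj V M) (fobj V N) c (fmap V M N \<phi>) y"
      using y p cl[OF p(1)] c by (simp add: V_def SM(7) SN(4) hom_smult_def[of A] scalars_def)
  qed (auto simp: V_def V_map_def hom_smult_def)
next
  fix M N :: "('a, 'u, 'g) graded" and \<phi> \<psi>
  assume M: "M \<in> Gr G B" and N: "N \<in> Gr G B" and f: "\<phi> \<in> gr_hom G B M N" "\<psi> \<in> gr_hom G B M N"
  note SM = V_simps[OF M] and SN = V_simps[OF N]
  show "fmap V M N (hom_add M N \<phi> \<psi>) = hom_add (fobj V M) (fobj V N) (fmap V M N \<phi>) (fmap V M N \<psi>)"
  proof (rule extensionalityI[of _ "carrier (V_obj M)"])
    fix y assume y: "y \<in> carrier (V_obj M)"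
    then obtain \<chi> where p: "\<chi> \<in> lin_hom B P M" "y = j \<chi>" using SM(1) by auto
    have cl: "compose (carrier P) \<phi> \<chi> \<in> lin_hom B P N" if "\<phi> \<in> gr_hom G B M N" for \<phi>
      using B.Gr_lin_hom_compose[OF P_Gr p(1) gr_hom_lin_hom[OF that]] .
    have "compose (carrier P) (hom_add M N \<phi> \<psi>) \<chi> = hom_add P N (compose (carrier P) \<phi> \<chi>) (compose (carrier P) \<psi> \<chi>)"
      using lin_homD(1)[OF p(1)] by (auto simp: compose_def hom_add_def restrict_def fun_eq_iff)
    then show "fmap V M N (hom_add M N \<phi> \<psi>) y = hom_add (fobj V M) (fobj V N) (fmap V M N \<phi>) (fmap V M N \<psi>) y"
      using y p cl[OF f(1)] cl[OF f(2)] by (simp add: V_def SM(7) SN(3) hom_add_def[of "V_obj M"])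
  qed (auto simp: V_def V_map_def hom_add_def)
next
  fix L M N :: "('a, 'u, 'g) graded" and \<phi> \<psi>
  assume L: "L \<in> Gr G B" and M: "M \<in> Gr G B" and N: "N \<in> Gr G B"
    and f: "\<phi> \<in> gr_hom G B L M" "\<psi> \<in> gr_hom G B M N"
  note SL = V_simps[OF L] and SM = V_simps[OF M]
  show "fmap V L N (compose (carrier L) \<psi> \<phi>) = compose (carrier (fobj V L)) (fmap V M N \<psi>) (fmap V L M \<phi>)"
  proof (rule extensionalityI[of _ "carrier (V_obj L)"])
    fix y assume y: "y \<in> carrier (V_obj L)"
    then obtain \<chi> where p: "\<chi> \<in> lin_hom B P L" "y = j \<chi>" using SL(1) by auto
    have "compose (carrier P) (compose (carrier L) \<psi> \<phi>) \<chi> = compose (carrier P) \<psi> (compose (carrier P) \<phi> \<chi>)"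
      using lin_homD(1)[OF p(1)] by (auto simp: compose_def restrict_def fun_eq_iff)
    then show "fmap V L N (compose (carrier L) \<psi> \<phi>) y = compose (carrier (fobj V L)) (fmap V M N \<psi>) (fmap V L M \<phi>) y"
      using y p B.Gr_lin_hom_compose[OF P_Gr p(1) gr_hom_lin_hom[OF f(1)]]
      by (simp add: V_def SL(7) SM(7) compose_eq)
  qed (auto simp: V_def V_map_def compose_extensional)
next
  fix g and M :: "('a, 'u, 'g) graded" assume g: "g \<in> carrier G"
  show "fobj V (shift G g M) = shift G g (fobj V M)" using V_obj_shift[OF g] by (simp add: V_def)
next
  fix g and M N :: "('a, 'u, 'g) graded" and \<phi> assume g: "g \<in> carrier G"
  show "fmap V (shift G g M) (shift G g N) \<phi> = fmap V M N \<phi>" by (simp add: V_def V_map_def V_obj_shift[OF g])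
qed

end

lemma graded_functorD:
  assumes F: "graded_functor K G A B F"
  shows graded_functor_obj: "M \<in> Gr G A \<Longrightarrow> fobj F M \<in> Gr G B"
    and graded_functor_hom: "\<lbrakk>M \<in> Gr G A; N \<in> Gr G A; \<phi> \<in> gr_hom G A M N\<rbrakk> \<Longrightarrow>
      fmap F M N \<phi> \<in> gr_hom G B (fobj F M) (fobj F N)"
    and graded_functor_id: "M \<in> Gr G A \<Longrightarrow> fmap F M M (\<lambda>x\<in>carrier M. x) = (\<lambda>x\<in>carrier (fobj F M). x)"
    and graded_functor_comp: "\<lbrakk>L \<in> Gr G A; M \<in> Gr G A; N \<in> Gr G A; \<phi> \<in> gr_hom G A L M; \<psi> \<in> gr_hom G A M N\<rbrakk> \<Longrightarrow>
      fmap F L N (compose (carrier L) \<psi> \<phi>) = compose (carrier (fobj F L)) (fmap F M N \<psi>) (fmap F L M \<phi>)"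
    and graded_functor_add: "\<lbrakk>M \<in> Gr G A; N \<in> Gr G A; \<phi> \<in> gr_hom G A M N; \<psi> \<in> gr_hom G A M N\<rbrakk> \<Longrightarrow>
      fmap F M N (hom_add M N \<phi> \<psi>) = hom_add (fobj F M) (fobj F N) (fmap F M N \<phi>) (fmap F M N \<psi>)"
    and graded_functor_smult: "\<lbrakk>M \<in> Gr G A; N \<in> Gr G A; c \<in> carrier K; \<phi> \<in> gr_hom G A M N\<rbrakk> \<Longrightarrow>
      fmap F M N (hom_smult A M N c \<phi>) = hom_smult B (fobj F M) (fobj F N) c (fmap F M N \<phi>)"
    and graded_functor_shift: "\<lbrakk>g \<in> carrier G; M \<in> Gr G A\<rbrakk> \<Longrightarrow> fobj F (shift G g M) = shift G g (fobj F M)"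
    and graded_functor_hom_shift: "\<lbrakk>g \<in> carrier G; M \<in> Gr G A; N \<in> Gr G A; \<phi> \<in> gr_hom G A M N\<rbrakk> \<Longrightarrow>
      fmap F (shift G g M) (shift G g N) \<phi> = fmap F M N \<phi>"
  using F by (simp_all add: graded_functor_def linear_functor_def)

section \<open>Unit and counit of the corner equivalence\<close>

context full_corner
begin

text \<open>The canonical map from M to \<open>Hom(eA, eM)\<close>, sending m to right
  multiplication by m, followed by the encoding.\<close>

definition unit_map :: "('a, 'u, 'g) graded \<Rightarrow> 'u \<Rightarrow> 'u" where
  "unit_map M = (\<lambda>m\<in>carrier M. j (\<lambda>x\<in>carrier P. x \<odot>\<^sub>M m))"

text \<open>The canonical map from N to the fixed part of \<open>Hom(eA, N)\<close>. For x in eA the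
  product \<open>x \<bullet> e\<close> lies in the corner, so it can act on N.\<close>

definition counit_map :: "('a, 'u, 'g) graded \<Rightarrow> 'u \<Rightarrow> 'u" where
  "counit_map N = (\<lambda>n\<in>carrier N. j (\<lambda>x\<in>carrier P. (x \<bullet> e) \<odot>\<^sub>N n))"

lemma left_mult_hom:
  assumes M: "M \<in> Gr G A" and m: "m \<in> carrier M"
  shows "(\<lambda>x\<in>carrier P. x \<odot>\<^sub>M m) \<in> lin_hom B P (fixed_part e M)"
proof (rule lin_homI)
  note P = B.GrD[OF P_Gr]
  show "(\<lambda>x\<in>carrier P. x \<odot>\<^sub>M m) x \<in> carrier (fixed_part e M)" if x: "x \<in> carrier P" for x
    using x m GrD(6)[OF M, of e x m] by (simp add: GrD(3)[OF M])
  show "(\<lambda>x\<in>carrier P. x \<odot>\<^sub>M m) (x \<oplus>\<^sub>P y) =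
      (\<lambda>x\<in>carrier P. x \<odot>\<^sub>M m) x \<oplus>\<^bsub>fixed_part e M\<^esub> (\<lambda>x\<in>carrier P. x \<odot>\<^sub>M m) y"
    if "x \<in> carrier P" "y \<in> carrier P" for x y
    using that m abelian_groupE(1)[OF P(2) that] by (simp add: GrD(4)[OF M])
  show "(\<lambda>x\<in>carrier P. x \<odot>\<^sub>M m) (b \<odot>\<^sub>P x) = b \<odot>\<^bsub>fixed_part e M\<^esub> (\<lambda>x\<in>carrier P. x \<odot>\<^sub>M m) x"
    if "b \<in> carrier B" "x \<in> carrier P" for b x using that m P(3)[OF that] by (simp add: GrD(6)[OF M])
qed simp

lemma unit_map_gr_hom:
  assumes M: "M \<in> Gr G A" shows "unit_map M \<in> gr_hom G A M (V_obj (fixed_part e M))"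
proof (rule gr_homI)
  let ?F = "fixed_part e M"
  note F = fixed_part_Gr[OF M] and l = left_mult_hom[OF M]
  note SF = V_simps[OF F]
  interpret M: graded_group G M by (rule Gr_graded_group[OF M])
  show "unit_map M x \<in> carrier (V_obj ?F)" if "x \<in> carrier M" for x
    unfolding SF(1) using l[OF that] that by (simp add: unit_map_def)
  show "unit_map M (x \<oplus>\<^sub>M y) = unit_map M x \<oplus>\<^bsub>V_obj ?F\<^esub> unit_map M y"
    if xy: "x \<in> carrier M" "y \<in> carrier M" for x y
  proof -
    have "(\<lambda>z\<in>carrier P. z \<odot>\<^sub>M (x \<oplus>\<^sub>M y)) =
        hom_add P ?F (\<lambda>z\<in>carrier P. z \<odot>\<^sub>M x) (\<lambda>z\<in>carrier P. z \<odot>\<^sub>M y)"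
      using xy by (auto simp: hom_add_def GrD(5)[OF M] restrict_def fun_eq_iff)
    then show ?thesis using xy SF(3)[OF l[OF xy(1)] l[OF xy(2)]] by (simp add: unit_map_def)
  qed
  show "unit_map M (a \<odot>\<^sub>M x) = a \<odot>\<^bsub>V_obj ?F\<^esub> unit_map M x"
    if a: "a \<in> carrier A" and x: "x \<in> carrier M" for a x
  proof -
    have "(\<lambda>z\<in>carrier P. z \<odot>\<^sub>M (a \<odot>\<^sub>M x)) = (\<lambda>z\<in>carrier P. (\<lambda>z\<in>carrier P. z \<odot>\<^sub>M x) (z \<bullet> a))"
      using P_mult[OF _ a] a x by (auto simp: GrD(6)[OF M] restrict_def fun_eq_iff)
    then show ?thesis using a x SF(4)[OF l[OF x]] by (simp add: unit_map_def GrD(3)[OF M])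
  qed
  show "unit_map M x \<in> component (V_obj ?F) g" if g: "g \<in> carrier G" and x: "x \<in> component M g" for g x
  proof -
    have xc: "x \<in> carrier M" using Gr_component_closed[OF M g x] .
    have "z \<odot>\<^sub>M x \<in> component ?F (h \<otimes>\<^sub>G g)" if h: "h \<in> carrier G" and z: "z \<in> component P h" for h z
      using Gr_component_smult[OF M h g _ x, of z] z xc GrD(6)[OF M, of e z x] by (simp add: GrD(3)[OF M])
    then have "(\<lambda>z\<in>carrier P. z \<odot>\<^sub>M x) \<in> lin_hom_component G B P ?F g"
      using l[OF xc] by (auto simp: lin_hom_component_def)
    then show ?thesis unfolding SF(5)[OF g] using xc by (simp add: unit_map_def)
  qed
qed (simp add: unit_map_def)

text \<open>Here fullness is used: m is the sum of the \<open>u i\<close> acting on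
  \<open>(e \<bullet> v i) \<odot>\<^sub>M m\<close>, so m is determined by the associated map on
  eA.\<close>

lemma unit_map_bij:
  assumes M: "M \<in> Gr G A" shows "bij_betw (unit_map M) (carrier M) (carrier (V_obj (fixed_part e M)))"
proof -
  let ?F = "fixed_part e M"
  note F = fixed_part_Gr[OF M] and l = left_mult_hom[OF M]
  note SF = V_simps[OF F]
  interpret M: graded_group G M by (rule Gr_graded_group[OF M])
  have uvc: "u i \<in> carrier A" "v i \<in> carrier A" if "i \<in> E" for i using uv that by auto
  have sum: "(\<Oplus>\<^sub>M i\<in>E. u i \<odot>\<^sub>M ((e \<bullet> v i) \<odot>\<^sub>M m)) = m" if m: "m \<in> carrier M" for m
  proof -
    have "m = (\<Oplus>\<^sub>A i\<in>E. u i \<bullet> e \<bullet> v i) \<odot>\<^sub>M m" using full GrD(7)[OF M m] by simp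
    also have "\<dots> = (\<Oplus>\<^sub>M i\<in>E. (u i \<bullet> e \<bullet> v i) \<odot>\<^sub>M m)" using m uvc by (intro Gr_finsum_smult[OF M]) auto
    also have "\<dots> = (\<Oplus>\<^sub>M i\<in>E. u i \<odot>\<^sub>M ((e \<bullet> v i) \<odot>\<^sub>M m))"
      using m uvc by (intro M.finsum_cong') (auto simp: GrD(3,6)[OF M] A.m_assoc)
    finally show ?thesis by simp
  qed
  have "inj_on (unit_map M) (carrier M)"
  proof (rule inj_onI)
    fix m m' assume m: "m \<in> carrier M" "m' \<in> carrier M" and eq: "unit_map M m = unit_map M m'"
    then have eq': "(\<lambda>x\<in>carrier P. x \<odot>\<^sub>M m) = (\<lambda>x\<in>carrier P. x \<odot>\<^sub>M m')"
      using SF(6)[OF l[OF m(1)] l[OF m(2)]] by (simp add: unit_map_def)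
    have "x \<odot>\<^sub>M m = x \<odot>\<^sub>M m'" if "x \<in> carrier P" for x using fun_cong[OF eq', of x] that by simp
    then have "(\<Oplus>\<^sub>M i\<in>E. u i \<odot>\<^sub>M ((e \<bullet> v i) \<odot>\<^sub>M m)) = (\<Oplus>\<^sub>M i\<in>E. u i \<odot>\<^sub>M ((e \<bullet> v i) \<odot>\<^sub>M m'))"
      using P_left uvc m by (intro M.finsum_cong') (auto simp: GrD(3)[OF M])
    then show "m = m'" using sum m by simp
  qed
  moreover have "\<exists>m\<in>carrier M. unit_map M m = y" if y: "y \<in> carrier (V_obj ?F)" for y
  proof -
    obtain \<psi> where p: "\<psi> \<in> lin_hom B P ?F" "y = j \<psi>" using y SF(1) by auto
    note pd = lin_homD[OF p(1)]
    \<comment> \<open>The same formula with psi in place of the multiplication. For x in eA the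
      coefficient \<open>x \<bullet> u i \<bullet> e\<close> lies in the corner and can be pulled
      into psi, where the sum collapses to x.\<close>
    define m where "m = (\<Oplus>\<^sub>M i\<in>E. u i \<odot>\<^sub>M \<psi> (e \<bullet> v i))"
    have pc: "\<psi> x \<in> carrier M" "e \<odot>\<^sub>M \<psi> x = \<psi> x" if "x \<in> carrier P" for x using pd(1)[OF that] by auto
    have mc: "m \<in> carrier M" unfolding m_def using uvc pc[OF P_left]
      by (intro M.finsum_closed) (auto simp: GrD(3)[OF M])
    have "x \<odot>\<^sub>M m = \<psi> x" if x: "x \<in> carrier P" for x
    proof -
      have xc: "x \<in> carrier A" "e \<bullet> x = x" using x by auto
      have s: "(x \<bullet> u i) \<odot>\<^sub>M \<psi> (e \<bullet> v i) = \<psi> (x \<bullet> (u i \<bullet> e \<bullet> v i))" if i: "i \<in> E" for i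
      proof -
        have b: "x \<bullet> u i \<bullet> e \<in> carrier B" using xc uvc[OF i] by (simp add: A.m_assoc[symmetric])
        have "(x \<bullet> u i) \<odot>\<^sub>M \<psi> (e \<bullet> v i) = (x \<bullet> u i) \<odot>\<^sub>M (e \<odot>\<^sub>M \<psi> (e \<bullet> v i))"
          using pc(2)[OF P_left] uvc[OF i] by simp
        also have "\<dots> = (x \<bullet> u i \<bullet> e) \<odot>\<^bsub>?F\<^esub> \<psi> (e \<bullet> v i)"
          using xc uvc[OF i] pc(1)[OF P_left] by (simp add: GrD(6)[OF M])
        also have "\<dots> = \<psi> ((x \<bullet> u i \<bullet> e) \<odot>\<^sub>P (e \<bullet> v i))" using pd(3)[OF b P_left] uvc[OF i] by simp
        also have "(x \<bullet> u i \<bullet> e) \<odot>\<^sub>P (e \<bullet> v i) = x \<bullet> (u i \<bullet> e \<bullet> v i)" using xc uvc[OF i] by (simp add: A.m_assoc)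
        finally show ?thesis .
      qed
      have "x \<odot>\<^sub>M m = (\<Oplus>\<^sub>M i\<in>E. x \<odot>\<^sub>M (u i \<odot>\<^sub>M \<psi> (e \<bullet> v i)))"
        unfolding m_def using xc uvc pc(1)[OF P_left] by (intro Gr_smult_finsum[OF M]) (auto simp: GrD(3)[OF M])
      also have "\<dots> = (\<Oplus>\<^sub>M i\<in>E. \<psi> (x \<bullet> (u i \<bullet> e \<bullet> v i)))" using s xc uvc pc(1)[OF P_left] pc(1)[OF P_mult[OF x]]
        by (intro M.finsum_cong') (auto simp: GrD(6)[OF M, symmetric])
      also have "\<dots> = (\<Oplus>\<^bsub>?F\<^esub>i\<in>E. \<psi> (x \<bullet> (u i \<bullet> e \<bullet> v i)))"
        using pc[OF P_mult[OF x]] uvc by (intro fixed_part_finsum[OF M, symmetric]) auto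
      also have "\<dots> = \<psi> (\<Oplus>\<^sub>P i\<in>E. x \<bullet> (u i \<bullet> e \<bullet> v i))" using P_mult[OF x] uvc
        by (intro additive_finsum[OF B.GrD(2)[OF P_Gr] B.GrD(2)[OF F] pd(5), symmetric]) auto
      also have "(\<Oplus>\<^sub>P i\<in>E. x \<bullet> (u i \<bullet> e \<bullet> v i)) = (\<Oplus>\<^sub>A i\<in>E. x \<bullet> (u i \<bullet> e \<bullet> v i))"
        using P_mult[OF x] uvc by (subst fixed_part_finsum[OF regular_Gr]) auto
      also have "\<dots> = x \<bullet> (\<Oplus>\<^sub>A i\<in>E. u i \<bullet> e \<bullet> v i)" using xc uvc E_finite by (intro A.finsum_rdistr[symmetric]) auto
      finally show ?thesis using full xc by simp
    qed
    then have "(\<lambda>x\<in>carrier P. x \<odot>\<^sub>M m) = \<psi>" using pd(4) by (intro extensionalityI[of _ "carrier P"]) auto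
    then show ?thesis using mc p by (intro bexI[of _ m]) (auto simp: unit_map_def)
  qed
  moreover have "unit_map M ` carrier M \<subseteq> carrier (V_obj ?F)" using gr_homD(1)[OF unit_map_gr_hom[OF M]] by blast
  ultimately show ?thesis unfolding bij_betw_def by (intro conjI equalityI subsetI) blast+
qed

lemma corner_mult_hom:
  assumes N: "N \<in> Gr G B" and n: "n \<in> carrier N"
  shows "(\<lambda>x\<in>carrier P. (x \<bullet> e) \<odot>\<^sub>N n) \<in> lin_hom B P N"
proof (rule lin_homI)
  note P = B.GrD[OF P_Gr] and N' = B.GrD[OF N]
  have xe: "x \<bullet> e \<in> carrier B" if "x \<in> carrier P" for x using that P_mult[OF that ec] by simp
  show "(\<lambda>x\<in>carrier P. (x \<bullet> e) \<odot>\<^sub>N n) x \<in> carrier N" if x: "x \<in> carrier P" for x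
    using N'(3)[OF xe[OF x] n] x by simp
  show "(\<lambda>x\<in>carrier P. (x \<bullet> e) \<odot>\<^sub>N n) (x \<oplus>\<^sub>P y) =
      (\<lambda>x\<in>carrier P. (x \<bullet> e) \<odot>\<^sub>N n) x \<oplus>\<^sub>N (\<lambda>x\<in>carrier P. (x \<bullet> e) \<odot>\<^sub>N n) y"
    if "x \<in> carrier P" "y \<in> carrier P" for x y
    using that abelian_groupE(1)[OF P(2) that] N'(4)[OF xe[OF that(1)] xe[OF that(2)] n] by (simp add: A.l_distr)
  show "(\<lambda>x\<in>carrier P. (x \<bullet> e) \<odot>\<^sub>N n) (b \<odot>\<^sub>P x) = b \<odot>\<^sub>N (\<lambda>x\<in>carrier P. (x \<bullet> e) \<odot>\<^sub>N n) x"
    if "b \<in> carrier B" "x \<in> carrier P" for b x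
    using that P(3)[OF that] N'(6)[OF that(1) xe[OF that(2)] n] by (simp add: A.m_assoc)
qed simp

lemma counit_map_gr_hom:
  assumes N: "N \<in> Gr G B" shows "counit_map N \<in> gr_hom G B N (fixed_part e (V_obj N))"
proof (rule gr_homI)
  note VN = V_obj_Gr[OF N] and l = corner_mult_hom[OF N] and SN = V_simps[OF N] and N' = B.GrD[OF N]
  interpret N: graded_group G N by (rule B.Gr_graded_group[OF N])
  have xe: "x \<bullet> e \<in> carrier B" if "x \<in> carrier P" for x using that P_mult[OF that ec] by simp
  have fixd: "e \<odot>\<^bsub>V_obj N\<^esub> counit_map N n = counit_map N n" if n: "n \<in> carrier N" for n
  proof -
    have "(\<lambda>z\<in>carrier P. (\<lambda>x\<in>carrier P. (x \<bullet> e) \<odot>\<^sub>N n) (z \<bullet> e)) = (\<lambda>x\<in>carrier P. (x \<bullet> e) \<odot>\<^sub>N n)"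
      using P_mult[OF _ ec] by (auto simp: restrict_def fun_eq_iff)
    then show ?thesis using n SN(4)[OF l[OF n]] by (simp add: counit_map_def)
  qed
  have cl: "counit_map N n \<in> carrier (V_obj N)" if n: "n \<in> carrier N" for n
    unfolding SN(1) using l[OF n] n by (simp add: counit_map_def)
  show "counit_map N n \<in> carrier (fixed_part e (V_obj N))" if n: "n \<in> carrier N" for n using cl fixd n by simp
  show "counit_map N (x \<oplus>\<^sub>N y) = counit_map N x \<oplus>\<^bsub>fixed_part e (V_obj N)\<^esub> counit_map N y"
    if xy: "x \<in> carrier N" "y \<in> carrier N" for x y
  proof -
    have "(\<lambda>z\<in>carrier P. (z \<bullet> e) \<odot>\<^sub>N (x \<oplus>\<^sub>N y)) =
        hom_add P N (\<lambda>z\<in>carrier P. (z \<bullet> e) \<odot>\<^sub>N x) (\<lambda>z\<in>carrier P. (z \<bullet> e) \<odot>\<^sub>N y)"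
      using xy N'(5)[OF xe] by (auto simp: hom_add_def restrict_def fun_eq_iff)
    then show ?thesis using xy SN(3)[OF l[OF xy(1)] l[OF xy(2)]] by (simp add: counit_map_def)
  qed
  show "counit_map N (b \<odot>\<^sub>N x) = b \<odot>\<^bsub>fixed_part e (V_obj N)\<^esub> counit_map N x"
    if b: "b \<in> carrier B" and x: "x \<in> carrier N" for b x
  proof -
    have bc: "b \<in> carrier A" "b \<bullet> e = b" "e \<bullet> b = b" using b by auto
    have "(z \<bullet> e) \<odot>\<^sub>N (b \<odot>\<^sub>N x) = (z \<bullet> b \<bullet> e) \<odot>\<^sub>N x" if z: "z \<in> carrier P" for z
      using N'(6)[OF xe[OF z] b x] z bc by (simp add: A.m_assoc)
    then have "(\<lambda>z\<in>carrier P. (z \<bullet> e) \<odot>\<^sub>N (b \<odot>\<^sub>N x)) =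
        (\<lambda>z\<in>carrier P. (\<lambda>z\<in>carrier P. (z \<bullet> e) \<odot>\<^sub>N x) (z \<bullet> b))"
      using P_mult[OF _ bc(1)] by (auto simp: restrict_def fun_eq_iff)
    then show ?thesis using x N'(3)[OF b x] SN(4)[OF l[OF x]] by (simp add: counit_map_def)
  qed
  show "counit_map N x \<in> component (fixed_part e (V_obj N)) g" if g: "g \<in> carrier G" and x: "x \<in> component N g" for g x
  proof -
    have xc: "x \<in> carrier N" using B.Gr_component_closed[OF N g x] .
    have "(z \<bullet> e) \<odot>\<^sub>N x \<in> component N (h \<otimes>\<^sub>G g)" if h: "h \<in> carrier G" and z: "z \<in> component P h" for h z
    proof -
      have "z \<bullet> e \<in> component B h" using z xe[of z] component_A1_mult[OF h _ e_A1, of z] by simp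
      then show ?thesis using B.Gr_component_smult[OF N h g _ x] by blast
    qed
    then have "(\<lambda>z\<in>carrier P. (z \<bullet> e) \<odot>\<^sub>N x) \<in> lin_hom_component G B P N g"
      using l[OF xc] by (auto simp: lin_hom_component_def)
    then have "counit_map N x \<in> component (V_obj N) g" unfolding SN(5)[OF g] using xc by (simp add: counit_map_def)
    then show ?thesis using cl[OF xc] fixd[OF xc] by simp
  qed
qed (simp add: counit_map_def)

text \<open>Evaluation at e is the inverse. A map fixed by e satisfies
  \<open>\<psi> (x \<bullet> e) = \<psi> x\<close>, and linearity over the corner turns the left
  side into the action of \<open>x \<bullet> e\<close> on the value at e.\<close>

lemma counit_map_bij:
  assumes N: "N \<in> Gr G B" shows "bij_betw (counit_map N) (carrier N) (carrier (fixed_part e (V_obj N)))"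
proof -
  note l = corner_mult_hom[OF N] and SN = V_simps[OF N] and N' = B.GrD[OF N]
  have eP: "e \<in> carrier P" using e_idem by simp
  have "inj_on (counit_map N) (carrier N)"
  proof (rule inj_onI)
    fix m m' assume m: "m \<in> carrier N" "m' \<in> carrier N" and eq: "counit_map N m = counit_map N m'"
    then have "(\<lambda>x\<in>carrier P. (x \<bullet> e) \<odot>\<^sub>N m) = (\<lambda>x\<in>carrier P. (x \<bullet> e) \<odot>\<^sub>N m')"
      using SN(6)[OF l[OF m(1)] l[OF m(2)]] by (simp add: counit_map_def)
    from fun_cong[OF this, of e] have "e \<odot>\<^sub>N m = e \<odot>\<^sub>N m'" using eP e_idem by simp
    then show "m = m'" using N'(7)[OF m(1)] N'(7)[OF m(2)] by simp
  qed
  moreover have "\<exists>n\<in>carrier N. counit_map N n = y" if y: "y \<in> carrier (fixed_part e (V_obj N))" for y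
  proof -
    obtain \<psi> where p: "\<psi> \<in> lin_hom B P N" "y = j \<psi>" "e \<odot>\<^bsub>V_obj N\<^esub> j \<psi> = j \<psi>" using y SN(1) by auto
    note pd = lin_homD[OF p(1)]
    have eq: "(\<lambda>x\<in>carrier P. \<psi> (x \<bullet> e)) = \<psi>"
      using p(3) SN(4)[OF p(1)] SN(6)[OF HomP_smult_closed[OF ec p(1)] p(1)] by simp
    have pe: "\<psi> (x \<bullet> e) = \<psi> x" if "x \<in> carrier P" for x using fun_cong[OF eq, of x] that by simp
    have "(x \<bullet> e) \<odot>\<^sub>N \<psi> e = \<psi> x" if x: "x \<in> carrier P" for x
    proof -
      have "x \<bullet> e \<in> carrier B" using x P_mult[OF x ec] by simp
      from pd(3)[OF this eP] show ?thesis using pe[OF x] x by simp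
    qed
    then have "(\<lambda>x\<in>carrier P. (x \<bullet> e) \<odot>\<^sub>N \<psi> e) = \<psi>" using pd(4) by (intro extensionalityI[of _ "carrier P"]) auto
    then show ?thesis using pd(1)[OF eP] p by (intro bexI[of _ "\<psi> e"]) (auto simp: counit_map_def)
  qed
  moreover have "counit_map N ` carrier N \<subseteq> carrier (fixed_part e (V_obj N))"
    using gr_homD(1)[OF counit_map_gr_hom[OF N]] by blast
  ultimately show ?thesis unfolding bij_betw_def by (intro conjI equalityI subsetI) blast+
qed

lemma corner_equivalence: "graded_equivalence K G A B U"
  unfolding graded_equivalence_def
proof (intro conjI exI[of _ V])
  show "graded_functor K G A B U" "graded_functor K G B A V" by (rule U_functor V_functor)+
  note UV = graded_functorD(1,2)[OF U_functor] graded_functorD(1,2)[OF V_functor]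
  show "gr_naturally_isomorphic G A A (comp_functor V U) id_functor"
  proof (rule gr_naturally_isomorphic_inverse[where \<kappa> = unit_map and K = K])
    show "unit_map N (fmap id_functor M N \<phi> x) = fmap (comp_functor V U) M N \<phi> (unit_map M x)"
      if M: "M \<in> Gr G A" and N: "N \<in> Gr G A" and f: "\<phi> \<in> gr_hom G A M N"
        and x: "x \<in> carrier (fobj id_functor M)" for M N :: "('a, 'u, 'g) graded" and \<phi> x
    proof -
      have xc: "x \<in> carrier M" using x by (simp add: id_functor_def)
      note fd = gr_homD[OF f]
      note SM = V_simps[OF fixed_part_Gr[OF M]]
      have "compose (carrier P) (restrict \<phi> (carrier (fixed_part e M))) (\<lambda>z\<in>carrier P. z \<odot>\<^sub>M x) =
          (\<lambda>z\<in>carrier P. z \<odot>\<^sub>N \<phi> x)" using lin_homD(1)[OF left_mult_hom[OF M xc]] fd(3)[OF _ xc]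
        by (auto simp: compose_def restrict_def fun_eq_iff)
      then show ?thesis using xc fd(1)[OF xc] SM(7)[OF left_mult_hom[OF M xc]]
        by (simp add: unit_map_def id_functor_def comp_functor_def U_def V_def)
    qed
    show "bij_betw (unit_map M) (carrier (fobj id_functor M)) (carrier (fobj (comp_functor V U) M))"
      if "M \<in> Gr G A" for M :: "('a, 'u, 'g) graded"
      using unit_map_bij[OF that] by (simp add: id_functor_def comp_functor_def U_def V_def)
  qed (use UV unit_map_gr_hom V_obj_Gr[OF fixed_part_Gr] in \<open>simp_all add: graded_algebra_axioms id_functor_def
      comp_functor_def U_def V_def fixed_part_shift V_obj_shift unit_map_def\<close>)
  show "gr_naturally_isomorphic G B B (comp_functor U V) id_functor"
  proof (rule gr_naturally_isomorphic_inverse[where \<kappa> = counit_map and K = K])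
    show "counit_map N (fmap id_functor M N \<phi> x) = fmap (comp_functor U V) M N \<phi> (counit_map M x)"
      if M: "M \<in> Gr G B" and N: "N \<in> Gr G B" and f: "\<phi> \<in> gr_hom G B M N"
        and x: "x \<in> carrier (fobj id_functor M)" for M N :: "('a, 'u, 'g) graded" and \<phi> x
    proof -
      have xc: "x \<in> carrier M" using x by (simp add: id_functor_def)
      note fd = gr_homD[OF f]
      note SM = V_simps[OF M]
      have xe: "z \<bullet> e \<in> carrier B" if "z \<in> carrier P" for z using that P_mult[OF that ec] by simp
      have "compose (carrier P) \<phi> (\<lambda>z\<in>carrier P. (z \<bullet> e) \<odot>\<^sub>M x) = (\<lambda>z\<in>carrier P. (z \<bullet> e) \<odot>\<^sub>N \<phi> x)"
        using fd(3)[OF xe xc] by (auto simp: compose_def restrict_def fun_eq_iff)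
      then show ?thesis
        using xc fd(1)[OF xc] SM(7)[OF corner_mult_hom[OF M xc]] gr_homD(1)[OF counit_map_gr_hom[OF M] xc]
        by (simp add: counit_map_def id_functor_def comp_functor_def U_def V_def)
    qed
    show "bij_betw (counit_map M) (carrier (fobj id_functor M)) (carrier (fobj (comp_functor U V) M))"
      if "M \<in> Gr G B" for M :: "('a, 'u, 'g) graded"
      using counit_map_bij[OF that] by (simp add: id_functor_def comp_functor_def U_def V_def)
  qed (use UV counit_map_gr_hom fixed_part_Gr[OF V_obj_Gr] in \<open>simp_all add: B_graded_algebra id_functor_def
      comp_functor_def U_def V_def fixed_part_shift V_obj_shift counit_map_def\<close>)
qed

end

section \<open>Existence of an equivalent gr-basic algebra\<close>

lemma list_encoding:
  assumes "infinite (UNIV :: 'u set)"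
  obtains enc :: "'u list \<Rightarrow> 'u" where "\<And>xs ys. \<lbrakk>length xs = length ys; enc xs = enc ys\<rbrakk> \<Longrightarrow> xs = ys"
proof -
  have "(card_of (UNIV \<times> UNIV :: ('u \<times> 'u) set), card_of (UNIV :: 'u set)) \<in> ordLeq"
    using card_of_Times_same_infinite[OF assms] ordIso_imp_ordLeq by blast
  then obtain p :: "'u \<times> 'u \<Rightarrow> 'u" where p: "inj p"
    using card_of_ordLeq[of "UNIV \<times> UNIV :: ('u \<times> 'u) set" "UNIV :: 'u set"] by auto
  \<comment> \<open>Iterated pairing with a fixed value at the empty list. The length is not
    recorded, so lists are only told apart among those of equal length.\<close>
  define enc where "enc xs = foldr (\<lambda>x y. p (x, y)) xs undefined" for xs
  have "xs = ys" if "length xs = length ys" "enc xs = enc ys" for xs ys using that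
  proof (induction xs ys rule: list_induct2)
    case (Cons x xs y ys)
    then have "p (x, enc xs) = p (y, enc ys)" by (simp add: enc_def)
    then show ?case using p Cons.IH by (auto dest: injD)
  qed simp
  then show ?thesis using that by blast
qed

theorem gr_basic_equivalent:
  fixes A :: "('k, 'a, 'g) graded"
  assumes A: "graded_algebra K G A" and fd: "fin_dim K A" and inf: "infinite (UNIV :: 'u set)"
  shows "\<exists>B :: ('k, 'a, 'g) graded. gr_basic K G B \<and> graded_equivalent TYPE('u) K G A B"
proof -
  interpret graded_algebra K G A by fact
  show ?thesis
  proof (rule basic_idempotent[OF fd])
  fix T and E :: "'a set" and u v :: "'a \<Rightarrow> 'a"
  assume T: "orthogonal_idempotents G A T"
    "\<And>f h. \<lbrakk>f \<in> T; h \<in> T; f \<noteq> h\<rbrakk> \<Longrightarrow> \<not> factors_through G A f h"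
    and E: "finite E" "u \<in> E \<rightarrow> carrier A" "v \<in> E \<rightarrow> carrier A"
      "(\<Oplus>\<^sub>A i\<in>E. u i \<otimes>\<^sub>A (\<Oplus>\<^sub>A f\<in>T. f) \<otimes>\<^sub>A v i) = \<one>\<^sub>A"
  define e where "e = (\<Oplus>\<^sub>A f\<in>T. f)"
  note e = corner_basic_set[OF T e_def]
  interpret B: graded_algebra K G "corner A e" using corner_graded_algebra[OF e(1,2)] .
  have basic: "gr_basic K G (corner A e)" using B.basic_set_gr_basic[OF e(3) corner_fin_dim[OF e(1,2) fd]] .
  obtain S where S: "finite S" "S \<subseteq> carrier A" "\<And>L. \<lbrakk>subspace K A L; S \<subseteq> L\<rbrakk> \<Longrightarrow> L = carrier A"
    using kmodule.fin_dimD[OF algebra_kmodule fd] by blast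
  obtain ss where ss: "set ss = S" using finite_list[OF S(1)] by blast
  obtain enc :: "'u list \<Rightarrow> 'u" where enc: "\<And>xs ys. \<lbrakk>length xs = length ys; enc xs = enc ys\<rbrakk> \<Longrightarrow> xs = ys"
    using list_encoding[OF inf] by blast
  \<comment> \<open>A \<open>B\<close>-linear map on \<open>eA\<close> is determined by its values on a spanning set.\<close>
  define j :: "('a \<Rightarrow> 'u) \<Rightarrow> 'u" where "j \<phi> = enc (map (\<lambda>s. \<phi> (e \<otimes>\<^sub>A s)) ss)" for \<phi>
  let ?P = "fixed_part e (regular A)"
  have ec: "e \<in> carrier A" using A1_closed[OF e(1)] .
  have j: "inj_on j (lin_hom (corner A e) ?P N)" if N: "N \<in> Gr G (corner A e)" for N :: "('a, 'u, 'g) graded"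
  proof (rule inj_onI)
    fix \<phi> \<psi> assume f: "\<phi> \<in> lin_hom (corner A e) ?P N" "\<psi> \<in> lin_hom (corner A e) ?P N" and eq: "j \<phi> = j \<psi>"
    note fd = lin_homD(2,3)[OF f(1)] lin_homD(2,3)[OF f(2)]
    have "map (\<lambda>s. \<phi> (e \<otimes>\<^sub>A s)) ss = map (\<lambda>s. \<psi> (e \<otimes>\<^sub>A s)) ss" using eq by (intro enc) (simp_all add: j_def)
    then have onS: "\<phi> (e \<otimes>\<^sub>A s) = \<psi> (e \<otimes>\<^sub>A s)" if "s \<in> S" for s using ss that by auto
    have Pc: "e \<otimes>\<^sub>A a \<in> carrier ?P" if "a \<in> carrier A" for a
    proof -
      have "e \<otimes>\<^sub>A (e \<otimes>\<^sub>A a) = e \<otimes>\<^sub>A e \<otimes>\<^sub>A a" using that ec by (simp add: A.m_assoc)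
      then show ?thesis using that ec e(2) by simp
    qed
    \<comment> \<open>The set on which the two maps agree. It is a K-subspace, because a field
      scalar acts on eA through \<open>c e\<close> in the corner, and it contains the spanning
      set.\<close>
    let ?L = "{a \<in> carrier A. \<phi> (e \<otimes>\<^sub>A a) = \<psi> (e \<otimes>\<^sub>A a)}"
    have "subspace K A ?L"
    proof (rule scalar_subspace)
      have "\<zero>\<^sub>A \<in> carrier (corner A e)" using ec by simp
      moreover have "e \<in> carrier ?P" using ec e(2) by simp
      ultimately have "\<phi> \<zero>\<^sub>A = \<zero>\<^sub>N" "\<psi> \<zero>\<^sub>A = \<zero>\<^sub>N"
        using fd(2)[of "\<zero>\<^sub>A" e] fd(4)[of "\<zero>\<^sub>A" e] B.Gr_zero_smult[OF N] lin_homD(1)[OF f(1)] lin_homD(1)[OF f(2)] ec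
        by simp_all
      then show "\<zero>\<^sub>A \<in> ?L" using ec by simp
      show "a \<oplus>\<^sub>A b \<in> ?L" if "a \<in> ?L" "b \<in> ?L" for a b
        using that fd(1)[OF Pc Pc, of a b] fd(3)[OF Pc Pc, of a b] ec by (simp add: A.r_distr)
      show "c \<odot>\<^sub>A a \<in> ?L" if c: "c \<in> carrier K" and a: "a \<in> ?L" for c a
      proof -
        have cb: "c \<odot>\<^sub>A e \<in> carrier (corner A e)" using c ec e(2) by (simp add: smult_mult_left smult_mult_right)
        have "(c \<odot>\<^sub>A e) \<odot>\<^bsub>?P\<^esub> (e \<otimes>\<^sub>A a) = e \<otimes>\<^sub>A (c \<odot>\<^sub>A a)"
          using c a ec e(2) by (simp add: smult_mult_left smult_mult_right A.m_assoc[symmetric])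
        then show ?thesis using fd(2)[OF cb Pc, of a] fd(4)[OF cb Pc, of a] a c by simp
      qed
    qed auto
    moreover have "S \<subseteq> ?L" using onS S(2) by auto
    ultimately have all: "?L = carrier A" using S(3) by blast
    show "\<phi> = \<psi>"
    proof (rule lin_hom_eqI[OF f])
      fix x assume x: "x \<in> carrier ?P"
      then have "x \<in> ?L" using all by simp
      then show "\<phi> x = \<psi> x" using x by simp
    qed
  qed
  interpret full_corner K G A e E u v j by unfold_locales (use e E j in \<open>simp_all add: e_def\<close>)
  show ?thesis using basic corner_equivalence unfolding graded_equivalent_def by blast
  qed
qed

section \<open>Indecomposable projective modules\<close>

lemma (in abelian_group) minus_eqI:
  assumes "x = a \<oplus> b" "a \<in> carrier G" "b \<in> carrier G" shows "x \<ominus> a = b"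
proof -
  have "a \<oplus> b \<oplus> \<ominus> a = b \<oplus> (a \<oplus> \<ominus> a)" using assms by (simp add: a_ac)
  then show ?thesis using assms by (simp add: minus_eq r_neg)
qed

context graded_algebra
begin

text \<open>M is the direct sum of kernel and image of an idempotent endomorphism. With the converse
  below, indecomposability becomes a statement about endomorphisms, which an equivalence can
  see.\<close>

lemma indecomposable_idempotent:
  assumes M: "M \<in> Gr G A" and ind: "gr_indecomposable G A M" and f: "\<phi> \<in> gr_hom G A M M"
    and idem: "\<And>x. x \<in> carrier M \<Longrightarrow> \<phi> (\<phi> x) = \<phi> x"
  shows "(\<forall>x\<in>carrier M. \<phi> x = \<zero>\<^sub>M) \<or> (\<forall>x\<in>carrier M. \<phi> x = x)"
proof -
  interpret M: graded_group G M by (rule Gr_graded_group[OF M])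
  note fd = gr_homD[OF f]
  note f0 = additive_zero[OF M.abelian_group_axioms M.abelian_group_axioms fd(5)]
  let ?K = "{x \<in> carrier M. \<phi> x = \<zero>\<^sub>M}" and ?I = "\<phi> ` carrier M"
  have K: "gr_submodule G A ?K M" using gr_submodule_kernel[OF M M f] .
  have I: "gr_submodule G A ?I M" using gr_submodule_image[OF M M f gr_submodule_carrier[OF M]] .
  have dif: "x \<ominus>\<^sub>M \<phi> x \<in> ?K" if "x \<in> carrier M" for x
    using additive_minus[OF M.abelian_group_axioms M.abelian_group_axioms fd(5) that fd(1)[OF that]] that fd(1)[OF that] idem[OF that]
      M.minus_eq_zero_iff[of "\<phi> x" "\<phi> x"] by simp
  have "?K \<inter> ?I = {\<zero>\<^sub>M}"
  proof
    show "?K \<inter> ?I \<subseteq> {\<zero>\<^sub>M}" using idem by auto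
    show "{\<zero>\<^sub>M} \<subseteq> ?K \<inter> ?I" using gr_submoduleD(5)[OF M K] gr_submoduleD(5)[OF M I] by blast
  qed
  moreover have "?K <+>\<^sub>M ?I = carrier M"
  proof
    show "?K <+>\<^sub>M ?I \<subseteq> carrier M" using fd(1) by (auto simp: set_add_def')
    show "carrier M \<subseteq> ?K <+>\<^sub>M ?I"
    proof
      fix x assume x: "x \<in> carrier M"
      have "x = (x \<ominus>\<^sub>M \<phi> x) \<oplus>\<^sub>M \<phi> x" using x fd(1)[OF x] by (simp add: M.minus_eq M.a_assoc M.l_neg)
      then show "x \<in> ?K <+>\<^sub>M ?I" unfolding set_add_def' using dif[OF x] x by blast
    qed
  qed
  ultimately have "?K = {\<zero>\<^sub>M} \<or> ?I = {\<zero>\<^sub>M}" using ind K I unfolding gr_indecomposable_def by blast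
  then show ?thesis
  proof
    assume "?K = {\<zero>\<^sub>M}"
    then have "x \<ominus>\<^sub>M \<phi> x = \<zero>\<^sub>M" if "x \<in> carrier M" for x using dif[OF that] by blast
    then have "\<phi> x = x" if "x \<in> carrier M" for x using M.minus_eq_zero_iff[OF that fd(1)[OF that]] that by simp
    then show ?thesis by blast
  qed blast
qed

text \<open>A decomposition of M into N and L yields the projection onto N along L as an idempotent
  endomorphism. It is the identity on N and zero on L, so if it is trivial, one summand
  vanishes.\<close>

lemma idempotents_indecomposable:
  assumes M: "M \<in> Gr G A" and nz: "carrier M \<noteq> {\<zero>\<^sub>M}"
    and idem: "\<And>\<phi>. \<lbrakk>\<phi> \<in> gr_hom G A M M; \<And>x. x \<in> carrier M \<Longrightarrow> \<phi> (\<phi> x) = \<phi> x\<rbrakk> \<Longrightarrow>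
      (\<forall>x\<in>carrier M. \<phi> x = \<zero>\<^sub>M) \<or> (\<forall>x\<in>carrier M. \<phi> x = x)"
  shows "gr_indecomposable G A M" unfolding gr_indecomposable_def
proof (intro conjI notI)
  note M' = GrD[OF M]
  interpret M: graded_group G M by (rule M'(1))
  show "carrier M = {\<zero>\<^sub>M} \<Longrightarrow> False" using nz by simp
  assume "\<exists>N\<^sub>1 N\<^sub>2. gr_submodule G A N\<^sub>1 M \<and> gr_submodule G A N\<^sub>2 M \<and> N\<^sub>1 \<noteq> {\<zero>\<^sub>M} \<and> N\<^sub>2 \<noteq> {\<zero>\<^sub>M} \<and>
    N\<^sub>1 \<inter> N\<^sub>2 = {\<zero>\<^sub>M} \<and> N\<^sub>1 <+>\<^sub>M N\<^sub>2 = carrier M"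
  then obtain N L where N: "gr_submodule G A N M" and L: "gr_submodule G A L M" and Nz: "N \<noteq> {\<zero>\<^sub>M}" and Lz: "L \<noteq> {\<zero>\<^sub>M}"
    and int: "N \<inter> L = {\<zero>\<^sub>M}" and sum: "N <+>\<^sub>M L = carrier M" by blast
  note Nd = gr_submoduleD[OF M N] and Ld = gr_submoduleD[OF M L]
  have Nc: "x \<in> carrier M" if "x \<in> N" for x using that Nd(4) by auto
  have Lc: "x \<in> carrier M" if "x \<in> L" for x using that Ld(4) by auto
  have uniq: "n = n'" if n: "n \<in> N" "n' \<in> N" "x \<in> carrier M" "x \<ominus>\<^sub>M n \<in> L" "x \<ominus>\<^sub>M n' \<in> L" for n n' x
  proof -
    have "x \<oplus>\<^sub>M (\<ominus>\<^sub>M n' \<oplus>\<^sub>M \<ominus>\<^sub>M x) = \<ominus>\<^sub>M n'" using n(3) Nc[OF n(2)] by (simp add: M.a_lcomm[of x] M.r_neg)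
    then have "(x \<ominus>\<^sub>M n') \<ominus>\<^sub>M (x \<ominus>\<^sub>M n) = n \<ominus>\<^sub>M n'" using n(3) Nc[OF n(1)] Nc[OF n(2)]
      by (simp add: M.minus_eq M.minus_add M.minus_minus M.a_ac M.r_neg1 M.r_neg2)
    then have "n \<ominus>\<^sub>M n' \<in> L" using Ld(7)[OF n(5,4)] by simp
    then have "n \<ominus>\<^sub>M n' = \<zero>\<^sub>M" using Nd(7)[OF n(1,2)] int by blast
    then show ?thesis using M.minus_eq_zero_iff Nc n by simp
  qed
  have ex: "\<exists>n. n \<in> N \<and> x \<ominus>\<^sub>M n \<in> L" if x: "x \<in> carrier M" for x
  proof -
    obtain n l where nl: "n \<in> N" "l \<in> L" "x = n \<oplus>\<^sub>M l" using x unfolding sum[symmetric] set_add_def' by blast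
    then have "x \<ominus>\<^sub>M n = l" using M.minus_eqI[OF nl(3) Nc[OF nl(1)] Lc[OF nl(2)]] by simp
    then show ?thesis using nl by blast
  qed
  \<comment> \<open>The projection onto N along L. Its value at x is characterized by lying in N and
    differing from x by an element of L; every property of the map is obtained from this through
    \<open>phi_eq\<close>.\<close>
  define \<phi> where "\<phi> = (\<lambda>x\<in>carrier M. SOME n. n \<in> N \<and> x \<ominus>\<^sub>M n \<in> L)"
  have phi: "\<phi> x \<in> N" "x \<ominus>\<^sub>M \<phi> x \<in> L" if "x \<in> carrier M" for x
    using someI_ex[OF ex[OF that]] that by (simp_all add: \<phi>_def)
  have phi_eq: "\<phi> x = n" if "n \<in> N" "x \<ominus>\<^sub>M n \<in> L" "x \<in> carrier M" for x n
    using uniq[OF phi(1)[OF that(3)] that(1,3) phi(2)[OF that(3)] that(2)] .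
  have "\<phi> \<in> gr_hom G A M M"
  proof (rule gr_homI)
    show "\<phi> \<in> extensional (carrier M)" by (simp add: \<phi>_def)
    show "\<phi> x \<in> carrier M" if "x \<in> carrier M" for x using Nc[OF phi(1)[OF that]] .
    show "\<phi> (x \<oplus>\<^sub>M y) = \<phi> x \<oplus>\<^sub>M \<phi> y" if x: "x \<in> carrier M" and y: "y \<in> carrier M" for x y
    proof (rule phi_eq)
      show "\<phi> x \<oplus>\<^sub>M \<phi> y \<in> N" using Nd(6) phi x y by simp
      have "(x \<oplus>\<^sub>M y) \<ominus>\<^sub>M (\<phi> x \<oplus>\<^sub>M \<phi> y) = (x \<ominus>\<^sub>M \<phi> x) \<oplus>\<^sub>M (y \<ominus>\<^sub>M \<phi> y)"
        using x y Nc[OF phi(1)[OF x]] Nc[OF phi(1)[OF y]] by (simp add: M.minus_eq M.minus_add M.a_ac)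
      then show "(x \<oplus>\<^sub>M y) \<ominus>\<^sub>M (\<phi> x \<oplus>\<^sub>M \<phi> y) \<in> L" using Ld(6) phi x y by simp
    qed (use x y in simp)
    show "\<phi> (a \<odot>\<^sub>M x) = a \<odot>\<^sub>M \<phi> x" if a: "a \<in> carrier A" and x: "x \<in> carrier M" for a x
    proof (rule phi_eq)
      show "a \<odot>\<^sub>M \<phi> x \<in> N" using Nd(2)[OF a phi(1)[OF x]] .
      show "a \<odot>\<^sub>M x \<ominus>\<^sub>M a \<odot>\<^sub>M \<phi> x \<in> L"
        using Gr_smult_minus[OF M a x Nc[OF phi(1)[OF x]]] Ld(2)[OF a phi(2)[OF x]] by simp
    qed (use M'(3) a x in simp)
    show "\<phi> x \<in> component M g" if g: "g \<in> carrier G" and x: "x \<in> component M g" for g x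
    proof -
      have xc: "x \<in> carrier M" using M'(9)[OF g x] .
      \<comment> \<open>The component of \<open>\<phi> x\<close> in degree g satisfies the same
        characterization as \<open>\<phi> x\<close>, hence equals it.\<close>
      have "gpr G M (x \<ominus>\<^sub>M \<phi> x) g = x \<ominus>\<^sub>M gpr G M (\<phi> x) g"
        using M.gpr_minus[OF xc Nc[OF phi(1)[OF xc]] g] M.gpr_homogeneous[OF g x g] by simp
      then have "x \<ominus>\<^sub>M gpr G M (\<phi> x) g \<in> L" using Ld(3)[OF phi(2)[OF xc] g] by simp
      then have "\<phi> x = gpr G M (\<phi> x) g" using phi_eq[OF Nd(3)[OF phi(1)[OF xc] g] _ xc] by simp
      then show ?thesis using M.gpr_component[OF Nc[OF phi(1)[OF xc]] g] by simp
    qed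
  qed
  moreover have onN: "\<phi> x = x" if "x \<in> N" for x
    using phi_eq[OF that _ Nc[OF that]] M.minus_eq_zero_iff[of x x] Nc[OF that] Ld(5) by simp
  ultimately consider "\<forall>x\<in>carrier M. \<phi> x = \<zero>\<^sub>M" | "\<forall>x\<in>carrier M. \<phi> x = x" using idem phi(1) by blast
  then show False
  proof cases
    case 1
    then have "N \<subseteq> {\<zero>\<^sub>M}" using onN Nc by auto
    then show False using Nz Nd(5) by blast
  next
    case 2
    have "l \<in> {\<zero>\<^sub>M}" if "l \<in> L" for l using phi(1)[OF Lc[OF that]] 2 Lc[OF that] that int by auto
    then show False using Lz Ld(5) by blast
  qed
qed

text \<open>\<open>Q\<close> is isomorphic to \<open>Af\<close>, with \<open>q\<close> corresponding to \<open>f\<close>.\<close>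

definition generated_by :: "('a, 'm, 'g) graded \<Rightarrow> 'm \<Rightarrow> 'a \<Rightarrow> bool" where
  "generated_by Q q f \<longleftrightarrow> Q \<in> Gr G A \<and> q \<in> component Q \<one>\<^sub>G \<and> f \<odot>\<^sub>Q q = q \<and>
     (\<forall>x\<in>carrier Q. \<exists>b\<in>carrier A. x = b \<odot>\<^sub>Q q) \<and> (\<forall>b\<in>carrier A. b \<odot>\<^sub>Q q = \<zero>\<^sub>Q \<longrightarrow> b \<bullet> f = \<zero>\<^sub>A)"

context
  fixes Q :: "('a, 'm, 'g) graded" and q f
  assumes gen: "generated_by Q q f" and f: "local_idempotent G A f"
begin

lemma generatedD:
  shows "Q \<in> Gr G A" "q \<in> component Q \<one>\<^sub>G" "q \<in> carrier Q" "f \<odot>\<^sub>Q q = q"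
    "\<And>b. \<lbrakk>b \<in> carrier A; b \<odot>\<^sub>Q q = \<zero>\<^sub>Q\<rbrakk> \<Longrightarrow> b \<bullet> f = \<zero>\<^sub>A"
  using gen Gr_component_closed[of Q "\<one>\<^sub>G" q] by (auto simp: generated_by_def)

lemma generated_ex: "x \<in> carrier Q \<Longrightarrow> \<exists>b\<in>carrier A. x = b \<odot>\<^sub>Q q"
  using gen by (simp add: generated_by_def)

lemmas lf = local_idempotentD[OF f]

lemma generated_ex_homogeneous:
  assumes g: "g \<in> carrier G" and x: "x \<in> component Q g" shows "\<exists>b\<in>component A g. x = b \<odot>\<^sub>Q q"
proof -
  interpret Q: graded_group G Q by (rule Gr_graded_group[OF generatedD(1)])
  obtain b where b: "b \<in> carrier A" "x = b \<odot>\<^sub>Q q" using generated_ex Q.component_closed[OF g x] by blast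
  have "x = gpr G Q x g" using Q.gpr_homogeneous[OF g x g] by simp
  also have "\<dots> = gpr G A b g \<odot>\<^sub>Q q" using gpr_smult_right[OF generatedD(1) _ generatedD(2) b(1) g] b(2) g by simp
  finally show ?thesis using AG.gpr_component[OF b(1) g] by blast
qed

lemma generated_eq:
  assumes "b \<in> carrier A" "c \<in> carrier A" "b \<odot>\<^sub>Q q = c \<odot>\<^sub>Q q" shows "b \<bullet> f = c \<bullet> f"
proof -
  interpret Q: graded_group G Q by (rule Gr_graded_group[OF generatedD(1)])
  have "(b \<ominus>\<^sub>A c) \<odot>\<^sub>Q q = \<zero>\<^sub>Q" using Gr_minus_smult[OF generatedD(1) assms(1,2) generatedD(3)] assms generatedD(3)
    by (simp add: Q.minus_eq_zero_iff GrD(3)[OF generatedD(1)])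
  then have "(b \<ominus>\<^sub>A c) \<bullet> f = \<zero>\<^sub>A" using generatedD(5) assms by simp
  then have "b \<bullet> f \<ominus>\<^sub>A c \<bullet> f = \<zero>\<^sub>A" using assms lf(2) by (simp add: A.minus_eq A.l_distr A.l_minus)
  then show ?thesis using assms lf(2) by (simp add: A.minus_eq_zero_iff)
qed

lemma generator_nonzero: "q \<noteq> \<zero>\<^sub>Q"
proof
  assume "q = \<zero>\<^sub>Q"
  then have "\<one>\<^sub>A \<bullet> f = \<zero>\<^sub>A" using generatedD(5)[of "\<one>\<^sub>A"] GrD(7)[OF generatedD(1) generatedD(3)] by simp
  then show False using lf by simp
qed

text \<open>The universal property of Af. If b and c agree on q, then bf = cf, and x = fx gives
  \<open>b \<odot>\<^sub>X x = c \<odot>\<^sub>X x\<close>; so the chosen coefficient does not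
  matter. An x of degree g asks for the shift of X by g, as q has identity degree.\<close>

lemma generated_map:
  assumes X: "X \<in> Gr G A" and g: "g \<in> carrier G" and x: "x \<in> component X g" "f \<odot>\<^sub>X x = x"
  obtains \<phi> where "\<phi> \<in> gr_hom G A Q (shift G g X)" "\<And>b. b \<in> carrier A \<Longrightarrow> \<phi> (b \<odot>\<^sub>Q q) = b \<odot>\<^sub>X x"
proof -
  note Q = GrD[OF generatedD(1)] and X' = GrD[OF X]
  have xc: "x \<in> carrier X" using X'(9)[OF g x(1)] .
  define \<phi> where "\<phi> = (\<lambda>y\<in>carrier Q. (SOME b. b \<in> carrier A \<and> y = b \<odot>\<^sub>Q q) \<odot>\<^sub>X x)"
  have \<phi>: "\<phi> (b \<odot>\<^sub>Q q) = b \<odot>\<^sub>X x" if b: "b \<in> carrier A" for b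
  proof -
    define c where "c = (SOME c. c \<in> carrier A \<and> b \<odot>\<^sub>Q q = c \<odot>\<^sub>Q q)"
    have "\<exists>c. c \<in> carrier A \<and> b \<odot>\<^sub>Q q = c \<odot>\<^sub>Q q" using b by blast
    then have c: "c \<in> carrier A" "b \<odot>\<^sub>Q q = c \<odot>\<^sub>Q q" unfolding c_def by (rule someI2_ex, simp)+
    have "c \<odot>\<^sub>X x = c \<bullet> f \<odot>\<^sub>X x" using X'(6)[OF c(1) lf(2) xc] x(2) by simp
    also have "\<dots> = b \<bullet> f \<odot>\<^sub>X x" using generated_eq[OF b c(1) c(2)] by simp
    also have "\<dots> = b \<odot>\<^sub>X x" using X'(6)[OF b lf(2) xc] x(2) by simp
    finally show ?thesis using Q(3)[OF b generatedD(3)] by (simp add: \<phi>_def c_def)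
  qed
  have "\<phi> \<in> gr_hom G A Q (shift G g X)"
  proof (rule gr_homI)
    show "\<phi> y \<in> carrier (shift G g X)" if "y \<in> carrier Q" for y using generated_ex[OF that] \<phi> X'(3) xc by auto
    show "\<phi> (y \<oplus>\<^sub>Q z) = \<phi> y \<oplus>\<^bsub>shift G g X\<^esub> \<phi> z" if yz: "y \<in> carrier Q" "z \<in> carrier Q" for y z
    proof -
      obtain b c where bc: "b \<in> carrier A" "c \<in> carrier A" "y = b \<odot>\<^sub>Q q" "z = c \<odot>\<^sub>Q q"
        using generated_ex yz by metis
      then have "y \<oplus>\<^sub>Q z = (b \<oplus>\<^sub>A c) \<odot>\<^sub>Q q" using Q(4) generatedD(3) by simp
      then show ?thesis using bc \<phi> X'(4) xc by simp
    qed
    show "\<phi> (a \<odot>\<^sub>Q y) = a \<odot>\<^bsub>shift G g X\<^esub> \<phi> y" if ay: "a \<in> carrier A" "y \<in> carrier Q" for a y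
    proof -
      obtain b where b: "b \<in> carrier A" "y = b \<odot>\<^sub>Q q" using generated_ex ay by metis
      then have "a \<odot>\<^sub>Q y = (a \<bullet> b) \<odot>\<^sub>Q q" using Q(6) ay generatedD(3) by simp
      then show ?thesis using b ay \<phi> X'(6) xc by simp
    qed
    show "\<phi> y \<in> component (shift G g X) h" if h: "h \<in> carrier G" "y \<in> component Q h" for h y
    proof -
      obtain b where "b \<in> component A h" "y = b \<odot>\<^sub>Q q" using generated_ex_homogeneous[OF h] by blast
      then show ?thesis using \<phi> AG.component_closed[OF h(1)] X'(8)[OF h(1) g _ x(1)] h(1) by simp
    qed
  qed (simp add: \<phi>_def)
  then show ?thesis using that \<phi> by blast
qed

text \<open>A graded endomorphism is given by its value bq, where b can be taken in the corner of f
  in identity degree. If the map is idempotent, so is b, and locality leaves only 0 and f.\<close>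

lemma generated_indecomposable: "gr_indecomposable G A Q"
proof (rule idempotents_indecomposable[OF generatedD(1)])
  note Q = GrD[OF generatedD(1)]
  show "carrier Q \<noteq> {\<zero>\<^sub>Q}" using generatedD(3) generator_nonzero by auto
  fix \<phi> assume p: "\<phi> \<in> gr_hom G A Q Q" and idem: "\<And>x. x \<in> carrier Q \<Longrightarrow> \<phi> (\<phi> x) = \<phi> x"
  note pd = gr_homD[OF p]
  obtain c where c: "c \<in> A1" "\<phi> q = c \<odot>\<^sub>Q q"
    using generated_ex_homogeneous[OF _ gr_hom_component[OF p _ generatedD(2)]] by auto
  define b where "b = c \<bullet> f"
  have b: "b \<in> A1" "b \<in> carrier A" "b \<bullet> f = b" "\<phi> q = b \<odot>\<^sub>Q q"
    using c A1_mult[OF c(1) lf(1)] A1_closed[OF c(1)] lf Q(6)[of c f q] generatedD(3,4) by (auto simp: b_def A.m_assoc)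
  have "f \<bullet> b \<bullet> f = b \<bullet> f"
    using generated_eq[of "f \<bullet> b" b] lf b pd(3)[OF lf(2) generatedD(3)] generatedD(3,4) Q(6)[OF lf(2) b(2) generatedD(3)] by simp
  then have fb: "f \<bullet> b = b" using b lf by (simp add: A.m_assoc)
  have "b \<bullet> b \<bullet> f = b \<bullet> f"
    using generated_eq[of "b \<bullet> b" b] b pd(3)[OF b(2) generatedD(3)] idem[OF generatedD(3)] Q(6)[OF b(2) b(2) generatedD(3)] by simp
  then have bb: "b \<bullet> b = b" using b lf by (simp add: A.m_assoc)
  have val: "\<exists>a\<in>carrier A. x = a \<odot>\<^sub>Q q \<and> \<phi> x = a \<odot>\<^sub>Q (b \<odot>\<^sub>Q q)" if "x \<in> carrier Q" for x
    using generated_ex[OF that] pd(3)[OF _ generatedD(3)] b(4) by auto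
  from A1_idempotent_of_local[OF f b(1) bb fb b(3)]
  show "(\<forall>x\<in>carrier Q. \<phi> x = \<zero>\<^sub>Q) \<or> (\<forall>x\<in>carrier Q. \<phi> x = x)"
  proof
    assume "b = \<zero>\<^sub>A"
    then have "\<phi> x = \<zero>\<^sub>Q" if "x \<in> carrier Q" for x
      using val[OF that] Gr_zero_smult[OF generatedD(1) generatedD(3)] Gr_smult_zero[OF generatedD(1)] by auto
    then show ?thesis by blast
  next
    assume "b = f"
    then have "\<phi> x = x" if "x \<in> carrier Q" for x using val[OF that] generatedD(4) by auto
    then show ?thesis by blast
  qed
qed

text \<open>It is enough to lift the image of q. Any preimage is corrected by passing to its
  component in identity degree and multiplying by f.\<close>

lemma generated_projective: "gr_projective G A Q"
  unfolding gr_projective_def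
proof (intro ballI impI)
  fix X Y :: "('a, 'm, 'g) graded" and \<pi> \<phi>
  assume X: "X \<in> Gr G A" and Y: "Y \<in> Gr G A" and p: "\<pi> \<in> gr_hom G A X Y"
    and h: "\<phi> \<in> gr_hom G A Q Y" and surj: "\<pi> ` carrier X = carrier Y"
  note pd = gr_homD[OF p] and hd = gr_homD[OF h] and Q = GrD[OF generatedD(1)]
  interpret X: graded_group G X by (rule Gr_graded_group[OF X])
  interpret Y: graded_group G Y by (rule Gr_graded_group[OF Y])
  have yc: "\<phi> q \<in> component Y \<one>\<^sub>G" using gr_hom_component[OF h _ generatedD(2)] by simp
  have fy: "f \<odot>\<^sub>Y \<phi> q = \<phi> q" using hd(3)[OF lf(2) generatedD(3)] generatedD(4) by simp
  obtain x0 where x0: "x0 \<in> carrier X" "\<pi> x0 = \<phi> q" using surj hd(1)[OF generatedD(3)] by (metis imageE)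
  define x where "x = f \<odot>\<^sub>X gpr G X x0 \<one>\<^sub>G"
  have x: "x \<in> component X \<one>\<^sub>G" "x \<in> carrier X"
    using Gr_component_smult[OF X _ _ lf(1) X.gpr_component[OF x0(1)], of "\<one>\<^sub>G"] X.component_closed[of "\<one>\<^sub>G"]
    by (auto simp: x_def)
  have fx: "f \<odot>\<^sub>X x = x" using Gr_smult_assoc[OF X lf(2) lf(2), of "gpr G X x0 \<one>\<^sub>G"] x0 lf(3) by (simp add: x_def)
  have "\<pi> (gpr G X x0 \<one>\<^sub>G) = \<phi> q"
    using gr_hom_gpr[OF X Y p x0(1), of "\<one>\<^sub>G"] x0(2) Y.gpr_homogeneous[OF _ yc, of "\<one>\<^sub>G"] by simp
  then have px: "\<pi> x = \<phi> q" using pd(3)[OF lf(2), of "gpr G X x0 \<one>\<^sub>G"] x0 fy by (simp add: x_def)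
  obtain \<psi> where s: "\<psi> \<in> gr_hom G A Q (shift G \<one>\<^sub>G X)" "\<And>b. b \<in> carrier A \<Longrightarrow> \<psi> (b \<odot>\<^sub>Q q) = b \<odot>\<^sub>X x"
    using generated_map[OF X _ x(1) fx] by auto
  have "compose (carrier Q) \<pi> \<psi> = \<phi>"
  proof (rule extensionalityI[of _ "carrier Q"])
    fix y assume y: "y \<in> carrier Q"
    then obtain b where b: "b \<in> carrier A" "y = b \<odot>\<^sub>Q q" using generated_ex by blast
    then show "compose (carrier Q) \<pi> \<psi> y = \<phi> y"
      using y s(2)[OF b(1)] pd(3)[OF b(1) x(2)] px hd(3)[OF b(1) generatedD(3)] by (simp add: compose_eq)
  qed (use hd(4) compose_extensional in auto)
  then show "\<exists>\<psi>\<in>gr_hom G A Q X. compose (carrier Q) \<pi> \<psi> = \<phi>" using s(1) by auto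
qed

end

text \<open>The isomorphism and its inverse send the generators to uq' and vq. Their composite fixes
  q, and comparing coefficients gives f = uf'vf.\<close>

lemma generated_iso_factors:
  assumes Q: "generated_by Q q f" "local_idempotent G A f" and Q': "generated_by Q' q' f'" "local_idempotent G A f'"
    and g: "g \<in> carrier G" and iso: "gr_iso G A Q (shift G g Q') \<noteq> {}"
  shows "factors_through G A f f'"
proof -
  note D = generatedD[OF Q] and D' = generatedD[OF Q'] and lf = local_idempotentD[OF Q(2)]
    and lf' = local_idempotentD[OF Q'(2)]
  note M = GrD[OF D(1)] and M' = GrD[OF D'(1)]
  obtain \<phi> where "\<phi> \<in> gr_iso G A Q (shift G g Q')" using iso by blast
  then obtain \<psi> where h: "\<phi> \<in> gr_hom G A Q (shift G g Q')" "\<psi> \<in> gr_hom G A (shift G g Q') Q"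
    "\<And>x. x \<in> carrier Q \<Longrightarrow> \<psi> (\<phi> x) = x" by (rule gr_isoE) blast
  have "\<phi> q \<in> component Q' g" using gr_hom_component[OF h(1) _ D(2)] g by simp
  then obtain u where u: "u \<in> component A g" "\<phi> q = u \<odot>\<^sub>Q' q'" using generated_ex_homogeneous[OF Q' g] by blast
  have "\<psi> q' \<in> component Q (inv\<^bsub>G\<^esub> g)" using gr_hom_component[OF h(2), of "inv\<^bsub>G\<^esub> g" q'] D'(2) g by simp
  then obtain v where v: "v \<in> component A (inv\<^bsub>G\<^esub> g)" "\<psi> q' = v \<odot>\<^sub>Q q"
    using generated_ex_homogeneous[OF Q, of "inv\<^bsub>G\<^esub> g"] g by auto
  have c: "u \<in> carrier A" "v \<in> carrier A" using AG.component_closed[OF g u(1)] AG.component_closed[OF _ v(1)] g by auto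
  have "u \<odot>\<^sub>Q' q' = (u \<bullet> f') \<odot>\<^sub>Q' q'" using M'(6)[OF c(1) lf'(2) D'(3)] D'(4) by simp
  then have "q = \<psi> ((u \<bullet> f') \<odot>\<^sub>Q' q')" using h(3)[OF D(3)] u(2) by simp
  also have "\<dots> = (u \<bullet> f') \<odot>\<^sub>Q (v \<odot>\<^sub>Q q)" using gr_homD(3)[OF h(2), of "u \<bullet> f'" q'] c lf' D'(3) v(2) by simp
  also have "\<dots> = (u \<bullet> f' \<bullet> v) \<odot>\<^sub>Q q" using M(6)[of "u \<bullet> f'" v q] c lf' D(3) by simp
  finally have "f \<odot>\<^sub>Q q = (u \<bullet> f' \<bullet> v) \<odot>\<^sub>Q q" using D(4) by simp
  from generated_eq[OF Q _ _ this] have "f \<bullet> f = u \<bullet> f' \<bullet> v \<bullet> f" using lf(2) lf'(2) c by simp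
  then have "u \<bullet> f' \<bullet> (v \<bullet> f) = f" using lf lf' c by (simp add: A.m_assoc)
  moreover have "v \<bullet> f \<in> component A (inv\<^bsub>G\<^esub> g)" using component_A1_mult[OF _ v(1) lf(1)] g by simp
  ultimately show ?thesis unfolding factors_through_def using g u(1) by blast
qed

end

section \<open>Nilpotence of the graded radical and its action on modules\<close>

context graded_algebra
begin

text \<open>Products of k homogeneous radical elements followed by one homogeneous element. These
  are plain sets of products, not ideals: vanishing need only be known for such products.\<close>

primrec rad_power :: "nat \<Rightarrow> 'a set" where
  "rad_power 0 = (\<Union>g\<in>carrier G. component A g)"
| "rad_power (Suc k) = {a \<bullet> z |a z. (\<exists>g\<in>carrier G. a \<in> component A g) \<and> a \<in> J \<and> z \<in> rad_power k}"

lemma rad_power_homogeneous: "z \<in> rad_power k \<Longrightarrow> \<exists>g\<in>carrier G. z \<in> component A g"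
proof (induction k arbitrary: z)
  case (Suc k)
  then obtain a w g where "g \<in> carrier G" "a \<in> component A g" "w \<in> rad_power k" "z = a \<bullet> w" by auto
  moreover obtain h where "h \<in> carrier G" "w \<in> component A h" using Suc.IH calculation by blast
  ultimately show ?case using component_mult G.m_closed by blast
qed auto

lemma rad_power_closed: "z \<in> rad_power k \<Longrightarrow> z \<in> carrier A"
  using rad_power_homogeneous AG.component_closed by blast

lemma rad_power_mult: "\<lbrakk>z \<in> rad_power k; g \<in> carrier G; b \<in> component A g\<rbrakk> \<Longrightarrow> z \<bullet> b \<in> rad_power k"
proof (induction k arbitrary: z)
  case 0
  then show ?case using component_mult G.m_closed by fastforce
next
  case (Suc k)
  then obtain a w h where a: "h \<in> carrier G" "a \<in> component A h" "a \<in> J" "w \<in> rad_power k" "z = a \<bullet> w" by auto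
  have c: "a \<in> carrier A" "w \<in> carrier A" "b \<in> carrier A"
    using AG.component_closed[OF a(1,2)] rad_power_closed[OF a(4)] AG.component_closed[OF Suc.prems(2,3)] by auto
  have "z \<bullet> b = a \<bullet> (w \<bullet> b)" using a(5) c by (simp add: A.m_assoc)
  moreover have "w \<bullet> b \<in> rad_power k" using Suc.IH[OF a(4) Suc.prems(2,3)] .
  ultimately show ?case using a by auto
qed

text \<open>The last, arbitrary factor times b lies in the radical and becomes one more radical
  factor, with 1 as the new last factor.\<close>

lemma rad_power_mult_radical:
  "\<lbrakk>z \<in> rad_power k; g \<in> carrier G; b \<in> component A g; b \<in> J\<rbrakk> \<Longrightarrow> z \<bullet> b \<in> rad_power (Suc k)"
proof (induction k arbitrary: z)
  case 0
  then obtain h where h: "h \<in> carrier G" "z \<in> component A h" by auto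
  have c: "z \<in> carrier A" "b \<in> carrier A" using AG.component_closed h 0 by auto
  have "z \<bullet> b \<in> J" using radicalD(2)[OF c(1) 0(4)] by simp
  moreover have "z \<bullet> b \<in> component A (h \<otimes>\<^sub>G g)" using component_mult h 0 by simp
  moreover have "z \<bullet> b = (z \<bullet> b) \<bullet> \<one>\<^sub>A" using c by simp
  moreover have "\<one>\<^sub>A \<in> rad_power 0" using one_component by auto
  ultimately show ?case using h 0(2) by (auto simp del: A.r_one)
next
  case (Suc k)
  then obtain a w h where a: "h \<in> carrier G" "a \<in> component A h" "a \<in> J" "w \<in> rad_power k" "z = a \<bullet> w" by auto
  have c: "a \<in> carrier A" "w \<in> carrier A" "b \<in> carrier A"
    using AG.component_closed[OF a(1,2)] rad_power_closed[OF a(4)] AG.component_closed[OF Suc.prems(2,3)] by auto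
  have "z \<bullet> b = a \<bullet> (w \<bullet> b)" using a(5) c by (simp add: A.m_assoc)
  moreover have "w \<bullet> b \<in> rad_power (Suc k)" using Suc.IH[OF a(4) Suc.prems(2-4)] .
  ultimately show ?case using a by (subst rad_power.simps(2)) blast
qed

text \<open>The left ideals generated by \<open>z\<close> and by \<open>az\<close>, with \<open>a\<close> in the radical, are distinct unless
  \<open>z = 0\<close>, which bounds the length of nonzero products.\<close>

lemma rad_power_nilpotent:
  assumes fd: "fin_dim K A" obtains k where "rad_power k \<subseteq> {\<zero>\<^sub>A}"
proof -
  obtain r :: "'a set \<Rightarrow> nat" and m :: nat where r: "\<And>L. r L \<le> m"
    "\<And>L L'. \<lbrakk>subspace K A L; subspace K A L'; L \<subset> L'\<rbrakk> \<Longrightarrow> r L < r L'"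
    using kmodule.rank_exists[OF algebra_kmodule fd] by blast
  define L where "L z = (\<lambda>b. b \<bullet> z) ` carrier A" for z
  have sub: "subspace K A (L z)" if z: "z \<in> carrier A" for z
  proof (rule scalar_subspace)
    show "\<zero>\<^sub>A \<in> L z" unfolding L_def using z by (intro image_eqI[where x = "\<zero>\<^sub>A"]) auto
    show "x \<oplus>\<^sub>A y \<in> L z" if xy: "x \<in> L z" "y \<in> L z" for x y
    proof -
      obtain a b where "a \<in> carrier A" "b \<in> carrier A" "x = a \<bullet> z" "y = b \<bullet> z" using xy by (auto simp: L_def)
      then show ?thesis unfolding L_def using z by (intro image_eqI[where x = "a \<oplus>\<^sub>A b"]) (auto simp: A.l_distr)
    qed
    show "c \<odot>\<^sub>A x \<in> L z" if c: "c \<in> carrier K" and x: "x \<in> L z" for c x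
    proof -
      obtain a where "a \<in> carrier A" "x = a \<bullet> z" using x by (auto simp: L_def)
      then show ?thesis unfolding L_def using z c
        by (intro image_eqI[where x = "c \<odot>\<^sub>A a"]) (auto simp: smult_mult_left)
    qed
  qed (use z in \<open>auto simp: L_def\<close>)
  have bound: "r (L z) + k \<le> m" if "z \<in> rad_power k" "z \<noteq> \<zero>\<^sub>A" for z k using that
  proof (induction k arbitrary: z)
    case 0
    then show ?case using r(1) by simp
  next
    case (Suc k)
    then obtain a w g where a: "g \<in> carrier G" "a \<in> component A g" "a \<in> J" "w \<in> rad_power k" "z = a \<bullet> w" by auto
    obtain h where h: "h \<in> carrier G" "w \<in> component A h" using rad_power_homogeneous[OF a(4)] by blast
    have c: "a \<in> carrier A" "w \<in> carrier A" "z \<in> carrier A"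
      using AG.component_closed[OF a(1,2)] AG.component_closed[OF h] a(5) by auto
    have w0: "w \<noteq> \<zero>\<^sub>A" using Suc.prems(2) a(5) c by auto
    have z: "z \<in> component A (g \<otimes>\<^sub>G h)" using component_mult[OF a(1) h(1) a(2) h(2)] a(5) by simp
    have "w \<notin> L z"
    proof
      assume "w \<in> L z"
      then obtain b where b: "b \<in> carrier A" "w = b \<bullet> z" by (auto simp: L_def)
      \<comment> \<open>Comparing degrees in w = baw, only this component of b contributes. So
        \<open>1 - ya\<close> annihilates w, but it has a left inverse because a is in the
        radical.\<close>
      define y where "y = gpr G A b (inv\<^bsub>G\<^esub> g)"
      have y: "y \<in> component A (inv\<^bsub>G\<^esub> g)" "y \<in> carrier A" using AG.gpr_component b a(1) by (auto simp: y_def)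
      have "w = gpr G A w h" using AG.gpr_homogeneous[OF h(1,2) h(1)] by simp
      also have "\<dots> = gpr G A (b \<bullet> z) (inv\<^bsub>G\<^esub> g \<otimes>\<^sub>G (g \<otimes>\<^sub>G h))"
        using b(2) a(1) h(1) by (simp add: G.m_assoc[symmetric])
      also have "\<dots> = y \<bullet> z"
        using gpr_smult_right[OF regular_Gr, of "g \<otimes>\<^sub>G h" z b "inv\<^bsub>G\<^esub> g"] a(1) h(1) z b(1) by (simp add: y_def)
      finally have "w = y \<bullet> a \<bullet> w" using a(5) y c by (simp add: A.m_assoc)
      then have "w \<ominus>\<^sub>A y \<bullet> a \<bullet> w = \<zero>\<^sub>A" using c y by (simp add: A.minus_eq_zero_iff)
      then have 0: "(\<one>\<^sub>A \<ominus>\<^sub>A y \<bullet> a) \<bullet> w = \<zero>\<^sub>A" using c y by (simp add: A.minus_eq A.l_distr A.l_minus)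
      obtain d where d: "d \<in> carrier A" "d \<bullet> (\<one>\<^sub>A \<ominus>\<^sub>A y \<bullet> a) = \<one>\<^sub>A"
        using radical_homogeneous[OF a(1,2)] a(3) y(1) by blast
      have "w = d \<bullet> (\<one>\<^sub>A \<ominus>\<^sub>A y \<bullet> a) \<bullet> w" using d c by simp
      also have "\<dots> = d \<bullet> ((\<one>\<^sub>A \<ominus>\<^sub>A y \<bullet> a) \<bullet> w)" using d(1) c y by (simp add: A.m_assoc)
      finally show False using 0 d w0 by simp
    qed
    moreover have "w \<in> L w" unfolding L_def using c by (intro image_eqI[where x = "\<one>\<^sub>A"]) auto
    moreover have "L z \<subseteq> L w"
    proof
      fix x assume "x \<in> L z"
      then obtain b where "b \<in> carrier A" "x = b \<bullet> z" by (auto simp: L_def)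
      then have "x = (b \<bullet> a) \<bullet> w" "b \<bullet> a \<in> carrier A" using a(5) c by (auto simp: A.m_assoc)
      then show "x \<in> L w" by (auto simp: L_def)
    qed
    ultimately have "r (L z) < r (L w)" by (intro r(2) sub c) blast
    then show ?case using Suc.IH[OF a(4) w0] by simp
  qed
  have "rad_power (Suc m) \<subseteq> {\<zero>\<^sub>A}" using bound[of _ "Suc m"] by fastforce
  then show ?thesis using that by blast
qed

text \<open>A Nakayama lemma resting on nilpotence: if products of k radical factors still act
  nontrivially on X but products of k + 1 do not, the elements killed by the former form a proper
  submodule that contains JX.\<close>

lemma proper_radical_submodule:
  assumes fd: "fin_dim K A" and X: "X \<in> Gr G A" and ne: "carrier X \<noteq> {\<zero>\<^sub>X}"
  obtains N where "gr_submodule G A N X" "N \<noteq> carrier X"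
    "\<And>g a x. \<lbrakk>g \<in> carrier G; a \<in> component A g; a \<in> J; x \<in> carrier X\<rbrakk> \<Longrightarrow> a \<odot>\<^sub>X x \<in> N"
proof -
  note X' = GrD[OF X]
  interpret X: graded_group G X by (rule X'(1))
  define P where "P k \<longleftrightarrow> (\<exists>z\<in>rad_power k. \<exists>x\<in>carrier X. z \<odot>\<^sub>X x \<noteq> \<zero>\<^sub>X)" for k
  obtain m where m: "rad_power m \<subseteq> {\<zero>\<^sub>A}" using rad_power_nilpotent[OF fd] .
  then have nP: "\<not> P m" using Gr_zero_smult[OF X] by (auto simp: P_def)
  obtain x where x: "x \<in> carrier X" "x \<noteq> \<zero>\<^sub>X" using ne X.zero_closed by blast
  have "P 0" unfolding P_def
  proof (intro bexI)
    show "\<one>\<^sub>A \<odot>\<^sub>X x \<noteq> \<zero>\<^sub>X" using x X'(7) by simp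
  qed (use x one_component in auto)
  \<comment> \<open>The last length at which some product moves X. Length 0 qualifies through the
    unit, and lengths large enough fail by nilpotence.\<close>
  then obtain k where k: "P k" "\<not> P (Suc k)" using nP by (induction m) auto
  define N where "N = {x \<in> carrier X. \<forall>z\<in>rad_power k. z \<odot>\<^sub>X x = \<zero>\<^sub>X}"
  note zc = rad_power_closed
  have "gr_submodule G A N X"
  proof (rule gr_submoduleI[OF X])
    show "a \<odot>\<^sub>X x \<in> N" if a: "g \<in> carrier G" "a \<in> component A g" and x: "x \<in> N" for g a x
    proof -
      have ac: "a \<in> carrier A" and xc: "x \<in> carrier X" using AG.component_closed[OF a] x by (auto simp: N_def)
      have "z \<odot>\<^sub>X (a \<odot>\<^sub>X x) = \<zero>\<^sub>X" if z: "z \<in> rad_power k" for z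
        using rad_power_mult[OF z a] x X'(6)[OF zc[OF z] ac xc] by (simp add: N_def)
      then show ?thesis using X'(3)[OF ac xc] by (simp add: N_def)
    qed
    show "gpr G X x g \<in> N" if x: "x \<in> N" and g: "g \<in> carrier G" for x g
    proof -
      have xc: "x \<in> carrier X" using x by (simp add: N_def)
      have "z \<odot>\<^sub>X gpr G X x g = \<zero>\<^sub>X" if z: "z \<in> rad_power k" for z
      proof -
        obtain h where h: "h \<in> carrier G" "z \<in> component A h" using rad_power_homogeneous[OF z] by blast
        have "z \<odot>\<^sub>X gpr G X x g = gpr G X (z \<odot>\<^sub>X x) (h \<otimes>\<^sub>G g)" using gpr_smult[OF X h xc g] by simp
        then show ?thesis using x z h g by (simp add: N_def)
      qed
      then show ?thesis using xc g by (simp add: N_def)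
    qed
  qed (use zc in \<open>auto simp: N_def Gr_smult_zero[OF X] X'(5)\<close>)
  moreover have "N \<noteq> carrier X" using k(1) by (auto simp: N_def P_def)
  moreover have "a \<odot>\<^sub>X x \<in> N" if a: "g \<in> carrier G" "a \<in> component A g" "a \<in> J" and x: "x \<in> carrier X" for g a x
  proof -
    have ac: "a \<in> carrier A" using AG.component_closed[OF a(1,2)] .
    have "z \<odot>\<^sub>X (a \<odot>\<^sub>X x) = \<zero>\<^sub>X" if z: "z \<in> rad_power k" for z
    proof -
      have "z \<bullet> a \<odot>\<^sub>X x = \<zero>\<^sub>X" using rad_power_mult_radical[OF z a] k(2) x unfolding P_def by blast
      then show ?thesis using X'(6)[OF zc[OF z] ac x] by simp
    qed
    then show ?thesis using X'(3)[OF ac x] by (simp add: N_def)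
  qed
  ultimately show ?thesis by (rule that)
qed

text \<open>A quotient consists of sets. Choosing a representative of each coset copies it back into
  the type of X, where projectivity and the functors can be applied to it.\<close>

lemma quotient_in_universe:
  fixes X :: "('a, 'u, 'g) graded"
  assumes X: "X \<in> Gr G A" and N: "gr_submodule G A N X"
  obtains Y :: "('a, 'u, 'g) graded" and \<pi> where "Y \<in> Gr G A" "\<pi> \<in> gr_hom G A X Y" "\<pi> ` carrier X = carrier Y"
    "\<And>x y. \<lbrakk>x \<in> carrier X; y \<in> carrier X\<rbrakk> \<Longrightarrow> \<pi> x = \<pi> y \<longleftrightarrow> x \<ominus>\<^sub>X y \<in> N"
proof -
  interpret X: graded_group G X by (rule Gr_graded_group[OF X])
  note Q = quotient_Gr[OF X N] and Nd = gr_submoduleD[OF X N]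
  interpret N: abelian_subgroup N X using X.abelian_group_axioms Nd(1) by (intro abelian_subgroupI3)
  let ?Q = "quotient X N"
  define j where "j C = (SOME x. x \<in> C)" for C :: "'u set"
  have jC: "j (N +>\<^sub>X x) \<in> N +>\<^sub>X x" if "x \<in> carrier X" for x
    unfolding j_def using N.a_rcos_self[OF that] by (rule someI)
  have inj: "inj_on j (carrier ?Q)"
  proof (rule inj_onI)
    fix C D assume "C \<in> carrier ?Q" "D \<in> carrier ?Q" and eq: "j C = j D"
    then obtain x y where x: "x \<in> carrier X" "C = N +>\<^sub>X x" and y: "y \<in> carrier X" "D = N +>\<^sub>X y"
      unfolding Q(3) by blast
    have "N +>\<^sub>X x = N +>\<^sub>X j C" "N +>\<^sub>X y = N +>\<^sub>X j D" using N.a_repr_independence'[OF jC] x y by auto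
    then show "C = D" using eq x y by simp
  qed
  define Y where "Y = transport j ?Q"
  note T = transport_Gr[OF Q(1) inj, folded Y_def]
  define \<pi> where "\<pi> = compose (carrier X) (restrict j (carrier ?Q)) (\<lambda>x\<in>carrier X. N +>\<^sub>X x)"
  have \<pi>: "\<pi> x = j (N +>\<^sub>X x)" if "x \<in> carrier X" for x using that Q(3) by (simp add: \<pi>_def compose_eq)
  show ?thesis
  proof (rule that[of Y \<pi>])
    show "\<pi> \<in> gr_hom G A X Y" unfolding \<pi>_def using gr_hom_compose[OF X Q(2) gr_iso_gr_hom[OF T(2)]] .
    have "\<pi> ` carrier X = j ` carrier ?Q" using \<pi> unfolding Q(3) by (auto simp: image_image)
    then show "\<pi> ` carrier X = carrier Y" by (simp add: Y_def transport_def)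
    show "\<pi> x = \<pi> y \<longleftrightarrow> x \<ominus>\<^sub>X y \<in> N" if xy: "x \<in> carrier X" "y \<in> carrier X" for x y
      using inj xy Q(3) Q(4)[OF xy] by (auto simp: \<pi> inj_on_def)
  qed (rule T)
qed

end

section \<open>Classification of the indecomposable projectives\<close>

context graded_algebra
begin

text \<open>Let \<open>y = fy\<close> be homogeneous and outside a proper submodule containing \<open>JX\<close>, and let \<open>N\<close> be a
  maximal such submodule avoiding \<open>y\<close>.  Then \<open>X = N + Ay\<close> and \<open>N \<inter> Ay = Jy\<close>, so that \<open>X/N\<close> is a
  quotient of a shift of \<open>Af\<close>; lifting the projection along it splits \<open>X\<close>.\<close>

lemma indecomposable_projective_iso:
  fixes X :: "('a, 'u, 'g) graded" and Q :: "'a \<Rightarrow> ('a, 'u, 'g) graded" and q :: "'a \<Rightarrow> 'u"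
  assumes E: "basic_set G A E" and fd: "fin_dim K A" and gen: "\<And>f. f \<in> E \<Longrightarrow> generated_by (Q f) (q f) f"
    and X: "X \<in> Gr G A" and ind: "gr_indecomposable G A X" and proj: "gr_projective G A X"
  shows "\<exists>f\<in>E. \<exists>g\<in>carrier G. gr_iso G A X (shift G g (Q f)) \<noteq> {}"
proof -
  note X' = GrD[OF X]
  interpret X: graded_group G X by (rule X'(1))
  note D = basic_idem[OF E]
  note loc = D(2)
  obtain N0 where N0: "gr_submodule G A N0 X" "N0 \<noteq> carrier X"
    "\<And>g a x. \<lbrakk>g \<in> carrier G; a \<in> component A g; a \<in> J; x \<in> carrier X\<rbrakk> \<Longrightarrow> a \<odot>\<^sub>X x \<in> N0"
    using proper_radical_submodule[OF fd X] ind unfolding gr_indecomposable_def by metis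
  have sumE: "x = (\<Oplus>\<^sub>X f\<in>E. f \<odot>\<^sub>X x)" if x: "x \<in> carrier X" for x
  proof -
    have "x = (\<Oplus>\<^sub>A f\<in>E. f) \<odot>\<^sub>X x" using basic_setD(2)[OF E] X'(7)[OF x] by simp
    also have "\<dots> = (\<Oplus>\<^sub>X f\<in>E. f \<odot>\<^sub>X x)" using x D(4) by (intro Gr_finsum_smult[OF X]) auto
    finally show ?thesis .
  qed
  \<comment> \<open>A graded submodule that misses an element misses a homogeneous component of it cut out by some
    \<open>f \<in> E\<close>.\<close>
  have cut: "\<exists>f\<in>E. \<exists>h\<in>carrier G. f \<odot>\<^sub>X gpr G X x h \<notin> L"
    if L: "gr_submodule G A L X" and x: "x \<in> carrier X" "x \<notin> L" for L x
  proof (rule ccontr)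
    note Ld = gr_submoduleD[OF X L]
    assume "\<not> ?thesis"
    then have "f \<odot>\<^sub>X gpr G X x h \<in> L" if "f \<in> E" "h \<in> carrier G" for f h using that by blast
    then have "gpr G X x h \<in> L" if "h \<in> carrier G" for h
      using sumE[of "gpr G X x h"] X.additive_subgroup_finsum[OF Ld(1), of E "\<lambda>f. f \<odot>\<^sub>X gpr G X x h"] that x by simp
    then show False using X.in_subgroupI[OF Ld(1) x(1)] x(2) by blast
  qed
  have cut_props: "f \<odot>\<^sub>X gpr G X x h \<in> component X h" "f \<odot>\<^sub>X (f \<odot>\<^sub>X gpr G X x h) = f \<odot>\<^sub>X gpr G X x h"
    if "f \<in> E" "h \<in> carrier G" "x \<in> carrier X" for f h x
    using X'(8)[OF _ that(2) D(3)[OF that(1)] X.gpr_component[OF that(3,2)]] that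
      X'(6)[of f f "gpr G X x h"] D(4,5)[OF that(1)] by simp_all
  obtain x0 where "x0 \<in> carrier X" "x0 \<notin> N0" using N0(2) gr_submoduleD(4)[OF X N0(1)] by blast
  then obtain f h where f: "f \<in> E" and h: "h \<in> carrier G" and "f \<odot>\<^sub>X gpr G X x0 h \<notin> N0"
    using cut[OF N0(1)] by blast
  then obtain y where y: "y \<in> component X h" "f \<odot>\<^sub>X y = y" "y \<notin> N0"
    using cut_props[OF f h \<open>x0 \<in> carrier X\<close>] by blast
  have yc: "y \<in> carrier X" using X'(9)[OF h y(1)] .
  note lf = local_idempotentD[OF loc[OF f]]
  obtain N where N: "gr_submodule G A N X" "N0 \<subseteq> N" "y \<notin> N"
    and Nmax: "\<And>L. \<lbrakk>gr_submodule G A L X; N \<subset> L\<rbrakk> \<Longrightarrow> y \<in> L"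
    using gr_submodule_maximal_avoiding[OF X N0(1) y(3)] by blast
  note Nd = gr_submoduleD[OF X N(1)]
  have Nc: "x \<in> carrier X" if "x \<in> N" for x using that Nd(4) by auto
  have JN: "a \<odot>\<^sub>X x \<in> N" if "g \<in> carrier G" "a \<in> component A g" "a \<in> J" "x \<in> carrier X" for g a x
    using N0(3)[OF that] N(2) by blast

  \<comment> \<open>The multiples of y inside N come from the radical. Off-diagonal blocks of b are
    in the radical anyway; a diagonal block outside it would have an inverse t, and multiplying by t
    would put y itself into N.\<close>
  have kernel: "b \<bullet> f \<in> J" if b: "b \<in> carrier A" "b \<odot>\<^sub>X y \<in> N" for b
  proof (rule AG.in_subgroupI[OF radical_subgroup])
    show "b \<bullet> f \<in> carrier A" using b lf by simp
    fix g assume g: "g \<in> carrier G"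
    let ?b = "gpr G A b g"
    have bg: "?b \<in> component A g" "?b \<in> carrier A" using b g by (simp_all add: AG.gpr_component)
    have bN: "?b \<odot>\<^sub>X y \<in> N" using gpr_smult_right[OF X h y(1) b(1) g] Nd(3)[OF b(2), of "g \<otimes>\<^sub>G h"] g h by simp
    have "f' \<bullet> ?b \<bullet> f \<in> J" if f': "f' \<in> E" for f'
    proof (cases "f' = f")
      case False
      then show ?thesis using basic_off_diagonal[OF E f' f bg(2)] by simp
    next
      case True
      let ?c = "f \<bullet> ?b \<bullet> f"
      have c: "?c \<in> component A g" "f \<bullet> ?c = ?c" "?c \<bullet> f = ?c"
        using component_A1_mult[OF g A1_component_mult[OF g lf(1) bg(1)] lf(1)] lf bg by (simp_all add: A.m_assoc)
      have "?c \<in> J"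
      proof (rule ccontr)
        assume "?c \<notin> J"
        then obtain t where t: "t \<in> component A (inv\<^bsub>G\<^esub> g)" "t \<bullet> ?c = f"
          using radical_or_unit(2)[OF E f f g c] by blast
        have tc: "t \<in> carrier A" using AG.component_closed[OF _ t(1)] g by simp
        have cy: "?c \<odot>\<^sub>X y = f \<odot>\<^sub>X (?b \<odot>\<^sub>X y)" using X'(6)[of "f \<bullet> ?b" f y] X'(6)[of f ?b y] lf bg yc y(2) by simp
        have "y = (t \<bullet> ?c) \<odot>\<^sub>X y" using t y by simp
        also have "\<dots> = t \<odot>\<^sub>X (?c \<odot>\<^sub>X y)" using X'(6)[OF tc _ yc, of ?c] lf bg by simp
        also have "\<dots> \<in> N" unfolding cy using Nd(2)[OF tc Nd(2)[OF lf(2) bN]] .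
        finally show False using N(3) by simp
      qed
      then show ?thesis using True by simp
    qed
    then have "(\<Oplus>\<^sub>A f'\<in>E. f' \<bullet> (?b \<bullet> f)) \<in> J"
      using D(4) bg lf by (intro A.additive_subgroup_finsum[OF radical_subgroup]) (simp add: A.m_assoc)
    moreover have "(\<Oplus>\<^sub>A f'\<in>E. f' \<bullet> (?b \<bullet> f)) = (\<Oplus>\<^sub>A f'\<in>E. f') \<bullet> (?b \<bullet> f)"
      using D(1,4) bg lf by (intro A.finsum_ldistr[symmetric]) auto
    moreover have "gpr G A (b \<bullet> f) g = ?b \<bullet> f" using gpr_smult_right[OF regular_Gr, of "\<one>\<^sub>G" f b g] lf b g by simp
    ultimately show "gpr G A (b \<bullet> f) g \<in> J" using basic_setD(2)[OF E] bg lf by simp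
  qed

  let ?L = "{n \<oplus>\<^sub>X z |n z. n \<in> N \<and> z \<in> (\<lambda>a. a \<odot>\<^sub>X y) ` carrier A}"
  have L: "gr_submodule G A ?L X" using gr_submodule_sum[OF X N(1) gr_submodule_cyclic[OF X h y(1)]] .
  have NL: "N \<subseteq> ?L"
  proof
    fix n assume "n \<in> N"
    moreover have "n = n \<oplus>\<^sub>X \<zero>\<^sub>A \<odot>\<^sub>X y" using Gr_zero_smult[OF X yc] Nc[OF \<open>n \<in> N\<close>] by simp
    ultimately show "n \<in> ?L" by blast
  qed
  \<comment> \<open>X = N + Ay. Otherwise there is a homogeneous z = f'z outside, and maximality of
    N puts y into N + Az. So y is cz modulo N, with c in the block of f and f'. If c is in the
    radical, then y is in N; if not, c is invertible and z lies in N + Ay after all.\<close>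
  have full: "x \<in> ?L" if x: "x \<in> carrier X" for x
  proof (rule ccontr)
    assume "x \<notin> ?L"
    then obtain f' g where f': "f' \<in> E" and g: "g \<in> carrier G" and zL: "f' \<odot>\<^sub>X gpr G X x g \<notin> ?L"
      using cut[OF L x] by blast
    define z where "z = f' \<odot>\<^sub>X gpr G X x g"
    have z: "z \<in> component X g" "f' \<odot>\<^sub>X z = z" "z \<notin> ?L" using cut_props[OF f' g x] zL by (simp_all add: z_def)
    have zc: "z \<in> carrier X" using X'(9)[OF g z(1)] .
    note lf' = local_idempotentD[OF loc[OF f']]
    let ?M = "{n \<oplus>\<^sub>X w |n w. n \<in> N \<and> w \<in> (\<lambda>a. a \<odot>\<^sub>X z) ` carrier A}"
    have M: "gr_submodule G A ?M X" using gr_submodule_sum[OF X N(1) gr_submodule_cyclic[OF X g z(1)]] .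
    have "n \<in> ?M" if n: "n \<in> N" for n
    proof -
      have "n = n \<oplus>\<^sub>X \<zero>\<^sub>A \<odot>\<^sub>X z" using Gr_zero_smult[OF X zc] Nc[OF n] by simp
      then show ?thesis using n by blast
    qed
    moreover have "z \<in> ?M"
    proof -
      have "z = \<zero>\<^sub>X \<oplus>\<^sub>X \<one>\<^sub>A \<odot>\<^sub>X z" using X'(7)[OF zc] zc by simp
      then show ?thesis using Nd(5) by blast
    qed
    moreover have "z \<notin> N" using z(3) NL by blast
    ultimately have "y \<in> ?M" by (intro Nmax[OF M]) blast
    then obtain n b where nb: "n \<in> N" "b \<in> carrier A" "y = n \<oplus>\<^sub>X b \<odot>\<^sub>X z" by blast
    \<comment> \<open>The degree of a coefficient that takes z, of degree g, to y, of degree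
      h.\<close>
    define k where "k = h \<otimes>\<^sub>G inv\<^bsub>G\<^esub> g"
    have k: "k \<in> carrier G" "k \<otimes>\<^sub>G g = h" using g h by (simp_all add: k_def G.m_assoc)
    let ?b = "gpr G A b k" and ?n = "gpr G X n h"
    have bk: "?b \<in> component A k" "?b \<in> carrier A" using nb k by (simp_all add: AG.gpr_component)
    have n: "?n \<in> N" "?n \<in> carrier X" using Nd(3)[OF nb(1) h] Nc by auto
    have "y = gpr G X (n \<oplus>\<^sub>X b \<odot>\<^sub>X z) h" using X.gpr_homogeneous[OF h y(1) h] nb(3) by simp
    also have "\<dots> = ?n \<oplus>\<^sub>X ?b \<odot>\<^sub>X z"
      using gpr_smult_right[OF X g z(1) nb(2) k(1)] k(2) Nc[OF nb(1)] X'(3)[OF nb(2) zc] h by (simp add: X.gpr_add)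
    finally have ynb: "y = ?n \<oplus>\<^sub>X ?b \<odot>\<^sub>X z" .
    let ?c = "f \<bullet> ?b \<bullet> f'"
    have c: "?c \<in> component A k" "f \<bullet> ?c = ?c" "?c \<bullet> f' = ?c" "?c \<in> carrier A"
      using component_A1_mult[OF k(1) A1_component_mult[OF k(1) lf(1) bk(1)] lf'(1)] lf lf' bk by (simp_all add: A.m_assoc)
    have cz: "?c \<odot>\<^sub>X z = f \<odot>\<^sub>X (?b \<odot>\<^sub>X z)" using X'(6)[of "f \<bullet> ?b" f' z] X'(6)[of f ?b z] lf lf' bk zc z(2) by simp
    have "f \<odot>\<^sub>X y = f \<odot>\<^sub>X ?n \<oplus>\<^sub>X ?c \<odot>\<^sub>X z"
      unfolding cz by (subst ynb) (rule X'(5)[OF lf(2) n(2) X'(3)[OF bk(2) zc]])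
    then have yfn: "y = f \<odot>\<^sub>X ?n \<oplus>\<^sub>X ?c \<odot>\<^sub>X z" using y(2) by simp
    have fn: "f \<odot>\<^sub>X ?n \<in> N" "f \<odot>\<^sub>X ?n \<in> carrier X" using Nd(2)[OF lf(2) n(1)] Nc by auto
    show False
    proof (cases "?c \<in> J")
      case True
      then have "?c \<odot>\<^sub>X z \<in> N" using JN[OF k(1) c(1) _ zc] by simp
      then show False using yfn fn(1) Nd(6) N(3) by metis
    next
      case False
      have ff': "f = f'" using radical_or_unit(1)[OF E f f' k(1) c(1-3) False] .
      obtain t where t: "t \<in> component A (inv\<^bsub>G\<^esub> k)" "t \<bullet> ?c = f"
        using radical_or_unit(2)[OF E f f' k(1) c(1-3) False] by blast
      have tc: "t \<in> carrier A" using AG.component_closed[OF _ t(1)] k by simp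
      have "t \<odot>\<^sub>X y = t \<odot>\<^sub>X (f \<odot>\<^sub>X ?n) \<oplus>\<^sub>X t \<odot>\<^sub>X (?c \<odot>\<^sub>X z)"
        by (subst yfn) (rule X'(5)[OF tc fn(2) X'(3)[OF c(4) zc]])
      also have "t \<odot>\<^sub>X (?c \<odot>\<^sub>X z) = z" using X'(6)[OF tc c(4) zc] t(2) z(2) ff' by simp
      finally have ty: "t \<odot>\<^sub>X y = t \<odot>\<^sub>X (f \<odot>\<^sub>X ?n) \<oplus>\<^sub>X z" .
      have tn: "t \<odot>\<^sub>X (f \<odot>\<^sub>X ?n) \<in> N" "t \<odot>\<^sub>X (f \<odot>\<^sub>X ?n) \<in> carrier X" using Nd(2)[OF tc fn(1)] Nc by auto
      have "z = t \<odot>\<^sub>X y \<ominus>\<^sub>X t \<odot>\<^sub>X (f \<odot>\<^sub>X ?n)" using X.minus_eqI[OF ty tn(2) zc] by simp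
      also have "\<dots> = (\<ominus>\<^sub>X (t \<odot>\<^sub>X (f \<odot>\<^sub>X ?n))) \<oplus>\<^sub>X t \<odot>\<^sub>X y"
        using tn(2) X'(3)[OF tc yc] by (simp add: X.minus_eq X.a_comm)
      finally have "z \<in> ?L" using Nd(8)[OF tn(1)] tc by blast
      then show False using z(3) by simp
    qed
  qed

  obtain Y :: "('a, 'u, 'g) graded" and \<pi> where Y: "Y \<in> Gr G A" "\<pi> \<in> gr_hom G A X Y" "\<pi> ` carrier X = carrier Y"
    "\<And>x y. \<lbrakk>x \<in> carrier X; y \<in> carrier X\<rbrakk> \<Longrightarrow> \<pi> x = \<pi> y \<longleftrightarrow> x \<ominus>\<^sub>X y \<in> N" using quotient_in_universe[OF X N(1)] by blast
  note gf = gen[OF f] loc[OF f]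
  note Qd = generatedD[OF gf] and Q' = GrD[OF generatedD(1)[OF gf]]
  \<comment> \<open>Shifting by the inverse of h gives the generator \<open>q f\<close> degree h, so
    that sending it to y preserves degrees.\<close>
  let ?i = "inv\<^bsub>G\<^esub> h"
  have i: "?i \<in> carrier G" using h by simp
  let ?Q = "shift G ?i (Q f)"
  have QS: "?Q \<in> Gr G A" using shift_Gr(1)[OF Qd(1) i] .
  obtain p where p0: "p \<in> gr_hom G A (Q f) (shift G h X)"
    and p: "\<And>b. b \<in> carrier A \<Longrightarrow> p (b \<odot>\<^bsub>Q f\<^esub> q f) = b \<odot>\<^sub>X y" using generated_map[OF gf X h y(1,2)] by blast
  have "shift G ?i (shift G h X) = X" using shift_shift[OF i h, of X] h by simp
  then have p': "p \<in> gr_hom G A ?Q X" using gr_hom_shift[OF i, of "Q f" "shift G h X"] p0 by simp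
  note pd = gr_homD[OF p']
  let ?\<pi> = "compose (carrier ?Q) \<pi> p"
  have ph: "?\<pi> \<in> gr_hom G A ?Q Y" using gr_hom_compose[OF QS p' Y(2)] .
  have surj: "?\<pi> ` carrier ?Q = carrier Y"
  proof
    show "?\<pi> ` carrier ?Q \<subseteq> carrier Y" using gr_homD(1)[OF ph] by blast
    show "carrier Y \<subseteq> ?\<pi> ` carrier ?Q"
    proof
      fix w assume "w \<in> carrier Y"
      then obtain x where x: "x \<in> carrier X" "w = \<pi> x" using Y(3) by blast
      obtain n b where nb: "n \<in> N" "b \<in> carrier A" "x = n \<oplus>\<^sub>X b \<odot>\<^sub>X y" using full[OF x(1)] by blast
      have bby: "b \<odot>\<^sub>X y \<in> carrier X" using X'(3)[OF nb(2) yc] .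
      have "x = b \<odot>\<^sub>X y \<oplus>\<^sub>X n" using nb(3) bby Nc[OF nb(1)] by (simp add: X.a_comm)
      then have "x \<ominus>\<^sub>X b \<odot>\<^sub>X y = n" using X.minus_eqI bby Nc[OF nb(1)] by blast
      then have "\<pi> x = \<pi> (b \<odot>\<^sub>X y)" using Y(4)[OF x(1) bby] nb(1) by simp
      then have "w = ?\<pi> (b \<odot>\<^bsub>Q f\<^esub> q f)" using x(2) p[OF nb(2)] Q'(3)[OF nb(2) Qd(3)] by (simp add: compose_eq)
      then show "w \<in> ?\<pi> ` carrier ?Q" using Q'(3)[OF nb(2) Qd(3)] by (simp add: image_eqI)
    qed
  qed
  obtain s where s: "s \<in> gr_hom G A X ?Q" "compose (carrier X) ?\<pi> s = \<pi>"
    using proj QS Y(1,2) ph surj unfolding gr_projective_def by blast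
  note sd = gr_homD[OF s(1)]
  have "s y \<in> component (Q f) \<one>\<^sub>G" using gr_hom_component[OF s(1) h y(1)] h by simp
  then obtain c where c: "c \<in> A1" "s y = c \<odot>\<^bsub>Q f\<^esub> q f" using generated_ex_homogeneous[OF gf, of "\<one>\<^sub>G"] by auto
  have cc: "c \<in> carrier A" using A1_closed[OF c(1)] .
  have "\<pi> (p (s y)) = \<pi> y" using fun_cong[OF s(2), of y] yc sd(1)[OF yc] by (simp add: compose_eq)
  then have "p (s y) \<ominus>\<^sub>X y \<in> N" using Y(4)[OF pd(1)[OF sd(1)[OF yc]] yc] by simp
  then have "(c \<ominus>\<^sub>A \<one>\<^sub>A) \<odot>\<^sub>X y \<in> N"
    using c(2) p[OF cc] Gr_minus_smult[OF X cc A.one_closed yc] X'(7)[OF yc] by simp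
  then have cJ: "(c \<ominus>\<^sub>A \<one>\<^sub>A) \<bullet> f \<in> J" using kernel cc by simp
  \<comment> \<open>The value of s at y is cq, and p takes it back to y modulo N; hence
    \<open>(c - 1)f\<close> is in the radical. The compression d = fcf is then congruent to f, so it
    is outside the radical and invertible in the corner.\<close>
  define d where "d = f \<bullet> c \<bullet> f"
  have d: "d \<in> A1" "d \<in> carrier A" "f \<bullet> d = d" "d \<bullet> f = d"
    using A1_mult[OF A1_mult[OF lf(1) c(1)] lf(1)] cc lf by (auto simp: d_def A.m_assoc)
  have sy: "s y = d \<odot>\<^bsub>Q f\<^esub> q f"
  proof -
    have "s y = f \<odot>\<^bsub>Q f\<^esub> (c \<odot>\<^bsub>Q f\<^esub> q f)" using sd(3)[OF lf(2) yc] y(2) c(2) by simp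
    also have "\<dots> = f \<odot>\<^bsub>Q f\<^esub> (c \<odot>\<^bsub>Q f\<^esub> (f \<odot>\<^bsub>Q f\<^esub> q f))" using Qd(4) by simp
    also have "\<dots> = d \<odot>\<^bsub>Q f\<^esub> q f"
      using Q'(6)[of "f \<bullet> c" f "q f"] Q'(6)[of f c "f \<odot>\<^bsub>Q f\<^esub> q f"] Q'(3)[OF lf(2) Qd(3)] lf cc Qd(3) by (simp add: d_def)
    finally show ?thesis .
  qed
  have "f \<bullet> ((c \<ominus>\<^sub>A \<one>\<^sub>A) \<bullet> f) \<in> J" using radicalD(2)[OF lf(2) _] cJ by simp
  moreover have "f \<bullet> ((c \<ominus>\<^sub>A \<one>\<^sub>A) \<bullet> f) = d \<ominus>\<^sub>A f"
    using lf cc by (simp add: d_def A.minus_eq A.l_distr A.r_distr A.l_minus A.r_minus A.m_assoc)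
  ultimately have dfJ: "d \<ominus>\<^sub>A f \<in> J" by simp
  have "d \<notin> J"
  proof
    assume "d \<in> J"
    then have "d \<ominus>\<^sub>A (d \<ominus>\<^sub>A f) \<in> J" using A.additive_subgroup_minus[OF radical_subgroup _ dfJ] by simp
    moreover have "d \<ominus>\<^sub>A (d \<ominus>\<^sub>A f) = f"
      using d lf by (intro A.minus_eqI) (simp_all add: A.minus_eq A.a_assoc A.l_neg)
    ultimately show False using idempotent_not_radical[OF lf(1,3)] lf(4) by simp
  qed
  then obtain t where t: "t \<in> A1" "f \<bullet> t = t" "t \<bullet> d = f"
    using radical_or_unit(2)[OF E f f G.one_closed d(1,3,4)] by auto
  have tc: "t \<in> carrier A" using A1_closed[OF t(1)] .
  \<comment> \<open>The correction of y by the inverse t of d, which s sends exactly to the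
    generator. Sending the generator to \<open>y'\<close> therefore gives a section of s.\<close>
  define y' where "y' = t \<odot>\<^sub>X y"
  have y': "y' \<in> component X h" "y' \<in> carrier X" "f \<odot>\<^sub>X y' = y'"
    using X'(8)[OF _ h t(1) y(1)] h X'(3)[OF tc yc] X'(6)[OF lf(2) tc yc] t(2) by (simp_all add: y'_def)
  have sy': "s y' = q f" using sd(3)[OF tc yc] sy Q'(6)[OF tc d(2) Qd(3)] t(3) Qd(4) by (simp add: y'_def)
  obtain \<psi> where ps0: "\<psi> \<in> gr_hom G A (Q f) (shift G h X)"
    and ps: "\<And>b. b \<in> carrier A \<Longrightarrow> \<psi> (b \<odot>\<^bsub>Q f\<^esub> q f) = b \<odot>\<^sub>X y'" using generated_map[OF gf X h y'(1,3)] by blast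
  have ps': "\<psi> \<in> gr_hom G A ?Q X"
    using gr_hom_shift[OF i, of "Q f" "shift G h X"] ps0 \<open>shift G ?i (shift G h X) = X\<close> by simp
  have sp: "s (\<psi> w) = w" if w: "w \<in> carrier ?Q" for w
  proof -
    obtain b where "b \<in> carrier A" "w = b \<odot>\<^bsub>Q f\<^esub> q f" using generated_ex[OF gf] w by auto
    then show ?thesis using ps sd(3)[OF _ y'(2)] sy' by simp
  qed
  \<comment> \<open>An idempotent endomorphism of X. If it were zero, \<open>y'\<close> and with it
    the generator would vanish; so it is the identity, by indecomposability, and s is an
    isomorphism.\<close>
  let ?\<phi> = "compose (carrier X) \<psi> s"
  have "?\<phi> (?\<phi> x) = ?\<phi> x" if "x \<in> carrier X" for x
    using that sd(1)[OF that] gr_homD(1)[OF ps'] sp by (simp add: compose_eq)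
  then consider "\<forall>x\<in>carrier X. ?\<phi> x = \<zero>\<^sub>X" | "\<forall>x\<in>carrier X. ?\<phi> x = x"
    using indecomposable_idempotent[OF X ind gr_hom_compose[OF X s(1) ps']] by blast
  then have "\<psi> (s x) = x" if "x \<in> carrier X" for x
  proof cases
    case 1
    have "\<psi> (q f) = y'" using ps[of "\<one>\<^sub>A"] Q'(7)[OF Qd(3)] X'(7)[OF y'(2)] by simp
    then have "y' = \<zero>\<^sub>X" using bspec[OF 1 y'(2)] y'(2) sy' by (simp add: compose_eq)
    then have "q f = \<zero>\<^bsub>Q f\<^esub>" using additive_zero[OF X'(2) Gr_abelian_group[OF QS] sd(5)] sy' by simp
    then show ?thesis using generator_nonzero[OF gf] by simp
  qed (use that in \<open>simp add: compose_eq\<close>)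
  then have "s \<in> gr_iso G A X ?Q" using gr_isoI'[OF s(1) ps' _ sp] by blast
  then show ?thesis using f i by blast
qed

end

section \<open>Isomorphisms of endomorphism algebras\<close>

lemma gr_alg_isomorphic_trans:
  assumes AB: "gr_alg_isomorphic K G A B" and BC: "gr_alg_isomorphic K G B C"
  shows "gr_alg_isomorphic K G A C"
proof -
  obtain \<phi> where f: "\<phi> \<in> ring_iso A B" "\<And>c x. \<lbrakk>c \<in> carrier K; x \<in> carrier A\<rbrakk> \<Longrightarrow> \<phi> (c \<odot>\<^sub>A x) = c \<odot>\<^sub>B \<phi> x"
    "\<And>g. g \<in> carrier G \<Longrightarrow> \<phi> ` component A g \<subseteq> component B g" using AB unfolding gr_alg_isomorphic_def by auto
  obtain \<psi> where h: "\<psi> \<in> ring_iso B C" "\<And>c x. \<lbrakk>c \<in> carrier K; x \<in> carrier B\<rbrakk> \<Longrightarrow> \<psi> (c \<odot>\<^sub>B x) = c \<odot>\<^sub>C \<psi> x"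
    "\<And>g. g \<in> carrier G \<Longrightarrow> \<psi> ` component B g \<subseteq> component C g" using BC unfolding gr_alg_isomorphic_def by auto
  have "\<phi> x \<in> carrier B" if "x \<in> carrier A" for x using f(1) that by (auto simp: ring_iso_def ring_hom_def)
  moreover have "\<psi> \<circ> \<phi> \<in> ring_iso A C" using ring_iso_set_trans[OF f(1) h(1)] .
  moreover have "(\<psi> \<circ> \<phi>) ` component A g \<subseteq> component C g" if "g \<in> carrier G" for g using f(3)[OF that] h(3)[OF that] by auto
  ultimately show ?thesis unfolding gr_alg_isomorphic_def using f(2) h(2) by (intro bexI[of _ "\<psi> \<circ> \<phi>"]) auto
qed

lemma gr_alg_isomorphicI:
  assumes b: "bij_betw \<Phi> (carrier A) (carrier B)"
    and m: "\<And>x y. \<lbrakk>x \<in> carrier A; y \<in> carrier A\<rbrakk> \<Longrightarrow> \<Phi> (x \<otimes>\<^sub>A y) = \<Phi> x \<otimes>\<^sub>B \<Phi> y"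
    and a: "\<And>x y. \<lbrakk>x \<in> carrier A; y \<in> carrier A\<rbrakk> \<Longrightarrow> \<Phi> (x \<oplus>\<^sub>A y) = \<Phi> x \<oplus>\<^sub>B \<Phi> y"
    and o: "\<Phi> \<one>\<^sub>A = \<one>\<^sub>B"
    and c: "\<And>c x. \<lbrakk>c \<in> carrier K; x \<in> carrier A\<rbrakk> \<Longrightarrow> \<Phi> (c \<odot>\<^sub>A x) = c \<odot>\<^sub>B \<Phi> x"
    and g: "\<And>g x. \<lbrakk>g \<in> carrier G; x \<in> component A g\<rbrakk> \<Longrightarrow> \<Phi> x \<in> component B g"
  shows "gr_alg_isomorphic K G A B"
proof -
  have "\<Phi> x \<in> carrier B" if "x \<in> carrier A" for x using b that by (auto simp: bij_betw_def)
  then have "\<Phi> \<in> ring_iso A B" using m a o b by (auto simp: ring_iso_def ring_hom_def)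
  then show ?thesis unfolding gr_alg_isomorphic_def using c g by (intro bexI[of _ \<Phi>]) auto
qed

context graded_algebra
begin

text \<open>Right multiplications are the endomorphisms of the regular module, each determined by
  its value at 1. With maps composed from left to right, this is a homomorphism rather than an
  antihomomorphism.\<close>

lemma regular_End: "gr_alg_isomorphic K G A (End_algebra G A (regular A))"
proof (rule gr_alg_isomorphicI)
  let ?R = "regular A"
  have lin: "rmul ?R b \<in> lin_hom A ?R ?R" if b: "b \<in> carrier A" for b
    by (rule lin_homI) (use b in \<open>simp_all add: rmul_def A.l_distr A.m_assoc\<close>)
  show "bij_betw (rmul ?R) (carrier A) (carrier (End_algebra G A ?R))"
  proof (rule bij_betwI[where g = "\<lambda>\<phi>. \<phi> \<one>\<^sub>A"])
    show "rmul ?R \<in> carrier A \<rightarrow> carrier (End_algebra G A ?R)" using lin by simp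
    show "(\<lambda>\<phi>. \<phi> \<one>\<^sub>A) \<in> carrier (End_algebra G A ?R) \<rightarrow> carrier A" using lin_homD(1)[of _ A ?R ?R] by simp
    show "rmul ?R x \<one>\<^sub>A = x" if "x \<in> carrier A" for x using that by (simp add: rmul_def)
    show "rmul ?R (\<phi> \<one>\<^sub>A) = \<phi>" if "\<phi> \<in> carrier (End_algebra G A ?R)" for \<phi>
    proof (rule lin_hom_eqI)
      have p: "\<phi> \<in> lin_hom A ?R ?R" using that by simp
      then show "\<phi> \<in> lin_hom A ?R ?R" .
      show "rmul ?R (\<phi> \<one>\<^sub>A) \<in> lin_hom A ?R ?R" using lin lin_homD(1)[OF p] by simp
      show "rmul ?R (\<phi> \<one>\<^sub>A) x = \<phi> x" if "x \<in> carrier ?R" for x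
        using lin_homD(3)[OF p, of x "\<one>\<^sub>A"] that by (simp add: rmul_def)
    qed
  qed
  show "rmul ?R (x \<bullet> y) = rmul ?R x \<otimes>\<^bsub>End_algebra G A ?R\<^esub> rmul ?R y" if "x \<in> carrier A" "y \<in> carrier A" for x y
    using that by (auto simp: rmul_def compose_def A.m_assoc restrict_def fun_eq_iff)
  show "rmul ?R (x \<oplus>\<^sub>A y) = rmul ?R x \<oplus>\<^bsub>End_algebra G A ?R\<^esub> rmul ?R y" if "x \<in> carrier A" "y \<in> carrier A" for x y
    using that by (auto simp: rmul_def hom_add_def A.r_distr restrict_def fun_eq_iff)
  show "rmul ?R \<one>\<^sub>A = \<one>\<^bsub>End_algebra G A ?R\<^esub>" by (auto simp: rmul_def restrict_def fun_eq_iff)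
  show "rmul ?R (c \<odot>\<^sub>A x) = c \<odot>\<^bsub>End_algebra G A ?R\<^esub> rmul ?R x" if "c \<in> carrier K" "x \<in> carrier A" for c x
    using that by (auto simp: rmul_def hom_smult_def scalars_def smult_mult_left smult_mult_right restrict_def fun_eq_iff)
  show "rmul ?R x \<in> component (End_algebra G A ?R) g" if "g \<in> carrier G" "x \<in> component A g" for g x
    using rmul_gr_hom[OF regular_Gr, of g x] that by (simp add: lin_hom_component_shift)
qed

text \<open>Conjugation by the isomorphism. It respects degrees because a graded morphism M to N is
  also one between the shifts of M and N.\<close>

lemma End_gr_iso:
  assumes M: "M \<in> Gr G A" and N: "N \<in> Gr G A" and "\<alpha> \<in> gr_iso G A M N"
  shows "gr_alg_isomorphic K G (End_algebra G A M) (End_algebra G A N)"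
proof -
  obtain \<beta> where a: "\<alpha> \<in> gr_hom G A M N" and b: "\<beta> \<in> gr_hom G A N M"
    and ba: "\<And>x. x \<in> carrier M \<Longrightarrow> \<beta> (\<alpha> x) = x" and ab: "\<And>y. y \<in> carrier N \<Longrightarrow> \<alpha> (\<beta> y) = y"
    using gr_isoE[OF assms(3)] by blast
  note ad = gr_homD[OF a] and bd = gr_homD[OF b]
  have conj: "(\<lambda>y\<in>carrier N. \<alpha> (\<phi> (\<beta> y))) \<in> gr_hom G A N (shift G g N)"
    if "g \<in> carrier G" "\<phi> \<in> gr_hom G A M (shift G g M)" for \<phi> g
  proof -
    have "\<alpha> \<in> gr_hom G A (shift G g M) (shift G g N)" using a unfolding gr_hom_shift[OF that(1)] .
    then show ?thesis using gr_hom_compose[OF N b gr_hom_compose[OF M that(2), of \<alpha> "shift G g N"]] bd(1)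
      by (simp add: compose_def restrict_def cong: if_cong)
  qed
  have lin: "(\<lambda>y\<in>carrier N. \<alpha> (\<phi> (\<beta> y))) \<in> lin_hom A N N"
    if M: "M \<in> Gr G A" and N: "N \<in> Gr G A" and a: "\<alpha> \<in> gr_hom G A M N" and b: "\<beta> \<in> gr_hom G A N M"
      and "\<phi> \<in> lin_hom A M M" for \<phi> \<alpha> \<beta> and M :: "('a, 'e, 'g) graded" and N :: "('a, 'f, 'g) graded"
    using Gr_lin_hom_compose[OF N gr_hom_lin_hom[OF b] Gr_lin_hom_compose[OF M that(5) gr_hom_lin_hom[OF a]]] gr_homD(1)[OF b]
    by (simp add: compose_def restrict_def cong: if_cong)
  let ?\<Phi> = "\<lambda>\<phi>. \<lambda>y\<in>carrier N. \<alpha> (\<phi> (\<beta> y))" and ?\<Psi> = "\<lambda>\<psi>. \<lambda>x\<in>carrier M. \<beta> (\<psi> (\<alpha> x))"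
  show ?thesis
  proof (rule gr_alg_isomorphicI)
    show "bij_betw ?\<Phi> (carrier (End_algebra G A M)) (carrier (End_algebra G A N))"
    proof (rule bij_betwI[where g = ?\<Psi>])
      show "?\<Phi> \<in> carrier (End_algebra G A M) \<rightarrow> carrier (End_algebra G A N)" using lin[OF M N a b] by simp
      show "?\<Psi> \<in> carrier (End_algebra G A N) \<rightarrow> carrier (End_algebra G A M)" using lin[OF N M b a] by simp
      show "?\<Psi> (?\<Phi> \<phi>) = \<phi>" if "\<phi> \<in> carrier (End_algebra G A M)" for \<phi>
      proof (rule ext)
        fix x
        have p: "\<phi> \<in> lin_hom A M M" using that by simp
        show "?\<Psi> (?\<Phi> \<phi>) x = \<phi> x"
          using lin_homD(1,4)[OF p] ad(1) ba by (cases "x \<in> carrier M") (auto simp: extensional_def)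
      qed
      show "?\<Phi> (?\<Psi> \<psi>) = \<psi>" if "\<psi> \<in> carrier (End_algebra G A N)" for \<psi>
      proof (rule ext)
        fix x
        have p: "\<psi> \<in> lin_hom A N N" using that by simp
        show "?\<Phi> (?\<Psi> \<psi>) x = \<psi> x"
          using lin_homD(1,4)[OF p] bd(1) ab by (cases "x \<in> carrier N") (auto simp: extensional_def)
      qed
    qed
    show "?\<Phi> (\<phi> \<otimes>\<^bsub>End_algebra G A M\<^esub> \<psi>) = ?\<Phi> \<phi> \<otimes>\<^bsub>End_algebra G A N\<^esub> ?\<Phi> \<psi>"
      "?\<Phi> (\<phi> \<oplus>\<^bsub>End_algebra G A M\<^esub> \<psi>) = ?\<Phi> \<phi> \<oplus>\<^bsub>End_algebra G A N\<^esub> ?\<Phi> \<psi>"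
      if "\<phi> \<in> carrier (End_algebra G A M)" "\<psi> \<in> carrier (End_algebra G A M)" for \<phi> \<psi>
    proof -
      have p: "\<phi> \<in> lin_hom A M M" "\<psi> \<in> lin_hom A M M" using that by simp_all
      show "?\<Phi> (\<phi> \<otimes>\<^bsub>End_algebra G A M\<^esub> \<psi>) = ?\<Phi> \<phi> \<otimes>\<^bsub>End_algebra G A N\<^esub> ?\<Phi> \<psi>"
        using lin_homD(1)[OF p(1)] bd(1) ad(1) ba by (auto simp: compose_def restrict_def fun_eq_iff)
      show "?\<Phi> (\<phi> \<oplus>\<^bsub>End_algebra G A M\<^esub> \<psi>) = ?\<Phi> \<phi> \<oplus>\<^bsub>End_algebra G A N\<^esub> ?\<Phi> \<psi>"
        using lin_homD(1)[OF p(1)] lin_homD(1)[OF p(2)] bd(1) ad(2) by (auto simp: hom_add_def restrict_def fun_eq_iff)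
    qed
    show "?\<Phi> \<one>\<^bsub>End_algebra G A M\<^esub> = \<one>\<^bsub>End_algebra G A N\<^esub>" using bd(1) ab by (auto simp: restrict_def fun_eq_iff)
    show "?\<Phi> (c \<odot>\<^bsub>End_algebra G A M\<^esub> \<phi>) = c \<odot>\<^bsub>End_algebra G A N\<^esub> ?\<Phi> \<phi>"
      if "c \<in> carrier K" "\<phi> \<in> carrier (End_algebra G A M)" for c \<phi>
      using that lin_homD(1)[of \<phi> A M M] bd(1) ad(3) by (auto simp: hom_smult_def scalars_def restrict_def fun_eq_iff)
    show "?\<Phi> \<phi> \<in> component (End_algebra G A N) g" if "g \<in> carrier G" "\<phi> \<in> component (End_algebra G A M) g" for g \<phi>
      using conj[OF that(1)] that(2) by (simp add: lin_hom_component_shift)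
  qed
qed

end

text \<open>A direct sum described by inclusions and projections. \<open>direct_sum\<close> consists
  of families and so leaves the universe, whereas this description stays inside it and consists of
  equations between composites and sums of maps, which additive functors preserve.\<close>

definition gr_biproduct :: "'g monoid \<Rightarrow> ('k, 'a, 'g) graded \<Rightarrow> nat
    \<Rightarrow> (nat \<Rightarrow> ('a, 'm, 'g) graded) \<Rightarrow> ('a, 'm, 'g) graded \<Rightarrow> bool" where
  "gr_biproduct G A n P T \<longleftrightarrow>
     (\<exists>\<iota> p. (\<forall>i<n. \<iota> i \<in> gr_hom G A (P i) T \<and> p i \<in> gr_hom G A T (P i)) \<and>
        (\<forall>i<n. \<forall>k<n. \<forall>x\<in>carrier (P i). p k (\<iota> i x) = (if k = i then x else \<zero>\<^bsub>P k\<^esub>)) \<and>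
        (\<forall>x\<in>carrier T. (\<Oplus>\<^sub>T i\<in>{..<n}. \<iota> i (p i x)) = x))"

text \<open>A complete family \<open>P\<^sub>0, \<dots>, P\<^sub>n\<^sub>-\<^sub>1\<close>, together with a module \<open>T \<cong> \<Oplus>P\<^sub>i\<close> whose endomorphism algebra is \<open>D\<close>.\<close>

definition progenerating_family :: "'k ring \<Rightarrow> 'g monoid \<Rightarrow> ('k, 'd, 'g) graded \<Rightarrow> ('k, 'a, 'g) graded \<Rightarrow> nat
    \<Rightarrow> (nat \<Rightarrow> ('a, 'u, 'g) graded) \<Rightarrow> ('a, 'u, 'g) graded \<Rightarrow> bool" where
  "progenerating_family K G D A n P T \<longleftrightarrow>
     (\<forall>i<n. P i \<in> Gr G A \<and> gr_indecomposable G A (P i) \<and> gr_projective G A (P i)) \<and>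
     (\<forall>i<n. \<forall>j<n. \<forall>g\<in>carrier G. i \<noteq> j \<longrightarrow> gr_iso G A (P i) (shift G g (P j)) = {}) \<and>
     (\<forall>Q \<in> (Gr G A :: ('a, 'u, 'g) graded set). gr_indecomposable G A Q \<and> gr_projective G A Q \<longrightarrow>
        (\<exists>i<n. \<exists>g\<in>carrier G. gr_iso G A Q (shift G g (P i)) \<noteq> {})) \<and>
     T \<in> Gr G A \<and> gr_alg_isomorphic K G D (End_algebra G A T) \<and> gr_biproduct G A n P T"

lemma gr_biproductE:
  assumes "gr_biproduct G A n P T"
  obtains \<iota> p where "\<And>i. i < n \<Longrightarrow> \<iota> i \<in> gr_hom G A (P i) T" "\<And>i. i < n \<Longrightarrow> p i \<in> gr_hom G A T (P i)"
    "\<And>i k x. \<lbrakk>i < n; k < n; x \<in> carrier (P i)\<rbrakk> \<Longrightarrow> p k (\<iota> i x) = (if k = i then x else \<zero>\<^bsub>P k\<^esub>)"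
    "\<And>x. x \<in> carrier T \<Longrightarrow> (\<Oplus>\<^sub>T i\<in>{..<n}. \<iota> i (p i x)) = x"
proof -
  from assms obtain \<iota> p where h: "\<forall>i<n. \<iota> i \<in> gr_hom G A (P i) T \<and> p i \<in> gr_hom G A T (P i)"
    "\<forall>i<n. \<forall>k<n. \<forall>x\<in>carrier (P i). p k (\<iota> i x) = (if k = i then x else \<zero>\<^bsub>P k\<^esub>)"
    "\<forall>x\<in>carrier T. (\<Oplus>\<^sub>T i\<in>{..<n}. \<iota> i (p i x)) = x" unfolding gr_biproduct_def by (elim exE conjE)
  show thesis by (rule that[of \<iota> p]) (simp_all add: h)
qed

lemma progenerating_familyD:
  fixes P :: "nat \<Rightarrow> ('a, 'u, 'g) graded" and Q :: "('a, 'u, 'g) graded"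
  assumes "progenerating_family K G D A n P T"
  shows "i < n \<Longrightarrow> P i \<in> Gr G A" "i < n \<Longrightarrow> gr_indecomposable G A (P i)" "i < n \<Longrightarrow> gr_projective G A (P i)"
    "\<lbrakk>i < n; k < n; g \<in> carrier G; i \<noteq> k\<rbrakk> \<Longrightarrow> gr_iso G A (P i) (shift G g (P k)) = {}"
    "\<lbrakk>Q \<in> Gr G A; gr_indecomposable G A Q; gr_projective G A Q\<rbrakk> \<Longrightarrow>
      \<exists>i<n. \<exists>g\<in>carrier G. gr_iso G A Q (shift G g (P i)) \<noteq> {}"
    "T \<in> Gr G A" "gr_alg_isomorphic K G D (End_algebra G A T)" "gr_biproduct G A n P T"
  using assms by (simp_all add: progenerating_family_def)

section \<open>The progenerating family of a gr-basic algebra\<close>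

context graded_algebra
begin

text \<open>Every element is encoded by chosen coordinates with respect to a finite spanning set.
  They need not be unique: coordinates determine the element, and that is injectivity.\<close>

lemma embedding_in_universe:
  assumes fd: "fin_dim K A" and inf: "infinite (UNIV :: 'u set)" and emb: "\<exists>f :: 'k \<Rightarrow> 'u. inj_on f (carrier K)"
  obtains j :: "'a \<Rightarrow> 'u" where "inj_on j (carrier A)"
proof -
  obtain S where S: "finite S" "S \<subseteq> carrier A"
    "\<forall>x\<in>carrier A. \<exists>c \<in> S \<rightarrow> carrier K. x = (\<Oplus>\<^sub>A s\<in>S. c s \<odot>\<^sub>A s)" using fd unfolding fin_dim_def by blast
  then obtain c where c: "\<And>x. x \<in> carrier A \<Longrightarrow> c x \<in> S \<rightarrow> carrier K \<and> x = (\<Oplus>\<^sub>A s\<in>S. c x s \<odot>\<^sub>A s)" by metis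
  obtain ss where ss: "set ss = S" using finite_list[OF S(1)] by blast
  obtain enc :: "'u list \<Rightarrow> 'u" where enc: "\<And>xs ys. \<lbrakk>length xs = length ys; enc xs = enc ys\<rbrakk> \<Longrightarrow> xs = ys"
    using list_encoding[OF inf] by blast
  obtain i :: "'k \<Rightarrow> 'u" where i: "inj_on i (carrier K)" using emb by blast
  have "inj_on (\<lambda>x. enc (map (\<lambda>s. i (c x s)) ss)) (carrier A)"
  proof (rule inj_onI)
    fix x y assume x: "x \<in> carrier A" and y: "y \<in> carrier A"
      and "enc (map (\<lambda>s. i (c x s)) ss) = enc (map (\<lambda>s. i (c y s)) ss)"
    then have "map (\<lambda>s. i (c x s)) ss = map (\<lambda>s. i (c y s)) ss" by (intro enc) simp_all
    then have "i (c x s) = i (c y s)" if "s \<in> S" for s using ss that by auto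
    then have eq: "c x s = c y s" if "s \<in> S" for s
      using inj_onD[OF i] funcset_mem[OF conjunct1[OF c[OF x]] that] funcset_mem[OF conjunct1[OF c[OF y]] that] that by blast
    have "(\<Oplus>\<^sub>A s\<in>S. c x s \<odot>\<^sub>A s) = (\<Oplus>\<^sub>A s\<in>S. c y s \<odot>\<^sub>A s)"
      using eq funcset_mem[OF conjunct1[OF c[OF y]]] S(2) by (intro A.finsum_cong') auto
    then show "x = y" using conjunct2[OF c[OF x]] conjunct2[OF c[OF y]] by simp
  qed
  then show thesis by (rule that)
qed

lemma basic_generators:
  assumes E: "basic_set G A E" and j: "inj_on (j :: 'a \<Rightarrow> 'u) (carrier A)" and f: "f \<in> E"
  defines "T \<equiv> transport j (regular A)"
  shows "generated_by (sub T (j ` (\<lambda>a. a \<bullet> f) ` carrier A)) (j f) f" "gr_submodule G A (j ` (\<lambda>a. a \<bullet> f) ` carrier A) T"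
proof -
  note lf = local_idempotentD[OF basic_idem(2)[OF E f]]
  have jr: "inj_on j (carrier (regular A))" using j by simp
  have T: "T \<in> Gr G A" using transport_Gr(1)[OF regular_Gr jr] by (simp add: T_def)
  have Ts: "component T g = j ` component A g" "\<zero>\<^sub>T = j \<zero>\<^sub>A" for g by (simp_all add: T_def transport_def)
  have sm: "a \<odot>\<^sub>T j b = j (a \<bullet> b)" if "b \<in> carrier A" for a b using that j by (simp add: T_def transport_def)
  have N: "j ` (\<lambda>a. a \<bullet> f) ` carrier A = (\<lambda>a. a \<odot>\<^sub>T j f) ` carrier A" using sm[OF lf(2)] by (simp add: image_image)
  show sub: "gr_submodule G A (j ` (\<lambda>a. a \<bullet> f) ` carrier A) T"
    unfolding N using lf(1) Ts by (intro gr_submodule_cyclic[OF T G.one_closed]) simp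
  show "generated_by (sub T (j ` (\<lambda>a. a \<bullet> f) ` carrier A)) (j f) f" unfolding generated_by_def
  proof (intro conjI ballI impI)
    show "sub T (j ` (\<lambda>a. a \<bullet> f) ` carrier A) \<in> Gr G A" using sub_Gr[OF T sub] .
    have "j f = j (f \<bullet> f)" using lf(3) by simp
    then have "j f \<in> j ` (\<lambda>a. a \<bullet> f) ` carrier A" using lf(2) by blast
    then show "j f \<in> component (sub T (j ` (\<lambda>a. a \<bullet> f) ` carrier A)) \<one>\<^sub>G" using lf(1) by (auto simp: Ts)
    show "f \<odot>\<^bsub>sub T (j ` (\<lambda>a. a \<bullet> f) ` carrier A)\<^esub> j f = j f" using sm[OF lf(2)] lf(3) by simp
    show "\<exists>b\<in>carrier A. x = b \<odot>\<^bsub>sub T (j ` (\<lambda>a. a \<bullet> f) ` carrier A)\<^esub> j f"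
      if "x \<in> carrier (sub T (j ` (\<lambda>a. a \<bullet> f) ` carrier A))" for x using that sm[OF lf(2)] by auto
    show "b \<bullet> f = \<zero>\<^sub>A" if "b \<in> carrier A"
      "b \<odot>\<^bsub>sub T (j ` (\<lambda>a. a \<bullet> f) ` carrier A)\<^esub> j f = \<zero>\<^bsub>sub T (j ` (\<lambda>a. a \<bullet> f) ` carrier A)\<^esub>" for b
      using that sm[OF lf(2)] inj_onD[OF j, of "b \<bullet> f" "\<zero>\<^sub>A"] lf(2) by (simp add: Ts)
  qed
qed

text \<open>T is a copy of the regular module in the universe and \<open>P i\<close> the copy of the
  left ideal of the i-th idempotent inside it.\<close>

lemma basic_progenerating_family:
  assumes E: "basic_set G A E" and fd: "fin_dim K A"
    and inf: "infinite (UNIV :: 'u set)" and emb: "\<exists>f :: 'k \<Rightarrow> 'u. inj_on f (carrier K)"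
  shows "\<exists>n P (T :: ('a, 'u, 'g) graded). progenerating_family K G A A n P T"
proof -
  obtain j :: "'a \<Rightarrow> 'u" where j: "inj_on j (carrier A)" using embedding_in_universe[OF fd inf emb] .
  note D = basic_idem[OF E]
  obtain n and h where h: "bij_betw h {..<n::nat} E" using ex_bij_betw_nat_finite[OF D(1)] by (auto simp: lessThan_atLeast0)
  have hE: "h i \<in> E" if "i < n" for i using h that by (auto simp: bij_betw_def)
  have hA: "h i \<in> carrier A" "h i \<in> A1" if "i < n" for i using D(3,4) hE[OF that] by auto
  have hne: "h i \<noteq> h k" if "i < n" "k < n" "i \<noteq> k" for i k using h that by (auto simp: bij_betw_def inj_on_def)
  define T where "T = transport j (regular A)"
  define N where "N f = j ` (\<lambda>a. a \<bullet> f) ` carrier A" for f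
  define P where "P i = sub T (N (h i))" for i
  note gen = basic_generators(1)[OF E j, folded T_def, folded N_def] and sub = basic_generators(2)[OF E j, folded T_def, folded N_def]
  have jr: "inj_on j (carrier (regular A))" using j by simp
  have T: "T \<in> Gr G A" and jT: "restrict j (carrier A) \<in> gr_iso G A (regular A) T"
    using transport_Gr[OF regular_Gr jr] by (simp_all add: T_def)
  have Ts: "component T g = j ` component A g" "\<zero>\<^sub>T = j \<zero>\<^sub>A" "carrier T = j ` carrier A" for g
    by (simp_all add: T_def transport_def)
  interpret T: graded_group G T using Gr_graded_group[OF T] .
  have add: "j a \<oplus>\<^sub>T j b = j (a \<oplus>\<^sub>A b)" if "a \<in> carrier A" "b \<in> carrier A" for a b
    using that j by (simp add: T_def transport_def)
  have sm: "a \<odot>\<^sub>T j b = j (a \<bullet> b)" if "b \<in> carrier A" for a b using that j by (simp add: T_def transport_def)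
  have g: "generated_by (P i) (j (h i)) (h i)" "local_idempotent G A (h i)" if "i < n" for i
    using gen[OF hE[OF that]] D(2)[OF hE[OF that]] by (simp_all add: P_def)
  \<comment> \<open>The inclusions of the left ideals. The projections below are right
    multiplications by the idempotents, so the biproduct equations are orthogonality and the
    decomposition of the unit.\<close>
  define \<iota> where "\<iota> i = (\<lambda>x\<in>N (h i). x)" for i
  define p where "p i = (\<lambda>x\<in>carrier T. j (inv_into (carrier A) j x \<bullet> h i))" for i
  have pj: "p i (j a) = j (a \<bullet> h i)" if "a \<in> carrier A" for a i using that j by (simp add: p_def Ts)
  have \<iota>: "\<iota> i \<in> gr_hom G A (P i) T" if "i < n" for i
    using gr_submodule_inclusion[OF T sub[OF hE[OF that]]] by (simp add: \<iota>_def P_def)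
  have p: "p i \<in> gr_hom G A T (P i)" if i: "i < n" for i
  proof (rule gr_homI)
    show "p i \<in> extensional (carrier T)" by (simp add: p_def)
    show "p i x \<in> carrier (P i)" if x: "x \<in> carrier T" for x
    proof -
      obtain a where a: "a \<in> carrier A" "x = j a" using x unfolding Ts by blast
      then show ?thesis unfolding a(2) pj[OF a(1)] by (simp add: P_def N_def)
    qed
    show "p i (x \<oplus>\<^sub>T y) = p i x \<oplus>\<^bsub>P i\<^esub> p i y" if x: "x \<in> carrier T" and y: "y \<in> carrier T" for x y
    proof -
      obtain a where "a \<in> carrier A" "x = j a" using x unfolding Ts by blast
      moreover obtain b where "b \<in> carrier A" "y = j b" using y unfolding Ts by blast
      ultimately show ?thesis using hA[OF i] by (simp add: pj add P_def A.l_distr)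
    qed
    show "p i (c \<odot>\<^sub>T x) = c \<odot>\<^bsub>P i\<^esub> p i x" if c: "c \<in> carrier A" and x: "x \<in> carrier T" for c x
    proof -
      obtain a where "a \<in> carrier A" "x = j a" using x unfolding Ts by blast
      then show ?thesis using hA[OF i] c by (simp add: pj sm P_def A.m_assoc)
    qed
    show "p i x \<in> component (P i) g" if g: "g \<in> carrier G" and x: "x \<in> component T g" for g x
    proof -
      obtain a where a: "a \<in> component A g" "x = j a" using x unfolding Ts by blast
      have ac: "a \<in> carrier A" using AG.component_closed[OF g a(1)] .
      have "a \<bullet> h i \<in> component A g" using component_mult[OF g G.one_closed a(1) hA(2)[OF i]] g by simp
      then show ?thesis using ac a(2) by (auto simp: pj P_def N_def Ts)
    qed
  qed
  have pi: "p k (\<iota> i x) = (if k = i then x else \<zero>\<^bsub>P k\<^esub>)" if i: "i < n" and k: "k < n" and x: "x \<in> carrier (P i)" for i k x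
  proof -
    obtain a where a: "a \<in> carrier A" "x = j (a \<bullet> h i)" using x by (auto simp: P_def N_def)
    have "h i \<bullet> h k = (if k = i then h i else \<zero>\<^sub>A)" using D(5)[OF hE[OF i] hE[OF k]] hne[OF i k] by auto
    then have "a \<bullet> h i \<bullet> h k = (if k = i then a \<bullet> h i else \<zero>\<^sub>A)" using a(1) hA(1)[OF i] hA(1)[OF k] by (simp add: A.m_assoc)
    moreover have "p k (\<iota> i x) = j (a \<bullet> h i \<bullet> h k)" using a x hA(1)[OF i] by (simp add: \<iota>_def pj P_def)
    ultimately show ?thesis using a(2) by (simp add: P_def Ts)
  qed
  have sum: "(\<Oplus>\<^sub>T i\<in>{..<n}. \<iota> i (p i x)) = x" if x: "x \<in> carrier T" for x
  proof -
    obtain a where a: "a \<in> carrier A" "x = j a" using x by (auto simp: Ts)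
    have "\<iota> i (p i x) = j (a \<bullet> h i)" for i using a by (auto simp: \<iota>_def pj N_def)
    then have "(\<Oplus>\<^sub>T i\<in>{..<n}. \<iota> i (p i x)) = (\<Oplus>\<^sub>T i\<in>{..<n}. j (a \<bullet> h i))" by simp
    also have "\<dots> = j (\<Oplus>\<^sub>A i\<in>{..<n}. a \<bullet> h i)"
    proof -
      have "additive A T j" using add by (auto simp: additive_def Ts)
      then show ?thesis using a(1) hA(1) by (subst additive_finsum[OF A.abelian_group_axioms T.abelian_group_axioms]) auto
    qed
    also have "(\<Oplus>\<^sub>A i\<in>{..<n}. a \<bullet> h i) = a \<bullet> (\<Oplus>\<^sub>A i\<in>{..<n}. h i)" using a(1) hA(1) by (subst A.finsum_rdistr) auto
    also have "(\<Oplus>\<^sub>A i\<in>{..<n}. h i) = (\<Oplus>\<^sub>A f\<in>h ` {..<n}. f)"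
      using h hA(1) by (subst A.finsum_reindex) (auto simp: bij_betw_def)
    also have "\<dots> = \<one>\<^sub>A" using basic_setD(2)[OF E] h by (simp add: bij_betw_def)
    finally show ?thesis using a by simp
  qed
  have alg: "gr_alg_isomorphic K G A (End_algebra G A T)"
    using gr_alg_isomorphic_trans[OF regular_End End_gr_iso[OF regular_Gr T jT]] .
  have niso: "gr_iso G A (P i) (shift G c (P k)) = {}" if "i < n" "k < n" "c \<in> carrier G" "i \<noteq> k" for i k c
    using generated_iso_factors[OF g[OF that(1)] g[OF that(2)] that(3)] basic_setD(3)[OF E hE[OF that(1)] hE[OF that(2)] hne[OF that(1,2,4)]] by blast
  have cpl: "\<exists>i<n. \<exists>c\<in>carrier G. gr_iso G A X (shift G c (P i)) \<noteq> {}"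
    if X: "X \<in> Gr G A" "gr_indecomposable G A X" "gr_projective G A X" for X :: "('a, 'u, 'g) graded"
  proof -
    obtain f c where "f \<in> E" "c \<in> carrier G" "gr_iso G A X (shift G c (sub T (N f))) \<noteq> {}"
      using indecomposable_projective_iso[OF E fd gen X] by blast
    then show ?thesis using h unfolding P_def bij_betw_def by (metis imageE lessThan_iff)
  qed
  have obj: "P i \<in> Gr G A \<and> gr_indecomposable G A (P i) \<and> gr_projective G A (P i)" if "i < n" for i
    using generatedD(1)[OF g[OF that]] generated_indecomposable[OF g[OF that]] generated_projective[OF g[OF that]] by blast
  have "gr_biproduct G A n P T" unfolding gr_biproduct_def
    by (intro exI[of _ \<iota>] exI[of _ p] conjI allI impI ballI) (fact \<iota> p pi sum)+
  then have "progenerating_family K G A A n P T" unfolding progenerating_family_def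
  proof (intro conjI)
    show "\<forall>i<n. P i \<in> Gr G A \<and> gr_indecomposable G A (P i) \<and> gr_projective G A (P i)" using obj by simp
    show "\<forall>i<n. \<forall>k<n. \<forall>c\<in>carrier G. i \<noteq> k \<longrightarrow> gr_iso G A (P i) (shift G c (P k)) = {}" using niso by simp
  qed (use cpl T alg in simp_all)
  then show ?thesis by blast
qed

lemma cyclic_fin_dim:
  assumes fd: "fin_dim K A" and gen: "Q \<in> Gr G A" and qc: "q \<in> carrier Q"
    and cyc: "\<And>x. x \<in> carrier Q \<Longrightarrow> \<exists>b\<in>carrier A. x = b \<odot>\<^sub>Q q"
  shows "fin_dim K (scalars A Q)"
proof -
  note Q = GrD[OF gen]
  interpret V: kmodule K "scalars A Q" by (rule scalars_kmodule[OF gen])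
  obtain S where S: "finite S" "S \<subseteq> carrier A" "\<And>L. \<lbrakk>subspace K A L; S \<subseteq> L\<rbrakk> \<Longrightarrow> L = carrier A"
    using kmodule.fin_dimD[OF algebra_kmodule fd] by blast
  show ?thesis
  proof (rule V.fin_dimI)
    show "finite ((\<lambda>s. s \<odot>\<^sub>Q q) ` S)" using S(1) by simp
    show "(\<lambda>s. s \<odot>\<^sub>Q q) ` S \<subseteq> carrier (scalars A Q)" using S(2) Q(3) qc by auto
    fix L assume L: "subspace K (scalars A Q) L" "(\<lambda>s. s \<odot>\<^sub>Q q) ` S \<subseteq> L"
    note Ld = V.subspaceD[OF L(1)]
    have "subspace K A {b \<in> carrier A. b \<odot>\<^sub>Q q \<in> L}"
    proof (rule scalar_subspace)
      show "\<zero>\<^sub>A \<in> {b \<in> carrier A. b \<odot>\<^sub>Q q \<in> L}" using Ld(3) Gr_zero_smult[OF gen qc] by simp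
      show "x \<oplus>\<^sub>A y \<in> {b \<in> carrier A. b \<odot>\<^sub>Q q \<in> L}"
        if "x \<in> {b \<in> carrier A. b \<odot>\<^sub>Q q \<in> L}" "y \<in> {b \<in> carrier A. b \<odot>\<^sub>Q q \<in> L}" for x y
        using that Ld(4)[of "x \<odot>\<^sub>Q q" "y \<odot>\<^sub>Q q"] Q(4) qc by simp
      show "c \<odot>\<^sub>A x \<in> {b \<in> carrier A. b \<odot>\<^sub>Q q \<in> L}"
        if c: "c \<in> carrier K" and x: "x \<in> {b \<in> carrier A. b \<odot>\<^sub>Q q \<in> L}" for c x
      proof -
        have "(c \<odot>\<^sub>A x) \<odot>\<^sub>Q q = (c \<odot>\<^sub>A \<one>\<^sub>A) \<odot>\<^sub>Q (x \<odot>\<^sub>Q q)"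
          using c x qc Q(6)[of "c \<odot>\<^sub>A \<one>\<^sub>A" x q] by (simp add: smult_mult_left)
        then show ?thesis using Ld(6)[OF c, of "x \<odot>\<^sub>Q q"] x c by simp
      qed
    qed auto
    moreover have "S \<subseteq> {b \<in> carrier A. b \<odot>\<^sub>Q q \<in> L}" using S(2) L(2) by auto
    ultimately have "{b \<in> carrier A. b \<odot>\<^sub>Q q \<in> L} = carrier A" by (rule S(3))
    then have bL: "b \<odot>\<^sub>Q q \<in> L" if "b \<in> carrier A" for b using that by blast
    show "carrier (scalars A Q) \<subseteq> L"
    proof
      fix x assume "x \<in> carrier (scalars A Q)"
      then obtain b where "b \<in> carrier A" "x = b \<odot>\<^sub>Q q" using cyc by auto
      then show "x \<in> L" using bL by simp
    qed
  qed
qed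

text \<open>By the classification, X is isomorphic to a shift of some Af, hence generated by one
  element over a finite-dimensional algebra. This supplies the finite dimension asked for in
  \<open>complete_gr_projectives\<close> when the module comes out of a functor.\<close>

lemma indecomposable_projective_fin_dim:
  assumes E: "basic_set G A E" and fd: "fin_dim K A"
    and inf: "infinite (UNIV :: 'u set)" and emb: "\<exists>f :: 'k \<Rightarrow> 'u. inj_on f (carrier K)"
    and X: "X \<in> Gr G A" "gr_indecomposable G A X" "gr_projective G A (X :: ('a, 'u, 'g) graded)"
  shows "fin_dim K (scalars A X)"
proof -
  obtain j :: "'a \<Rightarrow> 'u" where j: "inj_on j (carrier A)" using embedding_in_universe[OF fd inf emb] .
  note gen = basic_generators(1)[OF E j]
  obtain f c \<phi> where f: "f \<in> E" "c \<in> carrier G"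
    and phi: "\<phi> \<in> gr_iso G A X (shift G c (sub (transport j (regular A)) (j ` (\<lambda>a. a \<bullet> f) ` carrier A)))"
    using indecomposable_projective_iso[OF E fd gen X] by blast
  note gf = gen[OF f(1)] basic_idem(2)[OF E f(1)]
  obtain \<psi> where psi: "\<And>x. x \<in> carrier X \<Longrightarrow> \<psi> (\<phi> x) = x"
    "\<psi> \<in> gr_hom G A (shift G c (sub (transport j (regular A)) (j ` (\<lambda>a. a \<bullet> f) ` carrier A))) X"
    using gr_isoE[OF phi] by metis
  note pd = gr_homD[OF gr_iso_gr_hom[OF phi]] and sd = gr_homD[OF psi(2)]
  show ?thesis
  proof (rule cyclic_fin_dim[OF fd X(1)])
    show "\<psi> (j f) \<in> carrier X" using sd(1) generatedD(3)[OF gf] by simp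
    show "\<exists>b\<in>carrier A. x = b \<odot>\<^sub>X \<psi> (j f)" if x: "x \<in> carrier X" for x
    proof -
      obtain b where b: "b \<in> carrier A" "\<phi> x = b \<odot>\<^bsub>sub (transport j (regular A)) (j ` (\<lambda>a. a \<bullet> f) ` carrier A)\<^esub> j f"
        using generated_ex[OF gf, of "\<phi> x"] pd(1)[OF x] by auto
      have "x = b \<odot>\<^sub>X \<psi> (j f)"
        using sd(3)[OF b(1), of "j f"] generatedD(3)[OF gf] psi(1)[OF x] unfolding b(2) shift_simps by metis
      then show ?thesis using b(1) by blast
    qed
  qed
qed

end

section \<open>Assembling graded algebra isomorphisms degree by degree\<close>

context graded_algebra
begin

text \<open>Graded rings are determined by the additive groups of their components together with the products
  of homogeneous elements.\<close>

lemma degreewise_isomorphic: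
  fixes R :: "('k, 'r, 'g) graded" and S :: "('k, 's, 'g) graded"
  assumes "ring R" "graded_group G R" and "ring S" "graded_group G S"
    and one: "\<one>\<^sub>R \<in> component R \<one>\<^sub>G"
    and mult: "\<And>g h x y. \<lbrakk>g \<in> carrier G; h \<in> carrier G; x \<in> component R g; y \<in> component R h\<rbrakk> \<Longrightarrow>
      x \<otimes>\<^sub>R y \<in> component R (g \<otimes>\<^sub>G h)"
    and smR: "\<And>c. c \<in> carrier K \<Longrightarrow> additive R R (\<lambda>x. c \<odot>\<^sub>R x)"
      "\<And>c g x. \<lbrakk>c \<in> carrier K; g \<in> carrier G; x \<in> component R g\<rbrakk> \<Longrightarrow> c \<odot>\<^sub>R x \<in> component R g"
    and smS: "\<And>c. c \<in> carrier K \<Longrightarrow> additive S S (\<lambda>x. c \<odot>\<^sub>S x)"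
    and bij: "\<And>g. g \<in> carrier G \<Longrightarrow> bij_betw (\<Phi> g) (component R g) (component S g)"
    and add: "\<And>g x y. \<lbrakk>g \<in> carrier G; x \<in> component R g; y \<in> component R g\<rbrakk> \<Longrightarrow> \<Phi> g (x \<oplus>\<^sub>R y) = \<Phi> g x \<oplus>\<^sub>S \<Phi> g y"
    and mul: "\<And>g h x y. \<lbrakk>g \<in> carrier G; h \<in> carrier G; x \<in> component R g; y \<in> component R h\<rbrakk> \<Longrightarrow>
      \<Phi> (g \<otimes>\<^sub>G h) (x \<otimes>\<^sub>R y) = \<Phi> g x \<otimes>\<^sub>S \<Phi> h y"
    and uno: "\<Phi> \<one>\<^sub>G \<one>\<^sub>R = \<one>\<^sub>S"
    and sm: "\<And>c g x. \<lbrakk>c \<in> carrier K; g \<in> carrier G; x \<in> component R g\<rbrakk> \<Longrightarrow> \<Phi> g (c \<odot>\<^sub>R x) = c \<odot>\<^sub>S \<Phi> g x"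
  shows "gr_alg_isomorphic K G R S"
proof -
  interpret R: ring R by fact
  interpret S: ring S by fact
  interpret R: graded_group G R by fact
  interpret S: graded_group G S by fact
  have Pc: "\<Phi> g x \<in> component S g" "\<Phi> g x \<in> carrier S" if "g \<in> carrier G" "x \<in> component R g" for g x
    using bij[OF that(1)] that S.component_closed[OF that(1)] by (auto simp: bij_betw_def)
  have zR: "\<zero>\<^sub>R \<in> component R g" if "g \<in> carrier G" for g
    using additive_subgroupD(2)[OF R.component_subgroup[OF that]] .
  have P0: "\<Phi> g \<zero>\<^sub>R = \<zero>\<^sub>S" if g: "g \<in> carrier G" for g
    using add[OF g zR[OF g] zR[OF g]] Pc(2)[OF g zR[OF g]] S.minus_eqI[of "\<Phi> g \<zero>\<^sub>R"]
      S.minus_eq_zero_iff[of "\<Phi> g \<zero>\<^sub>R" "\<Phi> g \<zero>\<^sub>R"] by simp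
  \<comment> \<open>The additive extension of the maps given in each degree. Its component in degree
    g is \<open>\<Phi> g\<close> of the component, so bijectivity reduces to single degrees.\<close>
  define \<Psi> where "\<Psi> x = (\<Oplus>\<^sub>S g\<in>carrier G. \<Phi> g (gpr G R x g))" for x
  have Pg: "\<Phi> g (gpr G R x g) \<in> carrier S" if "g \<in> carrier G" "x \<in> carrier R" for g x
    using Pc(2)[OF that(1) R.gpr_component[OF that(2,1)]] .
  have add': "additive R S \<Psi>" unfolding additive_def
  proof (intro conjI ballI)
    show "\<Psi> \<in> carrier R \<rightarrow> carrier S" using Pg by (auto simp: \<Psi>_def intro!: S.finsum_closed)
    show "\<Psi> (x \<oplus>\<^sub>R y) = \<Psi> x \<oplus>\<^sub>S \<Psi> y" if "x \<in> carrier R" "y \<in> carrier R" for x y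
    proof -
      have "\<Psi> (x \<oplus>\<^sub>R y) = (\<Oplus>\<^sub>S g\<in>carrier G. \<Phi> g (gpr G R x g) \<oplus>\<^sub>S \<Phi> g (gpr G R y g))"
        unfolding \<Psi>_def using that Pg add R.gpr_component by (intro S.finsum_cong') (auto simp: R.gpr_add)
      also have "\<dots> = \<Psi> x \<oplus>\<^sub>S \<Psi> y" unfolding \<Psi>_def using Pg that by (intro S.finsum_addf) auto
      finally show ?thesis .
    qed
  qed
  have cl: "\<Psi> x \<in> carrier S" if "x \<in> carrier R" for x using add' that by (auto simp: additive_def)
  have hom: "\<Psi> x = \<Phi> g x" if g: "g \<in> carrier G" and x: "x \<in> component R g" for g x
  proof -
    have "\<Psi> x = \<Phi> g (gpr G R x g)"
      unfolding \<Psi>_def using g x finite_group P0 Pc by (intro S.finsum_eq_single) (simp_all add: R.gpr_homogeneous)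
    then show ?thesis using R.gpr_homogeneous[OF g x g] by simp
  qed
  have comp: "gpr G S (\<Psi> x) g = \<Phi> g (gpr G R x g)" if "x \<in> carrier R" "g \<in> carrier G" for x g
    unfolding \<Psi>_def using that Pc(1) R.gpr_component by (intro S.gpr_unique) auto
  show ?thesis
  proof (rule gr_alg_isomorphicI[where \<Phi> = \<Psi>])
    show "bij_betw \<Psi> (carrier R) (carrier S)" unfolding bij_betw_def
    proof (intro conjI inj_onI equalityI subsetI)
      fix x y assume xy: "x \<in> carrier R" "y \<in> carrier R" "\<Psi> x = \<Psi> y"
      show "x = y"
      proof (rule R.gpr_eqI[OF xy(1,2)])
        fix g assume g: "g \<in> carrier G"
        then show "gpr G R x g = gpr G R y g"
          using comp[OF xy(1) g] comp[OF xy(2) g] xy(3) inj_onD[OF bij_betw_imp_inj_on[OF bij[OF g]]]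
            R.gpr_component[OF xy(1) g] R.gpr_component[OF xy(2) g] by simp
      qed
    next
      fix y assume y: "y \<in> carrier S"
      define f where "f g = inv_into (component R g) (\<Phi> g) (gpr G S y g)" for g
      have f: "f g \<in> component R g" "\<Phi> g (f g) = gpr G S y g" if g: "g \<in> carrier G" for g
        using S.gpr_component[OF y g] bij[OF g] inv_into_into[of "gpr G S y g" "\<Phi> g" "component R g"]
          f_inv_into_f[of "gpr G S y g" "\<Phi> g" "component R g"] by (simp_all add: f_def bij_betw_def)
      let ?x = "\<Oplus>\<^sub>R g\<in>carrier G. f g"
      have x: "?x \<in> carrier R" using f(1) R.component_closed by (intro R.finsum_closed) auto
      have "\<Psi> ?x = y"
      proof (rule S.gpr_eqI[OF cl[OF x] y])
        show "gpr G S (\<Psi> ?x) g = gpr G S y g" if "g \<in> carrier G" for g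
          using comp[OF x that] R.gpr_unique[of f g] f that by simp
      qed
      then show "y \<in> \<Psi> ` carrier R" using x by blast
    qed (use cl in auto)
    \<comment> \<open>Multiplicativity is extended from homogeneous elements one factor at a time:
      here y is homogeneous and x arbitrary, and then the second factor is freed.\<close>
    have hm: "\<Psi> (x \<otimes>\<^sub>R y) = \<Psi> x \<otimes>\<^sub>S \<Psi> y" if x: "x \<in> carrier R" and h: "h \<in> carrier G" and y: "y \<in> component R h" for x y h
    proof (rule additive_eq_homogeneous[OF R.graded_group_axioms S.abelian_group_axioms, of "\<lambda>x. \<Psi> (x \<otimes>\<^sub>R y)" "\<lambda>x. \<Psi> x \<otimes>\<^sub>S \<Psi> y", OF _ _ _ x])
      have yc: "y \<in> carrier R" using R.component_closed[OF h y] .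
      show "additive R S (\<lambda>x. \<Psi> (x \<otimes>\<^sub>R y))" "additive R S (\<lambda>x. \<Psi> x \<otimes>\<^sub>S \<Psi> y)"
        using add' yc by (auto simp: additive_def R.l_distr S.l_distr Pi_def)
      show "\<Psi> (x \<otimes>\<^sub>R y) = \<Psi> x \<otimes>\<^sub>S \<Psi> y" if "g \<in> carrier G" "x \<in> component R g" for g x
        using hom[OF _ mult[OF that(1) h that(2) y]] hom[OF that] hom[OF h y] mul[OF that(1) h that(2) y] that(1) h by simp
    qed
    show "\<Psi> (x \<otimes>\<^sub>R y) = \<Psi> x \<otimes>\<^sub>S \<Psi> y" if x: "x \<in> carrier R" and y: "y \<in> carrier R" for x y
    proof (rule additive_eq_homogeneous[OF R.graded_group_axioms S.abelian_group_axioms, of "\<lambda>y. \<Psi> (x \<otimes>\<^sub>R y)" "\<lambda>y. \<Psi> x \<otimes>\<^sub>S \<Psi> y", OF _ _ _ y])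
      show "additive R S (\<lambda>y. \<Psi> (x \<otimes>\<^sub>R y))" "additive R S (\<lambda>y. \<Psi> x \<otimes>\<^sub>S \<Psi> y)"
        using add' x by (auto simp: additive_def R.r_distr S.r_distr Pi_def)
    qed (rule hm[OF x])
    show "\<Psi> (x \<oplus>\<^sub>R y) = \<Psi> x \<oplus>\<^sub>S \<Psi> y" if "x \<in> carrier R" "y \<in> carrier R" for x y
      using add' that by (simp add: additive_def)
    show "\<Psi> \<one>\<^sub>R = \<one>\<^sub>S" using hom[OF G.one_closed one] uno by simp
    show "\<Psi> (c \<odot>\<^sub>R x) = c \<odot>\<^sub>S \<Psi> x" if c: "c \<in> carrier K" and x: "x \<in> carrier R" for c x
    proof (rule additive_eq_homogeneous[OF R.graded_group_axioms S.abelian_group_axioms, of "\<lambda>x. \<Psi> (c \<odot>\<^sub>R x)" "\<lambda>x. c \<odot>\<^sub>S \<Psi> x", OF _ _ _ x])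
      show "additive R S (\<lambda>x. \<Psi> (c \<odot>\<^sub>R x))" "additive R S (\<lambda>x. c \<odot>\<^sub>S \<Psi> x)"
        using add' smR(1)[OF c] smS[OF c] by (auto simp: additive_def Pi_def)
      show "\<Psi> (c \<odot>\<^sub>R x) = c \<odot>\<^sub>S \<Psi> x" if "g \<in> carrier G" "x \<in> component R g" for g x
        using hom[OF that(1) smR(2)[OF c that]] hom[OF that] sm[OF c that] by simp
    qed
    show "\<Psi> x \<in> component S g" if "g \<in> carrier G" "x \<in> component R g" for g x using hom[OF that] Pc(1)[OF that] by simp
  qed
qed

lemma End_smult:
  assumes M: "M \<in> Gr G A" and c: "c \<in> carrier K"
  shows "additive (End_algebra G A M) (End_algebra G A M) (\<lambda>x. c \<odot>\<^bsub>End_algebra G A M\<^esub> x)"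
    and "\<lbrakk>g \<in> carrier G; \<phi> \<in> lin_hom_component G A M M g\<rbrakk> \<Longrightarrow> hom_smult A M M c \<phi> \<in> lin_hom_component G A M M g"
proof -
  note M' = GrD[OF M]
  have c1: "c \<odot>\<^sub>A \<one>\<^sub>A \<in> component A \<one>\<^sub>G" using component_smult[OF c G.one_closed one_component] .
  then have cA: "c \<odot>\<^sub>A \<one>\<^sub>A \<in> carrier A" using A1_closed by blast
  show "additive (End_algebra G A M) (End_algebra G A M) (\<lambda>x. c \<odot>\<^bsub>End_algebra G A M\<^esub> x)" unfolding additive_def
  proof (intro conjI ballI)
    show "(\<lambda>x. c \<odot>\<^bsub>End_algebra G A M\<^esub> x) \<in> carrier (End_algebra G A M) \<rightarrow> carrier (End_algebra G A M)"
      using hom_smult_lin_hom[OF M M _ c] by simp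
    fix x y assume "x \<in> carrier (End_algebra G A M)" "y \<in> carrier (End_algebra G A M)"
    then show "c \<odot>\<^bsub>End_algebra G A M\<^esub> (x \<oplus>\<^bsub>End_algebra G A M\<^esub> y) =
        c \<odot>\<^bsub>End_algebra G A M\<^esub> x \<oplus>\<^bsub>End_algebra G A M\<^esub> c \<odot>\<^bsub>End_algebra G A M\<^esub> y"
      using lin_homD(1)[of x A M M] lin_homD(1)[of y A M M] M'(5)[OF cA]
      by (auto simp: hom_smult_def hom_add_def scalars_def restrict_def fun_eq_iff)
  qed
  show "hom_smult A M M c \<phi> \<in> lin_hom_component G A M M g" if g: "g \<in> carrier G" and "\<phi> \<in> lin_hom_component G A M M g"
  proof -
    have p: "\<phi> \<in> lin_hom A M M" "\<And>h. h \<in> carrier G \<Longrightarrow> \<phi> ` component M h \<subseteq> component M (h \<otimes>\<^sub>G g)"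
      using that(2) by (auto simp: lin_hom_component_def)
    have "hom_smult A M M c \<phi> x \<in> component M (h \<otimes>\<^sub>G g)" if h: "h \<in> carrier G" and x: "x \<in> component M h" for h x
      using M'(8)[OF G.one_closed G.m_closed[OF h g] c1, of "\<phi> x"] p(2)[OF h] x h g M'(9)[OF h x]
      by (auto simp: hom_smult_def scalars_def)
    then show ?thesis using hom_smult_lin_hom[OF M M p(1) c] by (auto simp: lin_hom_component_def)
  qed
qed

text \<open>A map of degree h is equally a morphism from the shift of M by g to the shift by gh.
  Products of homogeneous endomorphisms thereby become composites in the category of graded
  modules.\<close>

lemma End_component_mult:
  assumes M: "M \<in> Gr G A" and g: "g \<in> carrier G" and h: "h \<in> carrier G"
    and f: "\<phi> \<in> gr_hom G A M (shift G g M)" and f': "\<psi> \<in> gr_hom G A M (shift G h M)"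
  shows "\<psi> \<in> gr_hom G A (shift G g M) (shift G (g \<otimes>\<^sub>G h) M)" "compose (carrier M) \<psi> \<phi> \<in> gr_hom G A M (shift G (g \<otimes>\<^sub>G h) M)"
proof -
  have "\<psi> \<in> gr_hom G A (shift G g M) (shift G g (shift G h M))" using f' unfolding gr_hom_shift[OF g] .
  then show p: "\<psi> \<in> gr_hom G A (shift G g M) (shift G (g \<otimes>\<^sub>G h) M)" unfolding shift_shift[OF g h] .
  show "compose (carrier M) \<psi> \<phi> \<in> gr_hom G A M (shift G (g \<otimes>\<^sub>G h) M)" using gr_hom_compose[OF M f p] .
qed

end

lemma (in graded_algebra) hom_add_gr_hom:
  assumes M: "M \<in> Gr G A" and N: "N \<in> Gr G A" and f: "\<phi> \<in> gr_hom G A M N" "\<psi> \<in> gr_hom G A M N"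
  shows "hom_add M N \<phi> \<psi> \<in> gr_hom G A M N"
proof -
  interpret N: graded_group G N using Gr_graded_group[OF N] .
  have "hom_add M N \<phi> \<psi> x \<in> component N g" if g: "g \<in> carrier G" and x: "x \<in> component M g" for g x
    using additive_subgroupD(3)[OF N.component_subgroup[OF g] gr_hom_component[OF f(1) g x] gr_hom_component[OF f(2) g x]]
      Gr_component_closed[OF M g x] by (simp add: hom_add_def)
  then show ?thesis using hom_add_lin_hom[OF N M gr_hom_lin_hom[OF f(1)] gr_hom_lin_hom[OF f(2)]] by (auto simp: gr_hom_def)
qed

text \<open>An equivalence with its inverse and both natural isomorphisms as explicit parameters and
  naturality stated pointwise. The data are symmetric in the two algebras.\<close>

locale module_equivalence = A: graded_algebra K G A + B: graded_algebra K G B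
  for K :: "'k ring" and G :: "'g monoid" and A :: "('k, 'a, 'g) graded" and B :: "('k, 'b, 'g) graded" +
  fixes F :: "('a, 'b, 'u, 'g) functor_data" and V :: "('b, 'a, 'u, 'g) functor_data"
    and \<eta> :: "('a, 'u, 'g) graded \<Rightarrow> 'u \<Rightarrow> 'u" and \<epsilon> :: "('b, 'u, 'g) graded \<Rightarrow> 'u \<Rightarrow> 'u"
  assumes F: "graded_functor K G A B F" and V: "graded_functor K G B A V"
    and eta: "\<And>M. M \<in> Gr G A \<Longrightarrow> \<eta> M \<in> gr_iso G A (fobj V (fobj F M)) M"
    and eta_nat: "\<And>M N \<phi> x. \<lbrakk>M \<in> Gr G A; N \<in> Gr G A; \<phi> \<in> gr_hom G A M N; x \<in> carrier (fobj V (fobj F M))\<rbrakk> \<Longrightarrow>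
      \<eta> N (fmap V (fobj F M) (fobj F N) (fmap F M N \<phi>) x) = \<phi> (\<eta> M x)"
    and eps: "\<And>M. M \<in> Gr G B \<Longrightarrow> \<epsilon> M \<in> gr_iso G B (fobj F (fobj V M)) M"
    and eps_nat: "\<And>M N \<phi> x. \<lbrakk>M \<in> Gr G B; N \<in> Gr G B; \<phi> \<in> gr_hom G B M N; x \<in> carrier (fobj F (fobj V M))\<rbrakk> \<Longrightarrow>
      \<epsilon> N (fmap F (fobj V M) (fobj V N) (fmap V M N \<phi>) x) = \<phi> (\<epsilon> M x)"

lemma graded_equivalentE:
  fixes A :: "('k, 'a, 'g) graded" and B :: "('k, 'b, 'g) graded"
  assumes "graded_equivalent TYPE('u) K G A B" "graded_algebra K G A" "graded_algebra K G B"
  obtains F V \<eta> and \<epsilon> :: "('b, 'u, 'g) graded \<Rightarrow> 'u \<Rightarrow> 'u" where "module_equivalence K G A B F V \<eta> \<epsilon>"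
proof -
  obtain F :: "('a, 'b, 'u, 'g) functor_data" and V where FV: "graded_functor K G A B F" "graded_functor K G B A V"
    and n: "gr_naturally_isomorphic G A A (comp_functor V F) id_functor" "gr_naturally_isomorphic G B B (comp_functor F V) id_functor"
    using assms(1) unfolding graded_equivalent_def graded_equivalence_def by blast
  obtain \<eta> where e: "\<forall>M\<in>Gr G A. \<eta> M \<in> gr_iso G A (fobj V (fobj F M)) M"
    "\<forall>M\<in>Gr G A. \<forall>N\<in>Gr G A. \<forall>\<phi>\<in>gr_hom G A M N. compose (carrier (fobj V (fobj F M))) (\<eta> N) (fmap V (fobj F M) (fobj F N) (fmap F M N \<phi>)) =
          compose (carrier (fobj V (fobj F M))) \<phi> (\<eta> M)"
    using n(1) by (auto simp: gr_naturally_isomorphic_def comp_functor_def id_functor_def)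
  obtain \<epsilon> where e': "\<forall>M\<in>Gr G B. \<epsilon> M \<in> gr_iso G B (fobj F (fobj V M)) M"
    "\<forall>M\<in>Gr G B. \<forall>N\<in>Gr G B. \<forall>\<phi>\<in>gr_hom G B M N. compose (carrier (fobj F (fobj V M))) (\<epsilon> N) (fmap F (fobj V M) (fobj V N) (fmap V M N \<phi>)) =
          compose (carrier (fobj F (fobj V M))) \<phi> (\<epsilon> M)"
    using n(2) by (auto simp: gr_naturally_isomorphic_def comp_functor_def id_functor_def)
  have "module_equivalence K G A B F V \<eta> \<epsilon>"
  proof (intro module_equivalence.intro module_equivalence_axioms.intro assms(2,3) FV)
    fix M N :: "('a, 'u, 'g) graded" and \<phi> x assume h: "M \<in> Gr G A" "N \<in> Gr G A" "\<phi> \<in> gr_hom G A M N" "x \<in> carrier (fobj V (fobj F M))"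
    show "\<eta> N (fmap V (fobj F M) (fobj F N) (fmap F M N \<phi>) x) = \<phi> (\<eta> M x)"
      using fun_cong[OF e(2)[rule_format, OF h(1-3)], of x] h(4) by (simp add: compose_eq)
  next
    fix M N :: "('b, 'u, 'g) graded" and \<phi> x assume h: "M \<in> Gr G B" "N \<in> Gr G B" "\<phi> \<in> gr_hom G B M N" "x \<in> carrier (fobj F (fobj V M))"
    show "\<epsilon> N (fmap F (fobj V M) (fobj V N) (fmap V M N \<phi>) x) = \<phi> (\<epsilon> M x)"
      using fun_cong[OF e'(2)[rule_format, OF h(1-3)], of x] h(4) by (simp add: compose_eq)
  qed (use e(1) e'(1) in simp_all)
  then show thesis by (rule that)
qed

section \<open>Graded equivalences are fully faithful and preserve surjections and
  indecomposability\<close>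

context module_equivalence
begin

abbreviation FO where "FO \<equiv> fobj F"
abbreviation VO where "VO \<equiv> fobj V"

lemmas FD = graded_functorD[OF F] and VD = graded_functorD[OF V]

text \<open>Makes each fact about F available for the inverse functor as well.\<close>

lemma flip: "module_equivalence K G B A V F \<epsilon> \<eta>"
proof (rule module_equivalence.intro[OF B.graded_algebra_axioms A.graded_algebra_axioms])
  show "module_equivalence_axioms K G B A V F \<epsilon> \<eta>"
    by (rule module_equivalence_axioms.intro; fact V F eps eps_nat eta eta_nat)
qed

lemma eta_surj:
  assumes M: "M \<in> Gr G A" and x: "x \<in> carrier M" obtains y where "y \<in> carrier (VO (FO M))" "\<eta> M y = x"
proof -
  have "x \<in> \<eta> M ` carrier (VO (FO M))" using bij_betw_imp_surj_on[OF gr_iso_bij_betw[OF eta[OF M]]] x by simp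
  then show thesis using that by blast
qed

text \<open>Naturality expresses a morphism on the image of the isomorphism \<open>\<eta> M\<close>,
  which is all of M, through its image under both functors.\<close>

lemma faithful:
  assumes M: "M \<in> Gr G A" and N: "N \<in> Gr G A" and f: "\<phi> \<in> gr_hom G A M N" "\<psi> \<in> gr_hom G A M N"
    and eq: "fmap F M N \<phi> = fmap F M N \<psi>"
  shows "\<phi> = \<psi>"
proof (rule lin_hom_eqI[OF gr_hom_lin_hom[OF f(1)] gr_hom_lin_hom[OF f(2)]])
  fix x assume "x \<in> carrier M"
  then obtain y where y: "y \<in> carrier (VO (FO M))" "\<eta> M y = x" using eta_surj[OF M] by blast
  show "\<phi> x = \<psi> x" using eta_nat[OF M N f(1) y(1)] eta_nat[OF M N f(2) y(1)] eq y(2) by simp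
qed

lemma fmap_comp:
  assumes "L \<in> Gr G A" "M \<in> Gr G A" "N \<in> Gr G A" "\<phi> \<in> gr_hom G A L M" "\<psi> \<in> gr_hom G A M N" "x \<in> carrier (FO L)"
  shows "fmap F L N (compose (carrier L) \<psi> \<phi>) x = fmap F M N \<psi> (fmap F L M \<phi> x)"
  using FD(4)[OF assms(1-5)] assms(6) by (simp add: compose_eq)

text \<open>The zero map satisfies o + o = o. Additivity carries this equation to its image, and in
  an abelian group only zero satisfies it.\<close>

lemma fmap_zero:
  assumes M: "M \<in> Gr G A" and N: "N \<in> Gr G A"
  shows "fmap F M N (\<lambda>x\<in>carrier M. \<zero>\<^sub>N) = (\<lambda>y\<in>carrier (FO M). \<zero>\<^bsub>FO N\<^esub>)"
proof (rule lin_hom_eqI)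
  let ?o = "\<lambda>x\<in>carrier M. \<zero>\<^sub>N"
  have z: "?o \<in> gr_hom G A M N" using A.gr_hom_zero[OF M N] .
  note Fz = FD(2)[OF M N z]
  show "fmap F M N ?o \<in> lin_hom B (FO M) (FO N)" using gr_hom_lin_hom[OF Fz] .
  show "(\<lambda>y\<in>carrier (FO M). \<zero>\<^bsub>FO N\<^esub>) \<in> lin_hom B (FO M) (FO N)" using B.lin_hom_zero[OF FD(1)[OF N] FD(1)[OF M]] .
  interpret N: abelian_group N using A.Gr_abelian_group[OF N] .
  interpret FN: abelian_group "FO N" using B.Gr_abelian_group[OF FD(1)[OF N]] .
  fix y assume y: "y \<in> carrier (FO M)"
  have "hom_add M N ?o ?o = ?o" by (auto simp: hom_add_def restrict_def fun_eq_iff)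
  then have "fmap F M N ?o y = fmap F M N ?o y \<oplus>\<^bsub>FO N\<^esub> fmap F M N ?o y"
    using fun_cong[OF FD(5)[OF M N z z], of y] y by (simp add: hom_add_def)
  then have "fmap F M N ?o y = \<zero>\<^bsub>FO N\<^esub>"
    using gr_homD(1)[OF Fz y] FN.minus_eqI[of "fmap F M N ?o y"] FN.minus_eq_zero_iff[of "fmap F M N ?o y" "fmap F M N ?o y"] by simp
  then show "fmap F M N ?o y = (\<lambda>y\<in>carrier (FO M). \<zero>\<^bsub>FO N\<^esub>) y" using y by simp
qed

lemma gr_iso_fmap:
  assumes M: "M \<in> Gr G A" and N: "N \<in> Gr G A" and a: "\<alpha> \<in> gr_iso G A M N"
  shows "fmap F M N \<alpha> \<in> gr_iso G B (FO M) (FO N)"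
proof -
  obtain \<beta> where ab: "\<alpha> \<in> gr_hom G A M N" "\<beta> \<in> gr_hom G A N M" "compose (carrier M) \<beta> \<alpha> = (\<lambda>x\<in>carrier M. x)"
    "compose (carrier N) \<alpha> \<beta> = (\<lambda>y\<in>carrier N. y)" using a unfolding gr_iso_def by blast
  show ?thesis unfolding gr_iso_def
    using FD(2)[OF M N ab(1)] FD(2)[OF N M ab(2)] FD(4)[OF M N M ab(1,2)] FD(4)[OF N M N ab(2,1)] ab(3,4) FD(3)[OF M] FD(3)[OF N]
    by auto
qed

end

context module_equivalence
begin

interpretation flip: module_equivalence K G B A V F \<epsilon> \<eta> by (rule flip)

text \<open>The candidate is V applied to chi, conjugated by eta. By naturality its image under F
  and then V is that of chi under V, and faithfulness of V removes V.\<close>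

lemma full:
  assumes M: "M \<in> Gr G A" and N: "N \<in> Gr G A" and c: "\<chi> \<in> gr_hom G B (FO M) (FO N)"
  shows "\<exists>\<phi>\<in>gr_hom G A M N. fmap F M N \<phi> = \<chi>"
proof -
  obtain \<theta> where t: "\<eta> M \<in> gr_hom G A (VO (FO M)) M" "\<theta> \<in> gr_hom G A M (VO (FO M))"
    "\<And>x. x \<in> carrier (VO (FO M)) \<Longrightarrow> \<theta> (\<eta> M x) = x" using gr_isoE[OF eta[OF M]] by metis
  note FM = FD(1)[OF M] and FN = FD(1)[OF N]
  note Vc = VD(2)[OF FM FN c]
  have e: "\<eta> N \<in> gr_hom G A (VO (FO N)) N" using gr_iso_gr_hom[OF eta[OF N]] .
  define \<phi> where "\<phi> = compose (carrier M) (\<eta> N) (compose (carrier M) (fmap V (FO M) (FO N) \<chi>) \<theta>)"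
  have p: "\<phi> \<in> gr_hom G A M N" unfolding \<phi>_def using A.gr_hom_compose[OF M A.gr_hom_compose[OF M t(2) Vc] e] .
  note Fp = FD(2)[OF M N p]
  have "fmap V (FO M) (FO N) (fmap F M N \<phi>) = fmap V (FO M) (FO N) \<chi>"
  proof (rule lin_hom_eqI[OF gr_hom_lin_hom[OF VD(2)[OF FM FN Fp]] gr_hom_lin_hom[OF Vc]])
    fix y assume y: "y \<in> carrier (VO (FO M))"
    have "\<eta> N (fmap V (FO M) (FO N) (fmap F M N \<phi>) y) = \<eta> N (fmap V (FO M) (FO N) \<chi> y)"
      using eta_nat[OF M N p y] gr_homD(1)[OF t(1) y] t(3)[OF y] by (simp add: \<phi>_def compose_eq)
    then show "fmap V (FO M) (FO N) (fmap F M N \<phi>) y = fmap V (FO M) (FO N) \<chi> y"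
      using bij_betw_imp_inj_on[OF gr_iso_bij_betw[OF eta[OF N]]] gr_homD(1)[OF VD(2)[OF FM FN Fp] y] gr_homD(1)[OF Vc y]
      by (simp add: inj_on_def)
  qed
  then show ?thesis using flip.faithful[OF FM FN Fp c] p by blast
qed

text \<open>Surjections are epimorphisms: they are recognised by quotients of the target.\<close>

lemma fmap_surj:
  assumes X: "X \<in> Gr G A" and Y: "Y \<in> Gr G A" and p: "\<pi> \<in> gr_hom G A X Y" and s: "\<pi> ` carrier X = carrier Y"
  shows "fmap F X Y \<pi> ` carrier (FO X) = carrier (FO Y)"
proof -
  note FX = FD(1)[OF X] and FY = FD(1)[OF Y] and Fp = FD(2)[OF X Y p]
  let ?N = "fmap F X Y \<pi> ` carrier (FO X)"
  have N: "gr_submodule G B ?N (FO Y)" using B.gr_submodule_image[OF FX FY Fp B.gr_submodule_carrier[OF FX]] .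
  interpret Y: abelian_group "FO Y" using B.Gr_abelian_group[OF FY] .
  obtain Z :: "('b, 'u, 'g) graded" and \<rho> where Z: "Z \<in> Gr G B" and r: "\<rho> \<in> gr_hom G B (FO Y) Z"
    and "\<rho> ` carrier (FO Y) = carrier Z"
    and r': "\<And>x y. \<lbrakk>x \<in> carrier (FO Y); y \<in> carrier (FO Y)\<rbrakk> \<Longrightarrow> \<rho> x = \<rho> y \<longleftrightarrow> x \<ominus>\<^bsub>FO Y\<^esub> y \<in> ?N"
  proof (rule B.quotient_in_universe[OF FY N])
    fix Z :: "('b, 'u, 'g) graded" and \<rho>
    assume "Z \<in> Gr G B" "\<rho> \<in> gr_hom G B (FO Y) Z" "\<rho> ` carrier (FO Y) = carrier Z"
      "\<And>x y. \<lbrakk>x \<in> carrier (FO Y); y \<in> carrier (FO Y)\<rbrakk> \<Longrightarrow> \<rho> x = \<rho> y \<longleftrightarrow> x \<ominus>\<^bsub>FO Y\<^esub> y \<in> ?N"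
    then show thesis by (rule that)
  qed
  let ?o = "\<lambda>y\<in>carrier (FO Y). \<zero>\<^sub>Z"
  have z: "?o \<in> gr_hom G B (FO Y) Z" using B.gr_hom_zero[OF FY Z] .
  have zN: "\<zero>\<^bsub>FO Y\<^esub> \<in> ?N" using B.gr_submoduleD(5)[OF FY N] .
  have r0: "\<rho> \<zero>\<^bsub>FO Y\<^esub> = \<zero>\<^sub>Z"
    using additive_zero[OF Y.abelian_group_axioms B.Gr_abelian_group[OF Z] gr_homD(5)[OF r]] .
  have rN: "\<rho> y = \<zero>\<^sub>Z \<longleftrightarrow> y \<in> ?N" if "y \<in> carrier (FO Y)" for y
    using r'[OF that Y.zero_closed] r0 that Y.minus_eqI[of y "\<zero>\<^bsub>FO Y\<^esub>" y] by simp
  \<comment> \<open>The projection onto the cokernel of F(pi) and the zero map agree after F(pi).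
    Under V the map VF(pi) is onto, since by naturality it corresponds to pi; so V(rho) and V(0)
    agree. Faithfulness gives rho = 0, and the cokernel is zero.\<close>
  have "compose (carrier (FO X)) \<rho> (fmap F X Y \<pi>) = compose (carrier (FO X)) ?o (fmap F X Y \<pi>)"
    using rN gr_homD(1)[OF Fp] by (auto simp: compose_def restrict_def fun_eq_iff)
  then have comp: "compose (carrier (VO (FO X))) (fmap V (FO Y) Z \<rho>) (fmap V (FO X) (FO Y) (fmap F X Y \<pi>)) =
      compose (carrier (VO (FO X))) (fmap V (FO Y) Z ?o) (fmap V (FO X) (FO Y) (fmap F X Y \<pi>))"
    using VD(4)[OF FX FY Z Fp r] VD(4)[OF FX FY Z Fp z] by simp
  have "fmap V (FO Y) Z \<rho> = fmap V (FO Y) Z ?o"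
  proof (rule lin_hom_eqI[OF gr_hom_lin_hom[OF VD(2)[OF FY Z r]] gr_hom_lin_hom[OF VD(2)[OF FY Z z]]])
    fix y assume y: "y \<in> carrier (VO (FO Y))"
    have "\<eta> Y y \<in> carrier Y" using gr_homD(1)[OF gr_iso_gr_hom[OF eta[OF Y]] y] .
    then have "\<eta> Y y \<in> \<pi> ` carrier X" using s by simp
    then obtain x where x: "\<eta> Y y = \<pi> x" "x \<in> carrier X" by (rule imageE)
    obtain w where w: "w \<in> carrier (VO (FO X))" "\<eta> X w = x" using eta_surj[OF X x(2)] .
    have "\<eta> Y (fmap V (FO X) (FO Y) (fmap F X Y \<pi>) w) = \<eta> Y y" using eta_nat[OF X Y p w(1)] w(2) x(1) by simp
    then have "fmap V (FO X) (FO Y) (fmap F X Y \<pi>) w = y"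
      using bij_betw_imp_inj_on[OF gr_iso_bij_betw[OF eta[OF Y]]] gr_homD(1)[OF VD(2)[OF FX FY Fp] w(1)] y
      by (simp add: inj_on_def)
    then show "fmap V (FO Y) Z \<rho> y = fmap V (FO Y) Z ?o y" using fun_cong[OF comp, of w] w(1) by (simp add: compose_eq)
  qed
  then have "\<rho> = ?o" using flip.faithful[OF FY Z r z] by blast
  then have "carrier (FO Y) \<subseteq> ?N" using rN by auto
  then show ?thesis using gr_homD(1)[OF Fp] by auto
qed

lemma gr_iso_reflect:
  assumes M: "M \<in> Gr G A" and N: "N \<in> Gr G A" and a: "gr_iso G B (FO M) (FO N) \<noteq> {}"
  shows "gr_iso G A M N \<noteq> {}"
proof -
  obtain \<alpha> \<beta> where ab: "\<alpha> \<in> gr_hom G B (FO M) (FO N)" "\<beta> \<in> gr_hom G B (FO N) (FO M)"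
    "compose (carrier (FO M)) \<beta> \<alpha> = (\<lambda>x\<in>carrier (FO M). x)" "compose (carrier (FO N)) \<alpha> \<beta> = (\<lambda>y\<in>carrier (FO N). y)"
    using a unfolding gr_iso_def by blast
  obtain \<phi> \<psi> where p: "\<phi> \<in> gr_hom G A M N" "fmap F M N \<phi> = \<alpha>" "\<psi> \<in> gr_hom G A N M" "fmap F N M \<psi> = \<beta>"
    using full[OF M N ab(1)] full[OF N M ab(2)] by blast
  have "compose (carrier M) \<psi> \<phi> = (\<lambda>x\<in>carrier M. x)"
    using faithful[OF M M A.gr_hom_compose[OF M p(1,3)] A.gr_hom_id[OF M]] FD(4)[OF M N M p(1,3)] p(2,4) ab(3) FD(3)[OF M] by simp
  moreover have "compose (carrier N) \<phi> \<psi> = (\<lambda>x\<in>carrier N. x)"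
    using faithful[OF N N A.gr_hom_compose[OF N p(3,1)] A.gr_hom_id[OF N]] FD(4)[OF N M N p(3,1)] p(2,4) ab(4) FD(3)[OF N] by simp
  ultimately show ?thesis using p(1,3) unfolding gr_iso_def by blast
qed

text \<open>Idempotent endomorphisms of FM come from idempotents of M, as F is fully faithful, and
  those are trivial. FM is nonzero because otherwise identity and zero on M would have the same
  image.\<close>

lemma fobj_indecomposable:
  assumes M: "M \<in> Gr G A" and ind: "gr_indecomposable G A M" shows "gr_indecomposable G B (FO M)"
proof (rule B.idempotents_indecomposable[OF FD(1)[OF M]])
  show "carrier (FO M) \<noteq> {\<zero>\<^bsub>FO M\<^esub>}"
  proof
    assume z: "carrier (FO M) = {\<zero>\<^bsub>FO M\<^esub>}"
    have "fmap F M M (\<lambda>x\<in>carrier M. x) = fmap F M M (\<lambda>x\<in>carrier M. \<zero>\<^sub>M)"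
      unfolding FD(3)[OF M] fmap_zero[OF M M] using z by (auto simp: restrict_def fun_eq_iff)
    then have eq: "(\<lambda>x\<in>carrier M. x) = (\<lambda>x\<in>carrier M. \<zero>\<^sub>M)"
      using faithful[OF M M A.gr_hom_id[OF M] A.gr_hom_zero[OF M M]] by blast
    have "x = \<zero>\<^sub>M" if "x \<in> carrier M" for x using fun_cong[OF eq, of x] that by simp
    moreover have "\<zero>\<^sub>M \<in> carrier M" using abelian_groupE(2)[OF A.Gr_abelian_group[OF M]] .
    ultimately show False using ind unfolding gr_indecomposable_def by blast
  qed
  fix \<chi> assume c: "\<chi> \<in> gr_hom G B (FO M) (FO M)" and idem: "\<And>x. x \<in> carrier (FO M) \<Longrightarrow> \<chi> (\<chi> x) = \<chi> x"
  obtain \<phi> where p: "\<phi> \<in> gr_hom G A M M" "fmap F M M \<phi> = \<chi>" using full[OF M M c] by blast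
  have "compose (carrier (FO M)) \<chi> \<chi> = \<chi>"
    by (rule lin_hom_eqI[OF gr_hom_lin_hom[OF B.gr_hom_compose[OF FD(1)[OF M] c c]] gr_hom_lin_hom[OF c]])
      (simp add: compose_eq idem)
  then have "compose (carrier M) \<phi> \<phi> = \<phi>"
    using faithful[OF M M A.gr_hom_compose[OF M p(1) p(1)] p(1)] FD(4)[OF M M M p(1) p(1)] p(2) by simp
  then have "\<phi> (\<phi> x) = \<phi> x" if "x \<in> carrier M" for x using that by (metis compose_eq)
  then consider "\<forall>x\<in>carrier M. \<phi> x = \<zero>\<^sub>M" | "\<forall>x\<in>carrier M. \<phi> x = x" using A.indecomposable_idempotent[OF M ind p(1)] by blast
  then show "(\<forall>x\<in>carrier (FO M). \<chi> x = \<zero>\<^bsub>FO M\<^esub>) \<or> (\<forall>x\<in>carrier (FO M). \<chi> x = x)"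
  proof cases
    case 1
    then have "\<phi> = (\<lambda>x\<in>carrier M. \<zero>\<^sub>M)"
      by (intro lin_hom_eqI[OF gr_hom_lin_hom[OF p(1)] gr_hom_lin_hom[OF A.gr_hom_zero[OF M M]]]) simp
    then have "\<chi> = (\<lambda>x\<in>carrier (FO M). \<zero>\<^bsub>FO M\<^esub>)" using p(2) fmap_zero[OF M M] by simp
    then show ?thesis by simp
  next
    case 2
    then have "\<phi> = (\<lambda>x\<in>carrier M. x)"
      by (intro lin_hom_eqI[OF gr_hom_lin_hom[OF p(1)] gr_hom_lin_hom[OF A.gr_hom_id[OF M]]]) simp
    then have "\<chi> = (\<lambda>x\<in>carrier (FO M). x)" using p(2) FD(3)[OF M] by simp
    then show ?thesis by simp
  qed
qed

end

section \<open>Preservation of projectives, endomorphism algebras and biproducts\<close>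

context module_equivalence
begin

interpretation flip: module_equivalence K G B A V F \<epsilon> \<eta> by (rule flip)

text \<open>A lifting problem over B is moved to A by V, which keeps the given epimorphism onto. It
  is solved there for P, identified with VFP through eta. Fullness of V brings the solution back,
  and faithfulness the equation it satisfies.\<close>

lemma fobj_projective:
  assumes P: "P \<in> Gr G A" and proj: "gr_projective G A P" shows "gr_projective G B (FO P)"
  unfolding gr_projective_def
proof (intro ballI impI)
  fix X Y :: "('b, 'u, 'g) graded" and \<pi> \<phi>
  assume X: "X \<in> Gr G B" and Y: "Y \<in> Gr G B" and p: "\<pi> \<in> gr_hom G B X Y" and f: "\<phi> \<in> gr_hom G B (FO P) Y"
    and s: "\<pi> ` carrier X = carrier Y"
  note FP = FD(1)[OF P]
  obtain \<theta> where t: "\<eta> P \<in> gr_hom G A (VO (FO P)) P" "\<theta> \<in> gr_hom G A P (VO (FO P))"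
    "\<And>x. x \<in> carrier (VO (FO P)) \<Longrightarrow> \<theta> (\<eta> P x) = x" using gr_isoE[OF eta[OF P]] by metis
  have Vf: "compose (carrier P) (fmap V (FO P) Y \<phi>) \<theta> \<in> gr_hom G A P (VO Y)"
    using A.gr_hom_compose[OF P t(2) VD(2)[OF FP Y f]] .
  obtain \<psi> where ps: "\<psi> \<in> gr_hom G A P (VO X)"
    "compose (carrier P) (fmap V X Y \<pi>) \<psi> = compose (carrier P) (fmap V (FO P) Y \<phi>) \<theta>"
    using proj VD(1)[OF X] VD(1)[OF Y] VD(2)[OF X Y p] Vf flip.fmap_surj[OF X Y p s] unfolding gr_projective_def by blast
  obtain \<psi>' where ps': "\<psi>' \<in> gr_hom G B (FO P) X" "fmap V (FO P) X \<psi>' = compose (carrier (VO (FO P))) \<psi> (\<eta> P)"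
    using flip.full[OF FP X A.gr_hom_compose[OF VD(1)[OF FP] t(1) ps(1)]] by blast
  have c: "compose (carrier (FO P)) \<pi> \<psi>' \<in> gr_hom G B (FO P) Y" using B.gr_hom_compose[OF FP ps'(1) p] .
  have "fmap V (FO P) Y (compose (carrier (FO P)) \<pi> \<psi>') = fmap V (FO P) Y \<phi>"
  proof (rule lin_hom_eqI[OF gr_hom_lin_hom[OF VD(2)[OF FP Y c]] gr_hom_lin_hom[OF VD(2)[OF FP Y f]]])
    fix x assume x: "x \<in> carrier (VO (FO P))"
    have e: "\<eta> P x \<in> carrier P" using gr_homD(1)[OF t(1) x] .
    have "fmap V X Y \<pi> (\<psi> (\<eta> P x)) = fmap V (FO P) Y \<phi> (\<theta> (\<eta> P x))"
      using fun_cong[OF ps(2), of "\<eta> P x"] e by (simp add: compose_eq)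
    then show "fmap V (FO P) Y (compose (carrier (FO P)) \<pi> \<psi>') x = fmap V (FO P) Y \<phi> x"
      using flip.fmap_comp[OF FP X Y ps'(1) p x] ps'(2) x t(3)[OF x] by (simp add: compose_eq)
  qed
  then have "compose (carrier (FO P)) \<pi> \<psi>' = \<phi>" using flip.faithful[OF FP Y c f] by blast
  then show "\<exists>\<psi>\<in>gr_hom G B (FO P) X. compose (carrier (FO P)) \<pi> \<psi> = \<phi>" using ps'(1) by blast
qed

lemma End_fobj:
  assumes T: "T \<in> Gr G A"
  shows "gr_alg_isomorphic K G (End_algebra G A T) (End_algebra G B (FO T))"
proof (rule A.degreewise_isomorphic[where \<Phi> = "\<lambda>g. fmap F T (shift G g T)"])
  note FT = FD(1)[OF T] and sT = A.shift_Gr(1)[OF T]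
  note ids = A.gr_hom_id[OF T]
  show "ring (End_algebra G A T)" "graded_group G (End_algebra G A T)" using A.End_ring[OF T] by auto
  show "ring (End_algebra G B (FO T))" "graded_group G (End_algebra G B (FO T))" using B.End_ring[OF FT] by auto
  show "\<one>\<^bsub>End_algebra G A T\<^esub> \<in> component (End_algebra G A T) \<one>\<^sub>G" using ids by (simp add: A.lin_hom_component_shift)
  have Fs: "fmap F T (shift G g T) \<phi> \<in> gr_hom G B (FO T) (shift G g (FO T))" if "g \<in> carrier G" "\<phi> \<in> gr_hom G A T (shift G g T)" for g \<phi>
    using FD(2)[OF T sT[OF that(1)] that(2)] FD(7)[OF that(1) T] by simp
  show "bij_betw (fmap F T (shift G g T)) (component (End_algebra G A T) g) (component (End_algebra G B (FO T)) g)"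
    if g: "g \<in> carrier G" for g
    unfolding bij_betw_def A.End_simps B.End_simps A.lin_hom_component_shift B.lin_hom_component_shift
  proof (intro conjI inj_onI equalityI subsetI)
    show "\<phi> = \<psi>" if "\<phi> \<in> gr_hom G A T (shift G g T)" "\<psi> \<in> gr_hom G A T (shift G g T)"
      "fmap F T (shift G g T) \<phi> = fmap F T (shift G g T) \<psi>" for \<phi> \<psi> using faithful[OF T sT[OF g] that] .
    show "\<chi> \<in> fmap F T (shift G g T) ` gr_hom G A T (shift G g T)" if "\<chi> \<in> gr_hom G B (FO T) (shift G g (FO T))" for \<chi>
      using full[OF T sT[OF g], of \<chi>] that FD(7)[OF g T] by auto
  qed (use Fs[OF g] in auto)
  fix g h \<phi> \<psi> assume g: "g \<in> carrier G"
  {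
    assume h: "h \<in> carrier G" and "\<phi> \<in> component (End_algebra G A T) g" "\<psi> \<in> component (End_algebra G A T) h"
    then have f: "\<phi> \<in> gr_hom G A T (shift G g T)" "\<psi> \<in> gr_hom G A T (shift G h T)" by (simp_all add: A.lin_hom_component_shift)
    have gh: "g \<otimes>\<^sub>G h \<in> carrier G" using g h by simp
    note m = A.End_component_mult[OF T g h f]
    show "\<phi> \<otimes>\<^bsub>End_algebra G A T\<^esub> \<psi> \<in> component (End_algebra G A T) (g \<otimes>\<^sub>G h)" using m(2) by (simp add: A.lin_hom_component_shift)
    \<comment> \<open>The functor does not distinguish a morphism from its shifted version. This
      makes the maps given in separate degrees multiplicative together.\<close>
    have "fmap F (shift G g T) (shift G (g \<otimes>\<^sub>G h) T) \<psi> = fmap F T (shift G h T) \<psi>"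
      using FD(8)[OF g T sT[OF h] f(2)] A.shift_shift[OF g h, of T] by simp
    then show "fmap F T (shift G (g \<otimes>\<^sub>G h) T) (\<phi> \<otimes>\<^bsub>End_algebra G A T\<^esub> \<psi>) =
        fmap F T (shift G g T) \<phi> \<otimes>\<^bsub>End_algebra G B (FO T)\<^esub> fmap F T (shift G h T) \<psi>"
      using FD(4)[OF T sT[OF g] sT[OF gh] f(1) m(1)] by simp
  }
  {
    fix \<phi> \<psi> assume "\<phi> \<in> component (End_algebra G A T) g" "\<psi> \<in> component (End_algebra G A T) g"
    then show "fmap F T (shift G g T) (\<phi> \<oplus>\<^bsub>End_algebra G A T\<^esub> \<psi>) =
        fmap F T (shift G g T) \<phi> \<oplus>\<^bsub>End_algebra G B (FO T)\<^esub> fmap F T (shift G g T) \<psi>"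
      using FD(5)[OF T sT[OF g], of \<phi> \<psi>] FD(7)[OF g T] by (simp add: A.lin_hom_component_shift hom_add_def)
  }
  {
    fix c \<phi> assume "c \<in> carrier K" "\<phi> \<in> component (End_algebra G A T) g"
    then show "fmap F T (shift G g T) (c \<odot>\<^bsub>End_algebra G A T\<^esub> \<phi>) = c \<odot>\<^bsub>End_algebra G B (FO T)\<^esub> fmap F T (shift G g T) \<phi>"
      "c \<odot>\<^bsub>End_algebra G A T\<^esub> \<phi> \<in> component (End_algebra G A T) g"
      using FD(6)[OF T sT[OF g], of c \<phi>] FD(7)[OF g T] A.End_smult(2)[OF T _ g, of c \<phi>]
      by (simp_all add: A.lin_hom_component_shift hom_smult_def scalars_def)
  }
qed (use A.End_smult(1)[OF assms] B.End_smult(1)[OF FD(1)[OF assms]] FD(3)[OF assms] in simp_all)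

text \<open>Functors are only known to respect sums of two morphisms, so the sum over all summands
  is built up through partial sums, the empty one being the zero map.\<close>

lemma fmap_biproduct:
  fixes n k :: nat
  assumes T: "T \<in> Gr G A" and P: "\<And>i. i < n \<Longrightarrow> P i \<in> Gr G A"
    and i: "\<And>i. i < n \<Longrightarrow> \<iota> i \<in> gr_hom G A (P i) T" "\<And>i. i < n \<Longrightarrow> p i \<in> gr_hom G A T (P i)" and "k \<le> n"
  shows "(\<lambda>x\<in>carrier T. \<Oplus>\<^sub>T i\<in>{..<k}. \<iota> i (p i x)) \<in> gr_hom G A T T \<and>
    fmap F T T (\<lambda>x\<in>carrier T. \<Oplus>\<^sub>T i\<in>{..<k}. \<iota> i (p i x)) =
      (\<lambda>y\<in>carrier (FO T). \<Oplus>\<^bsub>FO T\<^esub>i\<in>{..<k}. fmap F (P i) T (\<iota> i) (fmap F T (P i) (p i) y))" using \<open>k \<le> n\<close>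
proof (induction k)
  case 0
  interpret T: abelian_group T using A.Gr_abelian_group[OF T] .
  interpret FT: abelian_group "FO T" using B.Gr_abelian_group[OF FD(1)[OF T]] .
  show ?case using A.gr_hom_zero[OF T T] fmap_zero[OF T T] by (simp add: restrict_def)
next
  case (Suc k)
  then have k: "k < n" by simp
  note FT = FD(1)[OF T]
  interpret T: abelian_group T using A.Gr_abelian_group[OF T] .
  interpret FT: abelian_group "FO T" using B.Gr_abelian_group[OF FT] .
  let ?s = "\<lambda>k. \<lambda>x\<in>carrier T. \<Oplus>\<^sub>T i\<in>{..<k}. \<iota> i (p i x)" and ?c = "compose (carrier T) (\<iota> k) (p k)"
  let ?S = "\<lambda>k. \<lambda>y\<in>carrier (FO T). \<Oplus>\<^bsub>FO T\<^esub>i\<in>{..<k}. fmap F (P i) T (\<iota> i) (fmap F T (P i) (p i) y)"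
  have IH: "?s k \<in> gr_hom G A T T" "fmap F T T (?s k) = ?S k"
    using conjunct1[OF Suc.IH[OF less_imp_le[OF k]]] conjunct2[OF Suc.IH[OF less_imp_le[OF k]]] .
  have c: "?c \<in> gr_hom G A T T" using A.gr_hom_compose[OF T i(2)[OF k] i(1)[OF k]] .
  have cl: "\<iota> i (p i x) \<in> carrier T" if "i < n" "x \<in> carrier T" for i x
    using gr_homD(1)[OF i(1)[OF that(1)] gr_homD(1)[OF i(2)[OF that(1)] that(2)]] .
  have Fcl: "fmap F (P i) T (\<iota> i) (fmap F T (P i) (p i) y) \<in> carrier (FO T)" if j: "i < n" "y \<in> carrier (FO T)" for i y
    using gr_homD(1)[OF FD(2)[OF P[OF j(1)] T i(1)[OF j(1)]] gr_homD(1)[OF FD(2)[OF T P[OF j(1)] i(2)[OF j(1)]] j(2)]] .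
  have s: "?s (Suc k) = hom_add T T (?s k) ?c"
  proof (rule ext)
    fix x
    show "?s (Suc k) x = hom_add T T (?s k) ?c x"
    proof (cases "x \<in> carrier T")
      case True
      have "(\<Oplus>\<^sub>T i\<in>insert k {..<k}. \<iota> i (p i x)) = \<iota> k (p k x) \<oplus>\<^sub>T (\<Oplus>\<^sub>T i\<in>{..<k}. \<iota> i (p i x))"
        using cl True k by (intro T.finsum_insert) auto
      also have "\<dots> = (\<Oplus>\<^sub>T i\<in>{..<k}. \<iota> i (p i x)) \<oplus>\<^sub>T \<iota> k (p k x)"
        using cl True k by (intro T.a_comm T.finsum_closed) auto
      finally show ?thesis using True by (simp add: hom_add_def compose_eq lessThan_Suc)
    qed (simp add: hom_add_def)
  qed
  have S: "?S (Suc k) = hom_add (FO T) (FO T) (?S k) (compose (carrier (FO T)) (fmap F (P k) T (\<iota> k)) (fmap F T (P k) (p k)))"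
  proof (rule ext)
    fix y
    show "?S (Suc k) y = hom_add (FO T) (FO T) (?S k) (compose (carrier (FO T)) (fmap F (P k) T (\<iota> k)) (fmap F T (P k) (p k))) y"
    proof (cases "y \<in> carrier (FO T)")
      case True
      let ?f = "\<lambda>i. fmap F (P i) T (\<iota> i) (fmap F T (P i) (p i) y)"
      have "(\<Oplus>\<^bsub>FO T\<^esub>i\<in>insert k {..<k}. ?f i) = ?f k \<oplus>\<^bsub>FO T\<^esub> (\<Oplus>\<^bsub>FO T\<^esub>i\<in>{..<k}. ?f i)"
        using Fcl True k by (intro FT.finsum_insert) auto
      also have "\<dots> = (\<Oplus>\<^bsub>FO T\<^esub>i\<in>{..<k}. ?f i) \<oplus>\<^bsub>FO T\<^esub> ?f k"
        using Fcl True k by (intro FT.a_comm FT.finsum_closed) auto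
      finally show ?thesis using True by (simp add: hom_add_def compose_eq lessThan_Suc)
    qed (simp add: hom_add_def)
  qed
  show ?case
  proof
    show "?s (Suc k) \<in> gr_hom G A T T" unfolding s using A.hom_add_gr_hom[OF T T IH(1) c] .
    show "fmap F T T (?s (Suc k)) = ?S (Suc k)"
      unfolding s S using FD(5)[OF T T IH(1) c] FD(4)[OF T P[OF k] T i(2)[OF k] i(1)[OF k]] IH(2) by simp
  qed
qed

end

lemma gr_iso_sym: "gr_iso G A M N \<noteq> {} \<Longrightarrow> gr_iso G A N M \<noteq> {}"
  unfolding gr_iso_def by blast

lemma (in graded_algebra) gr_iso_trans:
  assumes L: "L \<in> Gr G A" and N: "N \<in> Gr G A" and "gr_iso G A L M \<noteq> {}" "gr_iso G A M N \<noteq> {}"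
  shows "gr_iso G A L N \<noteq> {}"
proof -
  obtain \<alpha> where "\<alpha> \<in> gr_iso G A L M" using assms(3) by auto
  then obtain \<alpha>' where a: "\<alpha> \<in> gr_hom G A L M" "\<alpha>' \<in> gr_hom G A M L" "\<And>x. x \<in> carrier L \<Longrightarrow> \<alpha>' (\<alpha> x) = x"
    "\<And>y. y \<in> carrier M \<Longrightarrow> \<alpha> (\<alpha>' y) = y" by (rule gr_isoE) blast
  obtain \<beta> where "\<beta> \<in> gr_iso G A M N" using assms(4) by auto
  then obtain \<beta>' where b: "\<beta> \<in> gr_hom G A M N" "\<beta>' \<in> gr_hom G A N M" "\<And>x. x \<in> carrier M \<Longrightarrow> \<beta>' (\<beta> x) = x"
    "\<And>y. y \<in> carrier N \<Longrightarrow> \<beta> (\<beta>' y) = y" by (rule gr_isoE) blast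
  have "compose (carrier L) \<beta> \<alpha> \<in> gr_iso G A L N"
    using gr_hom_compose[OF L a(1) b(1)] gr_hom_compose[OF N b(2) a(2)]
    by (rule gr_isoI') (simp_all add: compose_eq a(3,4) b(3,4) gr_homD(1)[OF a(1)] gr_homD(1)[OF a(2)] gr_homD(1)[OF b(1)] gr_homD(1)[OF b(2)])
  then show ?thesis by blast
qed

section \<open>Progenerating families under an equivalence\<close>

context module_equivalence
begin

interpretation flip: module_equivalence K G B A V F \<epsilon> \<eta> by (rule flip)

lemma progenerating_family_fobj:
  assumes fam: "progenerating_family K G D A n P T"
  shows "progenerating_family K G D B n (\<lambda>i. FO (P i)) (FO T)"
proof -
  note P = progenerating_familyD(1-3)[OF fam] and niso = progenerating_familyD(4)[OF fam]
    and cpl = progenerating_familyD(5)[OF fam] and T = progenerating_familyD(6)[OF fam] and alg = progenerating_familyD(7)[OF fam]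
  obtain \<iota> p where i: "\<And>i. i < n \<Longrightarrow> \<iota> i \<in> gr_hom G A (P i) T" "\<And>i. i < n \<Longrightarrow> p i \<in> gr_hom G A T (P i)"
    and pi: "\<And>i k x. \<lbrakk>i < n; k < n; x \<in> carrier (P i)\<rbrakk> \<Longrightarrow> p k (\<iota> i x) = (if k = i then x else \<zero>\<^bsub>P k\<^esub>)"
    and sum: "\<And>x. x \<in> carrier T \<Longrightarrow> (\<Oplus>\<^sub>T i\<in>{..<n}. \<iota> i (p i x)) = x"
    by (rule gr_biproductE[OF progenerating_familyD(8)[OF fam]]) blast
  note FT = FD(1)[OF T]
  show ?thesis unfolding progenerating_family_def
  proof (intro conjI allI impI ballI)
    show "FO (P i) \<in> Gr G B" "gr_indecomposable G B (FO (P i))" "gr_projective G B (FO (P i))" if "i < n" for i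
      using FD(1) fobj_indecomposable fobj_projective P that by auto
    show "gr_iso G B (FO (P i)) (shift G g (FO (P j))) = {}" if "i < n" "j < n" "g \<in> carrier G" "i \<noteq> j" for i j g
      using gr_iso_reflect[OF P(1)[OF that(1)] A.shift_Gr(1)[OF P(1)[OF that(2)] that(3)]] niso[OF that] FD(7)[OF that(3) P(1)[OF that(2)]]
      by auto
    show "\<exists>i<n. \<exists>g\<in>carrier G. gr_iso G B Q (shift G g (FO (P i))) \<noteq> {}"
      if Q: "Q \<in> Gr G B" and ind: "gr_indecomposable G B Q \<and> gr_projective G B Q" for Q :: "('b, 'u, 'g) graded"
    proof -
      \<comment> \<open>Completeness over B: VQ is indecomposable projective over A, hence
        isomorphic to a shift of some \<open>P i\<close>. Applying F and the isomorphism of FVQ with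
        Q returns to Q.\<close>
      note VQ = VD(1)[OF Q]
      obtain i g \<alpha> where ig: "i < n" "g \<in> carrier G" and a: "\<alpha> \<in> gr_iso G A (VO Q) (shift G g (P i))"
        using cpl[OF VQ flip.fobj_indecomposable[OF Q] flip.fobj_projective[OF Q]] ind by blast
      have "gr_iso G B (FO (VO Q)) (shift G g (FO (P i))) \<noteq> {}"
        using gr_iso_fmap[OF VQ A.shift_Gr(1)[OF P(1)[OF ig(1)] ig(2)] a] FD(7)[OF ig(2) P(1)[OF ig(1)]] by auto
      moreover have "gr_iso G B Q (FO (VO Q)) \<noteq> {}" by (rule gr_iso_sym) (use eps[OF Q] in blast)
      ultimately show ?thesis
        using B.gr_iso_trans[OF Q B.shift_Gr(1)[OF FD(1)[OF P(1)[OF ig(1)]] ig(2)]] ig by blast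
    qed
    show "FO T \<in> Gr G B" by (rule FT)
    show "gr_alg_isomorphic K G D (End_algebra G B (FO T))" using gr_alg_isomorphic_trans[OF alg End_fobj[OF T]] .
    let ?\<iota> = "\<lambda>i. fmap F (P i) T (\<iota> i)" and ?p = "\<lambda>i. fmap F T (P i) (p i)"
    have io: "?\<iota> i \<in> gr_hom G B (FO (P i)) (FO T) \<and> ?p i \<in> gr_hom G B (FO T) (FO (P i))" if "i < n" for i
      using FD(2)[OF P(1)[OF that] T i(1)[OF that]] FD(2)[OF T P(1)[OF that] i(2)[OF that]] by blast
    have pio: "?p j (?\<iota> k x) = (if j = k then x else \<zero>\<^bsub>FO (P j)\<^esub>)"
      if k: "k < n" and j: "j < n" and x: "x \<in> carrier (FO (P k))" for k j x
    proof -
      note Pk = P(1)[OF k] and Pj = P(1)[OF j]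
      have "?p j (?\<iota> k x) = fmap F (P k) (P j) (compose (carrier (P k)) (p j) (\<iota> k)) x"
        using fmap_comp[OF Pk T Pj i(1)[OF k] i(2)[OF j] x] by simp
      moreover have "compose (carrier (P k)) (p j) (\<iota> k) = (if j = k then (\<lambda>x\<in>carrier (P k). x) else (\<lambda>x\<in>carrier (P k). \<zero>\<^bsub>P j\<^esub>))"
        using pi[OF k j] by (auto simp: compose_def restrict_def fun_eq_iff)
      ultimately show ?thesis using fmap_zero[OF Pk Pj] FD(3)[OF Pk] x by simp
    qed
    have su: "(\<Oplus>\<^bsub>FO T\<^esub>i\<in>{..<n}. ?\<iota> i (?p i y)) = y" if y: "y \<in> carrier (FO T)" for y
    proof -
      have "(\<lambda>x\<in>carrier T. \<Oplus>\<^sub>T i\<in>{..<n}. \<iota> i (p i x)) = (\<lambda>x\<in>carrier T. x)" using sum by (auto simp: restrict_def fun_eq_iff)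
      then have "(\<lambda>y\<in>carrier (FO T). y) = (\<lambda>y\<in>carrier (FO T). \<Oplus>\<^bsub>FO T\<^esub>i\<in>{..<n}. ?\<iota> i (?p i y))"
        using conjunct2[OF fmap_biproduct[where n = n and k = n and P = P and \<iota> = \<iota> and p = p, OF T P(1) i order_refl]] FD(3)[OF T] by simp
      from fun_cong[OF this, of y] show ?thesis using y by simp
    qed
    show "gr_biproduct G B n (\<lambda>i. FO (P i)) (FO T)" unfolding gr_biproduct_def
      by (rule exI[of _ ?\<iota>], rule exI[of _ ?p], intro conjI allI impI ballI) (fact conjunct1[OF io] conjunct2[OF io] pio su)+
  qed
qed

end

section \<open>From biproducts to congruence\<close>

context graded_algebra
begin

text \<open>The family of projections maps T bijectively onto the direct sum, with summation of the
  inclusions as inverse. Operations and components of \<open>direct_sum\<close> are the images of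
  those of T, so the module axioms and the isomorphism come together.\<close>

lemma biproduct_direct_sum:
  fixes P :: "nat \<Rightarrow> ('a, 'm, 'g) graded"
  assumes T: "T \<in> Gr G A" and P: "\<And>i. i < n \<Longrightarrow> P i \<in> Gr G A"
    and bip: "gr_biproduct G A n P T"
  shows "direct_sum {..<n} P \<in> Gr G A" "gr_iso G A T (direct_sum {..<n} P) \<noteq> {}"
proof -
  obtain \<iota> p where i: "\<And>i. i < n \<Longrightarrow> \<iota> i \<in> gr_hom G A (P i) T" "\<And>i. i < n \<Longrightarrow> p i \<in> gr_hom G A T (P i)"
    and pi: "\<And>i k x. \<lbrakk>i < n; k < n; x \<in> carrier (P i)\<rbrakk> \<Longrightarrow> p k (\<iota> i x) = (if k = i then x else \<zero>\<^bsub>P k\<^esub>)"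
    and sum: "\<And>x. x \<in> carrier T \<Longrightarrow> (\<Oplus>\<^sub>T i\<in>{..<n}. \<iota> i (p i x)) = x" by (rule gr_biproductE[OF bip]) blast
  let ?S = "direct_sum {..<n} P"
  define \<alpha> where "\<alpha> x = (\<lambda>i\<in>{..<n}. p i x)" for x
  define \<beta> where "\<beta> y = (\<Oplus>\<^sub>T i\<in>{..<n}. \<iota> i (y i))" for y
  interpret T: graded_group G T by (rule Gr_graded_group[OF T])
  note PA = Gr_abelian_group[OF P] and id = gr_homD[OF i(1)] and pd = gr_homD[OF i(2)]
  have inv: "x = x'" if "x \<in> carrier T" "x' \<in> carrier T" "\<alpha> x = \<alpha> x'" for x x'
  proof -
    have "p j x = p j x'" if "j < n" for j using fun_cong[OF \<open>\<alpha> x = \<alpha> x'\<close>, of j] that by (simp add: \<alpha>_def)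
    then have "(\<Oplus>\<^sub>T i\<in>{..<n}. \<iota> i (p i x)) = (\<Oplus>\<^sub>T i\<in>{..<n}. \<iota> i (p i x'))"
      using id(1) pd(1) that(2) by (intro T.finsum_cong') auto
    then show ?thesis using sum[OF that(1)] sum[OF that(2)] by simp
  qed
  have ab: "\<alpha> (\<beta> y) = y" "\<beta> y \<in> carrier T" if y: "y \<in> (\<Pi>\<^sub>E i\<in>{..<n}. carrier (P i))" for y
  proof -
    have yc: "y j \<in> carrier (P j)" if "j < n" for j using y that by auto
    show "\<beta> y \<in> carrier T" unfolding \<beta>_def using id(1) yc by (intro T.finsum_closed) auto
    show "\<alpha> (\<beta> y) = y"
    proof (rule extensionalityI[of _ "{..<n}"])
      show "y \<in> extensional {..<n}" using y by (simp add: PiE_def)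
      fix j assume "j \<in> {..<n}"
      then have j: "j < n" by simp
      interpret Pj: abelian_group "P j" by (rule PA[OF j])
      have "p j (\<beta> y) = (\<Oplus>\<^bsub>P j\<^esub>i\<in>{..<n}. p j (\<iota> i (y i)))"
        unfolding \<beta>_def using id(1) yc by (intro additive_finsum[OF T.abelian_group_axioms PA[OF j] pd(5)[OF j]]) auto
      also have "\<dots> = p j (\<iota> j (y j))" using j yc pi by (intro Pj.finsum_eq_single) auto
      finally show "\<alpha> (\<beta> y) j = y j" using pi[OF j j yc[OF j]] j by (simp add: \<alpha>_def)
    qed (simp add: \<alpha>_def)
  qed
  have c: "carrier ?S = \<alpha> ` carrier T"
  proof
    show "carrier ?S \<subseteq> \<alpha> ` carrier T" unfolding direct_sum_simps using ab by (metis image_eqI subsetI)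
    show "\<alpha> ` carrier T \<subseteq> carrier ?S" using pd(1) by (auto simp: \<alpha>_def split: if_splits)
  qed
  have comp: "component ?S g = \<alpha> ` component T g" if g: "g \<in> carrier G" for g
  proof
    show "\<alpha> ` component T g \<subseteq> component ?S g" using gr_hom_component[OF i(2) g] by (auto simp: \<alpha>_def split: if_splits)
    show "component ?S g \<subseteq> \<alpha> ` component T g"
    proof
      fix y assume "y \<in> component ?S g"
      then have y: "y \<in> (\<Pi>\<^sub>E i\<in>{..<n}. component (P i) g)" by (simp add: direct_sum_simps)
      then have "y \<in> (\<Pi>\<^sub>E i\<in>{..<n}. carrier (P i))" using Gr_component_closed[OF P g] by (auto simp: PiE_def Pi_def)
      moreover have "\<beta> y \<in> component T g"
        unfolding \<beta>_def using y gr_hom_component[OF i(1) g] by (intro T.additive_subgroup_finsum[OF T.component_subgroup[OF g]]) auto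
      ultimately show "y \<in> \<alpha> ` component T g" using ab(1) by (metis image_eqI)
    qed
  qed
  have z: "zero ?S = \<alpha> (zero T)"
    using additive_zero[OF T.abelian_group_axioms PA pd(5)] by (auto simp: \<alpha>_def restrict_def fun_eq_iff)
  have a: "\<alpha> x \<oplus>\<^bsub>?S\<^esub> \<alpha> y = \<alpha> (x \<oplus>\<^sub>T y)" if "x \<in> carrier T" "y \<in> carrier T" for x y
    using pd(2) that by (auto simp: \<alpha>_def restrict_def fun_eq_iff)
  have s: "b \<odot>\<^bsub>?S\<^esub> \<alpha> x = \<alpha> (b \<odot>\<^sub>T x)" if "b \<in> carrier A" "x \<in> carrier T" for b x
    using pd(3) that by (auto simp: \<alpha>_def restrict_def fun_eq_iff)
  have k: "\<alpha> (gpr G T x g) = \<zero>\<^bsub>?S\<^esub>" if "x \<in> carrier T" "\<alpha> x = \<zero>\<^bsub>?S\<^esub>" "g \<in> carrier G" for x g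
  proof -
    have "x = \<zero>\<^sub>T" by (rule inv[OF that(1) T.zero_closed]) (simp only: that(2) z)
    then show ?thesis unfolding z using that(3) by simp
  qed
  note im = Gr_image[where Q = ?S and \<pi> = \<alpha>, OF T c z a s comp k]
  show S: "?S \<in> Gr G A" by (rule im(1))
  have h: "restrict \<alpha> (carrier T) \<in> gr_hom G A T ?S" by (rule im(2))
  have "bij_betw (restrict \<alpha> (carrier T)) (carrier T) (carrier ?S)"
    unfolding c using inv by (auto simp: bij_betw_def inj_on_def)
  then show "gr_iso G A T ?S \<noteq> {}" using bij_gr_hom_gr_iso(1)[OF T S h] by blast
qed

lemma progenerating_family_congruence:
  fixes P :: "nat \<Rightarrow> ('a, 'u, 'g) graded"
  assumes fam: "progenerating_family K G D A n P T" and D: "graded_algebra K G D" and basic: "gr_basic K G A"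
    and inf: "infinite (UNIV :: 'u set)" and emb: "\<exists>f :: 'k \<Rightarrow> 'u. inj_on f (carrier K)"
  shows "is_congruence TYPE('u) K G D A"
proof -
  have fd: "fin_dim K A" using basic by (simp add: gr_basic_def)
  obtain E where E: "basic_set G A E" using gr_basic_basic_set[OF basic] by blast
  note P = progenerating_familyD(1-3)[OF fam] and T = progenerating_familyD(6)[OF fam] and alg = progenerating_familyD(7)[OF fam]
  have cpl: "complete_gr_projectives K G A n P" unfolding complete_gr_projectives_def
    using progenerating_familyD(1-5)[OF fam] indecomposable_projective_fin_dim[OF E fd inf emb] by simp
  note S = biproduct_direct_sum[OF T P(1) progenerating_familyD(8)[OF fam]]
  have "gr_alg_isomorphic K G (End_algebra G A T) (End_algebra G A (direct_sum {..<n} P))"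
    using End_gr_iso[OF T S(1)] S(2) by blast
  \<comment> \<open>The family itself serves as the complete set of projectives, so the shifts in
    the definition of a congruence can all be taken to be trivial.\<close>
  then have "gr_alg_isomorphic K G D (End_algebra G A (direct_sum {..<n} (\<lambda>i. shift G ((\<lambda>_. \<one>\<^sub>G) i) (P i))))"
    using gr_alg_isomorphic_trans[OF alg] by simp
  with cpl D basic show ?thesis
    unfolding is_congruence_def by (intro conjI exI[of _ n] exI[of _ P] exI[of _ "\<lambda>_. \<one>\<^sub>G"]) simp_all
qed

end

theorem theorem3p2:
  fixes K :: "'k ring" and G :: "'g monoid" and A :: "('k, 'a, 'g) graded"
  assumes "field K" and "group G" and "finite (carrier G)"
    and "graded_algebra K G A" and "fin_dim K A"
    and universe: "infinite (UNIV :: 'u set)" "\<exists>f :: 'k \<Rightarrow> 'u. inj_on f (carrier K)"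
  shows "(\<exists>B :: ('k, 'a, 'g) graded. gr_basic K G B \<and> graded_equivalent TYPE('u) K G A B) \<and>
    (\<forall>(B :: ('k, 'b, 'g) graded) (C :: ('k, 'c, 'g) graded).
       gr_basic K G B \<and> gr_basic K G C \<and>
       graded_equivalent TYPE('u) K G A B \<and> graded_equivalent TYPE('u) K G A C \<longrightarrow>
       is_congruence TYPE('u) K G B C)"
proof (intro conjI allI impI)
  interpret A: graded_algebra K G A by fact
  show "\<exists>B :: ('k, 'a, 'g) graded. gr_basic K G B \<and> graded_equivalent TYPE('u) K G A B"
    using gr_basic_equivalent[OF assms(4,5) universe(1)] .
  fix B :: "('k, 'b, 'g) graded" and C :: "('k, 'c, 'g) graded"
  assume h: "gr_basic K G B \<and> gr_basic K G C \<and> graded_equivalent TYPE('u) K G A B \<and> graded_equivalent TYPE('u) K G A C"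
  then have gB: "graded_algebra K G B" and fB: "fin_dim K B" and gC: "graded_algebra K G C" by (simp_all add: gr_basic_def)
  interpret B: graded_algebra K G B by (rule gB)
  interpret C: graded_algebra K G C by (rule gC)
  obtain E where E: "basic_set G B E" using B.gr_basic_basic_set h by blast
  obtain n P and T :: "('b, 'u, 'g) graded" where fam: "progenerating_family K G B B n P T"
    using B.basic_progenerating_family[OF E fB universe] by blast
  obtain F V \<eta> and \<epsilon> :: "('b, 'u, 'g) graded \<Rightarrow> 'u \<Rightarrow> 'u" where AB: "module_equivalence K G A B F V \<eta> \<epsilon>"
    using graded_equivalentE[OF _ assms(4) gB] h by blast
  obtain F' V' \<eta>' and \<epsilon>' :: "('c, 'u, 'g) graded \<Rightarrow> 'u \<Rightarrow> 'u" where AC: "module_equivalence K G A C F' V' \<eta>' \<epsilon>'"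
    using graded_equivalentE[OF _ assms(4) gC] h by blast
  \<comment> \<open>The family of B is carried to A by the inverse of the given equivalence and from
    there to C.\<close>
  have "progenerating_family K G B C n (\<lambda>i. fobj F' (fobj V (P i))) (fobj F' (fobj V T))"
    using module_equivalence.progenerating_family_fobj[OF AC
        module_equivalence.progenerating_family_fobj[OF module_equivalence.flip[OF AB] fam]] .
  then show "is_congruence TYPE('u) K G B C" using C.progenerating_family_congruence gB h universe by blast
qed

end
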